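(* Let $1<p<\infty$ and let $(T_\alpha)_{\alpha\in\Lambda}$ be a countable indexed collection of operators on $l^p$. Let $\lambda\ge 1$ and let $P_1,P_2,\ldots$ be idempotents on $\widehat{l^p}$ such that $\|P_n\|\le\lambda$ and $P_n\widehat{T}_\alpha=\widehat{T}_\alpha P_n$ for all $n\ge1$ and $\alpha\in\Lambda$. For each $n$ let $\mathcal{M}_n$ be the range of $P_n$, and suppose each $\mathcal{M}_n$ is either finite dimensional or $\lambda$-isomorphic to $l^p$. Then $(T_\alpha)_{\alpha\in\Lambda}$ is approximately similar to $\big(T_\alpha\oplus(\widehat{T}_\alpha|_{\mathcal{M}_1})\oplus(\widehat{T}_\alpha|_{\mathcal{M}_2})\oplus\cdots\big)_{\alpha\in\Lambda}$, the latter acting on the $l^p$-direct sum $l^p\oplus\mathcal{M}_1\oplus\mathcal{M}_2\oplus\cdots$.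
   Context: Operators are bounded linear. Fix a nonprincipal ultrafilter $\mathcal{U}$ on $\mathbb{N}$. For a separable reflexive Banach space $\mathcal{Y}$, the ultrapower $\mathcal{Y}^{\mathcal{U}}$ is the quotient of the space of bounded sequences in $\mathcal{Y}$ by the subspace of sequences $(x^{(k)})$ with $\lim_{k,\mathcal{U}}\|x^{(k)}\|=0$; the class of $(x^{(k)})$ is written $(x^{(k)})_{k,\mathcal{U}}$. Let $\widehat{\mathcal{Y}}=\{(x^{(k)})_{k,\mathcal{U}}: \text{the weak limit of } x^{(k)} \text{ along } \mathcal{U} \text{ is } 0\}$. For $T\in B(\mathcal{Y})$, $T^{\mathcal{U}}(x^{(k)})_{k,\mathcal{U}}=(Tx^{(k)})_{k,\mathcal{U}}$; $\widehat{\mathcal{Y}}$ is invariant under $T^{\mathcal{U}}$ and $\widehat T$ denotes the restriction of $T^{\mathcal{U}}$ to $\widehat{\mathcal{Y}}$. Two Banach spaces are $\lambda$-isomorphic if there is an invertible $S$ between them with $\|S\|\|S^{-1}\|\le\lambda$. Direct sums of countably many spaces/operators are $l^p$-direct sums. Indexed collections $(T_\alpha)\subset B(\mathcal{Y}_1)$, $(X_\alpha)\subset B(\mathcal{Y}_2)$ are approximately similar if there exist $\lambda'\ge1$ and invertible $S_n:\mathcal{Y}_1\to\mathcal{Y}_2$ with $\|S_n\|\|S_n^{-1}\|\le\lambda'$, $X_\alpha-S_nT_\alpha S_n^{-1}$ compact for all $\alpha,n$, and $\|X_\alpha-S_nT_\alpha S_n^{-1}\|\to0$ as $n\to\infty$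 for every $\alpha$. *)

theory Defs
  imports "HOL-Analysis.Analysis" "HOL-Library.Function_Algebras" "HOL-Library.Product_Plus"
begin

class cscale =
  fixes cscale :: "complex \<Rightarrow> 'a \<Rightarrow> 'a" (infixr "*\<^sub>C" 75)

instantiation complex :: cscale
begin
definition cscale_complex_def: "cscale c (z::complex) = c * z"
instance ..
end

instantiation "fun" :: (type, cscale) cscale
begin
definition cscale_fun_def: "cscale c (f::'a \<Rightarrow> 'b) = (\<lambda>x. cscale c (f x))"
instance ..
end

instantiation prod :: (cscale, cscale) cscale
begin
definition cscale_prod_def: "cscale c (x::'a \<times> 'b) = (cscale c (fst x), cscale c (snd x))"
instance ..
end

section \<open>Spaces given by a carrier and a (semi)norm; quotient by null vectors is implicit\<close>

definition clinear_on :: "'a::{ab_group_add,cscale} set \<Rightarrow> ('a \<Rightarrow> 'b::{ab_group_add,cscale}) \<Rightarrow> bool" where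
  "clinear_on V f \<longleftrightarrow>
     (\<forall>x\<in>V. \<forall>y\<in>V. f (x + y) = f x + f y) \<and> (\<forall>c. \<forall>x\<in>V. f (c *\<^sub>C x) = c *\<^sub>C f x)"

definition op_bound :: "'a set \<Rightarrow> ('a \<Rightarrow> real) \<Rightarrow> ('b \<Rightarrow> real) \<Rightarrow> ('a \<Rightarrow> 'b) \<Rightarrow> real \<Rightarrow> bool" where
  "op_bound V nV nW f C \<longleftrightarrow> (\<forall>x\<in>V. nW (f x) \<le> C * nV x)"

definition bdd_op :: "'a::{ab_group_add,cscale} set \<Rightarrow> ('a \<Rightarrow> real) \<Rightarrow> 'b::{ab_group_add,cscale} set \<Rightarrow> ('b \<Rightarrow> real) \<Rightarrow> ('a \<Rightarrow> 'b) \<Rightarrow> bool" where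
  "bdd_op V nV W nW f \<longleftrightarrow> f ` V \<subseteq> W \<and> clinear_on V f \<and> (\<exists>C. op_bound V nV nW f C)"

definition iso_data :: "'a::{ab_group_add,cscale} set \<Rightarrow> ('a \<Rightarrow> real) \<Rightarrow> 'b::{ab_group_add,cscale} set \<Rightarrow> ('b \<Rightarrow> real)
    \<Rightarrow> ('a \<Rightarrow> 'b) \<Rightarrow> ('b \<Rightarrow> 'a) \<Rightarrow> real \<Rightarrow> real \<Rightarrow> bool" where
  "iso_data V nV W nW S R a b \<longleftrightarrow>
     S ` V \<subseteq> W \<and> R ` W \<subseteq> V \<and> clinear_on V S \<and> clinear_on W R \<and>
     (\<forall>x\<in>V. nV (R (S x) - x) = 0) \<and> (\<forall>w\<in>W. nW (S (R w) - w) = 0) \<and>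
     0 \<le> a \<and> 0 \<le> b \<and> op_bound V nV nW S a \<and> op_bound W nW nV R b"

definition lambda_iso :: "'a::{ab_group_add,cscale} set \<Rightarrow> ('a \<Rightarrow> real) \<Rightarrow> 'b::{ab_group_add,cscale} set \<Rightarrow> ('b \<Rightarrow> real) \<Rightarrow> real \<Rightarrow> bool" where
  "lambda_iso V nV W nW lam \<longleftrightarrow> (\<exists>S R a b. iso_data V nV W nW S R a b \<and> a * b \<le> lam)"

definition fin_dim_mod :: "'a::{ab_group_add,cscale} set \<Rightarrow> ('a \<Rightarrow> real) \<Rightarrow> bool" where
  "fin_dim_mod V nV \<longleftrightarrow>
     (\<exists>B. finite B \<and> B \<subseteq> V \<and> (\<forall>y\<in>V. \<exists>c. nV (y - (\<Sum>b\<in>B. c b *\<^sub>C b)) = 0))"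

definition compact_op :: "'a set \<Rightarrow> ('a \<Rightarrow> real) \<Rightarrow> 'b::ab_group_add set \<Rightarrow> ('b \<Rightarrow> real) \<Rightarrow> ('a \<Rightarrow> 'b) \<Rightarrow> bool" where
  "compact_op V nV W nW K \<longleftrightarrow>
     (\<forall>w::nat \<Rightarrow> 'a. (\<forall>j. w j \<in> V \<and> nV (w j) \<le> 1) \<longrightarrow>
        (\<exists>(r::nat \<Rightarrow> nat) y. strict_mono r \<and> y \<in> W \<and> ((\<lambda>j. nW (K (w (r j)) - y)) \<longlonglongrightarrow> 0)))"

definition approx_similar :: "'i set \<Rightarrow> 'a::{ab_group_add,cscale} set \<Rightarrow> ('a \<Rightarrow> real) \<Rightarrow> ('i \<Rightarrow> 'a \<Rightarrow> 'a)
    \<Rightarrow> 'b::{ab_group_add,cscale} set \<Rightarrow> ('b \<Rightarrow> real) \<Rightarrow> ('i \<Rightarrow> 'b \<Rightarrow> 'b) \<Rightarrow> bool" where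
  "approx_similar \<Lambda> V nV T W nW X \<longleftrightarrow>
     (\<exists>lam'\<ge>1. \<exists>S R.
        (\<forall>n. \<exists>a b. iso_data V nV W nW (S n) (R n) a b \<and> a * b \<le> lam') \<and>
        (\<forall>\<alpha>\<in>\<Lambda>. \<forall>n. compact_op W nW W nW (\<lambda>w. X \<alpha> w - S n (T \<alpha> (R n w)))) \<and>
        (\<forall>\<alpha>\<in>\<Lambda>. \<forall>\<epsilon>>0. eventually
           (\<lambda>n. op_bound W nW nW (\<lambda>w. X \<alpha> w - S n (T \<alpha> (R n w))) \<epsilon>) sequentially))"

definition lp :: "real \<Rightarrow> (nat \<Rightarrow> complex) set" where
  "lp p = {x. summable (\<lambda>i. cmod (x i) powr p)}"

definition lpnorm :: "real \<Rightarrow> (nat \<Rightarrow> complex) \<Rightarrow> real" where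
  "lpnorm p x = (\<Sum>i. cmod (x i) powr p) powr (1 / p)"

definition free_ultrafilter_nat :: "nat filter \<Rightarrow> bool" where
  "free_ultrafilter_nat U \<longleftrightarrow> U \<noteq> bot \<and>
     (\<forall>A. eventually (\<lambda>k. k \<in> A) U \<or> eventually (\<lambda>k. k \<notin> A) U) \<and>
     (\<forall>n. eventually (\<lambda>k. k \<noteq> n) U)"

text \<open>representatives of elements of the ultrapower (l^p)^U: bounded sequences in l^p\<close>
definition upw :: "real \<Rightarrow> (nat \<Rightarrow> nat \<Rightarrow> complex) set" where
  "upw p = {X. (\<forall>k. X k \<in> lp p) \<and> (\<exists>B. \<forall>k. lpnorm p (X k) \<le> B)}"

definition unorm :: "nat filter \<Rightarrow> real \<Rightarrow> (nat \<Rightarrow> nat \<Rightarrow> complex) \<Rightarrow> real" where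
  "unorm U p X = Lim U (\<lambda>k. lpnorm p (X k))"

definition wnull :: "nat filter \<Rightarrow> real \<Rightarrow> (nat \<Rightarrow> nat \<Rightarrow> complex) \<Rightarrow> bool" where
  "wnull U p X \<longleftrightarrow>
     (\<forall>f. bdd_op (lp p) (lpnorm p) (UNIV :: complex set) cmod f \<longrightarrow> ((\<lambda>k. f (X k)) \<longlongrightarrow> 0) U)"

definition hatlp :: "nat filter \<Rightarrow> real \<Rightarrow> (nat \<Rightarrow> nat \<Rightarrow> complex) set" where
  "hatlp U p = {X \<in> upw p. wnull U p X}"

definition hatop :: "((nat \<Rightarrow> complex) \<Rightarrow> (nat \<Rightarrow> complex)) \<Rightarrow> (nat \<Rightarrow> nat \<Rightarrow> complex) \<Rightarrow> (nat \<Rightarrow> nat \<Rightarrow> complex)" where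
  "hatop T X = (\<lambda>k. T (X k))"

definition rng :: "nat filter \<Rightarrow> real \<Rightarrow> ((nat \<Rightarrow> nat \<Rightarrow> complex) \<Rightarrow> (nat \<Rightarrow> nat \<Rightarrow> complex)) \<Rightarrow> (nat \<Rightarrow> nat \<Rightarrow> complex) set" where
  "rng U p P = {Y \<in> hatlp U p. \<exists>X\<in>hatlp U p. unorm U p (Y - P X) = 0}"

section \<open>l^p direct sum  l^p (+) M_1 (+) M_2 (+) ...  (M_(n+1) is component n)\<close>

definition dsum_space :: "nat filter \<Rightarrow> real \<Rightarrow> (nat \<Rightarrow> (nat \<Rightarrow> nat \<Rightarrow> complex) set)
    \<Rightarrow> ((nat \<Rightarrow> complex) \<times> (nat \<Rightarrow> nat \<Rightarrow> nat \<Rightarrow> complex)) set" where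
  "dsum_space U p M = {(x, m). x \<in> lp p \<and> (\<forall>n. m n \<in> M n) \<and> summable (\<lambda>n. unorm U p (m n) powr p)}"

definition dsum_norm :: "nat filter \<Rightarrow> real \<Rightarrow> ((nat \<Rightarrow> complex) \<times> (nat \<Rightarrow> nat \<Rightarrow> nat \<Rightarrow> complex)) \<Rightarrow> real" where
  "dsum_norm U p w = (lpnorm p (fst w) powr p + (\<Sum>n. unorm U p (snd w n) powr p)) powr (1 / p)"

definition dsum_op :: "((nat \<Rightarrow> complex) \<Rightarrow> (nat \<Rightarrow> complex))
    \<Rightarrow> ((nat \<Rightarrow> complex) \<times> (nat \<Rightarrow> nat \<Rightarrow> nat \<Rightarrow> complex)) \<Rightarrow> ((nat \<Rightarrow> complex) \<times> (nat \<Rightarrow> nat \<Rightarrow> nat \<Rightarrow> complex))" where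
  "dsum_op T w = (T (fst w), (\<lambda>n. hatop T (snd w n)))"

end

theory Submission
  imports Defs "HOL-Complex_Analysis.Great_Picard"
begin

text \<open>
  Each \<open>M\<^sub>n\<close> carries finite-rank maps \<open>f\<^sub>l\<close>, \<open>g\<^sub>l\<close> that almost commute with the given operators and satisfy
  \<open>\<Sum>\<^sub>l g\<^sub>l f\<^sub>l = 1\<close>; when \<open>M\<^sub>n\<close> is isomorphic to \<open>l\<^sup>p\<close> they come from a quasicentral diagonal partition of unity.
  Elements of the ultrapower with weak limit \<open>0\<close> have representatives supported arbitrarily far out, and functionals
  on that space are induced by finitely supported sequences, by uniform smoothness of \<open>l\<^sup>p\<close>.
  So the ranges of the \<open>f\<^sub>l\<close>, for infinitely many copies of every \<open>M\<^sub>n\<close>, can be copied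
  into consecutive disjoint blocks of \<open>\<nat>\<close>. With \<open>A\<close> the \<open>l\<^sup>p\<close>-sum of infinitely many copies of all the \<open>M\<^sub>n\<close>, this yields
  \<open>V : A \<rightarrow> l\<^sup>p\<close> and \<open>W : l\<^sup>p \<rightarrow> A\<close> with \<open>W V \<approx> 1\<close> which intertwine the operators up to small compact errors.
  With \<open>\<tau>\<close> the backward shift through the copies and \<open>\<pi>\<close> the projection onto the first copy,
  \<open>S x = ((1 - V W) x + V \<tau> W x, \<pi> W x)\<close> is an almost intertwining isomorphism of \<open>l\<^sup>p\<close> onto
  \<open>l\<^sup>p \<oplus> M\<^sub>1 \<oplus> M\<^sub>2 \<oplus> \<dots>\<close>, of condition number controlled by \<open>\<lambda>\<close> alone.
\<close>

section \<open>Complex vector spaces and seminormed subspaces\<close>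

text \<open>The ranges M_n live in the ultrapower; what can be brought down to l^p directly is
  finite-rank data, by evaluating representatives at one well chosen index k. This is why everything
  is first cut into finite-rank pieces. Each piece is intertwined only up to an error, and the
  errors are made summable. That gives two things at once: the total defect is small in norm for the
  first operators of the list, and it is compact for all of them, because every single piece tends
  to 0 along weakly null sequences and a dominated series of such pieces does so too. Norms must not
  accumulate. The pieces of one M_n overlap at most four times and the blocks of l^p are disjoint,
  so p-th powers of norms add up and all constants depend on lam alone. The infinitely many copies
  serve a swindle: l^p nearly splits into the kernel of W and the range of V, and shifting through
  the copies inside the range of V frees exactly one copy of every M_n. Functionals are extended
  from M_n to the whole weakly null part by composition with P_n, at the cost of a factor
  lam.\<close>

class cvec = ab_group_add + cscale +
  assumes cscale_right_distrib: "c *\<^sub>C (x + y) = c *\<^sub>C x + c *\<^sub>C y"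
    and cscale_left_distrib: "(c + d) *\<^sub>C x = c *\<^sub>C x + d *\<^sub>C x"
    and cscale_cscale [simp]: "c *\<^sub>C d *\<^sub>C x = (c * d) *\<^sub>C x"
    and cscale_one [simp]: "1 *\<^sub>C x = x"

instance complex :: cvec
  by standard (auto simp: cscale_complex_def algebra_simps)

instance "fun" :: (type, cvec) cvec
  by standard (auto simp: cscale_fun_def cscale_right_distrib cscale_left_distrib)

instance prod :: (cvec, cvec) cvec
  by standard (auto simp: cscale_prod_def cscale_right_distrib cscale_left_distrib)

lemma cscale_complex [simp]: "c *\<^sub>C (z::complex) = c * z"
  by (simp add: cscale_complex_def)

lemma cscale_fun_apply [simp]: "(c *\<^sub>C f) x = c *\<^sub>C f x"
  by (simp add: cscale_fun_def)

lemma fst_cscale [simp]: "fst (c *\<^sub>C x) = c *\<^sub>C fst x"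
  and snd_cscale [simp]: "snd (c *\<^sub>C x) = c *\<^sub>C snd x"
  by (auto simp: cscale_prod_def)

lemma cscale_zero_left [simp]: "0 *\<^sub>C (x::'a::cvec) = 0"
  using cscale_left_distrib[of 0 0 x] by simp

lemma cscale_zero_right [simp]: "c *\<^sub>C (0::'a::cvec) = 0"
  using cscale_right_distrib[of c 0 "0::'a"] by simp

lemma cscale_minus_left [simp]: "(- c) *\<^sub>C (x::'a::cvec) = - (c *\<^sub>C x)"
  using cscale_left_distrib[of c "-c" x] by (simp add: eq_neg_iff_add_eq_0 add.commute)

lemma cscale_minus_right [simp]: "c *\<^sub>C (- x) = - (c *\<^sub>C (x::'a::cvec))"
  using cscale_right_distrib[of c x "-x"] by (simp add: eq_neg_iff_add_eq_0 add.commute)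

lemma cscale_right_diff_distrib: "c *\<^sub>C (x - y) = c *\<^sub>C x - c *\<^sub>C (y::'a::cvec)"
  using cscale_right_distrib[of c x "-y"] by simp

lemma cscale_left_diff_distrib: "(c - d) *\<^sub>C x = c *\<^sub>C x - d *\<^sub>C (x::'a::cvec)"
  using cscale_left_distrib[of c "-d" x] by simp

lemma cscale_sum_right: "c *\<^sub>C (\<Sum>i\<in>I. f i) = (\<Sum>i\<in>I. c *\<^sub>C (f i::'a::cvec))"
  by (induction I rule: infinite_finite_induct) (auto simp: cscale_right_distrib)

lemma sum_fun_apply: "(\<Sum>i\<in>I. f i) x = (\<Sum>i\<in>I. f i x :: 'b::comm_monoid_add)"
  by (induction I rule: infinite_finite_induct) auto

definition csubspace :: "'a::cvec set \<Rightarrow> bool" where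
  "csubspace V \<longleftrightarrow> 0 \<in> V \<and> (\<forall>x\<in>V. \<forall>y\<in>V. x + y \<in> V) \<and> (\<forall>c. \<forall>x\<in>V. c *\<^sub>C x \<in> V)"

lemma csubspaceD:
  assumes "csubspace V"
  shows "0 \<in> V" "x \<in> V \<Longrightarrow> y \<in> V \<Longrightarrow> x + y \<in> V" "x \<in> V \<Longrightarrow> c *\<^sub>C x \<in> V"
    "x \<in> V \<Longrightarrow> - x \<in> V" "x \<in> V \<Longrightarrow> y \<in> V \<Longrightarrow> x - y \<in> V"
proof -
  show "0 \<in> V" and add: "x \<in> V \<Longrightarrow> y \<in> V \<Longrightarrow> x + y \<in> V"
    and sc: "x \<in> V \<Longrightarrow> c *\<^sub>C x \<in> V" for x y c
    using assms by (auto simp: csubspace_def)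
  show minus: "x \<in> V \<Longrightarrow> - x \<in> V" for x using sc[of x "-1"] by simp
  show "x \<in> V \<Longrightarrow> y \<in> V \<Longrightarrow> x - y \<in> V" using add[of x "-y"] minus[of y] by simp
qed

lemma csubspace_sum:
  assumes "csubspace V" "\<And>i. i \<in> I \<Longrightarrow> f i \<in> V"
  shows "(\<Sum>i\<in>I. f i) \<in> V"
  using assms(2) by (induction I rule: infinite_finite_induct) (auto intro: csubspaceD[OF assms(1)])

lemma csubspace_UNIV [simp]: "csubspace UNIV" by (simp add: csubspace_def)

lemma clinear_onD:
  assumes "clinear_on V f"
  shows "x \<in> V \<Longrightarrow> y \<in> V \<Longrightarrow> f (x + y) = f x + f y" "x \<in> V \<Longrightarrow> f (c *\<^sub>C x) = c *\<^sub>C f x"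
  using assms by (auto simp: clinear_on_def)

lemma clinear_on_rules:
  fixes f :: "'a::cvec \<Rightarrow> 'b::cvec"
  assumes "clinear_on V f" "csubspace V"
  shows "f 0 = 0" "x \<in> V \<Longrightarrow> f (- x) = - f x" "x \<in> V \<Longrightarrow> y \<in> V \<Longrightarrow> f (x - y) = f x - f y"
    "(\<And>i. i \<in> I \<Longrightarrow> g i \<in> V) \<Longrightarrow> f (\<Sum>i\<in>I. g i) = (\<Sum>i\<in>I. f (g i))"
proof -
  note l = clinear_onD[OF assms(1)] note s = csubspaceD[OF assms(2)]
  show f0: "f 0 = 0" using l(2)[of 0 0] s(1) by simp
  show m: "x \<in> V \<Longrightarrow> f (- x) = - f x" for x using l(2)[of x "-1"] by simp
  show "x \<in> V \<Longrightarrow> y \<in> V \<Longrightarrow> f (x - y) = f x - f y"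
    using l(1)[of x "-y"] m[of y] s(4)[of y] by simp
  show "(\<And>i. i \<in> I \<Longrightarrow> g i \<in> V) \<Longrightarrow> f (\<Sum>i\<in>I. g i) = (\<Sum>i\<in>I. f (g i))"
  proof (induction I rule: infinite_finite_induct)
    case (insert x F)
    then show ?case using l(1)[of "g x" "sum g F"] csubspace_sum[OF assms(2), of F g] by simp
  qed (auto simp: f0)
qed

lemma clinear_on_compose:
  assumes "clinear_on V f" "clinear_on W g" "f ` V \<subseteq> W"
  shows "clinear_on V (\<lambda>x. g (f x))"
  using assms by (auto simp: clinear_on_def image_subset_iff)

lemma clinear_on_add:
  "clinear_on V f \<Longrightarrow> clinear_on V g \<Longrightarrow> clinear_on V (\<lambda>x. f x + (g x :: 'b::cvec))"
  by (auto simp: clinear_on_def cscale_right_distrib algebra_simps)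

lemma clinear_on_diff:
  "clinear_on V f \<Longrightarrow> clinear_on V g \<Longrightarrow> clinear_on V (\<lambda>x. f x - (g x :: 'b::cvec))"
  by (auto simp: clinear_on_def cscale_right_diff_distrib algebra_simps)

lemma clinear_on_id [simp]: "clinear_on V (\<lambda>x. x)"
  by (auto simp: clinear_on_def)

lemma clinear_on_zero: "clinear_on V (\<lambda>x. (0::'b::cvec))"
  by (auto simp: clinear_on_def)

lemma clinear_on_sum:
  assumes "\<And>i. i \<in> I \<Longrightarrow> clinear_on V (f i)"
  shows "clinear_on V (\<lambda>x. \<Sum>i\<in>I. (f i x :: 'b::cvec))"
  using assms by (induction I rule: infinite_finite_induct) (auto intro: clinear_on_zero clinear_on_add)

lemma clinear_on_cscale_left:
  "clinear_on V f \<Longrightarrow> clinear_on V (\<lambda>x. f x *\<^sub>C (b::'b::cvec))"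
  by (auto simp: clinear_on_def cscale_left_distrib)

lemma clinear_on_subset: "clinear_on V f \<Longrightarrow> V' \<subseteq> V \<Longrightarrow> clinear_on V' f"
  unfolding clinear_on_def by blast

text \<open>Elements of the ultrapower are handled through representatives, so a carrier with a
  seminorm stands for a normed space; vectors are identified when the seminorm of their difference
  is 0.\<close>

definition seminormed :: "'a::cvec set \<Rightarrow> ('a \<Rightarrow> real) \<Rightarrow> bool" where
  "seminormed V n \<longleftrightarrow> csubspace V \<and> (\<forall>x\<in>V. 0 \<le> n x) \<and> (\<forall>x\<in>V. \<forall>y\<in>V. n (x + y) \<le> n x + n y)
     \<and> (\<forall>c. \<forall>x\<in>V. n (c *\<^sub>C x) = cmod c * n x)"

lemma seminormedD:
  assumes "seminormed V n"
  shows "csubspace V" "x \<in> V \<Longrightarrow> 0 \<le> n x" "x \<in> V \<Longrightarrow> y \<in> V \<Longrightarrow> n (x + y) \<le> n x + n y"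
    "x \<in> V \<Longrightarrow> n (c *\<^sub>C x) = cmod c * n x" "n 0 = 0" "x \<in> V \<Longrightarrow> n (- x) = n x"
    "x \<in> V \<Longrightarrow> y \<in> V \<Longrightarrow> n (x - y) \<le> n x + n y"
    "x \<in> V \<Longrightarrow> y \<in> V \<Longrightarrow> n (x - y) = n (y - x)"
    "x \<in> V \<Longrightarrow> y \<in> V \<Longrightarrow> n x \<le> n y + n (x - y)"
    "x \<in> V \<Longrightarrow> y \<in> V \<Longrightarrow> z \<in> V \<Longrightarrow> n (x - z) \<le> n (x - y) + n (y - z)"
proof -
  show V: "csubspace V" and nn: "x \<in> V \<Longrightarrow> 0 \<le> n x"
    and tr: "x \<in> V \<Longrightarrow> y \<in> V \<Longrightarrow> n (x + y) \<le> n x + n y"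
    and sc: "x \<in> V \<Longrightarrow> n (c *\<^sub>C x) = cmod c * n x" for x y c
    using assms by (auto simp: seminormed_def)
  note s = csubspaceD[OF V]
  show "n 0 = 0" using sc[of 0 0] s(1) by simp
  show m: "x \<in> V \<Longrightarrow> n (- x) = n x" for x using sc[of x "-1"] by simp
  show "x \<in> V \<Longrightarrow> y \<in> V \<Longrightarrow> n (x - y) \<le> n x + n y" using tr[of x "-y"] m[of y] s(4)[of y] by simp
  show "x \<in> V \<Longrightarrow> y \<in> V \<Longrightarrow> n (x - y) = n (y - x)" using m[of "x-y"] s(5)[of x y] by simp
  show "x \<in> V \<Longrightarrow> y \<in> V \<Longrightarrow> n x \<le> n y + n (x - y)" using tr[of y "x-y"] s(5)[of x y] by simp
  show "x \<in> V \<Longrightarrow> y \<in> V \<Longrightarrow> z \<in> V \<Longrightarrow> n (x - z) \<le> n (x - y) + n (y - z)"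
    using tr[of "x-y" "y-z"] s(5) by simp
qed

lemma seminormed_sum:
  assumes "seminormed V n" "\<And>i. i \<in> I \<Longrightarrow> f i \<in> V"
  shows "n (\<Sum>i\<in>I. f i) \<le> (\<Sum>i\<in>I. n (f i))"
  using assms(2)
proof (induction I rule: infinite_finite_induct)
  case (insert x F)
  then show ?case
    using seminormedD(3)[OF assms(1), of "f x" "sum f F"]
      csubspace_sum[OF seminormedD(1)[OF assms(1)], of F f] by fastforce
qed (auto simp: seminormedD(5)[OF assms(1)])

lemma seminormed_sum_cscale:
  assumes "seminormed V n" "\<And>i. i \<in> I \<Longrightarrow> f i \<in> V"
  shows "n (\<Sum>i\<in>I. c i *\<^sub>C f i) \<le> (\<Sum>i\<in>I. cmod (c i) * n (f i))"
  using seminormed_sum[OF assms(1), of I "\<lambda>i. c i *\<^sub>C f i"] assms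
  by (simp add: seminormedD(1,4) csubspaceD(3))

lemma seminormed_subset: "seminormed V n \<Longrightarrow> csubspace V' \<Longrightarrow> V' \<subseteq> V \<Longrightarrow> seminormed V' n"
  unfolding seminormed_def by blast

lemma bdd_opE:
  assumes "bdd_op V nV W nW f" "\<And>x. x \<in> V \<Longrightarrow> 0 \<le> nV x"
  obtains C where "C > 0" "\<And>x. x \<in> V \<Longrightarrow> nW (f x) \<le> C * nV x"
proof -
  obtain C where C: "\<forall>x\<in>V. nW (f x) \<le> C * nV x" using assms(1) by (auto simp: bdd_op_def op_bound_def)
  show ?thesis
  proof
    show "\<bar>C\<bar> + 1 > 0" by simp
    fix x assume x: "x \<in> V"
    have "C * nV x \<le> (\<bar>C\<bar> + 1) * nV x" using assms(2)[OF x] by (intro mult_right_mono) auto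
    then show "nW (f x) \<le> (\<bar>C\<bar> + 1) * nV x" using C x by force
  qed
qed

lemma bdd_opD:
  assumes "bdd_op V nV W nW f"
  shows "clinear_on V f" "x \<in> V \<Longrightarrow> f x \<in> W"
  using assms by (auto simp: bdd_op_def)

lemma bdd_opI:
  assumes "clinear_on V f" "\<And>x. x \<in> V \<Longrightarrow> f x \<in> W" "\<And>x. x \<in> V \<Longrightarrow> nW (f x) \<le> C * nV x"
  shows "bdd_op V nV W nW f"
  using assms by (auto simp: bdd_op_def op_bound_def)

section \<open>The space \<open>l\<^sup>p\<close>\<close>

text \<open>Convexity of the power on the closed half-line. If one of the two points is 0, what
  remains is \<open>s powr p \<le> s\<close> for \<open>s\<close> in the unit interval.\<close>

lemma powr_convex_ineq:
  fixes x y t p :: real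
  assumes "1 \<le> p" "0 \<le> x" "0 \<le> y" "0 \<le> t" "t \<le> 1"
  shows "((1 - t) * x + t * y) powr p \<le> (1 - t) * x powr p + t * y powr p"
proof -
  have small: "(s * z) powr p \<le> s * z powr p" if "0 \<le> s" "s \<le> 1" "0 \<le> z" for s z :: real
  proof (cases "s = 0")
    case False
    have "s powr p \<le> s powr 1" using that assms False by (intro powr_mono') auto
    then show ?thesis using that by (simp add: powr_mult mult_right_mono)
  qed simp
  consider "x = 0" | "y = 0" | "x > 0" "y > 0" using assms by linarith
  then show ?thesis
  proof cases
    case 3
    then show ?thesis using convex_onD[OF powr_convex[OF assms(1)], of t x y] assms by simp
  qed (use small[of t y] small[of "1-t" x] assms in auto)
qed

definition restr :: "nat set \<Rightarrow> (nat \<Rightarrow> complex) \<Rightarrow> nat \<Rightarrow> complex" where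
  "restr S x = (\<lambda>i. if i \<in> S then x i else 0)"

definition unitv :: "nat \<Rightarrow> nat \<Rightarrow> complex" where
  "unitv s = (\<lambda>i. if i = s then 1 else 0)"

lemma restr_restr [simp]: "restr S (restr T x) = restr (S \<inter> T) x" by (auto simp: restr_def)

lemma clinear_restr: "clinear_on V (restr S)"
  by (auto simp: clinear_on_def restr_def)

lemmas restr_linear = clinear_on_rules[OF clinear_restr csubspace_UNIV, simplified]
  clinear_onD[OF clinear_restr[of UNIV], simplified]

lemma restr_eq_sum: "restr {..<N} x = (\<Sum>s<N. x s *\<^sub>C unitv s)"
proof
  fix i
  have "(\<Sum>s<N. x s * unitv s i) = (\<Sum>s<N. if s = i then x s else 0)"
    by (intro sum.cong) (auto simp: unitv_def)
  then show "restr {..<N} x i = (\<Sum>s<N. x s *\<^sub>C unitv s) i"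
    by (simp add: sum_fun_apply restr_def)
qed

lemma restr_split: "x = restr {..<N} x + restr {N..} x"
  by (auto simp: restr_def)

lemma restr_id: "(\<And>s. s \<notin> S \<Longrightarrow> x s = 0) \<Longrightarrow> restr S x = x"
  by (auto simp: restr_def)

locale lp_space =
  fixes p :: real
  assumes p_gt_1: "1 < p"
begin

lemma powr_p_root: "0 \<le> a \<Longrightarrow> (a powr p) powr (1 / p) = a" "0 \<le> a \<Longrightarrow> (a powr (1 / p)) powr p = a"
  using p_gt_1 by (simp_all add: powr_powr)

lemma powr_p_le_iff: "0 \<le> a \<Longrightarrow> 0 \<le> b \<Longrightarrow> a powr p \<le> b powr p \<longleftrightarrow> a \<le> b"
  using p_gt_1 by (metis linorder_not_le powr_less_mono2 powr_mono2 less_eq_real_def order_less_trans zero_less_one)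

lemma lpnorm_nonneg [simp]: "0 \<le> lpnorm p x"
  by (simp add: lpnorm_def)

lemma lpnorm_powr: "x \<in> lp p \<Longrightarrow> lpnorm p x powr p = (\<Sum>i. cmod (x i) powr p)"
  unfolding lpnorm_def by (rule powr_p_root) (auto intro!: suminf_nonneg simp: lp_def)

lemma lp_summable: "x \<in> lp p \<Longrightarrow> summable (\<lambda>i. cmod (x i) powr p)"
  by (simp add: lp_def)

lemma lp_criterion:
  assumes "0 \<le> B" "\<And>n. (\<Sum>i<n. cmod (x i) powr p) \<le> B powr p"
  shows "x \<in> lp p" "lpnorm p x \<le> B"
proof -
  have s: "summable (\<lambda>i. cmod (x i) powr p)"
    by (rule summableI_nonneg_bounded[where x="B powr p"]) (auto simp: assms)
  then show x: "x \<in> lp p" by (simp add: lp_def)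
  have "lpnorm p x powr p \<le> B powr p"
    unfolding lpnorm_powr[OF x] by (rule suminf_le_const[OF s]) (rule assms)
  then show "lpnorm p x \<le> B" using powr_p_le_iff assms(1) by simp
qed

lemma sum_powr_le_lpnorm:
  assumes "x \<in> lp p" "finite F" shows "(\<Sum>i\<in>F. cmod (x i) powr p) \<le> lpnorm p x powr p"
  unfolding lpnorm_powr[OF assms(1)] using assms
  by (intro sum_le_suminf) (auto simp: lp_def)

lemma coord_le_lpnorm: "x \<in> lp p \<Longrightarrow> cmod (x i) \<le> lpnorm p x"
  using sum_powr_le_lpnorm[of x "{i}"] by (simp add: powr_p_le_iff)

lemma lpnorm_zero_iff: "x \<in> lp p \<Longrightarrow> lpnorm p x = 0 \<longleftrightarrow> x = 0"
  using coord_le_lpnorm[of x] by (auto simp: lpnorm_def fun_eq_iff)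

lemma lp_mono:
  assumes "y \<in> lp p" "\<And>i. cmod (x i) \<le> cmod (y i)"
  shows "x \<in> lp p" "lpnorm p x \<le> lpnorm p y"
proof -
  have "(\<Sum>i<n. cmod (x i) powr p) \<le> lpnorm p y powr p" for n
  proof -
    have "(\<Sum>i<n. cmod (x i) powr p) \<le> (\<Sum>i<n. cmod (y i) powr p)"
      using assms(2) p_gt_1 by (intro sum_mono powr_mono2) auto
    also have "\<dots> \<le> lpnorm p y powr p" by (rule sum_powr_le_lpnorm) (auto simp: assms)
    finally show ?thesis .
  qed
  then show "x \<in> lp p" "lpnorm p x \<le> lpnorm p y" using lp_criterion[of "lpnorm p y" x] by auto
qed

text \<open>Minkowski's inequality from convexity: coordinatewise, \<open>x + y\<close> is bounded
  by \<open>a + b\<close> times a convex combination of the normalised vectors \<open>x / a\<close>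
  and \<open>y / b\<close>, with weight \<open>t = b / (a + b)\<close>.\<close>

lemma lp_add_bound:
  assumes x: "x \<in> lp p" and y: "y \<in> lp p"
  shows "x + y \<in> lp p \<and> lpnorm p (x + y) \<le> lpnorm p x + lpnorm p y"
proof (cases "x = 0 \<or> y = 0")
  case True
  then show ?thesis using x y by auto
next
  case False
  define a b where "a = lpnorm p x" and "b = lpnorm p y"
  have ab: "a > 0" "b > 0" using False lpnorm_zero_iff[OF x] lpnorm_zero_iff[OF y]
    by (auto simp: a_def b_def less_le)
  define t where "t = b / (a + b)"
  have t: "0 \<le> t" "t \<le> 1" "1 - t = a / (a + b)" using ab by (auto simp: t_def field_simps)
  have pt: "cmod ((x + y) i) powr p \<le>
     (a + b) powr p * ((1 - t) * (cmod (x i) powr p / a powr p) + t * (cmod (y i) powr p / b powr p))" for i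
  proof -
    have "cmod ((x + y) i) powr p \<le> (cmod (x i) + cmod (y i)) powr p"
      using p_gt_1 by (intro powr_mono2) (auto simp: norm_triangle_ineq)
    also have "cmod (x i) + cmod (y i) = (a + b) * ((1 - t) * (cmod (x i) / a) + t * (cmod (y i) / b))"
      using ab unfolding t(3) by (simp add: t_def distrib_left)
    also have "\<dots> powr p = (a + b) powr p * ((1 - t) * (cmod (x i) / a) + t * (cmod (y i) / b)) powr p"
      using ab t by (simp add: powr_mult)
    also have "\<dots> \<le> (a + b) powr p * ((1 - t) * (cmod (x i) / a) powr p + t * (cmod (y i) / b) powr p)"
      using ab t p_gt_1 by (intro mult_left_mono powr_convex_ineq) auto
    finally show ?thesis using ab by (simp add: powr_divide)
  qed
  have "(\<Sum>i<n. cmod ((x + y) i) powr p) \<le> (a + b) powr p" for n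
  proof -
    have "(\<Sum>i<n. cmod ((x + y) i) powr p) \<le> (\<Sum>i<n. (a + b) powr p * ((1 - t) * (cmod (x i) powr p / a powr p) + t * (cmod (y i) powr p / b powr p)))"
      by (intro sum_mono pt)
    also have "\<dots> = (a + b) powr p * ((1 - t) * ((\<Sum>i<n. cmod (x i) powr p) / a powr p) + t * ((\<Sum>i<n. cmod (y i) powr p) / b powr p))"
      unfolding sum_divide_distrib sum_distrib_left sum.distrib[symmetric] ..
    also have "\<dots> \<le> (a + b) powr p * ((1 - t) * 1 + t * 1)"
      using ab t sum_powr_le_lpnorm[OF x, of "{..<n}"] sum_powr_le_lpnorm[OF y, of "{..<n}"]
      by (intro mult_left_mono add_mono) (auto simp: a_def b_def)
    finally show ?thesis by simp
  qed
  then show ?thesis using lp_criterion[of "a + b" "x + y"] ab by (auto simp: a_def b_def)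
qed

lemma lp_cscale:
  assumes x: "x \<in> lp p"
  shows "c *\<^sub>C x \<in> lp p \<and> lpnorm p (c *\<^sub>C x) = cmod c * lpnorm p x"
proof
  have *: "cmod ((c *\<^sub>C x) i) powr p = cmod c powr p * cmod (x i) powr p" for i
    by (simp add: norm_mult powr_mult)
  show "c *\<^sub>C x \<in> lp p" using x unfolding lp_def mem_Collect_eq * by (rule summable_mult)
  have "(\<Sum>i. cmod ((c *\<^sub>C x) i) powr p) = cmod c powr p * (\<Sum>i. cmod (x i) powr p)"
    unfolding * using x by (intro suminf_mult) (simp add: lp_def)
  then show "lpnorm p (c *\<^sub>C x) = cmod c * lpnorm p x"
    unfolding lpnorm_def by (simp add: powr_mult powr_p_root suminf_nonneg lp_summable[OF x])
qed

lemma seminormed_lp: "seminormed (lp p) (lpnorm p)"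
  using lp_add_bound lp_cscale by (auto simp: seminormed_def csubspace_def lp_def)

lemmas lpD = seminormedD[OF seminormed_lp]
lemmas lpS = csubspaceD[OF lpD(1)]

lemma unitv_lp [simp]: "unitv s \<in> lp p" and lpnorm_unitv: "lpnorm p (unitv s) \<le> 1"
proof -
  have "(\<Sum>i<n. cmod (unitv s i) powr p) \<le> 1 powr p" for n
  proof -
    have "(\<Sum>i<n. cmod (unitv s i) powr p) = (\<Sum>i<n. if i = s then 1 else 0)"
      by (intro sum.cong) (auto simp: unitv_def)
    then show ?thesis by simp
  qed
  then show "unitv s \<in> lp p" "lpnorm p (unitv s) \<le> 1" using lp_criterion[of 1 "unitv s"] by auto
qed

lemma restr_lp: "x \<in> lp p \<Longrightarrow> restr S x \<in> lp p" and lpnorm_restr: "x \<in> lp p \<Longrightarrow> lpnorm p (restr S x) \<le> lpnorm p x"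
  by (rule lp_mono[of x]; auto simp: restr_def)+

lemma finite_support_lp:
  assumes "\<And>s. N \<le> s \<Longrightarrow> x s = 0" shows "x \<in> lp p"
proof -
  have "x = restr {..<N} x" using assms by (intro restr_id[symmetric]) auto
  also have "\<dots> \<in> lp p" unfolding restr_eq_sum by (intro csubspace_sum[OF lpD(1)] lpS(3)) auto
  finally show ?thesis .
qed

lemma lpnorm_powr_le_sum:
  assumes "\<And>s. s \<in> F \<Longrightarrow> y s \<in> lp p" "0 \<le> C"
    "\<And>i. cmod (x i) powr p \<le> C * (\<Sum>s\<in>F. cmod (y s i) powr p)"
  shows "x \<in> lp p" "lpnorm p x powr p \<le> C * (\<Sum>s\<in>F. lpnorm p (y s) powr p)"
proof -
  define B where "B = (C * (\<Sum>s\<in>F. lpnorm p (y s) powr p)) powr (1/p)"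
  have B: "B powr p = C * (\<Sum>s\<in>F. lpnorm p (y s) powr p)"
    unfolding B_def by (rule powr_p_root) (auto intro!: mult_nonneg_nonneg sum_nonneg assms)
  have "(\<Sum>i<n. cmod (x i) powr p) \<le> B powr p" for n
  proof -
    have "(\<Sum>i<n. cmod (x i) powr p) \<le> (\<Sum>i<n. C * (\<Sum>s\<in>F. cmod (y s i) powr p))" by (intro sum_mono assms)
    also have "\<dots> = C * (\<Sum>s\<in>F. \<Sum>i<n. cmod (y s i) powr p)"
      by (simp add: sum_distrib_left[symmetric] sum.swap[of _ F])
    also have "\<dots> \<le> B powr p" unfolding B
      by (intro mult_left_mono sum_mono sum_powr_le_lpnorm assms) auto
    finally show ?thesis .
  qed
  then show x: "x \<in> lp p" and "lpnorm p x powr p \<le> C * (\<Sum>s\<in>F. lpnorm p (y s) powr p)"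
    unfolding B[symmetric]
    using lp_criterion[of B x] by (auto simp: B_def powr_p_le_iff)
qed

lemma sum_le_lpnorm_powr:
  assumes "x \<in> lp p" "\<And>s. s \<in> F \<Longrightarrow> y s \<in> lp p"
    "\<And>i. (\<Sum>s\<in>F. cmod (y s i) powr p) \<le> cmod (x i) powr p"
  shows "(\<Sum>s\<in>F. lpnorm p (y s) powr p) \<le> lpnorm p x powr p"
proof -
  have "(\<Sum>s\<in>F. lpnorm p (y s) powr p) = (\<Sum>s\<in>F. \<Sum>i. cmod (y s i) powr p)"
    by (intro sum.cong) (auto simp: lpnorm_powr assms)
  also have "\<dots> = (\<Sum>i. \<Sum>s\<in>F. cmod (y s i) powr p)"
    by (intro suminf_sum[symmetric] lp_summable assms)
  also have "\<dots> \<le> (\<Sum>i. cmod (x i) powr p)"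
    by (intro suminf_le assms summable_sum lp_summable)
  finally show ?thesis by (simp add: lpnorm_powr[OF assms(1)])
qed

lemma sum_disjoint_powr:
  fixes y :: "'s \<Rightarrow> nat \<Rightarrow> complex"
  assumes "finite F" "disjoint_family_on S F"
  shows "cmod (\<Sum>s\<in>F. restr (S s) (y s) i) powr p = (\<Sum>s\<in>F. cmod (restr (S s) (y s) i) powr p)"
proof (cases "\<exists>s\<in>F. i \<in> S s")
  case True
  then obtain s where s: "s \<in> F" "i \<in> S s" by auto
  have z: "restr (S t) (y t) i = 0" if "t \<in> F - {s}" for t
    using that s assms(2) by (auto simp: disjoint_family_on_def restr_def)
  show ?thesis using z assms(1) s by (simp add: sum.remove[of F s])
next
  case False
  then show ?thesis by (simp add: restr_def)
qed

lemma restr_disjoint_sum_le: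
  assumes "x \<in> lp p" "finite F" "disjoint_family_on S F"
  shows "(\<Sum>s\<in>F. lpnorm p (restr (S s) x) powr p) \<le> lpnorm p x powr p"
proof (rule sum_le_lpnorm_powr[OF assms(1) restr_lp[OF assms(1)]])
  fix i
  show "(\<Sum>s\<in>F. cmod (restr (S s) x i) powr p) \<le> cmod (x i) powr p"
  proof (cases "\<exists>s\<in>F. i \<in> S s")
    case True
    then obtain s where s: "s \<in> F" "i \<in> S s" by auto
    have z: "restr (S t) x i = 0" if "t \<in> F - {s}" for t
      using that s assms(3) by (auto simp: disjoint_family_on_def restr_def)
    show ?thesis using z assms(2) s by (simp add: sum.remove[of F s] restr_def)
  next
    case False
    then show ?thesis by (simp add: restr_def)
  qed
qed

lemma lpnorm_disjoint_sum:
  fixes y :: "'s \<Rightarrow> nat \<Rightarrow> complex"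
  assumes "\<And>s. s \<in> F \<Longrightarrow> y s \<in> lp p" "finite F" "disjoint_family_on S F"
  shows "lpnorm p (\<Sum>s\<in>F. restr (S s) (y s)) powr p \<le> (\<Sum>s\<in>F. lpnorm p (restr (S s) (y s)) powr p)"
  using lpnorm_powr_le_sum(2)[of F "\<lambda>s. restr (S s) (y s)" 1 "\<Sum>s\<in>F. restr (S s) (y s)"]
    sum_disjoint_powr[OF assms(2,3)] assms(1) by (auto simp: restr_lp sum_fun_apply)

lemma tail_tendsto:
  assumes x: "x \<in> lp p" shows "(\<lambda>N. lpnorm p (restr {N..} x)) \<longlonglongrightarrow> 0"
proof -
  have s: "summable (\<lambda>i. cmod (x i) powr p)" using x by (rule lp_summable)
  have "lpnorm p (restr {N..} x) powr p = (\<Sum>i. cmod (x i) powr p) - (\<Sum>i<N. cmod (x i) powr p)" for N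
  proof -
    have "(\<Sum>i. cmod (restr {N..} x i) powr p) = (\<Sum>i. cmod (restr {N..} x (i+N)) powr p) + (\<Sum>i<N. cmod (restr {N..} x i) powr p)"
      by (intro suminf_split_initial_segment lp_summable restr_lp x)
    also have "\<dots> = (\<Sum>i. cmod (x (i+N)) powr p)" by (simp add: restr_def)
    also have "\<dots> = (\<Sum>i. cmod (x i) powr p) - (\<Sum>i<N. cmod (x i) powr p)"
      by (rule suminf_minus_initial_segment[OF s])
    finally show ?thesis using lpnorm_powr[OF restr_lp[OF x]] by simp
  qed
  moreover have "(\<lambda>N. (\<Sum>i. cmod (x i) powr p) - (\<Sum>i<N. cmod (x i) powr p)) \<longlonglongrightarrow> (\<Sum>i. cmod (x i) powr p) - (\<Sum>i. cmod (x i) powr p)"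
    by (intro tendsto_intros summable_LIMSEQ s)
  ultimately have "(\<lambda>N. lpnorm p (restr {N..} x) powr p) \<longlonglongrightarrow> 0" by simp
  then have "(\<lambda>N. (lpnorm p (restr {N..} x) powr p) powr (1/p)) \<longlonglongrightarrow> 0 powr (1/p)"
    using p_gt_1 by (intro tendsto_powr2) auto
  then show ?thesis by (simp add: powr_p_root)
qed

text \<open>Fatou's lemma along an arbitrary filter: finite partial sums pass to the limit. It is
  applied along \<open>U\<close> to weak limits and along \<open>sequentially\<close> to
  subsequences and to partial sums of a Neumann series.\<close>

lemma lp_limit:
  assumes F: "F \<noteq> bot" and X: "\<And>k. X k \<in> lp p" "eventually (\<lambda>k. lpnorm p (X k) \<le> B) F"
    and lim: "\<And>s. ((\<lambda>k. X k s) \<longlongrightarrow> x s) F"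
  shows "x \<in> lp p" "lpnorm p x \<le> B"
proof -
  obtain k where "lpnorm p (X k) \<le> B" using eventually_happens'[OF F X(2)] by auto
  then have B: "0 \<le> B" using lpnorm_nonneg[of "X k"] by linarith
  have "(\<Sum>i<n. cmod (x i) powr p) \<le> B powr p" for n
  proof (rule tendsto_upperbound[OF _ _ F])
    show "((\<lambda>k. \<Sum>i<n. cmod (X k i) powr p) \<longlongrightarrow> (\<Sum>i<n. cmod (x i) powr p)) F"
      using p_gt_1 by (intro tendsto_sum tendsto_powr2 tendsto_norm lim tendsto_const) auto
    show "eventually (\<lambda>k. (\<Sum>i<n. cmod (X k i) powr p) \<le> B powr p) F"
      using X(2)
    proof (eventually_elim)
      case (elim k)
      then have "lpnorm p (X k) powr p \<le> B powr p" using B by (simp add: powr_p_le_iff)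
      then show ?case using sum_powr_le_lpnorm[OF X(1)[of k], of "{..<n}"] by simp
    qed
  qed
  then show "x \<in> lp p" "lpnorm p x \<le> B" using lp_criterion[OF B] by auto
qed

end

section \<open>Functionals on l^p, weak convergence, Neumann series\<close>

context lp_space
begin

text \<open>This replaces the identification of the dual with l^q: no functional has mass at
  infinity. Otherwise there are \<open>m\<close> disjoint finite blocks on each of which
  \<open>Re f\<close> is at least \<open>\<epsilon> / 2\<close>, and boundedness forces
  \<open>m * \<epsilon> / 2 \<le> C * m powr (1/p)\<close> for all \<open>m\<close>, which is
  impossible for p > 1.\<close>

lemma functional_tail_small:
  assumes f: "bdd_op (lp p) (lpnorm p) (UNIV::complex set) cmod f" and \<epsilon>: "\<epsilon> > 0"
  shows "\<exists>N. \<forall>y\<in>lp p. (\<forall>s<N. y s = 0) \<longrightarrow> cmod (f y) \<le> \<epsilon> * lpnorm p y"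
proof (rule ccontr)
  assume neg: "\<not> ?thesis"
  note fl = clinear_onD[OF bdd_opD(1)[OF f]] clinear_on_rules[OF bdd_opD(1)[OF f] lpD(1)]
  obtain C where C: "C > 0" "\<And>x. x \<in> lp p \<Longrightarrow> cmod (f x) \<le> C * lpnorm p x"
    by (rule bdd_opE[OF f]) auto
  have one: "\<exists>y n. (\<forall>s. s < N \<or> n \<le> s \<longrightarrow> y s = 0) \<and> lpnorm p y \<le> 1 \<and> Re (f y) \<ge> \<epsilon> / 2" for N
  proof -
    obtain y where y: "y \<in> lp p" "\<And>s. s < N \<Longrightarrow> y s = 0" "cmod (f y) > \<epsilon> * lpnorm p y"
      using neg by (meson not_le)
    define t where "t = lpnorm p y"
    have t: "t > 0"
    proof (rule ccontr)
      assume "\<not> t > 0"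
      then have "y = 0" using lpnorm_zero_iff[OF y(1)] lpnorm_nonneg[of y] by (simp add: t_def)
      then show False using y(3) fl(3) lpD(5) by simp
    qed
    have fy0: "f y \<noteq> 0" using y(3) t \<epsilon> by (auto simp: t_def mult_less_0_iff)
    \<comment> \<open>Rotates and normalises \<open>y\<close>, so that \<open>f y'\<close> is real
      and at least \<epsilon> at a unit vector; cutting off a far tail then costs at most half of
      this value.\<close>
    define c where "c = cnj (f y) / (cmod (f y) * t)"
    define y' where "y' = c *\<^sub>C y"
    have cc: "cmod c = 1 / t" using fy0 t by (simp add: c_def norm_divide norm_mult)
    have y': "y' \<in> lp p" "lpnorm p y' = 1" using y(1) lpS(3) lpD(4)[of y c] cc t by (auto simp: y'_def t_def)
    have fy': "f y' = cmod (f y) / t"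
    proof -
      have "f y' = cnj (f y) * f y / (cmod (f y) * t)" by (simp add: y'_def fl(2) y c_def)
      also have "cnj (f y) * f y = (cmod (f y))\<^sup>2" by (metis complex_norm_square mult.commute)
      finally show ?thesis using fy0 by (simp add: power2_eq_square)
    qed
    have "\<epsilon> \<le> cmod (f y) / t" using y(3) t by (simp add: field_simps t_def)
    then have Re: "Re (f y') \<ge> \<epsilon>" by (simp add: fy')
    have "(\<lambda>n. C * lpnorm p (restr {n..} y')) \<longlonglongrightarrow> C * 0" by (intro tendsto_intros tail_tendsto y')
    then have "eventually (\<lambda>n. C * lpnorm p (restr {n..} y') < \<epsilon> / 2) sequentially"
      using \<epsilon> by (intro order_tendstoD) auto
    then obtain n where n: "C * lpnorm p (restr {n..} y') < \<epsilon> / 2" by (auto simp: eventually_sequentially)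
    have "f y' = f (restr {..<n} y') + f (restr {n..} y')"
      using restr_split[of y' n] fl(1)[of "restr {..<n} y'" "restr {n..} y'"] restr_lp y' by simp
    moreover have "cmod (f (restr {n..} y')) \<le> \<epsilon> / 2"
      using C(2)[OF restr_lp[OF y'(1)], of "{n..}"] n by simp
    ultimately have "Re (f (restr {..<n} y')) \<ge> \<epsilon> / 2"
      using Re abs_Re_le_cmod[of "f (restr {n..} y')"] by simp
    moreover have "lpnorm p (restr {..<n} y') \<le> 1" using lpnorm_restr[OF y'(1)] y'(2) by metis
    ultimately show ?thesis
      by (intro exI[of _ "restr {..<n} y'"] exI[of _ n]) (auto simp: restr_def y'_def y)
  qed
  \<comment> \<open>\<open>m\<close> disjoint blocks: the functional grows like \<open>m\<close>, the norm only like \<open>m\<^bsup>1/p\<^esup>\<close>.\<close>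
  have many: "\<forall>N. \<exists>y n. (\<forall>s. s < N \<or> n \<le> s \<longrightarrow> y s = 0) \<and> lpnorm p y powr p \<le> m \<and> Re (f y) \<ge> m * (\<epsilon> / 2)" for m :: nat
  proof (induction m)
    case 0
    have "lpnorm p 0 powr p \<le> real 0" "real 0 * (\<epsilon> / 2) \<le> Re (f 0)" unfolding fl(3) lpD(5) by auto
    then show ?case by (metis zero_fun_apply)
  next
    case (Suc m)
    show ?case
    proof
      fix N
      obtain y n where y: "\<And>s. s < N \<or> n \<le> s \<Longrightarrow> y s = 0" "lpnorm p y \<le> 1" "Re (f y) \<ge> \<epsilon> / 2"
        using one[of N] by blast
      obtain x k where x: "\<And>s. s < max n N \<or> k \<le> s \<Longrightarrow> x s = 0" "lpnorm p x powr p \<le> m" "Re (f x) \<ge> m * (\<epsilon> / 2)"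
        using Suc by blast
      have lp: "x \<in> lp p" "y \<in> lp p" using finite_support_lp[of k x] finite_support_lp[of n y] x(1) y(1) by auto
      have "cmod ((x + y) i) powr p \<le> 1 * (\<Sum>b\<in>{True,False}. cmod ((if b then x else y) i) powr p)" for i
        using x(1)[of i] y(1)[of i] by (cases "i < n") (auto simp: less_max_iff_disj)
      from lpnorm_powr_le_sum(2)[of "{True,False}" "\<lambda>b. if b then x else y" 1 "x + y", OF _ _ this]
      have "lpnorm p (x + y) powr p \<le> lpnorm p x powr p + lpnorm p y powr p" using lp by simp
      moreover have "lpnorm p y powr p \<le> 1" using y(2) powr_p_le_iff[of "lpnorm p y" 1] by simp
      ultimately have "lpnorm p (x + y) powr p \<le> Suc m" using x(2) by simp
      moreover have "Re (f (x + y)) \<ge> Suc m * (\<epsilon> / 2)"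
        using x(3) y(3) by (simp add: fl(1) lp algebra_simps add_divide_distrib)
      ultimately show "\<exists>y n. (\<forall>s. s < N \<or> n \<le> s \<longrightarrow> y s = 0) \<and> lpnorm p y powr p \<le> Suc m \<and> Re (f y) \<ge> Suc m * (\<epsilon> / 2)"
        using x(1) y(1) by (intro exI[of _ "x+y"] exI[of _ "max n k"]) (auto simp: less_max_iff_disj)
    qed
  qed
  have upper: "real m powr (1 - 1/p) \<le> 2 * C / \<epsilon>" if "m > 0" for m :: nat
  proof -
    obtain y n where y: "\<And>s. s < 0 \<or> n \<le> s \<Longrightarrow> y s = 0" "lpnorm p y powr p \<le> m" "Re (f y) \<ge> m * (\<epsilon> / 2)"
      using many[of m] by blast
    have lp: "y \<in> lp p" using finite_support_lp[of n y] y(1) by auto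
    have "(lpnorm p y powr p) powr (1/p) \<le> m powr (1/p)" using y(2) p_gt_1 by (intro powr_mono2) auto
    then have nm: "lpnorm p y \<le> m powr (1/p)" by (simp add: powr_p_root)
    have "m * (\<epsilon> / 2) \<le> C * lpnorm p y" using y(3) complex_Re_le_cmod[of "f y"] C(2)[OF lp] by linarith
    also have "\<dots> \<le> C * m powr (1/p)" using nm C by (intro mult_left_mono) auto
    finally have "m * (\<epsilon> / 2) / m powr (1/p) \<le> C" using that by (simp add: field_simps)
    moreover have "m powr (1 - 1/p) * (\<epsilon> / 2) = m * (\<epsilon> / 2) / m powr (1/p)" using that by (simp add: powr_diff)
    ultimately have "m powr (1 - 1/p) * (\<epsilon> / 2) \<le> C" by linarith
    then show ?thesis using \<epsilon> by (simp add: field_simps)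
  qed
  define a where "a = 1 - 1/p"
  have a: "a > 0" using p_gt_1 by (simp add: a_def)
  obtain m :: nat where m: "real m > (2 * C / \<epsilon>) powr (1 / a)" using reals_Archimedean2 by blast
  have "m > 0" using m by (metis of_nat_0_less_iff powr_ge_zero order_le_less_trans)
  have "((2 * C / \<epsilon>) powr (1 / a)) powr a < real m powr a" using m a by (intro powr_less_mono2) auto
  then have "real m powr (1 - 1/p) > 2 * C / \<epsilon>" using a C \<epsilon> unfolding a_def[symmetric] by (simp add: powr_powr)
  then show False using upper[OF \<open>m > 0\<close>] by linarith
qed

lemma coord_functional: "bdd_op (lp p) (lpnorm p) (UNIV::complex set) cmod (\<lambda>x. x s)"
  by (rule bdd_opI[where C=1]) (auto simp: clinear_on_def coord_le_lpnorm)

text \<open>Split a bounded sequence at the index given by \<open>functional_tail_small\<close>: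
  finitely many coordinates tend to 0, and the functional is uniformly small on the remaining
  tails.\<close>

lemma wnullI:
  assumes X: "\<And>k. X k \<in> lp p" "\<And>k. lpnorm p (X k) \<le> B" and lim: "\<And>s. ((\<lambda>k. X k s) \<longlongrightarrow> 0) F"
  shows "wnull F p X"
  unfolding wnull_def
proof (intro allI impI)
  fix f assume f: "bdd_op (lp p) (lpnorm p) (UNIV::complex set) cmod f"
  note fl = clinear_onD[OF bdd_opD(1)[OF f]] clinear_on_rules[OF bdd_opD(1)[OF f] lpD(1)]
  have B: "0 \<le> B" using X(2)[of 0] lpnorm_nonneg[of "X 0"] by linarith
  show "((\<lambda>k. f (X k)) \<longlongrightarrow> 0) F"
  proof (rule tendstoI)
    fix \<epsilon> :: real assume \<epsilon>: "\<epsilon> > 0"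
    \<comment> \<open>The tolerance is divided by \<open>B + 1\<close> rather than \<open>B\<close>
      because \<open>B\<close> may be 0.\<close>
    obtain N where N: "\<And>y. y \<in> lp p \<Longrightarrow> (\<And>s. s < N \<Longrightarrow> y s = 0) \<Longrightarrow> cmod (f y) \<le> \<epsilon> / (2 * (B + 1)) * lpnorm p y"
      using functional_tail_small[OF f, of "\<epsilon> / (2 * (B + 1))"] \<epsilon> B by auto
    have "((\<lambda>k. \<Sum>s<N. X k s * f (unitv s)) \<longlongrightarrow> (\<Sum>s<N. 0 * f (unitv s))) F"
      by (intro tendsto_intros lim)
    then have "eventually (\<lambda>k. dist (\<Sum>s<N. X k s * f (unitv s)) 0 < \<epsilon> / 2) F"
      using \<epsilon> by (intro tendstoD) auto
    then show "eventually (\<lambda>k. dist (f (X k)) 0 < \<epsilon>) F"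
    proof eventually_elim
      case (elim k)
      have "f (X k) = f (restr {..<N} (X k)) + f (restr {N..} (X k))"
        using restr_split[of "X k" N] fl(1)[of "restr {..<N} (X k)" "restr {N..} (X k)"] restr_lp X by simp
      also have "f (restr {..<N} (X k)) = (\<Sum>s<N. X k s * f (unitv s))"
        unfolding restr_eq_sum by (subst fl(6)) (auto simp: fl(2) lpS(3))
      finally have e: "f (X k) = (\<Sum>s<N. X k s * f (unitv s)) + f (restr {N..} (X k))" .
      have "cmod (f (restr {N..} (X k))) \<le> \<epsilon> / (2 * (B + 1)) * lpnorm p (restr {N..} (X k))"
        by (rule N[OF restr_lp[OF X(1)]]) (simp add: restr_def)
      also have "\<dots> \<le> \<epsilon> / (2 * (B + 1)) * B"
        using \<epsilon> B order_trans[OF lpnorm_restr[OF X(1)] X(2)] by (intro mult_left_mono) auto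
      also have "\<dots> \<le> \<epsilon> / 2" using \<epsilon> B by (simp add: field_simps)
      finally have "cmod (f (restr {N..} (X k))) \<le> \<epsilon> / 2" .
      then show ?case using elim norm_triangle_ineq[of "\<Sum>s<N. X k s * f (unitv s)" "f (restr {N..} (X k))"] by (simp add: e)
    qed
  qed
qed

text \<open>Weak sequential compactness of balls: a diagonal subsequence converges in every
  coordinate, the limit stays in the ball by Fatou, and coordinatewise null means weakly null. It
  provides the subsequences in the compactness proof.\<close>

lemma weak_seq_compact:
  fixes w :: "nat \<Rightarrow> nat \<Rightarrow> complex"
  assumes w: "\<And>j. w j \<in> lp p" "\<And>j. lpnorm p (w j) \<le> B"
  obtains r x where "strict_mono (r::nat\<Rightarrow>nat)" "x \<in> lp p" "lpnorm p x \<le> B" "wnull sequentially p (\<lambda>j. w (r j) - x)"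
proof -
  have "norm (w j s) \<le> B" for j s using coord_le_lpnorm[OF w(1), of j s] w(2)[of j] by simp
  then have "\<exists>r. strict_mono (r::nat\<Rightarrow>nat) \<and> (\<forall>s. \<exists>l. (\<lambda>j. w (r j) s) \<longlonglongrightarrow> l)"
    by (rule_tac function_convergent_subsequence[of UNIV w B]) auto
  then obtain r where r: "strict_mono (r::nat\<Rightarrow>nat)" and "\<forall>s. \<exists>l. (\<lambda>j. w (r j) s) \<longlonglongrightarrow> l" by blast
  then obtain x where x: "\<And>s. (\<lambda>j. w (r j) s) \<longlonglongrightarrow> x s" using choice[of "\<lambda>s l. (\<lambda>j. w (r j) s) \<longlonglongrightarrow> l"] by blast
  have xl: "x \<in> lp p" "lpnorm p x \<le> B"
    using lp_limit[of sequentially "\<lambda>j. w (r j)" B x] w x by auto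
  have "wnull sequentially p (\<lambda>j. w (r j) - x)"
  proof (rule wnullI[where B="2*B"])
    show "w (r j) - x \<in> lp p" for j using w xl lpS by simp
    show "lpnorm p (w (r j) - x) \<le> 2 * B" for j using lpD(7)[OF w(1)[of "r j"] xl(1)] w(2)[of "r j"] xl(2) by simp
    show "(\<lambda>j. (w (r j) - x) s) \<longlonglongrightarrow> 0" for s using x[of s] by (simp add: LIM_zero)
  qed
  with r xl that show ?thesis by blast
qed

text \<open>The Neumann series of \<open>D = - E\<close>. It is summed coordinatewise, and
  \<open>lp_limit\<close> shows that the sum lies in l^p, so completeness is never invoked. A left
  inverse is enough, since the other composition is treated separately where the lemma is
  applied.\<close>

lemma left_inverse_of_small_perturbation:
  assumes E: "clinear_on (lp p) E" "\<And>x. x \<in> lp p \<Longrightarrow> E x \<in> lp p" "\<And>x. x \<in> lp p \<Longrightarrow> lpnorm p (E x) \<le> lpnorm p x / 2"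
  obtains G where "clinear_on (lp p) G" "\<And>x. x \<in> lp p \<Longrightarrow> G x \<in> lp p" "\<And>x. x \<in> lp p \<Longrightarrow> lpnorm p (G x) \<le> 2 * lpnorm p x"
    "\<And>x. x \<in> lp p \<Longrightarrow> G (x + E x) = x"
proof -
  define D where "D = (\<lambda>x. - E x)"
  have D: "D x \<in> lp p" "lpnorm p (D x) \<le> lpnorm p x / 2" if "x \<in> lp p" for x
    using E(2,3)[OF that] lpS(4)[of "E x"] lpD(6)[of "E x"] unfolding D_def by auto
  have Dlin: "D (x + y) = D x + D y" "D (c *\<^sub>C x) = c *\<^sub>C D x" if "x \<in> lp p" "y \<in> lp p" for x y c
    using clinear_onD[OF E(1)] that by (auto simp: D_def)
  have Dk: "(D ^^ k) x \<in> lp p \<and> lpnorm p ((D ^^ k) x) \<le> (1/2)^k * lpnorm p x" if "x \<in> lp p" for k x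
  proof (induction k)
    case (Suc k)
    have "D ((D ^^ k) x) \<in> lp p" "lpnorm p (D ((D ^^ k) x)) \<le> lpnorm p ((D ^^ k) x) / 2"
      using Suc D by auto
    then show ?case using Suc by simp
  qed (simp add: that)
  have "clinear_on (lp p) (D ^^ k)" for k
  proof (induction k)
    case (Suc k)
    have "clinear_on (lp p) D" using Dlin by (simp add: clinear_on_def)
    from clinear_on_compose[OF Suc this] show ?case using Dk by (auto simp: o_def image_subset_iff)
  qed (simp add: id_def)
  then have lin: "(D ^^ k) (x + y) = (D ^^ k) x + (D ^^ k) y \<and> (D ^^ k) (c *\<^sub>C x) = c *\<^sub>C (D ^^ k) x" if "x \<in> lp p" "y \<in> lp p" for k c x y
    using that by (simp add: clinear_on_def)
  define G where "G x = (\<lambda>i. \<Sum>k. (D ^^ k) x i)" for x :: "nat \<Rightarrow> complex"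
  have bnd: "cmod ((D ^^ k) x i) \<le> (1/2)^k * lpnorm p x" if "x \<in> lp p" for k x i
    using coord_le_lpnorm[of "(D ^^ k) x" i] Dk[OF that, of k] by simp
  have sm: "summable (\<lambda>k. (D ^^ k) x i)" if "x \<in> lp p" for x i
    by (rule summable_comparison_test'[of "\<lambda>k. (1/2)^k * lpnorm p x" 0]) (auto intro: summable_mult2 summable_geometric bnd[OF that])
  show ?thesis
  proof
    show "clinear_on (lp p) G"
      using lin sm by (auto simp: clinear_on_def G_def fun_eq_iff suminf_add suminf_mult)
    fix x assume x: "x \<in> lp p"
    have part: "lpnorm p (\<Sum>k<n. (D ^^ k) x) \<le> 2 * lpnorm p x" for n
    proof -
      have "lpnorm p (\<Sum>k<n. (D ^^ k) x) \<le> (\<Sum>k<n. lpnorm p ((D ^^ k) x))"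
        by (rule seminormed_sum[OF seminormed_lp]) (simp add: Dk x)
      also have "\<dots> \<le> (\<Sum>k<n. (1/2)^k * lpnorm p x)" using Dk[OF x] by (intro sum_mono) auto
      also have "\<dots> = (\<Sum>k<n. (1/2)^k) * lpnorm p x" by (simp add: sum_distrib_right)
      also have "\<dots> \<le> 2 * lpnorm p x" by (intro mult_right_mono) (auto simp: sum_gp_strict)
      finally show ?thesis .
    qed
    have lim: "(\<lambda>n. (\<Sum>k<n. (D ^^ k) x) s) \<longlonglongrightarrow> G x s" for s
      unfolding sum_fun_apply G_def by (rule summable_LIMSEQ[OF sm[OF x]])
    show "G x \<in> lp p" "lpnorm p (G x) \<le> 2 * lpnorm p x"
      using lp_limit[of sequentially "\<lambda>n. \<Sum>k<n. (D ^^ k) x" "2 * lpnorm p x" "G x"] part lim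
        csubspace_sum[OF lpD(1), of "{..<_}" "\<lambda>k. (D ^^ k) x"] Dk[OF x] by auto
    show "G (x + E x) = x"
    proof
      fix i
      have Ex: "E x = - D x" by (simp add: D_def)
      \<comment> \<open>As \<open>x + E x = x - D x\<close>, the series telescopes and only its
        zeroth term \<open>x\<close> survives.\<close>
      have "(D ^^ k) (x + E x) i = (D ^^ k) x i - (D ^^ (Suc k)) x i" for k
      proof -
        have "(D ^^ k) (x + (-1) *\<^sub>C D x) = (D ^^ k) x + (-1) *\<^sub>C (D ^^ k) (D x)"
          using lin[OF x lpS(3), of "D x" k "-1" "-1"] lin[of "D x" "D x" k "-1"] Dk[OF x, of 1] by simp
        then show ?thesis by (simp add: Ex funpow_swap1)
      qed
      then have "G (x + E x) i = (\<Sum>k. (D ^^ k) x i - (D ^^ (Suc k)) x i)" by (simp add: G_def)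
      also have "\<dots> = (D ^^ 0) x i"
      proof (rule sums_unique[symmetric])
        have "(\<lambda>k. (D ^^ k) x i) \<longlonglongrightarrow> 0" by (rule summable_LIMSEQ_zero[OF sm[OF x]])
        from telescope_sums'[OF this] show "(\<lambda>k. (D ^^ k) x i - (D ^^ (Suc k)) x i) sums (D ^^ 0) x i" by simp
      qed
      finally show "G (x + E x) i = x i" by simp
    qed
  qed
qed

end

section \<open>Uniform smoothness of \<open>l\<^sup>p\<close>\<close>

text \<open>Up to the factor p, the gradient of the p-th power of the norm at \<open>x\<close>. It
  has the same support as \<open>x\<close>, so finitely supported vectors yield finitely supported
  functionals.\<close>

definition duality_map :: "real \<Rightarrow> (nat \<Rightarrow> complex) \<Rightarrow> nat \<Rightarrow> complex" where
  "duality_map p x = (\<lambda>i. cnj (x i) * of_real (cmod (x i) powr (p - 2)))"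

text \<open>The bilinear pairing, without conjugation. Over an infinite support the sum is 0 by
  convention, so \<open>cpair z\<close> is linear for every \<open>z\<close>; it is the true pairing
  when the support is finite, as it is in all applications.\<close>

definition cpair :: "(nat \<Rightarrow> complex) \<Rightarrow> (nat \<Rightarrow> complex) \<Rightarrow> complex" where
  "cpair z y = (\<Sum>s | z s \<noteq> 0. z s * y s)"

lemma cpair_eq: "finite F \<Longrightarrow> (\<And>s. s \<notin> F \<Longrightarrow> z s = 0) \<Longrightarrow> cpair z y = (\<Sum>s\<in>F. z s * y s)"
  unfolding cpair_def by (intro sum.mono_neutral_left) auto

lemma clinear_cpair: "clinear_on V (cpair z)"
  by (auto simp: clinear_on_def cpair_def sum.distrib algebra_simps sum_distrib_left)

lemma norm_duality_map: "1 < p \<Longrightarrow> cmod (duality_map p x i) = cmod (x i) powr (p - 1)"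
  using powr_add[of "cmod (x i)" 1 "p - 2"] by (simp add: duality_map_def norm_mult)

lemma young_nonneg:
  fixes a b \<alpha> \<beta> :: real
  assumes "0 \<le> a" "0 \<le> b" "0 \<le> \<alpha>" "0 \<le> \<beta>" "\<alpha> + \<beta> = 1"
  shows "a powr \<alpha> * b powr \<beta> \<le> \<alpha> * a + \<beta> * b"
proof (cases "a = 0 \<or> b = 0")
  case False
  then show ?thesis using assms by (intro Youngs_inequality_0) auto
qed (use assms in auto)

text \<open>First-order Taylor expansion: the square of \<open>cmod (1 + z)\<close> is
  \<open>1 + u\<close> with \<open>u = 2 * Re z + (cmod z)\<^sup>2\<close>, and the power p/2 has
  derivative p/2 at 1.\<close>

lemma norm_one_plus_powr_le:
  fixes \<epsilon> p :: real
  assumes "\<epsilon> > 0" "p > 0"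
  shows "\<exists>\<delta>>0. \<forall>z. cmod z \<le> \<delta> \<longrightarrow> cmod (1 + z) powr p \<le> 1 + p * Re z + \<epsilon> * cmod z"
proof -
  \<comment> \<open>As \<open>\<bar>u\<bar> \<le> 3 * cmod z\<close>, the remainder in
    \<open>u\<close> costs \<open>\<epsilon> / 2 * cmod z\<close>; the other half pays for the
    quadratic term, thanks to \<open>cmod z \<le> \<epsilon> / p\<close>.\<close>
  define \<eta> where "\<eta> = \<epsilon> / 6"
  have "((\<lambda>u::real. (1 + u) powr (p/2)) has_real_derivative (p/2)) (at 0)"
    by (auto intro!: derivative_eq_intros)
  then have "(\<lambda>u. ((1 + u) powr (p/2) - 1) / u) \<midarrow>0\<rightarrow> p/2"
    by (simp add: DERIV_def)
  then have "eventually (\<lambda>u. dist (((1 + u) powr (p/2) - 1) / u) (p/2) < \<eta>) (at 0)"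
    by (rule tendstoD) (simp add: \<eta>_def assms)
  then obtain d where d: "d > 0" "\<And>u. u \<noteq> 0 \<Longrightarrow> \<bar>u\<bar> < d \<Longrightarrow> \<bar>((1 + u) powr (p/2) - 1) / u - p/2\<bar> < \<eta>"
    by (auto simp: eventually_at dist_real_def)
  have h: "(1 + u) powr (p/2) \<le> 1 + (p/2) * u + \<eta> * \<bar>u\<bar>" if "\<bar>u\<bar> < d" for u
  proof (cases "u = 0")
    case False
    have "(1 + u) powr (p/2) - 1 - (p/2) * u = u * (((1 + u) powr (p/2) - 1) / u - p/2)"
      using False by (simp add: field_simps)
    also have "\<dots> \<le> \<bar>u\<bar> * \<bar>((1 + u) powr (p/2) - 1) / u - p/2\<bar>" by (metis abs_ge_self abs_mult)
    also have "\<dots> \<le> \<bar>u\<bar> * \<eta>" using d(2)[OF False that] by (intro mult_left_mono) auto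
    finally show ?thesis by (simp add: algebra_simps)
  qed simp
  define \<delta> where "\<delta> = min 1 (min (d / 4) (\<epsilon> / p))"
  show ?thesis
  proof (intro exI[of _ \<delta>] conjI allI impI)
    show "\<delta> > 0" using d assms by (auto simp: \<delta>_def)
    fix z :: complex assume z: "cmod z \<le> \<delta>"
    define u where "u = 2 * Re z + (cmod z)\<^sup>2"
    have z1: "cmod z \<le> 1" "cmod z \<le> d / 4" "cmod z \<le> \<epsilon> / p" using z by (auto simp: \<delta>_def)
    have sq: "(cmod z)\<^sup>2 \<le> cmod z" using z1(1) by (simp add: power2_eq_square mult_left_le)
    have au: "\<bar>u\<bar> \<le> 3 * cmod z" using abs_Re_le_cmod[of z] sq unfolding u_def
      by (smt (verit) zero_le_power2)
    have ud: "\<bar>u\<bar> < d" using au z1(2) d(1) by linarith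
    have "cmod (1 + z) powr p = ((cmod (1 + z))\<^sup>2) powr (p/2)" by (simp add: powr_powr flip: powr_numeral)
    also have "(cmod (1 + z))\<^sup>2 = 1 + u" unfolding u_def cmod_power2 by (simp add: power2_eq_square algebra_simps)
    also have "(1 + u) powr (p/2) \<le> 1 + (p/2) * u + \<eta> * \<bar>u\<bar>" by (rule h[OF ud])
    also have "\<dots> \<le> 1 + p * Re z + (p / 2) * (cmod z)\<^sup>2 + \<eta> * (3 * cmod z)"
      using au assms by (simp add: u_def algebra_simps \<eta>_def)
    also have "(p / 2) * (cmod z)\<^sup>2 \<le> (\<epsilon> / 2) * cmod z"
    proof -
      have "p * cmod z \<le> \<epsilon>" using z1(3) assms by (simp add: field_simps)
      then have "p * cmod z * cmod z \<le> \<epsilon> * cmod z" by (intro mult_right_mono) auto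
      then show ?thesis by (simp add: power2_eq_square)
    qed
    finally show "cmod (1 + z) powr p \<le> 1 + p * Re z + \<epsilon> * cmod z" by (simp add: \<eta>_def)
  qed
qed

text \<open>Two regimes. If \<open>b\<close> is small relative to \<open>a\<close>, scale by
  \<open>a\<close> and expand \<open>1 + b / a\<close>. Otherwise \<open>a\<close> is at most a
  multiple of \<open>b\<close>, and everything is absorbed by a multiple of
  \<open>cmod b powr p\<close>.\<close>

lemma norm_add_powr_le:
  fixes \<epsilon> p :: real
  assumes "\<epsilon> > 0" "p > 1"
  shows "\<exists>C\<ge>0. \<forall>a b. cmod (a + b) powr p \<le> cmod a powr p + p * Re (cnj a * of_real (cmod a powr (p - 2)) * b)
     + \<epsilon> * (cmod a powr (p - 1) * cmod b) + C * cmod b powr p"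
proof -
  obtain \<delta> where \<delta>: "\<delta> > 0" "\<And>z. cmod z \<le> \<delta> \<Longrightarrow> cmod (1 + z) powr p \<le> 1 + p * Re z + \<epsilon> * cmod z"
    using norm_one_plus_powr_le[of \<epsilon> p] assms by auto
  \<comment> \<open>In the second regime the first summand bounds the left-hand side, and the second
    one compensates the linear term, which may be negative.\<close>
  define C where "C = (1/\<delta> + 1) powr p + p * (1/\<delta>) powr (p - 1)"
  have C0: "C \<ge> 0" using assms \<delta> by (simp add: C_def)
  show ?thesis
  proof (intro exI[of _ C] conjI allI C0)
    fix a b :: complex
    have J: "cmod (cnj a * of_real (cmod a powr (p - 2)) * b) = cmod a powr (p - 1) * cmod b"
      using powr_add[of "cmod a" 1 "p - 2"] by (simp add: norm_mult)
    show "cmod (a + b) powr p \<le> cmod a powr p + p * Re (cnj a * of_real (cmod a powr (p - 2)) * b)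
       + \<epsilon> * (cmod a powr (p - 1) * cmod b) + C * cmod b powr p"
    proof (cases "cmod b \<le> \<delta> * cmod a \<and> a \<noteq> 0")
      case True
      define z where "z = b / a"
      have a: "cmod a > 0" using True by simp
      have z: "cmod z \<le> \<delta>" using True a by (simp add: z_def norm_divide field_simps)
      have "cmod (a + b) powr p = cmod a powr p * cmod (1 + z) powr p"
      proof -
        have "a + b = a * (1 + z)" using a by (simp add: z_def field_simps)
        then show ?thesis by (simp add: norm_mult powr_mult)
      qed
      also have "\<dots> \<le> cmod a powr p * (1 + p * Re z + \<epsilon> * cmod z)" by (intro mult_left_mono \<delta> z) auto
      also have "\<dots> = cmod a powr p + p * (cmod a powr p * Re z) + \<epsilon> * (cmod a powr p * cmod z)"
        by (simp add: algebra_simps)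
      also have "cmod a powr p * cmod z = cmod a powr (p - 1) * cmod b"
        using a by (simp add: z_def norm_divide powr_diff)
      also have "cmod a powr p * Re z = Re (cnj a * of_real (cmod a powr (p - 2)) * b)"
      proof -
        have "z = cnj a * b / (cmod a)\<^sup>2" unfolding z_def using a by (simp add: complex_div_cnj[of b a] mult.commute)
        then have "of_real (cmod a powr p) * z = cnj a * of_real (cmod a powr p / (cmod a)\<^sup>2) * b" by simp
        also have "cmod a powr p / (cmod a)\<^sup>2 = cmod a powr (p - 2)" using a by (simp add: powr_diff powr_numeral)
        finally have "of_real (cmod a powr p) * z = cnj a * of_real (cmod a powr (p - 2)) * b" .
        moreover have "cmod a powr p * Re z = Re (of_real (cmod a powr p) * z)" by simp
        ultimately show ?thesis by metis
      qed
      finally show ?thesis using mult_nonneg_nonneg[OF C0 powr_ge_zero[of "cmod b" p]] by linarith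
    next
      case False
      then have a: "cmod a \<le> cmod b / \<delta>" using \<delta>(1) by (auto simp: field_simps)
      have "cmod (a + b) \<le> (1/\<delta> + 1) * cmod b" using norm_triangle_ineq[of a b] a by (simp add: algebra_simps)
      then have "cmod (a + b) powr p \<le> ((1/\<delta> + 1) * cmod b) powr p" using assms by (intro powr_mono2) auto
      then have 1: "cmod (a + b) powr p \<le> (1/\<delta> + 1) powr p * cmod b powr p" using \<delta> by (simp add: powr_mult)
      have "cmod a powr (p - 1) * cmod b \<le> (1/\<delta> * cmod b) powr (p - 1) * cmod b"
        using a assms by (intro mult_right_mono powr_mono2) auto
      also have "\<dots> = (1/\<delta>) powr (p - 1) * (cmod b powr (p - 1) * cmod b powr 1)" using \<delta>(1) powr_mult[of "1/\<delta>" "cmod b" "p - 1"] by simp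
      also have "\<dots> = (1/\<delta>) powr (p - 1) * cmod b powr p" using powr_add[of "cmod b" "p - 1" 1] by simp
      finally have "p * (cmod a powr (p - 1) * cmod b) \<le> p * ((1/\<delta>) powr (p - 1) * cmod b powr p)"
        using assms by (intro mult_left_mono) auto
      moreover have "- Re (cnj a * of_real (cmod a powr (p - 2)) * b) \<le> cmod a powr (p - 1) * cmod b"
        using abs_Re_le_cmod[of "cnj a * of_real (cmod a powr (p - 2)) * b"] J by linarith
      from mult_left_mono[OF this, of p]
      have "- (p * Re (cnj a * of_real (cmod a powr (p - 2)) * b)) \<le> p * (cmod a powr (p - 1) * cmod b)"
        using assms(2) unfolding mult_minus_right by linarith
      moreover have "0 \<le> \<epsilon> * (cmod a powr (p - 1) * cmod b)" "0 \<le> cmod a powr p" using assms by auto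
      moreover have "C * cmod b powr p = (1/\<delta> + 1) powr p * cmod b powr p + p * ((1/\<delta>) powr (p - 1) * cmod b powr p)"
        by (simp add: C_def distrib_right)
      ultimately show ?thesis using 1 by linarith
    qed
  qed
qed

context lp_space
begin

text \<open>Hoelder's inequality for the exponents p/(p-1) and p: Young's inequality applied to each
  coordinate after dividing \<open>h\<close> by its norm.\<close>

lemma hoelder_duality:
  assumes "x \<in> lp p" "h \<in> lp p" "lpnorm p x \<le> 1" "finite F"
  shows "(\<Sum>i\<in>F. cmod (x i) powr (p - 1) * cmod (h i)) \<le> lpnorm p h"
proof (cases "h = 0")
  case False
  define t where "t = lpnorm p h"
  have t: "t > 0" using False lpnorm_zero_iff[OF assms(2)] lpnorm_nonneg[of h] by (simp add: t_def less_le)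
  have pt: "cmod (x i) powr (p - 1) * cmod (h i) \<le> t * ((1 - 1/p) * cmod (x i) powr p + 1/p * (cmod (h i) powr p / t powr p))" for i
  proof -
    have "(cmod (x i) powr p) powr (1 - 1/p) * ((cmod (h i) / t) powr p) powr (1/p)
       \<le> (1 - 1/p) * cmod (x i) powr p + 1/p * (cmod (h i) / t) powr p"
      using p_gt_1 by (intro young_nonneg) auto
    moreover have "(cmod (x i) powr p) powr (1 - 1/p) = cmod (x i) powr (p - 1)"
    proof -
      have "p * (1 - 1/p) = p - 1" using p_gt_1 by (simp add: right_diff_distrib)
      then show ?thesis by (simp add: powr_powr)
    qed
    ultimately have "cmod (x i) powr (p - 1) * (cmod (h i) / t) \<le> (1 - 1/p) * cmod (x i) powr p + 1/p * (cmod (h i) powr p / t powr p)"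
      using t by (simp add: powr_p_root powr_divide)
    then show ?thesis using t by (simp add: field_simps)
  qed
  have "(\<Sum>i\<in>F. cmod (x i) powr (p - 1) * cmod (h i)) \<le> (\<Sum>i\<in>F. t * ((1 - 1/p) * cmod (x i) powr p + 1/p * (cmod (h i) powr p / t powr p)))"
    by (intro sum_mono pt)
  also have "\<dots> = t * ((1 - 1/p) * (\<Sum>i\<in>F. cmod (x i) powr p) + 1/p * ((\<Sum>i\<in>F. cmod (h i) powr p) / t powr p))"
    unfolding sum_divide_distrib sum_distrib_left sum.distrib[symmetric] ..
  also have "\<dots> \<le> t * ((1 - 1/p) * 1 + 1/p * 1)"
  proof -
    have "(\<Sum>i\<in>F. cmod (x i) powr p) \<le> 1"
      using sum_powr_le_lpnorm[OF assms(1,4)] powr_p_le_iff[of "lpnorm p x" 1] assms(3) by simp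
    moreover have "(\<Sum>i\<in>F. cmod (h i) powr p) / t powr p \<le> 1"
      using sum_powr_le_lpnorm[OF assms(2,4)] t by (simp add: t_def)
    ultimately show ?thesis using t p_gt_1 by (intro mult_left_mono add_mono) auto
  qed
  finally show ?thesis by (simp add: t_def)
qed simp

lemma cpair_duality_le:
  assumes "\<And>s. n \<le> s \<Longrightarrow> x s = 0" "lpnorm p x \<le> 1" "h \<in> lp p"
  shows "cmod (cpair (duality_map p x) h) \<le> lpnorm p h"
proof -
  have "cpair (duality_map p x) h = (\<Sum>s<n. duality_map p x s * h s)"
    using assms(1) by (intro cpair_eq) (auto simp: duality_map_def)
  also have "cmod \<dots> \<le> (\<Sum>s<n. cmod (x s) powr (p - 1) * cmod (h s))"
    by (rule sum_norm_le) (simp add: norm_mult norm_duality_map p_gt_1)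
  also have "\<dots> \<le> lpnorm p h" using assms finite_support_lp[of n x] by (intro hoelder_duality) auto
  finally show ?thesis .
qed

text \<open>The scalar estimates are summed over the coordinates, Hoelder bounding the mixed term.
  The point is uniformity: \<open>C\<close> does not depend on the base point \<open>x\<close>, so
  the estimate can be used at every term of a representative at once.\<close>

lemma uniform_smoothness:
  assumes "\<epsilon> > 0"
  shows "\<exists>C\<ge>0. \<forall>x h n. (\<forall>s\<ge>n. x s = 0) \<longrightarrow> lpnorm p x \<le> 1 \<longrightarrow> h \<in> lp p \<longrightarrow>
     lpnorm p (x + h) \<le> 1 + Re (cpair (duality_map p x) h) + \<epsilon> * lpnorm p h + C * lpnorm p h powr p"
proof -
  obtain C where C: "C \<ge> 0" "\<And>a b. cmod (a + b) powr p \<le> cmod a powr p + p * Re (cnj a * of_real (cmod a powr (p - 2)) * b)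
     + \<epsilon> * (cmod a powr (p - 1) * cmod b) + C * cmod b powr p"
    using norm_add_powr_le[OF assms p_gt_1] by blast
  show ?thesis
  proof (intro exI[of _ C] conjI allI impI C(1))
    fix x h :: "nat \<Rightarrow> complex" and n :: nat
    assume n: "\<forall>s\<ge>n. x s = 0" and x1: "lpnorm p x \<le> 1" and h: "h \<in> lp p"
    have x: "x \<in> lp p" using n finite_support_lp by blast
    define P where "P = Re (cpair (duality_map p x) h)"
    define q where "q = 1 + p * P + \<epsilon> * lpnorm p h + C * lpnorm p h powr p"
    have sec: "(\<Sum>i<m. cmod ((x + h) i) powr p) \<le> q" for m
    proof -
      have "(\<Sum>i<m. cmod ((x + h) i) powr p) \<le> (\<Sum>i<max m n. cmod ((x + h) i) powr p)"
        by (intro sum_mono2) auto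
      also have "\<dots> \<le> (\<Sum>i<max m n. cmod (x i) powr p + p * Re (duality_map p x i * h i) + \<epsilon> * (cmod (x i) powr (p - 1) * cmod (h i)) + C * cmod (h i) powr p)"
        by (intro sum_mono) (use C(2) in \<open>auto simp: duality_map_def\<close>)
      also have "\<dots> = (\<Sum>i<max m n. cmod (x i) powr p) + p * (\<Sum>i<max m n. Re (duality_map p x i * h i)) + \<epsilon> * (\<Sum>i<max m n. cmod (x i) powr (p - 1) * cmod (h i)) + C * (\<Sum>i<max m n. cmod (h i) powr p)"
        by (simp add: sum.distrib sum_distrib_left)
      also have "(\<Sum>i<max m n. Re (duality_map p x i * h i)) = P"
        unfolding P_def using n by (subst cpair_eq[of "{..<max m n}"]) (auto simp: duality_map_def)
      also have "(\<Sum>i<max m n. cmod (x i) powr p) + p * P + \<epsilon> * (\<Sum>i<max m n. cmod (x i) powr (p - 1) * cmod (h i)) + C * (\<Sum>i<max m n. cmod (h i) powr p) \<le> q"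
        unfolding q_def
      proof (intro add_mono mult_left_mono order_refl)
        show "(\<Sum>i<max m n. cmod (x i) powr p) \<le> 1"
          using sum_powr_le_lpnorm[OF x, of "{..<max m n}"] powr_p_le_iff[of "lpnorm p x" 1] x1 by simp
      qed (use hoelder_duality[OF x h x1] sum_powr_le_lpnorm[OF h] C(1) assms p_gt_1 in auto)
      finally show ?thesis .
    qed
    have q: "0 \<le> q" using sec[of 0] by simp
    have "lpnorm p (x + h) \<le> q powr (1/p)"
      using q sec by (intro lp_criterion) (auto simp: powr_p_root)
    \<comment> \<open>Passing from the p-th power back to the norm: the tangent of the root at 1
      lies above it, and its slope 1/p cancels the factor p in front of the pairing.\<close>
    also have "q powr (1/p) * 1 powr (1 - 1/p) \<le> 1/p * q + (1 - 1/p) * 1"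
      using p_gt_1 q by (intro young_nonneg) auto
    then have "q powr (1/p) \<le> 1 + P + (\<epsilon> * lpnorm p h) / p + (C * lpnorm p h powr p) / p"
    proof -
      assume "q powr (1/p) * 1 powr (1 - 1/p) \<le> 1/p * q + (1 - 1/p) * 1"
      also have "1/p * q = 1/p + P + (\<epsilon> * lpnorm p h) / p + (C * lpnorm p h powr p) / p"
        using p_gt_1 by (simp add: q_def add_divide_distrib)
      finally show ?thesis by simp
    qed
    also have "\<dots> \<le> 1 + P + \<epsilon> * lpnorm p h + C * lpnorm p h powr p"
    proof (intro add_mono order_refl)
      have "a / p \<le> a" if "0 \<le> a" for a using that p_gt_1 by (simp add: divide_le_eq mult_le_cancel_left1)
      then show "\<epsilon> * lpnorm p h / p \<le> \<epsilon> * lpnorm p h" "C * lpnorm p h powr p / p \<le> C * lpnorm p h powr p"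
        using C(1) assms by auto
    qed
    finally show "lpnorm p (x + h) \<le> 1 + Re (cpair (duality_map p x) h) + \<epsilon> * lpnorm p h + C * lpnorm p h powr p"
      by (simp add: P_def)
  qed
qed

end

section \<open>The ultrapower of \<open>l\<^sup>p\<close>\<close>

locale ultra = lp_space +
  fixes U :: "nat filter"
  assumes ultrafilter: "free_ultrafilter_nat U"
begin

lemma U_ne_bot [simp]: "U \<noteq> bot"
  using ultrafilter by (simp add: free_ultrafilter_nat_def)

lemma eventually_not_U:
  assumes "\<not> eventually P U" shows "eventually (\<lambda>k. \<not> P k) U"
proof -
  have "\<forall>A. eventually (\<lambda>k. k \<in> A) U \<or> eventually (\<lambda>k. k \<notin> A) U"
    using ultrafilter by (simp add: free_ultrafilter_nat_def)
  from spec[OF this, of "{k. P k}"] show ?thesis using assms by simp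
qed

lemma U_le_sequentially: "U \<le> sequentially"
proof -
  have "eventually (\<lambda>k. n \<le> k) U" for n
  proof (induction n)
    case (Suc n)
    have "eventually (\<lambda>k. k \<noteq> n) U" using ultrafilter by (auto simp: free_ultrafilter_nat_def)
    with Suc show ?case by eventually_elim auto
  qed simp
  then show ?thesis unfolding le_filter_def eventually_sequentially by (metis (mono_tags, lifting) eventually_mono)
qed

lemma tendsto_U: "f \<longlonglongrightarrow> l \<Longrightarrow> (f \<longlongrightarrow> l) U"
  using U_le_sequentially by (rule tendsto_mono)

text \<open>By compactness of the ball there is a cluster point along \<open>U\<close>, and a
  cluster point along an ultrafilter is a limit.\<close>

lemma U_convergent:
  fixes f :: "nat \<Rightarrow> 'b::{real_normed_vector,heine_borel}"
  assumes "\<And>k. norm (f k) \<le> B"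
  obtains l where "(f \<longlongrightarrow> l) U" "norm l \<le> B"
proof -
  have "compact (cball (0::'b) B)" by simp
  moreover have "filtermap f U \<noteq> bot" by (simp add: filtermap_bot_iff)
  moreover have "eventually (\<lambda>x. x \<in> cball 0 B) (filtermap f U)" using assms by (simp add: eventually_filtermap)
  ultimately obtain l where l: "l \<in> cball 0 B" "inf (nhds l) (filtermap f U) \<noteq> bot"
    unfolding compact_filter by blast
  have "(f \<longlongrightarrow> l) U"
  proof (rule topological_tendstoI)
    fix S assume S: "open S" "l \<in> S"
    show "eventually (\<lambda>k. f k \<in> S) U"
    proof (rule ccontr)
      assume "\<not> ?thesis"
      then have "eventually (\<lambda>x. x \<notin> S) (filtermap f U)" using eventually_not_U by (simp add: eventually_filtermap)
      moreover have "eventually (\<lambda>x. x \<in> S) (nhds l)" using S eventually_nhds by blast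
      ultimately have "eventually (\<lambda>x. False) (inf (nhds l) (filtermap f U))" by (auto simp: eventually_inf)
      then show False using l(2) by (simp add: trivial_limit_def)
    qed
  qed
  then show ?thesis using that l(1) by auto
qed

abbreviation "hat \<equiv> hatlp U p"
abbreviation "un \<equiv> unorm U p"

lemma upwD: "X \<in> upw p \<Longrightarrow> X k \<in> lp p" by (auto simp: upw_def)

lemma upw_boundE:
  assumes "X \<in> upw p" obtains B where "B \<ge> 0" "\<And>k. lpnorm p (X k) \<le> B"
proof -
  obtain B where B: "\<And>k. lpnorm p (X k) \<le> B" using assms by (auto simp: upw_def)
  then have "B \<ge> 0" using lpnorm_nonneg[of "X 0"] order_trans by blast
  with B that show ?thesis by blast
qed

lemma unorm_tendsto:
  assumes "X \<in> upw p" shows "((\<lambda>k. lpnorm p (X k)) \<longlongrightarrow> un X) U"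
proof -
  obtain B where B: "\<And>k. lpnorm p (X k) \<le> B" using assms by (rule upw_boundE) (rule that)
  obtain l where "((\<lambda>k. lpnorm p (X k)) \<longlongrightarrow> l) U" by (rule U_convergent[of "\<lambda>k. lpnorm p (X k)" B]) (auto simp: B)
  moreover from this have "un X = l" unfolding unorm_def by (intro tendsto_Lim) auto
  ultimately show ?thesis by simp
qed

lemma unorm_le:
  assumes "X \<in> upw p" "eventually (\<lambda>k. lpnorm p (X k) \<le> B) U" shows "un X \<le> B"
  using tendsto_upperbound[OF unorm_tendsto[OF assms(1)] assms(2)] by simp

lemma unorm_less:
  "X \<in> upw p \<Longrightarrow> un X < B \<Longrightarrow> eventually (\<lambda>k. lpnorm p (X k) < B) U"
  "X \<in> upw p \<Longrightarrow> B < un X \<Longrightarrow> eventually (\<lambda>k. B < lpnorm p (X k)) U"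
  using order_tendstoD[OF unorm_tendsto] by blast+

lemma seminormed_upw: "seminormed (upw p) un"
proof -
  have add: "X + Y \<in> upw p" if X: "X \<in> upw p" and Y: "Y \<in> upw p" for X Y
  proof -
    obtain B C where BC: "\<And>k. lpnorm p (X k) \<le> B" "\<And>k. lpnorm p (Y k) \<le> C" using upw_boundE[OF X] upw_boundE[OF Y] by metis
    have "lpnorm p ((X + Y) k) \<le> B + C" for k using lpD(3)[OF upwD[OF X] upwD[OF Y], of k k] BC[of k] by simp
    then show ?thesis using lpS(2)[OF upwD[OF X] upwD[OF Y]] by (auto simp: upw_def)
  qed
  have sc: "c *\<^sub>C X \<in> upw p" if X: "X \<in> upw p" for X c
  proof -
    obtain B where B: "\<And>k. lpnorm p (X k) \<le> B" using upw_boundE[OF X] by metis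
    have "lpnorm p ((c *\<^sub>C X) k) \<le> cmod c * B" for k using lpD(4)[OF upwD[OF X], of c k] B[of k] by (simp add: mult_left_mono)
    then show ?thesis using lpS(3)[OF upwD[OF X]] by (auto simp: upw_def)
  qed
  have "csubspace (upw p)" using add sc lpS(1) lpD(5) by (auto simp: csubspace_def upw_def)
  moreover have "0 \<le> un X" if "X \<in> upw p" for X
    by (rule tendsto_lowerbound[OF unorm_tendsto[OF that]]) auto
  moreover have "un (X + Y) \<le> un X + un Y" if X: "X \<in> upw p" and Y: "Y \<in> upw p" for X Y
  proof (rule tendsto_le[OF U_ne_bot])
    show "((\<lambda>k. lpnorm p (X k) + lpnorm p (Y k)) \<longlongrightarrow> un X + un Y) U" by (intro tendsto_add unorm_tendsto X Y)
    show "((\<lambda>k. lpnorm p ((X + Y) k)) \<longlongrightarrow> un (X + Y)) U" by (intro unorm_tendsto add X Y)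
    show "eventually (\<lambda>k. lpnorm p ((X + Y) k) \<le> lpnorm p (X k) + lpnorm p (Y k)) U"
      using lpD(3)[OF upwD[OF X] upwD[OF Y]] by simp
  qed
  moreover have "un (c *\<^sub>C X) = cmod c * un X" if X: "X \<in> upw p" for X c
  proof (rule tendsto_unique[OF U_ne_bot unorm_tendsto[OF sc[OF X]]])
    show "((\<lambda>k. lpnorm p ((c *\<^sub>C X) k)) \<longlongrightarrow> cmod c * un X) U"
      using tendsto_mult[OF tendsto_const unorm_tendsto[OF X], of "cmod c"] lpD(4)[OF upwD[OF X]] by simp
  qed
  ultimately show ?thesis by (simp add: seminormed_def)
qed

lemmas upN = seminormedD[OF seminormed_upw]
lemmas upS = csubspaceD[OF upN(1)]

text \<open>By \<open>wnullI\<close> and the coordinate functionals, weak nullity of a bounded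
  sequence is a coordinatewise condition, so the quantifier over all functionals never has to be
  handled again.\<close>

lemma hat_iff: "X \<in> hat \<longleftrightarrow> X \<in> upw p \<and> (\<forall>s. ((\<lambda>k. X k s) \<longlongrightarrow> 0) U)"
proof
  assume "X \<in> hat"
  then show "X \<in> upw p \<and> (\<forall>s. ((\<lambda>k. X k s) \<longlongrightarrow> 0) U)"
    using coord_functional by (auto simp: hatlp_def wnull_def)
next
  assume X: "X \<in> upw p \<and> (\<forall>s. ((\<lambda>k. X k s) \<longlongrightarrow> 0) U)"
  then obtain B where B: "\<And>k. lpnorm p (X k) \<le> B" using upw_boundE[of X] by metis
  have "wnull U p X" using X by (intro wnullI[OF _ B]) (auto dest: upwD)
  then show "X \<in> hat" using X by (simp add: hatlp_def)
qed

lemma hat_upw: "X \<in> hat \<Longrightarrow> X \<in> upw p" by (simp add: hat_iff)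

lemma csubspace_hat: "csubspace hat"
  unfolding csubspace_def
proof (intro conjI ballI allI)
  show "0 \<in> hat" using upS(1) by (simp add: hat_iff)
  fix X assume X: "X \<in> hat"
  show "X + Y \<in> hat" if Y: "Y \<in> hat" for Y
  proof -
    have "((\<lambda>k. X k s + Y k s) \<longlongrightarrow> 0 + 0) U" for s
      using X Y by (intro tendsto_add) (simp_all add: hat_iff)
    then show ?thesis using upS(2) X Y by (simp add: hat_iff)
  qed
  show "c *\<^sub>C X \<in> hat" for c
  proof -
    have "((\<lambda>k. c * X k s) \<longlongrightarrow> c * 0) U" for s
      using X by (intro tendsto_mult tendsto_const) (simp add: hat_iff)
    then show ?thesis using upS(3) X by (simp add: hat_iff)
  qed
qed

lemma seminormed_hat: "seminormed hat un"
  by (rule seminormed_subset[OF seminormed_upw csubspace_hat]) (simp add: subset_iff hat_upw)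

lemmas haN = seminormedD[OF seminormed_hat]
lemmas haS = csubspaceD[OF csubspace_hat]

lemma unorm_zeroI:
  assumes "X \<in> upw p" "((\<lambda>k. lpnorm p (X k)) \<longlongrightarrow> 0) U" shows "un X = 0"
  using tendsto_unique[OF U_ne_bot unorm_tendsto[OF assms(1)] assms(2)] .

lemma unorm_eq_of_null:
  assumes "X \<in> upw p" "Y \<in> upw p" "un (X - Y) = 0" shows "un X = un Y"
  using upN(9)[OF assms(1,2)] upN(9)[OF assms(2,1)] upN(8)[OF assms(1,2)] assms(3) by linarith

lemma hat_null_perturb:
  assumes X: "X \<in> hat" and Y: "Y \<in> upw p" and n: "un (Y - X) = 0"
  shows "Y \<in> hat"
proof -
  have D: "Y - X \<in> upw p" using upS(5)[OF Y hat_upw[OF X]] .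
  have "((\<lambda>k. Y k s) \<longlongrightarrow> 0) U" for s
  proof -
    have "((\<lambda>k. lpnorm p ((Y - X) k)) \<longlongrightarrow> 0) U" using unorm_tendsto[OF D] n by simp
    then have "((\<lambda>k. (Y - X) k s) \<longlongrightarrow> 0) U"
      by (rule Lim_null_comparison[rotated]) (use coord_le_lpnorm[OF upwD[OF D]] in auto)
    moreover have "((\<lambda>k. X k s) \<longlongrightarrow> 0) U" using X by (simp add: hat_iff)
    ultimately have "((\<lambda>k. (Y - X) k s + X k s) \<longlongrightarrow> 0 + 0) U" by (rule tendsto_add)
    then show ?thesis by simp
  qed
  then show ?thesis using Y by (simp add: hat_iff)
qed

definition bop :: "((nat \<Rightarrow> complex) \<Rightarrow> nat \<Rightarrow> complex) \<Rightarrow> bool" where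
  "bop T \<longleftrightarrow> bdd_op (lp p) (lpnorm p) (lp p) (lpnorm p) T"

lemma bopE:
  assumes "bop T" obtains C where "C > 0" "\<And>x. x \<in> lp p \<Longrightarrow> lpnorm p (T x) \<le> C * lpnorm p x"
  using assms unfolding bop_def by (rule bdd_opE) auto

lemma bopD: "bop T \<Longrightarrow> clinear_on (lp p) T" "bop T \<Longrightarrow> x \<in> lp p \<Longrightarrow> T x \<in> lp p"
  by (auto simp: bop_def bdd_op_def)

lemma hatop_upw: assumes T: "bop T" and X: "X \<in> upw p" shows "hatop T X \<in> upw p"
proof -
  obtain C where C: "C > 0" "\<And>x. x \<in> lp p \<Longrightarrow> lpnorm p (T x) \<le> C * lpnorm p x" using T by (rule bopE) (rule that)
  obtain B where B: "\<And>k. lpnorm p (X k) \<le> B" using upw_boundE[OF X] by metis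
  have "lpnorm p (T (X k)) \<le> C * B" for k
    using C(2)[OF upwD[OF X], of k] B[of k] C(1) by (smt (verit) mult_left_mono)
  then show ?thesis using bopD(2)[OF T upwD[OF X]] by (auto simp: upw_def hatop_def)
qed

lemma hatop_bound:
  assumes T: "bop T" and C: "\<And>x. x \<in> lp p \<Longrightarrow> lpnorm p (T x) \<le> C * lpnorm p x" and X: "X \<in> upw p"
  shows "un (hatop T X) \<le> C * un X"
proof (rule tendsto_le[OF U_ne_bot])
  show "((\<lambda>k. C * lpnorm p (X k)) \<longlongrightarrow> C * un X) U" by (intro tendsto_intros unorm_tendsto X)
  show "((\<lambda>k. lpnorm p (hatop T X k)) \<longlongrightarrow> un (hatop T X)) U" by (intro unorm_tendsto hatop_upw T X)
qed (use C upwD[OF X] in \<open>auto simp: hatop_def\<close>)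

lemma clinear_hatop: "bop T \<Longrightarrow> clinear_on (upw p) (hatop T)"
  using clinear_onD[OF bopD(1)] by (auto simp: clinear_on_def hatop_def fun_eq_iff upw_def)

lemma hatop_hat: assumes T: "bop T" and X: "X \<in> hat" shows "hatop T X \<in> hat"
proof -
  obtain C where C: "C > 0" "\<And>x. x \<in> lp p \<Longrightarrow> lpnorm p (T x) \<le> C * lpnorm p x" using T by (rule bopE) (rule that)
  have "bdd_op (lp p) (lpnorm p) (UNIV::complex set) cmod (\<lambda>x. f (T x))"
    if f: "bdd_op (lp p) (lpnorm p) (UNIV::complex set) cmod f" for f
  proof -
    obtain D where D: "D > 0" "\<And>x. x \<in> lp p \<Longrightarrow> cmod (f x) \<le> D * lpnorm p x"
      by (rule bdd_opE[OF f]) auto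
    show ?thesis
    proof (rule bdd_opI[where C="D * C"])
      show "clinear_on (lp p) (\<lambda>x. f (T x))"
        using clinear_on_compose[OF bopD(1)[OF T] bdd_opD(1)[OF f]] bopD(2)[OF T] by auto
      show "cmod (f (T x)) \<le> D * C * lpnorm p x" if "x \<in> lp p" for x
        using D(2)[OF bopD(2)[OF T that]] C(2)[OF that] D(1) by (smt (verit) mult.assoc mult_left_mono)
    qed simp
  qed
  then have "wnull U p (hatop T X)" using X by (auto simp: hatlp_def wnull_def hatop_def)
  then show ?thesis using hatop_upw[OF T hat_upw[OF X]] by (simp add: hatlp_def)
qed

lemma hatop_null:
  assumes T: "bop T" and X: "X \<in> upw p" "un X = 0" shows "un (hatop T X) = 0"
proof -
  obtain C where C: "C > 0" "\<And>x. x \<in> lp p \<Longrightarrow> lpnorm p (T x) \<le> C * lpnorm p x" using T by (rule bopE) (rule that)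
  show ?thesis using hatop_bound[OF T C(2) X(1)] upN(2)[OF hatop_upw[OF T X(1)]] X(2) by simp
qed

text \<open>Every bounded sequence in l^p is a constant sequence plus an element of
  \<open>hat\<close>. The bound \<open>2 * B\<close> for the second part is the origin of the factor
  \<open>2 * lam\<close> in later constants.\<close>

lemma weak_limit:
  assumes Y: "\<And>k. Y k \<in> lp p" "\<And>k. lpnorm p (Y k) \<le> B"
  obtains y where "y \<in> lp p" "(\<lambda>k. Y k - y) \<in> hat" "un (\<lambda>k. Y k - y) \<le> 2 * B"
proof -
  have "\<exists>l. ((\<lambda>k. Y k s) \<longlongrightarrow> l) U" for s
    by (rule U_convergent[of "\<lambda>k. Y k s" B]) (use order_trans[OF coord_le_lpnorm[OF Y(1)] Y(2)] in auto)
  then obtain y where y: "\<And>s. ((\<lambda>k. Y k s) \<longlongrightarrow> y s) U" by metis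
  have yl: "y \<in> lp p" "lpnorm p y \<le> B" using lp_limit[of U Y B y] Y y by auto
  have b: "lpnorm p (Y k - y) \<le> 2 * B" for k using lpD(7)[OF Y(1) yl(1), of k] Y(2)[of k] yl(2) by simp
  have u: "(\<lambda>k. Y k - y) \<in> upw p" using b lpS(5)[OF Y(1) yl(1)] by (auto simp: upw_def)
  moreover have "((\<lambda>k. (Y k - y) s) \<longlongrightarrow> 0) U" for s using y[of s] by (simp add: LIM_zero)
  ultimately have "(\<lambda>k. Y k - y) \<in> hat" by (simp add: hat_iff)
  moreover have "un (\<lambda>k. Y k - y) \<le> 2 * B" using b by (intro unorm_le[OF u]) auto
  ultimately show ?thesis using that yl(1) by blast
qed

text \<open>Two cuts, both null in the ultrapower: the first \<open>N\<close> coordinates tend to 0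
  along \<open>U\<close> by weak nullity, and the tail of the k-th term is cut off where its norm is
  below \<open>1 / Suc k\<close>.\<close>

lemma hat_truncate:
  assumes X: "X \<in> hat"
  obtains X' where "X' \<in> hat" "un (X' - X) = 0" "\<And>k. \<exists>N'. \<forall>s. s < N \<or> N' \<le> s \<longrightarrow> X' k s = 0"
proof -
  have Xl: "X k \<in> lp p" for k using X hat_upw upwD by blast
  have "\<exists>n. lpnorm p (restr {n..} (X k)) < 1 / Suc k" for k
  proof -
    have "eventually (\<lambda>n. lpnorm p (restr {n..} (X k)) < 1 / Suc k) sequentially"
      by (rule order_tendstoD(2)[OF tail_tendsto[OF Xl]]) simp
    then show ?thesis by (auto simp: eventually_sequentially)
  qed
  then obtain n where n: "\<And>k. lpnorm p (restr {n k..} (X k)) < 1 / Suc k" by metis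
  define X' where "X' k = restr ({N..} \<inter> {..<n k}) (X k)" for k
  have X'l: "X' k \<in> lp p" for k using restr_lp[OF Xl] by (simp add: X'_def)
  obtain B where B: "\<And>k. lpnorm p (X k) \<le> B" using upw_boundE[OF hat_upw[OF X]] by metis
  have "lpnorm p (X' k) \<le> B" for k using order_trans[OF lpnorm_restr[OF Xl] B] by (simp add: X'_def)
  then have X'u: "X' \<in> upw p" using X'l by (auto simp: upw_def)
  have Du: "X' - X \<in> upw p" using X'u X hat_upw upS(5) by blast
  have "un (X' - X) = 0"
  proof (rule unorm_zeroI[OF Du])
    have 1: "((\<lambda>k. (\<Sum>s<N. cmod (X k s)) + 1 / Suc k) \<longlongrightarrow> (\<Sum>s<N. cmod 0) + 0) U"
      using X by (intro tendsto_add tendsto_sum tendsto_norm tendsto_U[OF LIMSEQ_inverse_real_of_nat[unfolded inverse_eq_divide]]) (auto simp: hat_iff)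
    have 2: "lpnorm p ((X' - X) k) \<le> (\<Sum>s<N. cmod (X k s)) + 1 / Suc k" for k
    proof -
      have "lpnorm p ((X' - X) k) = lpnorm p ((X - X') k)" using lpD(8)[OF Xl X'l, of k k] by simp
      also have "\<dots> \<le> lpnorm p (restr {..<N} (X k) + restr {n k..} (X k))"
        by (rule lp_mono(2)[OF lpS(2)[OF restr_lp[OF Xl] restr_lp[OF Xl]]]) (auto simp: X'_def restr_def norm_mult)
      also have "\<dots> \<le> lpnorm p (restr {..<N} (X k)) + lpnorm p (restr {n k..} (X k))"
        by (intro lpD restr_lp Xl)
      also have "lpnorm p (restr {..<N} (X k)) \<le> (\<Sum>s<N. cmod (X k s) * lpnorm p (unitv s))"
        unfolding restr_eq_sum by (rule seminormed_sum_cscale[OF seminormed_lp]) simp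
      also have "\<dots> \<le> (\<Sum>s<N. cmod (X k s))" by (intro sum_mono mult_left_le lpnorm_unitv) auto
      finally show ?thesis using n[of k] by simp
    qed
    show "((\<lambda>k. lpnorm p ((X' - X) k)) \<longlongrightarrow> 0) U"
    proof (rule Lim_null_comparison)
      show "eventually (\<lambda>k. norm (lpnorm p ((X' - X) k)) \<le> (\<Sum>s<N. cmod (X k s)) + 1 / Suc k) U"
        by (rule always_eventually) (use 2 in \<open>simp only: real_norm_def abs_of_nonneg lpnorm_nonneg\<close>, simp)
      show "((\<lambda>k. (\<Sum>s<N. cmod (X k s)) + 1 / Suc k) \<longlongrightarrow> 0) U" using 1 by simp
    qed
  qed
  moreover have "X' \<in> hat" by (rule hat_null_perturb[OF X X'u calculation])
  moreover have "\<exists>N'. \<forall>s. s < N \<or> N' \<le> s \<longrightarrow> X' k s = 0" for k by (rule exI[of _ "n k"]) (auto simp: X'_def restr_def)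
  ultimately show ?thesis using that by blast
qed

text \<open>For a single coefficient vector this is the definition of the ultrapower norm.
  Uniformity over all bounded coefficient vectors comes from compactness: bad vectors at almost
  every \<open>k\<close> would have a limit along \<open>U\<close>, at which the estimate already
  holds with a margin.\<close>

lemma eval_combination_bound:
  assumes I: "finite I" and g: "\<And>i. i \<in> I \<Longrightarrow> g i \<in> upw p" and \<epsilon>: "\<epsilon> > 0"
  shows "eventually (\<lambda>k. \<forall>c. (\<forall>i\<in>I. cmod (c i) \<le> K) \<longrightarrow>
     lpnorm p (\<Sum>i\<in>I. c i *\<^sub>C g i k) \<le> un (\<Sum>i\<in>I. c i *\<^sub>C g i) + \<epsilon>) U"
proof (rule ccontr)
  assume "\<not> ?thesis"
  then have ev: "eventually (\<lambda>k. \<exists>c. (\<forall>i\<in>I. cmod (c i) \<le> K) \<and>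
     lpnorm p (\<Sum>i\<in>I. c i *\<^sub>C g i k) > un (\<Sum>i\<in>I. c i *\<^sub>C g i) + \<epsilon>) U"
    by (drule_tac eventually_not_U) (simp add: not_le)
  define Q where "Q k c \<longleftrightarrow> (\<forall>i\<in>I. cmod (c i) \<le> K) \<and> lpnorm p (\<Sum>i\<in>I. c i *\<^sub>C g i k) > un (\<Sum>i\<in>I. c i *\<^sub>C g i) + \<epsilon>" for k c
  \<comment> \<open>Where no bad vector exists the coefficients are 0, so that the whole sequence is
    bounded and has a limit along \<open>U\<close>.\<close>
  define c where "c k = (if \<exists>c. Q k c then (SOME c. Q k c) else (\<lambda>_. 0))" for k
  have cQ: "Q k (c k)" if "\<exists>c. Q k c" for k
    using someI_ex[OF that] that by (simp add: c_def)
  have evQ: "eventually (\<lambda>k. Q k (c k)) U"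
    using ev unfolding Q_def[symmetric] by eventually_elim (rule cQ)
  have cb: "cmod (c k i) \<le> \<bar>K\<bar>" if "i \<in> I" for k i
  proof (cases "\<exists>c. Q k c")
    case True
    then have "Q k (c k)" by (rule cQ)
    then show ?thesis using that by (force simp: Q_def)
  qed (simp add: c_def)
  have "\<exists>l. ((\<lambda>k. c k i) \<longlongrightarrow> l) U" if "i \<in> I" for i
    by (rule U_convergent[of "\<lambda>k. c k i" "\<bar>K\<bar>"]) (use cb[OF that] in auto)
  then obtain l where l: "\<And>i. i \<in> I \<Longrightarrow> ((\<lambda>k. c k i) \<longlongrightarrow> l i) U" by metis
  have "\<exists>B. \<forall>k. lpnorm p (g i k) \<le> B" if "i \<in> I" for i using upw_boundE[OF g[OF that]] by metis
  then obtain B where B: "\<And>i k. i \<in> I \<Longrightarrow> lpnorm p (g i k) \<le> B i" by metis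
  define L where "L = (\<Sum>i\<in>I. l i *\<^sub>C g i)"
  have Lu: "L \<in> upw p" unfolding L_def by (intro csubspace_sum[OF upN(1)] upS(3) g)
  have Lk: "L k = (\<Sum>i\<in>I. l i *\<^sub>C g i k)" for k by (simp add: L_def sum_fun_apply)
  define d where "d k = (\<Sum>i\<in>I. cmod (c k i - l i) * (B i + un (g i)))" for k
  have "(d \<longlongrightarrow> (\<Sum>i\<in>I. cmod (l i - l i) * (B i + un (g i)))) U"
    unfolding d_def by (intro tendsto_intros l)
  then have d0: "(d \<longlongrightarrow> 0) U" by simp
  have "eventually (\<lambda>k. d k < \<epsilon> / 2) U" by (rule order_tendstoD(2)[OF d0]) (use \<epsilon> in simp)
  moreover have "eventually (\<lambda>k. lpnorm p (L k) < un L + \<epsilon> / 2) U" using unorm_less(1)[OF Lu] \<epsilon> by simp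
  ultimately have "eventually (\<lambda>k. False) U" using evQ
  proof eventually_elim
    case (elim k)
    have gl: "g i k \<in> lp p" if "i \<in> I" for i using g[OF that] upwD by blast
    have d1: "(\<Sum>i\<in>I. cmod (c k i - l i) * B i) + (\<Sum>i\<in>I. cmod (c k i - l i) * un (g i)) = d k"
      by (simp add: d_def distrib_left sum.distrib)
    have a: "(\<Sum>i\<in>I. c k i *\<^sub>C g i k) \<in> lp p" by (intro csubspace_sum[OF lpD(1)] lpS(3) gl)
    have "lpnorm p ((\<Sum>i\<in>I. c k i *\<^sub>C g i k) - L k) = lpnorm p (\<Sum>i\<in>I. (c k i - l i) *\<^sub>C g i k)"
      by (simp add: Lk sum_subtractf cscale_left_diff_distrib)
    also have "\<dots> \<le> (\<Sum>i\<in>I. cmod (c k i - l i) * lpnorm p (g i k))"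
      by (rule seminormed_sum_cscale[OF seminormed_lp gl])
    also have "\<dots> \<le> (\<Sum>i\<in>I. cmod (c k i - l i) * B i)" by (intro sum_mono mult_left_mono B) auto
    finally have 1: "lpnorm p (\<Sum>i\<in>I. c k i *\<^sub>C g i k) \<le> lpnorm p (L k) + (\<Sum>i\<in>I. cmod (c k i - l i) * B i)"
      using lpD(9)[OF a upwD[OF Lu], of k] by simp
    have b: "(\<Sum>i\<in>I. c k i *\<^sub>C g i) \<in> upw p" by (intro csubspace_sum[OF upN(1)] upS(3) g)
    have "un (L - (\<Sum>i\<in>I. c k i *\<^sub>C g i)) = un ((\<Sum>i\<in>I. c k i *\<^sub>C g i) - L)" by (rule upN(8)[OF Lu b])
    also have "\<dots> = un (\<Sum>i\<in>I. (c k i - l i) *\<^sub>C g i)"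
      by (simp add: L_def sum_subtractf cscale_left_diff_distrib)
    also have "\<dots> \<le> (\<Sum>i\<in>I. cmod (c k i - l i) * un (g i))"
      by (rule seminormed_sum_cscale[OF seminormed_upw g])
    finally have 2: "un L \<le> un (\<Sum>i\<in>I. c k i *\<^sub>C g i) + (\<Sum>i\<in>I. cmod (c k i - l i) * un (g i))"
      using upN(9)[OF Lu b] by simp
    show ?case using elim 1 2 d1 by (auto simp: Q_def)
  qed
  then show False by simp
qed

text \<open>The scaled form makes the error proportional to a free parameter \<open>r\<close>; later
  \<open>r\<close> is the norm of the vector whose coordinates are the \<open>c i\<close>, and
  unbounded sets of vectors are covered by a single \<open>k\<close>.\<close>

lemma eval_combination_bound_homogeneous:
  assumes I: "finite I" and g: "\<And>i. i \<in> I \<Longrightarrow> g i \<in> upw p" and \<epsilon>: "\<epsilon> > 0"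
  shows "eventually (\<lambda>k. \<forall>c r. 0 \<le> r \<longrightarrow> (\<forall>i\<in>I. cmod (c i) \<le> K * r) \<longrightarrow>
     lpnorm p (\<Sum>i\<in>I. c i *\<^sub>C g i k) \<le> un (\<Sum>i\<in>I. c i *\<^sub>C g i) + \<epsilon> * r) U"
proof -
  have "eventually (\<lambda>k. \<forall>c. (\<forall>i\<in>I. cmod (c i) \<le> K) \<longrightarrow>
     lpnorm p (\<Sum>i\<in>I. c i *\<^sub>C g i k) \<le> un (\<Sum>i\<in>I. c i *\<^sub>C g i) + \<epsilon>) U"
    by (intro eval_combination_bound I g \<epsilon>)
  then show ?thesis
proof (eventually_elim, intro allI impI)
  fix k c r
  assume ev: "\<forall>c. (\<forall>i\<in>I. cmod (c i) \<le> K) \<longrightarrow> lpnorm p (\<Sum>i\<in>I. c i *\<^sub>C g i k) \<le> un (\<Sum>i\<in>I. c i *\<^sub>C g i) + \<epsilon>"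
    and r: "(0::real) \<le> r" and c: "\<forall>i\<in>I. cmod (c i) \<le> K * r"
  show "lpnorm p (\<Sum>i\<in>I. c i *\<^sub>C g i k) \<le> un (\<Sum>i\<in>I. c i *\<^sub>C g i) + \<epsilon> * r"
  proof (cases "r = 0")
    case True
    then have "(\<Sum>i\<in>I. c i *\<^sub>C g i k) = 0" "(\<Sum>i\<in>I. c i *\<^sub>C g i) = 0" using c by (auto intro!: sum.neutral)
    then show ?thesis using True lpD(5) upN(5) by simp
  next
    case False
    define c' where "c' i = c i / of_real r" for i
    have cc: "c i = of_real r * c' i" for i using False by (simp add: c'_def)
    have "\<forall>i\<in>I. cmod (c' i) \<le> K" using c r False by (auto simp: c'_def norm_divide field_simps)
    then have b: "lpnorm p (\<Sum>i\<in>I. c' i *\<^sub>C g i k) \<le> un (\<Sum>i\<in>I. c' i *\<^sub>C g i) + \<epsilon>" using ev by blast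
    have "lpnorm p (\<Sum>i\<in>I. c i *\<^sub>C g i k) = lpnorm p (of_real r *\<^sub>C (\<Sum>i\<in>I. c' i *\<^sub>C g i k))"
      by (simp add: cc cscale_sum_right)
    also have "\<dots> = r * lpnorm p (\<Sum>i\<in>I. c' i *\<^sub>C g i k)"
    proof -
      have "(\<Sum>i\<in>I. c' i *\<^sub>C g i k) \<in> lp p" by (intro csubspace_sum[OF lpD(1)] lpS(3) upwD[OF g])
      from lpD(4)[OF this, of "of_real r"] show ?thesis using r by simp
    qed
    also have "\<dots> \<le> r * (un (\<Sum>i\<in>I. c' i *\<^sub>C g i) + \<epsilon>)" using b r by (rule mult_left_mono)
    also have "r * un (\<Sum>i\<in>I. c' i *\<^sub>C g i) = un (of_real r *\<^sub>C (\<Sum>i\<in>I. c' i *\<^sub>C g i))"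
    proof -
      have "(\<Sum>i\<in>I. c' i *\<^sub>C g i) \<in> upw p" by (intro csubspace_sum[OF upN(1)] upS(3) g)
      from upN(4)[OF this, of "of_real r"] show ?thesis using r by simp
    qed
    then have "r * (un (\<Sum>i\<in>I. c' i *\<^sub>C g i) + \<epsilon>) = un (\<Sum>i\<in>I. c i *\<^sub>C g i) + \<epsilon> * r"
      by (simp add: cc cscale_sum_right algebra_simps)
    finally show ?thesis .
  qed
qed
qed

end

lemma cpair_cscale_left: "cpair (c *\<^sub>C z) y = c * cpair z y"
proof (cases "c = 0")
  case False
  then show ?thesis by (simp add: cpair_def sum_distrib_left mult.assoc)
qed (simp add: cpair_def)

context ultra
begin

text \<open>A norming element of the functional, truncated to finite supports, is mapped by the duality map
  to finitely supported functionals; uniform smoothness shows that these represent the given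
  functional up to \<open>\<epsilon>\<close>.\<close>

lemma hat_functional_approx:
  assumes lin: "clinear_on hat \<phi>" and bd: "\<And>X. X \<in> hat \<Longrightarrow> cmod (\<phi> X) \<le> C * un X"
    and C: "C \<ge> 0" and eps: "\<epsilon> > 0"
  obtains z where "\<And>k. \<exists>N'. \<forall>s. s < N \<or> N' \<le> s \<longrightarrow> z k s = 0"
    "\<And>k y. y \<in> lp p \<Longrightarrow> cmod (cpair (z k) y) \<le> C * lpnorm p y"
    "\<And>s. ((\<lambda>k. z k s) \<longlongrightarrow> 0) U"
    "\<And>X. X \<in> hat \<Longrightarrow> eventually (\<lambda>k. cmod (\<phi> X - cpair (z k) (X k)) \<le> \<epsilon> * (un X + 1)) U"
proof -
  note ph = clinear_onD[OF lin] clinear_on_rules[OF lin csubspace_hat]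
  define S where "S = {cmod (\<phi> X) |X. X \<in> hat \<and> un X \<le> 1}"
  define c where "c = Sup S"
  have SC: "s \<le> C" if sS: "s \<in> S" for s
  proof -
    obtain X where X: "s = cmod (\<phi> X)" "X \<in> hat" "un X \<le> 1" using sS by (auto simp: S_def)
    then show ?thesis using bd[OF X(2)] mult_left_le[OF X(3) C] by simp
  qed
  then have bdd: "bdd_above S" by (auto simp: bdd_above_def)
  have S0: "0 \<in> S" using ph(3) haS(1) haN(5) by (auto simp: S_def intro!: exI[of _ "0::nat \<Rightarrow> nat \<Rightarrow> complex"])
  have cC: "c \<le> C" "0 \<le> c" unfolding c_def using SC S0 cSup_upper[OF S0 bdd] by (auto intro: cSup_least)
  have bc: "cmod (\<phi> X) \<le> c * un X" if X: "X \<in> hat" for X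
  proof (cases "un X = 0")
    case True
    then show ?thesis using bd[OF X] by simp
  next
    case False
    then have u: "un X > 0" using haN(2)[OF X] by simp
    have "cmod (\<phi> ((1 / of_real (un X)) *\<^sub>C X)) \<in> S" unfolding S_def
      using u X haS(3) haN(4)[OF X, of "1 / of_real (un X)"] by (auto simp: norm_divide)
    then have "cmod (\<phi> ((1 / of_real (un X)) *\<^sub>C X)) \<le> c" unfolding c_def by (rule cSup_upper[OF _ bdd])
    then show ?thesis using u by (simp add: ph(2) X norm_divide field_simps)
  qed
  show ?thesis
  proof (cases "c = 0")
    case True
    then have z: "\<phi> X = 0" if "X \<in> hat" for X using bc[OF that] by simp
    show ?thesis
    proof (rule that[of "\<lambda>k s. 0"])
      show "eventually (\<lambda>k. cmod (\<phi> X - cpair (\<lambda>s. 0) (X k)) \<le> \<epsilon> * (un X + 1)) U" if "X \<in> hat" for X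
        using z[OF that] haN(2)[OF that] eps by (simp add: cpair_def)
    qed (use C in \<open>auto simp: cpair_def\<close>)
  next
    case False
    then have c: "c > 0" using cC by simp
    \<comment> \<open>The comparison below loses five errors \<open>e\<close>, and after
      multiplication by the norm \<open>c\<close> they amount to
      \<open>\<epsilon> / 2\<close>.\<close>
    define e where "e = \<epsilon> / (10 * c)"
    have e: "e > 0" using eps c by (simp add: e_def)
    obtain C1 where C1: "C1 \<ge> 0" "\<And>x h n. (\<And>s. n \<le> s \<Longrightarrow> x s = 0) \<Longrightarrow> lpnorm p x \<le> 1 \<Longrightarrow> h \<in> lp p \<Longrightarrow>
       lpnorm p (x + h) \<le> 1 + Re (cpair (duality_map p x) h) + e * lpnorm p h + C1 * lpnorm p h powr p"
      using uniform_smoothness[OF e] by metis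
    \<comment> \<open>The step size. It is so small that \<open>e * t < 1\<close> and that the
      second-order term of the smoothness estimate for a displacement of norm at most
      \<open>2 * t\<close> is at most \<open>e * t\<close>.\<close>
    define t where "t = min (1 / (e + 1)) ((e / (C1 * 2 powr p + 1)) powr (1 / (p - 1)))"
    have K0: "C1 * 2 powr p + 1 > 0" using C1(1) by (intro add_nonneg_pos) auto
    have t0: "t > 0" using e K0 by (simp add: t_def)
    have et: "e * t < 1"
    proof -
      have "e * t \<le> e * (1 / (e + 1))" using e by (intro mult_left_mono) (auto simp: t_def)
      also have "\<dots> < 1" using e by simp
      finally show ?thesis .
    qed
    have tp: "C1 * (2 * t) powr p \<le> e * t"
    proof -
      have "t powr (p - 1) \<le> ((e / (C1 * 2 powr p + 1)) powr (1 / (p - 1))) powr (p - 1)"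
        using t0 p_gt_1 by (intro powr_mono2) (auto simp: t_def)
      also have "\<dots> = e / (C1 * 2 powr p + 1)" using p_gt_1 e K0 by (simp add: powr_powr)
      finally have "t powr (p - 1) * (C1 * 2 powr p + 1) \<le> e" using K0 by (simp add: pos_le_divide_eq)
      then have "C1 * 2 powr p * t powr (p - 1) \<le> e" using powr_ge_zero[of t "p - 1"] unfolding distrib_left mult_1_right by (simp only: mult_ac)
      then have "C1 * 2 powr p * t powr (p - 1) * t \<le> e * t" using t0 by (intro mult_right_mono) auto
      moreover have "t powr (p - 1) * t = t powr p" using t0 by (simp add: powr_diff)
      ultimately show ?thesis using t0 by (simp add: powr_mult mult.assoc)
    qed
    \<comment> \<open>The norming vector may miss the norm by \<delta>. This has the order of the
      other errors, \<open>e\<close> times the step size, so that division by \<open>t\<close>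
      leaves a multiple of \<open>e\<close>.\<close>
    define \<delta> where "\<delta> = e * t"
    have \<delta>: "0 < \<delta>" "\<delta> < 1" using e t0 et by (auto simp: \<delta>_def)
    have "c * (1 - \<delta> / 2) < c" using c \<delta> by simp
    then obtain X1 where X1: "X1 \<in> hat" "un X1 \<le> 1" "cmod (\<phi> X1) > c * (1 - \<delta> / 2)"
      using less_cSupD[of S "c * (1 - \<delta> / 2)"] S0 unfolding c_def[symmetric] by (auto simp: S_def)
    have n1: "cmod (\<phi> X1) > 0" using X1(3) mult_pos_pos[OF c, of "1 - \<delta> / 2"] \<delta> by linarith
    \<comment> \<open>Makes the value real and pushes the norm of the vector strictly below 1, which
      is needed to cut the representative to the unit ball. The two factors
      \<open>1 - \<delta> / 2\<close> together lose at most \<delta>.\<close>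
    define \<omega> where "\<omega> = of_real (1 - \<delta> / 2) * (cnj (\<phi> X1) / of_real (cmod (\<phi> X1)))"
    have cw: "cmod \<omega> = 1 - \<delta> / 2" using n1 \<delta> by (simp add: \<omega>_def norm_mult norm_divide del: of_real_diff)
    define X0 where "X0 = \<omega> *\<^sub>C X1"
    have X0: "X0 \<in> hat" using X1 haS(3) by (simp add: X0_def)
    have uX0: "un X0 < 1"
    proof -
      have "un X0 \<le> (1 - \<delta> / 2) * 1" unfolding X0_def using haN(4)[OF X1(1), of \<omega>] X1(2) \<delta> cw by (simp add: mult_left_le)
      then show ?thesis using \<delta> by simp
    qed
    have phX0: "\<phi> X0 = of_real ((1 - \<delta> / 2) * cmod (\<phi> X1))"
    proof -
      have "\<phi> X0 = of_real (1 - \<delta> / 2) * (cnj (\<phi> X1) * \<phi> X1) / of_real (cmod (\<phi> X1))"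
        by (simp add: X0_def ph(2) X1 \<omega>_def)
      also have "cnj (\<phi> X1) * \<phi> X1 = (cmod (\<phi> X1))\<^sup>2" by (metis complex_norm_square mult.commute)
      finally show ?thesis using n1 by (simp add: power2_eq_square)
    qed
    have "(1 - \<delta> / 2) * (c * (1 - \<delta> / 2)) \<le> (1 - \<delta> / 2) * cmod (\<phi> X1)" using X1(3) \<delta> by (intro mult_left_mono) auto
    moreover have "c * (1 - \<delta>) \<le> c * ((1 - \<delta> / 2) * (1 - \<delta> / 2))" using c
      by (intro mult_left_mono) (auto simp: algebra_simps)
    moreover have "c * ((1 - \<delta> / 2) * (1 - \<delta> / 2)) = (1 - \<delta> / 2) * (c * (1 - \<delta> / 2))" by (simp only: mult_ac)
    moreover have "Re (\<phi> X0) = (1 - \<delta> / 2) * cmod (\<phi> X1)" unfolding phX0 by (rule Re_complex_of_real)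
    ultimately have RX0: "Re (\<phi> X0) \<ge> c * (1 - \<delta>)" by linarith
    obtain X2 where X2: "X2 \<in> hat" "un (X2 - X0) = 0" "\<And>k. \<exists>N'. \<forall>s. s < N \<or> N' \<le> s \<longrightarrow> X2 k s = 0"
      using hat_truncate[OF X0, of N] by blast
    have uX2: "un X2 < 1" using unorm_eq_of_null[of X2 X0] X2 X0 uX0 hat_upw by metis
    \<comment> \<open>Only terms outside a set of \<open>U\<close> are replaced by 0, so the class
      is unchanged, while every single term is now a legitimate base point for
      \<open>uniform_smoothness\<close>.\<close>
    define X3 where "X3 k = (if lpnorm p (X2 k) \<le> 1 then X2 k else 0)" for k
    have X3n: "lpnorm p (X3 k) \<le> 1" for k using lpD(5) by (simp add: X3_def)
    have X3l: "X3 k \<in> lp p" for k using X2(1) hat_upw upwD lpS(1) by (auto simp: X3_def)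
    have X3u: "X3 \<in> upw p" using X3n X3l by (auto simp: upw_def)
    have u32: "un (X3 - X2) = 0"
    proof (rule unorm_zeroI)
      show "X3 - X2 \<in> upw p" using upS(5)[OF X3u hat_upw[OF X2(1)]] .
      have "eventually (\<lambda>k. lpnorm p ((X3 - X2) k) = 0) U"
        using unorm_less(1)[OF hat_upw[OF X2(1)] uX2] by eventually_elim (use lpD(5) in \<open>auto simp: X3_def\<close>)
      then show "((\<lambda>k. lpnorm p ((X3 - X2) k)) \<longlongrightarrow> 0) U" by (rule tendsto_eventually)
    qed
    have X3: "X3 \<in> hat" by (rule hat_null_perturb[OF X2(1) X3u u32])
    have phX3: "\<phi> X3 = \<phi> X0"
    proof -
      have "\<phi> (X3 - X2) = 0" using bd[OF haS(5)[OF X3 X2(1)]] u32 by simp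
      moreover have "\<phi> (X2 - X0) = 0" using bd[OF haS(5)[OF X2(1) X0]] X2(2) by simp
      ultimately show ?thesis using ph(5)[OF X3 X2(1)] ph(5)[OF X2(1) X0] by simp
    qed
    have X3s: "\<exists>N'. \<forall>s. s < N \<or> N' \<le> s \<longrightarrow> X3 k s = 0" for k using X2(3)[of k] by (auto simp: X3_def)
    define z where "z k = of_real c *\<^sub>C duality_map p (X3 k)" for k
    \<comment> \<open>The value of \<phi> at \<open>X3 + t H\<close> is a lower bound for
      \<open>c\<close> times its norm, and smoothness bounds that norm from above with the
      derivative given by \<open>duality_map\<close>. Comparison and division by \<open>t\<close>
      bound \<phi> by the pairing; 2 is an eventual bound for the terms of \<open>H\<close>.\<close>
    have one_sided: "eventually (\<lambda>k. Re (\<phi> H) \<le> Re (cpair (z k) (H k)) + \<epsilon> / 2) U" if H: "H \<in> hat" "un H \<le> 1" for H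
    proof -
      have tH: "of_real t *\<^sub>C H \<in> hat" using H haS(3) by blast
      have sH: "X3 + of_real t *\<^sub>C H \<in> hat" using X3 tH haS(2) by blast
      have "c * (1 - \<delta>) + t * Re (\<phi> H) \<le> Re (\<phi> (X3 + of_real t *\<^sub>C H))"
        using RX0 by (simp add: ph(1) X3 tH ph(2) H phX3)
      also have "\<dots> \<le> c * un (X3 + of_real t *\<^sub>C H)" using bc[OF sH] complex_Re_le_cmod order_trans by blast
      finally have "c * ((1 - \<delta>) + t * Re (\<phi> H) / c) \<le> c * un (X3 + of_real t *\<^sub>C H)" using c by (simp add: distrib_left)
      then have "(1 - \<delta>) + t * Re (\<phi> H) / c - e * t < un (X3 + of_real t *\<^sub>C H)" using c mult_pos_pos[OF e t0] by auto
      from unorm_less(2)[OF hat_upw[OF sH] this] unorm_less(1)[OF hat_upw[OF H(1)], of 2]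
      have "eventually (\<lambda>k. (1 - \<delta>) + t * Re (\<phi> H) / c - e * t < lpnorm p ((X3 + of_real t *\<^sub>C H) k) \<and> lpnorm p (H k) < 2) U"
        using H(2) by (auto intro: eventually_conj)
      then show ?thesis
      proof eventually_elim
        case (elim k)
        obtain N' where N': "\<And>s. N' \<le> s \<Longrightarrow> X3 k s = 0" using X3s[of k] by auto
        have Hl: "H k \<in> lp p" using H hat_upw upwD by blast
        define r where "r = Re (cpair (duality_map p (X3 k)) (H k))"
        have nt: "lpnorm p (of_real t *\<^sub>C H k) \<le> 2 * t" using elim t0 lpD(4)[OF Hl, of "of_real t"] by simp
        have "lpnorm p (X3 k + of_real t *\<^sub>C H k) \<le> 1 + Re (cpair (duality_map p (X3 k)) (of_real t *\<^sub>C H k)) + e * lpnorm p (of_real t *\<^sub>C H k) + C1 * lpnorm p (of_real t *\<^sub>C H k) powr p"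
          by (rule C1(2)[OF N' X3n lpS(3)[OF Hl]])
        also have "cpair (duality_map p (X3 k)) (of_real t *\<^sub>C H k) = of_real t * cpair (duality_map p (X3 k)) (H k)"
          using clinear_onD(2)[OF clinear_cpair[of UNIV], of "H k"] by simp
        also have "1 + Re (of_real t * cpair (duality_map p (X3 k)) (H k)) + e * lpnorm p (of_real t *\<^sub>C H k) + C1 * lpnorm p (of_real t *\<^sub>C H k) powr p \<le> 1 + t * r + e * (2 * t) + C1 * (2 * t) powr p"
          using nt e C1(1) p_gt_1 by (intro add_mono mult_left_mono powr_mono2) (auto simp: r_def)
        also have "\<dots> \<le> 1 + t * r + 3 * (e * t)" using tp by simp
        finally have "(1 - \<delta>) + t * Re (\<phi> H) / c - e * t < 1 + t * r + 3 * (e * t)" using elim unfolding plus_fun_apply cscale_fun_apply by linarith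
        then have "t * (Re (\<phi> H) / c) \<le> t * (r + 5 * e)" by (simp add: \<delta>_def algebra_simps)
        then have "Re (\<phi> H) / c \<le> r + 5 * e" by (rule mult_left_le_imp_le[OF _ t0])
        then have "Re (\<phi> H) \<le> c * r + c * (5 * e)" using c by (simp add: field_simps)
        moreover have "c * (5 * e) = \<epsilon> / 2" using c by (simp add: e_def)
        moreover have "c * r = Re (cpair (z k) (H k))" by (simp add: z_def cpair_cscale_left r_def)
        ultimately show ?case by simp
      qed
    qed
    have two_sided: "eventually (\<lambda>k. cmod (\<phi> H - cpair (z k) (H k)) \<le> \<epsilon>) U" if H: "H \<in> hat" "un H \<le> 1" for H
    proof -
      \<comment> \<open>Using the four rotations \<open>1\<close>, \<open>-1\<close>,
        \<open>\<i>\<close>, \<open>-\<i>\<close>, the one-sided estimate bounds real and imaginary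
        parts by \<open>\<epsilon> / 2\<close> each.\<close>
      have ts: "eventually (\<lambda>k. Re (w * (\<phi> H - cpair (z k) (H k))) \<le> \<epsilon> / 2) U" if "cmod w = 1" for w
      proof -
        have "eventually (\<lambda>k. Re (\<phi> (w *\<^sub>C H)) \<le> Re (cpair (z k) ((w *\<^sub>C H) k)) + \<epsilon> / 2) U"
          by (rule one_sided) (use haN(4)[OF H(1), of w] H(2) that haS(3)[OF H(1)] in simp_all)
        then show ?thesis
        proof eventually_elim
          case (elim k)
          have "cpair (z k) ((w *\<^sub>C H) k) = w * cpair (z k) (H k)"
            using clinear_onD(2)[OF clinear_cpair[of UNIV], of "H k"] by simp
          then show ?case using elim ph(2)[OF H(1), of w] by (simp add: right_diff_distrib)
        qed
      qed
      from ts[of 1, simplified] ts[of "-1", simplified] ts[of \<i>, simplified] ts[of "-\<i>", simplified]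
      show ?thesis
      proof eventually_elim
        case (elim k)
        then have "\<bar>Re (\<phi> H - cpair (z k) (H k))\<bar> \<le> \<epsilon> / 2" "\<bar>Im (\<phi> H - cpair (z k) (H k))\<bar> \<le> \<epsilon> / 2" unfolding minus_complex.simps by linarith+
        then show ?case using cmod_le[of "\<phi> H - cpair (z k) (H k)"] by linarith
      qed
    qed
    show ?thesis
    proof (rule that[of z])
      show "\<exists>N'. \<forall>s. s < N \<or> N' \<le> s \<longrightarrow> z k s = 0" for k
        using X3s[of k] by (auto simp: z_def duality_map_def)
      show "cmod (cpair (z k) y) \<le> C * lpnorm p y" if y: "y \<in> lp p" for k y
      proof -
        obtain N' where N': "\<And>s. N' \<le> s \<Longrightarrow> X3 k s = 0" using X3s[of k] by auto
        have "cmod (cpair (z k) y) = c * cmod (cpair (duality_map p (X3 k)) y)"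
          using c by (simp add: z_def cpair_cscale_left norm_mult)
        also have "\<dots> \<le> c * lpnorm p y" using c cpair_duality_le[OF N' X3n y] by simp
        also have "\<dots> \<le> C * lpnorm p y" using cC by (simp add: mult_right_mono)
        finally show ?thesis .
      qed
      show "((\<lambda>k. z k s) \<longlongrightarrow> 0) U" for s
      proof (rule tendsto_norm_zero_cancel)
        have "((\<lambda>k. X3 k s) \<longlongrightarrow> 0) U" using X3 by (simp add: hat_iff)
        then have "((\<lambda>k. c * cmod (X3 k s) powr (p - 1)) \<longlongrightarrow> c * cmod 0 powr (p - 1)) U"
          using p_gt_1 by (intro tendsto_mult tendsto_const tendsto_powr2 tendsto_norm) auto
        then show "((\<lambda>k. cmod (z k s)) \<longlongrightarrow> 0) U"
          using c p_gt_1 by (simp add: z_def norm_mult norm_duality_map)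
      qed
      fix X assume X: "X \<in> hat"
      \<comment> \<open>Normalising by \<open>un X + 1\<close> avoids a separate case for null
        vectors.\<close>
      define v where "v = un X + 1"
      have v: "v > 0" using haN(2)[OF X] by (simp add: v_def)
      define H where "H = (1 / of_real v) *\<^sub>C X"
      have H: "H \<in> hat" "un H \<le> 1" using haS(3)[OF X] haN(4)[OF X, of "1 / of_real v"] v
        by (auto simp: H_def norm_divide) (simp add: v_def)
      have XH: "X = of_real v *\<^sub>C H" using v by (simp add: H_def)
      show "eventually (\<lambda>k. cmod (\<phi> X - cpair (z k) (X k)) \<le> \<epsilon> * (un X + 1)) U"
        using two_sided[OF H]
      proof eventually_elim
        case (elim k)
        have "\<phi> X - cpair (z k) (X k) = of_real v * (\<phi> H - cpair (z k) (H k))"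
          using clinear_onD(2)[OF clinear_cpair[of UNIV], of "H k"] by (subst XH, subst XH) (simp add: ph(2) H right_diff_distrib)
        then have "cmod (\<phi> X - cpair (z k) (X k)) = v * cmod (\<phi> H - cpair (z k) (H k))" using v by (simp add: norm_mult)
        also have "\<dots> \<le> v * \<epsilon>" using elim v by simp
        finally show ?case by (simp add: v_def mult.commute)
      qed
    qed
  qed
qed

end

section \<open>Quasicentral diagonal partitions of unity\<close>

definition diag_op :: "(nat \<Rightarrow> real) \<Rightarrow> (nat \<Rightarrow> complex) \<Rightarrow> nat \<Rightarrow> complex" where
  "diag_op E x = (\<lambda>i. of_real (E i) * x i)"

lemma diag_op_diff: "diag_op (\<lambda>i. E i - F i) x = diag_op E x - diag_op F x"
  by (auto simp: diag_op_def algebra_simps)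

context ultra
begin

lemma diag_op_lp:
  assumes "x \<in> lp p" "\<And>i. \<bar>E i\<bar> \<le> 1"
  shows "diag_op E x \<in> lp p" "lpnorm p (diag_op E x) \<le> lpnorm p x"
  by (rule lp_mono[OF assms(1)]; simp add: diag_op_def norm_mult mult_left_le_one_le assms(2))+

text \<open>Finitely many columns \<open>A (unitv s)\<close> are vectors of l^p, so their tails are
  small simultaneously.\<close>

lemma corner_lower_small:
  assumes A: "bop A" and \<eta>: "\<eta> > 0"
  shows "eventually (\<lambda>m. \<forall>x\<in>lp p. lpnorm p (restr {m..} (A (restr {..<n} x))) \<le> \<eta> * lpnorm p x) sequentially"
proof -
  note lin = clinear_onD[OF bopD(1)[OF A]] clinear_on_rules[OF bopD(1)[OF A] lpD(1)]
  have "(\<lambda>m. \<Sum>s<n. lpnorm p (restr {m..} (A (unitv s)))) \<longlonglongrightarrow> (\<Sum>s<n. 0)"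
    by (intro tendsto_sum tail_tendsto bopD[OF A] unitv_lp)
  then have "eventually (\<lambda>m. (\<Sum>s<n. lpnorm p (restr {m..} (A (unitv s)))) < \<eta>) sequentially"
    by (rule order_tendstoD) (use \<eta> in simp)
  then show ?thesis
  proof (eventually_elim, intro ballI)
    fix m x assume e: "(\<Sum>s<n. lpnorm p (restr {m..} (A (unitv s)))) < \<eta>" and x: "x \<in> lp p"
    have "A (restr {..<n} x) = (\<Sum>s<n. x s *\<^sub>C A (unitv s))"
      unfolding restr_eq_sum by (subst lin(6)) (auto simp: lin(2) lpS(3))
    then have "restr {m..} (A (restr {..<n} x)) = (\<Sum>s<n. x s *\<^sub>C restr {m..} (A (unitv s)))"
      by (simp add: restr_linear)
    then have "lpnorm p (restr {m..} (A (restr {..<n} x))) \<le> (\<Sum>s<n. cmod (x s) * lpnorm p (restr {m..} (A (unitv s))))"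
      using seminormed_sum_cscale[OF seminormed_lp, of "{..<n}" "\<lambda>s. restr {m..} (A (unitv s))" x] restr_lp bopD(2)[OF A unitv_lp] by simp
    also have "\<dots> \<le> (\<Sum>s<n. lpnorm p x * lpnorm p (restr {m..} (A (unitv s))))"
      by (intro sum_mono mult_right_mono coord_le_lpnorm x) auto
    also have "\<dots> = lpnorm p x * (\<Sum>s<n. lpnorm p (restr {m..} (A (unitv s))))" by (simp add: sum_distrib_left)
    also have "\<dots> \<le> lpnorm p x * \<eta>" using e by (intro mult_left_mono) auto
    finally show "lpnorm p (restr {m..} (A (restr {..<n} x))) \<le> \<eta> * lpnorm p x" by (simp add: mult.commute)
  qed
qed

lemma functional_compose_bop:
  assumes f: "bdd_op (lp p) (lpnorm p) (UNIV::complex set) cmod f" and T: "bop T"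
  shows "bdd_op (lp p) (lpnorm p) (UNIV::complex set) cmod (\<lambda>x. f (T x))"
proof -
  obtain C where C: "C > 0" "\<And>x. x \<in> lp p \<Longrightarrow> lpnorm p (T x) \<le> C * lpnorm p x" using T by (rule bopE) (rule that)
  obtain D where D: "D > 0" "\<And>x. x \<in> lp p \<Longrightarrow> cmod (f x) \<le> D * lpnorm p x"
    by (rule bdd_opE[OF f]) auto
  show ?thesis
  proof (rule bdd_opI[where C="D * C"])
    show "clinear_on (lp p) (\<lambda>x. f (T x))"
      using clinear_on_compose[OF bopD(1)[OF T] bdd_opD(1)[OF f]] bopD(2)[OF T] by auto
    show "cmod (f (T x)) \<le> D * C * lpnorm p x" if x: "x \<in> lp p" for x
      using order_trans[OF D(2)[OF bopD(2)[OF T x]] mult_left_mono[OF C(2)[OF x], of D]] D(1) by (simp add: mult.assoc)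
  qed simp
qed

text \<open>The same for finitely many rows, which are functionals;
  \<open>functional_tail_small\<close> takes the place of the tail of a vector in the dual.\<close>

lemma corner_upper_small:
  assumes A: "bop A" and \<eta>: "\<eta> > 0"
  shows "eventually (\<lambda>m. \<forall>x\<in>lp p. lpnorm p (restr {..<n} (A (restr {m..} x))) \<le> \<eta> * lpnorm p x) sequentially"
proof -
  \<comment> \<open>Each of the \<open>n\<close> rows gets the share
    \<open>\<eta> / Suc n\<close>.\<close>
  have "\<exists>N. \<forall>y\<in>lp p. (\<forall>i<N. y i = 0) \<longrightarrow> cmod (A y s) \<le> \<eta> / Suc n * lpnorm p y" for s
    by (rule functional_tail_small[OF functional_compose_bop[OF coord_functional A]]) (use \<eta> in simp)
  then obtain N where N: "\<And>s y. y \<in> lp p \<Longrightarrow> (\<And>i. i < N s \<Longrightarrow> y i = 0) \<Longrightarrow> cmod (A y s) \<le> \<eta> / Suc n * lpnorm p y" by metis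
  have "lpnorm p (restr {..<n} (A (restr {m..} x))) \<le> \<eta> * lpnorm p x" if m: "m \<ge> (\<Sum>s<n. N s)" and x: "x \<in> lp p" for m x
  proof -
    have Ns: "N s \<le> m" if "s < n" for s
      using member_le_sum[of s "{..<n}" N] that m by simp
    have c: "cmod (A (restr {m..} x) s) \<le> \<eta> / Suc n * lpnorm p x" if s: "s < n" for s
    proof -
      have "cmod (A (restr {m..} x) s) \<le> \<eta> / Suc n * lpnorm p (restr {m..} x)"
        by (rule N[OF restr_lp[OF x]]) (use Ns[OF s] in \<open>simp add: restr_def\<close>)
      also have "\<dots> \<le> \<eta> / Suc n * lpnorm p x" using \<eta> lpnorm_restr[OF x] by (intro mult_left_mono) auto
      finally show ?thesis .
    qed
    have "lpnorm p (restr {..<n} (A (restr {m..} x))) \<le> (\<Sum>s<n. cmod (A (restr {m..} x) s) * lpnorm p (unitv s))"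
      unfolding restr_eq_sum[of n] by (rule seminormed_sum_cscale[OF seminormed_lp]) simp
    also have "\<dots> \<le> (\<Sum>s<n. \<eta> / Suc n * lpnorm p x * 1)"
      by (intro sum_mono mult_mono c lpnorm_unitv) (use \<eta> in auto)
    also have "\<dots> = (n / Suc n) * (\<eta> * lpnorm p x)" by simp
    also have "\<dots> \<le> 1 * (\<eta> * lpnorm p x)" using \<eta> by (intro mult_right_mono) auto
    finally show ?thesis by simp
  qed
  then show ?thesis unfolding eventually_sequentially by blast
qed

text \<open>With disjoint row sets and disjoint column sets the p-th powers add on both sides, so
  the number of blocks does not enter the bound. This is what averaging over many projections
  exploits.\<close>

lemma block_sum_bound:
  assumes A: "bop A" and C: "C \<ge> 0" "\<And>x. x \<in> lp p \<Longrightarrow> lpnorm p (A x) \<le> C * lpnorm p x"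
    and F: "finite F" "disjoint_family_on S F" "disjoint_family_on S' F" and x: "x \<in> lp p"
  shows "lpnorm p (\<Sum>s\<in>F. restr (S s) (A (restr (S' s) x))) \<le> C * lpnorm p x"
proof -
  have "lpnorm p (\<Sum>s\<in>F. restr (S s) (A (restr (S' s) x))) powr p \<le> (\<Sum>s\<in>F. lpnorm p (restr (S s) (A (restr (S' s) x))) powr p)"
    by (rule lpnorm_disjoint_sum[OF bopD(2)[OF A restr_lp[OF x]] F(1,2)])
  also have "\<dots> \<le> (\<Sum>s\<in>F. C powr p * lpnorm p (restr (S' s) x) powr p)"
  proof (rule sum_mono)
    fix s
    have "lpnorm p (restr (S s) (A (restr (S' s) x))) \<le> C * lpnorm p (restr (S' s) x)"
      using lpnorm_restr[OF bopD(2)[OF A restr_lp[OF x]]] C(2)[OF restr_lp[OF x]] by (rule order_trans)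
    then have "lpnorm p (restr (S s) (A (restr (S' s) x))) powr p \<le> (C * lpnorm p (restr (S' s) x)) powr p"
      using p_gt_1 by (intro powr_mono2) auto
    then show "lpnorm p (restr (S s) (A (restr (S' s) x))) powr p \<le> C powr p * lpnorm p (restr (S' s) x) powr p"
      using C(1) by (simp add: powr_mult)
  qed
  also have "\<dots> \<le> C powr p * lpnorm p x powr p"
    unfolding sum_distrib_left[symmetric] by (intro mult_left_mono restr_disjoint_sum_le x F) auto
  also have "\<dots> = (C * lpnorm p x) powr p" using C(1) by (simp add: powr_mult)
  finally show ?thesis using C(1) by (simp add: powr_p_le_iff)
qed

text \<open>The averages of finite coordinate projections along a rapidly increasing sequence almost commute
  with a given operator: up to small corners, their commutators are averages of off-diagonal blocks, whose sum
  stays bounded by the norm of the operator.\<close>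

lemma quasicentral_unit:
  fixes K N :: nat
  assumes A: "\<And>a. a < K \<Longrightarrow> bop (A a)" and e: "e > 0"
  shows "\<exists>E M. N < M \<and> (\<forall>i. 0 \<le> E i \<and> E i \<le> 1) \<and> (\<forall>i<N. E i = 1) \<and> (\<forall>i\<ge>M. E i = 0) \<and>
    (\<forall>a<K. \<forall>x\<in>lp p. lpnorm p (A a (diag_op E x) - diag_op E (A a x)) \<le> e * lpnorm p x)"
proof -
  have "\<forall>a. \<exists>C. a < K \<longrightarrow> C > 0 \<and> (\<forall>x\<in>lp p. lpnorm p (A a x) \<le> C * lpnorm p x)"
    using A bopE by metis
  then obtain Ca where Ca: "\<And>a. a < K \<Longrightarrow> Ca a > 0" "\<And>a x. a < K \<Longrightarrow> x \<in> lp p \<Longrightarrow> lpnorm p (A a x) \<le> Ca a * lpnorm p x" by metis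
  define C where "C = (\<Sum>a<K. Ca a)"
  have CaC: "Ca a \<le> C" if "a < K" for a unfolding C_def by (rule member_le_sum) (use that Ca(1) less_imp_le in auto)
  have C0: "C \<ge> 0" unfolding C_def by (rule sum_nonneg) (use Ca(1) less_imp_le in auto)
  have Cb: "lpnorm p (A a x) \<le> C * lpnorm p x" if "a < K" "x \<in> lp p" for a x
    using Ca(2)[OF that] mult_right_mono[OF CaC[OF that(1)], of "lpnorm p x"] by simp
  \<comment> \<open>Four families of corners contribute \<open>4 * \<eta> = e / 2\<close> after
    averaging.\<close>
  define \<eta> where "\<eta> = e / 8"
  have \<eta>: "\<eta> > 0" using e by (simp add: \<eta>_def)
  define Pr where "Pr n m \<longleftrightarrow> n < m \<and> (\<forall>a<K. \<forall>x\<in>lp p. lpnorm p (restr {m..} (A a (restr {..<n} x))) \<le> \<eta> * lpnorm p x \<and>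
     lpnorm p (restr {..<n} (A a (restr {m..} x))) \<le> \<eta> * lpnorm p x)" for n m
  have "\<exists>m. Pr n m" for n
  proof -
    have "eventually (\<lambda>m. \<forall>a\<in>{..<K}. (\<forall>x\<in>lp p. lpnorm p (restr {m..} (A a (restr {..<n} x))) \<le> \<eta> * lpnorm p x) \<and>
      (\<forall>x\<in>lp p. lpnorm p (restr {..<n} (A a (restr {m..} x))) \<le> \<eta> * lpnorm p x)) sequentially"
      by (rule eventually_ball_finite[OF finite_lessThan])
        (intro ballI eventually_conj corner_lower_small corner_upper_small A \<eta>; simp)
    from eventually_conj[OF this eventually_gt_at_top[of n]] show ?thesis
      by (auto simp: Pr_def eventually_sequentially)
  qed
  then obtain nx where nx: "\<And>n. Pr n (nx n)" by metis
  define n where "n s = (nx ^^ s) N" for s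
  have n0: "n 0 = N" and nS: "Pr (n s) (n (Suc s))" for s using nx by (auto simp: n_def)
  have sm: "strict_mono n" using nS by (simp add: strict_mono_Suc_iff Pr_def)
  have nmono: "n s \<le> n t" if "s \<le> t" for s t using sm that by (simp add: strict_mono_less_eq)
  \<comment> \<open>The two families of adjacent blocks contribute \<open>2 * C / L\<close>, which
    this choice keeps below \<open>e / 2\<close>.\<close>
  obtain L :: nat where L: "real L > 4 * C / e" "L > 0"
  proof -
    obtain L :: nat where "real L > 4 * C / e" using reals_Archimedean2 by blast
    moreover have "4 * C / e \<ge> 0" using C0 e by simp
    ultimately have "real L > 0" by linarith
    then show ?thesis using that[of L] \<open>real L > 4 * C / e\<close> by simp
  qed
  define E where "E i = (\<Sum>s\<in>{1..L}. if i < n s then 1 else 0) / real L" for i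
  have E01: "0 \<le> E i \<and> E i \<le> 1" for i
  proof
    show "0 \<le> E i" by (auto simp: E_def intro!: divide_nonneg_nonneg sum_nonneg)
    have "(\<Sum>s\<in>{1..L}. if i < n s then 1 else 0 :: real) \<le> (\<Sum>s\<in>{1..L}. 1)" by (intro sum_mono) auto
    then show "E i \<le> 1" using L by (simp add: E_def)
  qed
  have E1: "E i = 1" if "i < N" for i
  proof -
    have "i < n s" for s using nmono[of 0 s] n0 that by simp
    then show ?thesis using L by (simp add: E_def)
  qed
  have E0: "E i = 0" if "i \<ge> n (Suc L)" for i
  proof -
    have "\<not> i < n s" if "s \<in> {1..L}" for s using nmono[of s "Suc L"] that \<open>i \<ge> n (Suc L)\<close> by auto
    then show ?thesis by (simp add: E_def)
  qed
  define Q where "Q s = {..<n s}" for s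
  define R where "R s = {n s..}" for s
  define B where "B s = {n s..<n (Suc s)}" for s
  have dE: "diag_op E x = (1 / of_nat L) *\<^sub>C (\<Sum>s\<in>{1..L}. restr (Q s) x)" for x
    by (auto simp: fun_eq_iff diag_op_def E_def sum_fun_apply restr_def Q_def sum_distrib_right if_distrib sum.If_cases mult.commute)
  have comm: "lpnorm p (A a (diag_op E x) - diag_op E (A a x)) \<le> e * lpnorm p x" if a: "a < K" and x: "x \<in> lp p" for a x
  proof -
    note Aa = A[OF a]
    note lin = clinear_onD[OF bopD(1)[OF Aa]] clinear_on_rules[OF bopD(1)[OF Aa] lpD(1)]
    have Al [simp]: "A a y \<in> lp p" if "y \<in> lp p" for y using bopD(2)[OF Aa that] .
    have rl [simp]: "restr S y \<in> lp p" if "y \<in> lp p" for S y using restr_lp[OF that] .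
    \<comment> \<open>The commutator with the projection \<open>restr (Q s)\<close> splits along the
      intervals \<open>B\<close>. \<open>t1\<close> and \<open>t4\<close> join the adjacent
      intervals \<open>B (s - 1)\<close> and \<open>B s\<close>; the other four terms are corners at
      distance at least one interval from the diagonal, small by the choice of \<open>n\<close>.
      Averaging starts at \<open>s = 1\<close> so that \<open>s - 1\<close> is a true
      predecessor.\<close>
    define t1 where "t1 s = restr (B s) (A a (restr (B (s - 1)) x))" for s
    define t2 where "t2 s = restr (R (Suc s)) (A a (restr (Q s) x))" for s
    define t3 where "t3 s = restr (B s) (A a (restr (Q (s - 1)) x))" for s
    define t4 where "t4 s = restr (B (s - 1)) (A a (restr (B s) x))" for s
    define t5 where "t5 s = restr (Q s) (A a (restr (R (Suc s)) x))" for s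
    define t6 where "t6 s = restr (Q (s - 1)) (A a (restr (B s) x))" for s
    have tl: "t1 s \<in> lp p" "t2 s \<in> lp p" "t3 s \<in> lp p" "t4 s \<in> lp p" "t5 s \<in> lp p" "t6 s \<in> lp p" for s
      using x by (auto simp: t1_def t2_def t3_def t4_def t5_def t6_def)
    have dec: "A a (restr (Q s) x) - restr (Q s) (A a x) = (t1 s + t2 s + t3 s) - (t4 s + t5 s + t6 s)" if s: "s \<in> {1..L}" for s
    proof -
      have ss: "Suc (s - 1) = s" using s by simp
      have nn: "n (s - 1) \<le> n s" "n s \<le> n (Suc s)" by (rule nmono; simp)+
      have Rsp: "restr (R s) y = restr (B s) y + restr (R (Suc s)) y" for y using nn by (auto simp: R_def B_def restr_def)
      have Qsp: "restr (Q s) y = restr (Q (s - 1)) y + restr (B (s - 1)) y" for y using nn ss by (auto simp: Q_def B_def restr_def)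
      have QR: "y = restr (Q s) y + restr (R s) y" for y by (auto simp: Q_def R_def restr_def)
      have 1: "A a (restr (Q s) x) = restr (Q s) (A a (restr (Q s) x)) + restr (R s) (A a (restr (Q s) x))" by (rule QR)
      have 2: "restr (Q s) (A a x) = restr (Q s) (A a (restr (Q s) x)) + restr (Q s) (A a (restr (R s) x))"
        by (subst QR[of x]) (simp add: lin(1) x restr_linear)
      have 3: "restr (R s) (A a (restr (Q s) x)) = restr (B s) (A a (restr (Q s) x)) + t2 s"
        by (simp add: Rsp t2_def)
      have 4: "restr (B s) (A a (restr (Q s) x)) = t3 s + t1 s"
        by (simp add: Qsp[of x] lin(1) x restr_linear t1_def t3_def)
      have 5: "restr (Q s) (A a (restr (R s) x)) = restr (Q s) (A a (restr (B s) x)) + t5 s"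
        by (simp add: Rsp[of x] lin(1) x restr_linear t5_def)
      have 6: "restr (Q s) (A a (restr (B s) x)) = t6 s + t4 s"
        by (simp add: Qsp t6_def t4_def)
      show ?thesis using 1 2 3 4 5 6 by (simp add: algebra_simps)
    qed
    have small: "lpnorm p (t2 s) \<le> \<eta> * lpnorm p x" "lpnorm p (t3 s) \<le> \<eta> * lpnorm p x"
      "lpnorm p (t5 s) \<le> \<eta> * lpnorm p x" "lpnorm p (t6 s) \<le> \<eta> * lpnorm p x" if s: "s \<in> {1..L}" for s
    proof -
      have ss: "Suc (s - 1) = s" using s by simp
      show "lpnorm p (t2 s) \<le> \<eta> * lpnorm p x" "lpnorm p (t5 s) \<le> \<eta> * lpnorm p x"
        using nS[of s] a x by (auto simp: Pr_def t2_def t5_def R_def Q_def)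
      have BR: "restr (B s) y = restr (B s) (restr (R s) y)" "restr (B s) y = restr (R s) (restr (B s) y)" for y
        by (auto simp: B_def R_def restr_def)
      have "lpnorm p (t3 s) \<le> lpnorm p (restr (R s) (A a (restr (Q (s - 1)) x)))"
        unfolding t3_def BR(1)[of "A a (restr (Q (s - 1)) x)"] using x by (intro lpnorm_restr) simp
      also have "\<dots> \<le> \<eta> * lpnorm p x" using nS[of "s - 1"] a x ss by (simp add: Pr_def R_def Q_def)
      finally show "lpnorm p (t3 s) \<le> \<eta> * lpnorm p x" .
      have "lpnorm p (t6 s) = lpnorm p (restr (Q (s - 1)) (A a (restr (R s) (restr (B s) x))))"
        unfolding t6_def using BR(2)[of x] by simp
      also have "\<dots> \<le> \<eta> * lpnorm p (restr (B s) x)" using nS[of "s - 1"] a rl[OF x] ss unfolding Pr_def R_def Q_def by metis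
      also have "\<dots> \<le> \<eta> * lpnorm p x" using \<eta> lpnorm_restr[OF x] by (intro mult_left_mono) auto
      finally show "lpnorm p (t6 s) \<le> \<eta> * lpnorm p x" .
    qed
    have disjB: "B s \<inter> B t = {}" if "s \<noteq> t" for s t
    proof -
      have "B s \<inter> B t = {}" if "s < t" for s t using nmono[of "Suc s" t] that by (auto simp: B_def)
      then show ?thesis using \<open>s \<noteq> t\<close> by (metis inf_commute nat_neq_iff)
    qed
    have disj1: "disjoint_family_on B {1..L}" using disjB by (auto simp: disjoint_family_on_def)
    have disj2: "disjoint_family_on (\<lambda>s. B (s - 1)) {1..L}"
      unfolding disjoint_family_on_def
    proof (intro ballI impI)
      fix s t assume "s \<in> {1..L}" "t \<in> {1..L}" "s \<noteq> t"
      then show "B (s - 1) \<inter> B (t - 1) = {}" by (intro disjB) auto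
    qed
    have main: "lpnorm p (\<Sum>s\<in>{1..L}. t1 s) \<le> C * lpnorm p x" "lpnorm p (\<Sum>s\<in>{1..L}. t4 s) \<le> C * lpnorm p x"
      unfolding t1_def t4_def
      by (rule block_sum_bound[OF Aa C0 Cb[OF a] _ disj1 disj2 x] block_sum_bound[OF Aa C0 Cb[OF a] _ disj2 disj1 x]; simp)+
    have sl: "(\<Sum>s\<in>{1..L}. t s) \<in> lp p \<and> lpnorm p (\<Sum>s\<in>{1..L}. t s) \<le> L * (\<eta> * lpnorm p x)"
      if "\<And>s. s \<in> {1..L} \<Longrightarrow> t s \<in> lp p \<and> lpnorm p (t s) \<le> \<eta> * lpnorm p x" for t
    proof
      show "(\<Sum>s\<in>{1..L}. t s) \<in> lp p" by (intro csubspace_sum[OF lpD(1)]) (use that in auto)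
      have "lpnorm p (\<Sum>s\<in>{1..L}. t s) \<le> (\<Sum>s\<in>{1..L}. lpnorm p (t s))" by (rule seminormed_sum[OF seminormed_lp]) (use that in auto)
      also have "\<dots> \<le> (\<Sum>s\<in>{1..L}. \<eta> * lpnorm p x)" by (rule sum_mono) (use that in auto)
      finally show "lpnorm p (\<Sum>s\<in>{1..L}. t s) \<le> L * (\<eta> * lpnorm p x)" by simp
    qed
    define u1 u2 u3 u4 u5 u6 where "u1 = (\<Sum>s\<in>{1..L}. t1 s)" and "u2 = (\<Sum>s\<in>{1..L}. t2 s)" and "u3 = (\<Sum>s\<in>{1..L}. t3 s)"
      and "u4 = (\<Sum>s\<in>{1..L}. t4 s)" and "u5 = (\<Sum>s\<in>{1..L}. t5 s)" and "u6 = (\<Sum>s\<in>{1..L}. t6 s)"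
    have ul: "u1 \<in> lp p" "u2 \<in> lp p" "u3 \<in> lp p" "u4 \<in> lp p" "u5 \<in> lp p" "u6 \<in> lp p"
      unfolding u1_def u2_def u3_def u4_def u5_def u6_def by (intro csubspace_sum[OF lpD(1)] tl)+
    have un1: "lpnorm p u1 \<le> C * lpnorm p x" "lpnorm p u4 \<le> C * lpnorm p x" using main by (simp_all add: u1_def u4_def)
    have un2: "lpnorm p u2 \<le> L * (\<eta> * lpnorm p x)" "lpnorm p u3 \<le> L * (\<eta> * lpnorm p x)"
       "lpnorm p u5 \<le> L * (\<eta> * lpnorm p x)" "lpnorm p u6 \<le> L * (\<eta> * lpnorm p x)"
      using sl[of t2] sl[of t3] sl[of t5] sl[of t6] small tl unfolding u2_def u3_def u5_def u6_def by blast+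
    have sumd: "(\<Sum>s\<in>{1..L}. A a (restr (Q s) x) - restr (Q s) (A a x)) = (u1 + u2 + u3) - (u4 + u5 + u6)"
      unfolding u1_def u2_def u3_def u4_def u5_def u6_def by (simp add: dec sum.distrib sum_subtractf)
    have "A a (diag_op E x) - diag_op E (A a x) = (1 / of_nat L) *\<^sub>C (\<Sum>s\<in>{1..L}. A a (restr (Q s) x) - restr (Q s) (A a x))"
      unfolding dE
    proof -
      have "A a ((1 / of_nat L) *\<^sub>C (\<Sum>s\<in>{1..L}. restr (Q s) x)) = (1 / of_nat L) *\<^sub>C A a (\<Sum>s\<in>{1..L}. restr (Q s) x)"
        by (rule lin(2)) (intro csubspace_sum[OF lpD(1)] rl x)
      also have "A a (\<Sum>s\<in>{1..L}. restr (Q s) x) = (\<Sum>s\<in>{1..L}. A a (restr (Q s) x))" by (rule lin(6)) (intro rl x)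
      finally show "A a ((1 / of_nat L) *\<^sub>C (\<Sum>s\<in>{1..L}. restr (Q s) x)) - (1 / of_nat L) *\<^sub>C (\<Sum>s\<in>{1..L}. restr (Q s) (A a x))
         = (1 / of_nat L) *\<^sub>C (\<Sum>s\<in>{1..L}. A a (restr (Q s) x) - restr (Q s) (A a x))"
        by (simp only: sum_subtractf cscale_right_diff_distrib)
    qed
    also have "\<dots> = (1 / of_nat L) *\<^sub>C ((u1 + u2 + u3) - (u4 + u5 + u6))" by (simp only: sumd)
    finally have "lpnorm p (A a (diag_op E x) - diag_op E (A a x)) = (1 / L) * lpnorm p ((u1 + u2 + u3) - (u4 + u5 + u6))"
      using lpD(4)[of "(u1 + u2 + u3) - (u4 + u5 + u6)" "1 / of_nat L"] lpS(2,5) ul by (simp add: norm_divide)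
    also have "\<dots> \<le> (1 / L) * ((C * lpnorm p x + L * (\<eta> * lpnorm p x) + L * (\<eta> * lpnorm p x)) + (C * lpnorm p x + L * (\<eta> * lpnorm p x) + L * (\<eta> * lpnorm p x)))"
    proof (intro mult_left_mono)
      have "lpnorm p ((u1 + u2 + u3) - (u4 + u5 + u6)) \<le> lpnorm p (u1 + u2 + u3) + lpnorm p (u4 + u5 + u6)" by (intro lpD(7) lpS(2) ul)
      moreover have "lpnorm p (u1 + u2 + u3) \<le> lpnorm p (u1 + u2) + lpnorm p u3" "lpnorm p (u1 + u2) \<le> lpnorm p u1 + lpnorm p u2"
        "lpnorm p (u4 + u5 + u6) \<le> lpnorm p (u4 + u5) + lpnorm p u6" "lpnorm p (u4 + u5) \<le> lpnorm p u4 + lpnorm p u5"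
        by (intro lpD(3) lpS(2) ul)+
      ultimately show "lpnorm p ((u1 + u2 + u3) - (u4 + u5 + u6)) \<le> (C * lpnorm p x + L * (\<eta> * lpnorm p x) + L * (\<eta> * lpnorm p x)) + (C * lpnorm p x + L * (\<eta> * lpnorm p x) + L * (\<eta> * lpnorm p x))"
        using un1 un2 by linarith
    qed simp
    also have "\<dots> = (2 * C / L + 4 * \<eta>) * lpnorm p x" using L by (simp add: field_simps)
    also have "\<dots> \<le> e * lpnorm p x"
    proof (intro mult_right_mono)
      have "4 * C < e * L" using L e by (simp add: field_simps)
      then have "2 * C / L \<le> e / 2" using L by (simp add: field_simps)
      then show "2 * C / L + 4 * \<eta> \<le> e" by (simp add: \<eta>_def)
    qed simp
    finally show ?thesis .
  qed
  have "N < n (Suc L)" using n0 sm by (metis strict_mono_less zero_less_Suc)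
  with E01 E1 E0 comm show ?thesis by blast
qed

text \<open>The functions \<open>f l\<close> are the increments of an increasing sequence of
  quasicentral units, and \<open>g l\<close> is a wider increment that equals 1 where
  \<open>f l\<close> is nonzero. So g f = f, and no square roots of a partition of unity are needed.
  The window \<open>I l\<close> contains both supports and spans four consecutive intervals, hence
  the bound 4 on overlaps.\<close>

lemma diagonal_partition:
  fixes K :: "nat \<Rightarrow> nat" and A :: "nat \<Rightarrow> (nat \<Rightarrow> complex) \<Rightarrow> nat \<Rightarrow> complex"
  assumes A: "\<And>a. bop (A a)" and e: "\<And>l. e l > (0::real)"
  obtains f g :: "nat \<Rightarrow> nat \<Rightarrow> real" and I :: "nat \<Rightarrow> nat set"
  where "\<And>l i. 0 \<le> f l i" "\<And>l i. 0 \<le> g l i \<and> g l i \<le> 1" "\<And>l. finite (I l)"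
    "\<And>l i. i \<notin> I l \<Longrightarrow> f l i = 0" "\<And>l i. i \<notin> I l \<Longrightarrow> g l i = 0" "\<And>l i. f l i \<noteq> 0 \<Longrightarrow> g l i = 1"
    "\<And>L i. (\<Sum>l<L. f l i) \<le> 1" "\<And>L i. i < L \<Longrightarrow> (\<Sum>l<Suc L. f l i) = 1"
    "\<And>i. finite {l. i \<in> I l}" "\<And>i. card {l. i \<in> I l} \<le> 4"
    "\<And>l a x. a < K l \<Longrightarrow> x \<in> lp p \<Longrightarrow> lpnorm p (A a (diag_op (f l) x) - diag_op (f l) (A a x)) \<le> e l * lpnorm p x"
    "\<And>l a x. a < K l \<Longrightarrow> x \<in> lp p \<Longrightarrow> lpnorm p (A a (diag_op (g l) x) - diag_op (g l) (A a x)) \<le> e l * lpnorm p x"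
proof -
  \<comment> \<open>\<open>f l\<close> and \<open>g l\<close> are differences of two units with
    indices at least \<open>l - 1\<close>. So the unit with index \<open>l\<close> must meet the
    demands of all indices up to \<open>Suc l\<close>, with half of the tolerance.\<close>
  define e' where "e' l = Min (e ` {..Suc l}) / 2" for l
  define K' where "K' l = Max (K ` {..Suc l})" for l
  have e': "e' l > 0" for l using e by (simp add: e'_def)
  have e'e: "e' l \<le> e j / 2" if "j \<le> Suc l" for j l
    unfolding e'_def using that by (intro divide_right_mono Min_le) auto
  have K'K: "K j \<le> K' l" if "j \<le> Suc l" for j l unfolding K'_def using that by (intro Max_ge) auto
  have "\<forall>l N. \<exists>E M. N < M \<and> (\<forall>i. 0 \<le> E i \<and> E i \<le> 1) \<and> (\<forall>i<N. E i = 1) \<and> (\<forall>i\<ge>M. E i = 0) \<and>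
    (\<forall>a<K' l. \<forall>x\<in>lp p. lpnorm p (A a (diag_op E x) - diag_op E (A a x)) \<le> e' l * lpnorm p x)"
    by (intro allI quasicentral_unit A e')
  then obtain EE MM where EM: "\<And>l N. N < MM l N \<and> (\<forall>i. 0 \<le> EE l N i \<and> EE l N i \<le> 1) \<and> (\<forall>i<N. EE l N i = 1) \<and> (\<forall>i\<ge>MM l N. EE l N i = 0) \<and>
    (\<forall>a<K' l. \<forall>x\<in>lp p. lpnorm p (A a (diag_op (EE l N) x) - diag_op (EE l N) (A a x)) \<le> e' l * lpnorm p x)" by metis
  define c where "c = rec_nat 0 (\<lambda>l N. MM (Suc l) N)"
  have c0: "c 0 = 0" and cS: "c (Suc l) = MM (Suc l) (c l)" for l by (auto simp: c_def)
  have sm: "strict_mono c" unfolding strict_mono_Suc_iff using EM cS by metis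
  have cmono: "c s \<le> c t" if "s \<le> t" for s t using sm that by (simp add: strict_mono_less_eq)
  \<comment> \<open>\<open>E 0 = 0\<close> lets the sums of the increments telescope to
    \<open>E L\<close>. Each further unit is 1 below the cut where its predecessor ends, which makes
    the sequence increasing.\<close>
  define E where "E l = (case l of 0 \<Rightarrow> (\<lambda>_. 0) | Suc k \<Rightarrow> EE (Suc k) (c k))" for l
  have E01: "0 \<le> E l i" "E l i \<le> 1" for l i using EM by (auto simp: E_def split: nat.split)
  have E1: "E (Suc l) i = 1" if "i < c l" for l i using EM that by (simp add: E_def)
  have E0: "E l i = 0" if "i \<ge> c l" for l i using EM that cS by (auto simp: E_def split: nat.split)
  have Ec: "lpnorm p (A a (diag_op (E l) x) - diag_op (E l) (A a x)) \<le> e' l * lpnorm p x" if "a < K' l" "x \<in> lp p" for l a x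
  proof (cases l)
    case 0
    have "A a 0 = 0" by (rule clinear_on_rules(1)[OF bopD(1)[OF A] lpD(1)])
    moreover have "diag_op (E 0) y = 0" for y by (auto simp: E_def diag_op_def)
    ultimately show ?thesis using 0 lpD(5) e'[of l] by (simp add: less_imp_le)
  qed (use EM that in \<open>auto simp: E_def\<close>)
  define f where "f l i = E (Suc l) i - E l i" for l i
  define g where "g l i = E (l + 2) i - E (l - 1) i" for l i
  define I where "I l = {c (l - 2)..<c (l + 2)}" for l
  have Emono: "E l i \<le> E (Suc l) i" for l i
    using E1[of i l] E01[of l i] E01[of "Suc l" i] E0[of l i] by (cases "i < c l") auto
  have Emono': "E l i \<le> E k i" if "l \<le> k" for l k i using that by (induction rule: dec_induct) (use Emono order_trans in blast)+
  have f_nz: "c (l - 1) \<le> i \<and> i < c (Suc l)" if "f l i \<noteq> 0" for l i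
  proof
    show "i < c (Suc l)" using that E0[of l i] E0[of "Suc l" i] cmono[of l "Suc l"] by (fastforce simp: f_def)
    show "c (l - 1) \<le> i"
    proof (rule ccontr)
      assume "\<not> c (l - 1) \<le> i"
      then have i: "i < c (l - 1)" by simp
      then obtain k where k: "l = Suc k" using c0 by (cases l) auto
      then have "i < c l" using i cmono[of k l] by simp
      then show False using that E1[of i k] E1[of i l] i k by (simp add: f_def)
    qed
  qed
  have fI: "f l i = 0" if "i \<notin> I l" for l i
  proof (rule ccontr)
    assume "f l i \<noteq> 0"
    moreover have "c (l - 2) \<le> c (l - 1)" "c (Suc l) \<le> c (l + 2)" by (rule cmono; arith)+
    ultimately have "i \<in> I l" using f_nz[of l i] by (auto simp: I_def)
    then show False using that by simp
  qed
  have gI: "g l i = 0" if "i \<notin> I l" for l i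
  proof (cases "i < c (l - 2)")
    case True
    have "2 \<le> l"
    proof (rule ccontr)
      assume "\<not> 2 \<le> l"
      then have "l - 2 = 0" by arith
      then show False using True c0 by simp
    qed
    then obtain k where k: "l = k + 2" by (metis le_add_diff_inverse2)
    have "i < c k" "i < c (Suc (k + 2))" using True k cmono[of k "Suc (k+2)"] by auto
    then show ?thesis using E1[of i k] E1[of i "Suc (k+2)"] k by (simp add: g_def)
  next
    case False
    then have "c (l + 2) \<le> i" using that by (simp add: I_def)
    moreover have "c (l - 1) \<le> c (l + 2)" by (rule cmono) arith
    ultimately show ?thesis using E0[of "l+2" i] E0[of "l - 1" i] by (simp add: g_def)
  qed
  have fg: "g l i = 1" if "f l i \<noteq> 0" for l i
    using f_nz[OF that] E1[of i "Suc l"] E0[of "l - 1" i] by (auto simp: g_def)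
  have sumf: "(\<Sum>l<L. f l i) = E L i" for L i
    by (induction L) (auto simp: f_def E_def)
  have il: "i < c L" if "i < L" for i L using strict_mono_imp_increasing[OF sm, of L] that by simp
  have Isub: "\<exists>s. {l. i \<in> I l} \<subseteq> {s..s + 3}" for i
  proof -
    \<comment> \<open>The index of the interval containing \<open>i\<close>; only the windows from
      \<open>s - 1\<close> to \<open>s + 2\<close> can meet it.\<close>
    define s where "s = (LEAST s. i < c (Suc s))"
    have "i < c (Suc i)" using il[of i "Suc i"] by simp
    then have s1: "i < c (Suc s)" unfolding s_def by (rule LeastI)
    have s2: "c s \<le> i"
    proof (cases s)
      case (Suc k)
      then have "\<not> i < c (Suc k)" unfolding s_def using not_less_Least by (metis lessI s_def)
      then show ?thesis using Suc by simp
    qed (simp add: c0)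
    have "l \<in> {s - 1..s - 1 + 3}" if "i \<in> I l" for l
    proof -
      have "c (l - 2) \<le> i" "i < c (l + 2)" using that by (auto simp: I_def)
      then have "c (l - 2) < c (Suc s)" "c s < c (l + 2)" using s1 s2 by auto
      then have "l - 2 < Suc s" "s < l + 2" using sm by (auto simp: strict_mono_less)
      then show ?thesis by auto
    qed
    then show ?thesis by blast
  qed
  show ?thesis
  proof (rule that[of f g I])
    show "0 \<le> f l i" for l i using Emono by (simp add: f_def)
    show "0 \<le> g l i \<and> g l i \<le> 1" for l i
      using Emono'[of "l - 1" "l + 2" i] E01[of "l+2" i] E01[of "l - 1" i] by (simp add: g_def)
    show "finite (I l)" for l by (simp add: I_def)
    show "(\<Sum>l<L. f l i) \<le> 1" for L i using E01 sumf by simp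
    show "(\<Sum>l<Suc L. f l i) = 1" if "i < L" for L i unfolding sumf by (rule E1[OF il[OF that]])
    show "finite {l. i \<in> I l}" for i using Isub[of i] finite_subset by blast
    show "card {l. i \<in> I l} \<le> 4" for i
    proof -
      obtain s where "{l. i \<in> I l} \<subseteq> {s..s + 3}" using Isub by blast
      from card_mono[OF _ this] show ?thesis by simp
    qed
    have two: "lpnorm p (A a (diag_op (\<lambda>i. E k i - E j i) x) - diag_op (\<lambda>i. E k i - E j i) (A a x)) \<le> e l * lpnorm p x"
      if a: "a < K l" and x: "x \<in> lp p" and j: "l \<le> Suc j" and k: "l \<le> Suc k" for l a x j k
    proof -
      note lin = clinear_on_rules[OF bopD(1)[OF A] lpD(1)]
      have aK: "a < K' j" "a < K' k" using a K'K[OF j] K'K[OF k] by auto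
      have dl: "diag_op (E k) y \<in> lp p" if "y \<in> lp p" for k y using diag_op_lp(1)[OF that, of "E k"] E01 by simp
      have Al: "A a y \<in> lp p" if "y \<in> lp p" for y using bopD(2)[OF A that] .
      have eq: "A a (diag_op (\<lambda>i. E k i - E j i) x) - diag_op (\<lambda>i. E k i - E j i) (A a x)
        = (A a (diag_op (E k) x) - diag_op (E k) (A a x)) - (A a (diag_op (E j) x) - diag_op (E j) (A a x))"
        unfolding diag_op_diff using lin(3)[OF dl[OF x] dl[OF x]] by simp
      have "lpnorm p (A a (diag_op (\<lambda>i. E k i - E j i) x) - diag_op (\<lambda>i. E k i - E j i) (A a x)) \<le> e' k * lpnorm p x + e' j * lpnorm p x"
      proof -
        have "A a (diag_op (E i) x) - diag_op (E i) (A a x) \<in> lp p" for i by (intro lpS(5) dl Al x)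
        from lpD(7)[OF this this] show ?thesis unfolding eq
          by (rule order_trans) (intro add_mono Ec[OF aK(1) x] Ec[OF aK(2) x])
      qed
      also have "\<dots> \<le> e l / 2 * lpnorm p x + e l / 2 * lpnorm p x"
        by (rule add_mono[OF mult_right_mono[OF e'e[OF k]] mult_right_mono[OF e'e[OF j]]]) auto
      finally show ?thesis by simp
    qed
    show "lpnorm p (A a (diag_op (f l) x) - diag_op (f l) (A a x)) \<le> e l * lpnorm p x" if "a < K l" "x \<in> lp p" for l a x
      unfolding f_def[abs_def] using two[OF that, of l "Suc l"] by simp
    show "lpnorm p (A a (diag_op (g l) x) - diag_op (g l) (A a x)) \<le> e l * lpnorm p x" if "a < K l" "x \<in> lp p" for l a x
      unfolding g_def[abs_def] using two[OF that, of "l - 1" "l + 2"] by simp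
  qed (use fI gI fg in auto)
qed

end

section \<open>Decompositions of the ranges\<close>

definition comb :: "('i \<Rightarrow> 'a::cvec) \<Rightarrow> 'i set \<Rightarrow> ('i \<Rightarrow> complex) \<Rightarrow> 'a" where
  "comb b I c = (\<Sum>i\<in>I. c i *\<^sub>C b i)"

lemma comb_add: "comb b I (\<lambda>i. c i + d i) = comb b I c + comb b I d"
  by (simp add: comb_def cscale_left_distrib sum.distrib)

lemma comb_diff: "comb b I (\<lambda>i. c i - d i) = comb b I c - comb b I d"
  by (simp add: comb_def cscale_left_diff_distrib sum_subtractf)

lemma comb_cscale: "comb b I (\<lambda>i. k * c i) = k *\<^sub>C comb b I c"
  by (simp add: comb_def cscale_sum_right)

lemma comb_mem: "csubspace V \<Longrightarrow> (\<And>i. i \<in> I \<Longrightarrow> b i \<in> V) \<Longrightarrow> comb b I c \<in> V"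
  unfolding comb_def by (intro csubspace_sum csubspaceD(3)) auto

lemma clinear_comb: "(\<And>i. i \<in> I \<Longrightarrow> clinear_on V (\<phi> i)) \<Longrightarrow> clinear_on V (\<lambda>m. comb b I (\<lambda>i. \<phi> i m))"
  unfolding comb_def by (intro clinear_on_sum clinear_on_cscale_left) auto

context ultra
begin

text \<open>Finite-rank maps \<open>f\<^sub>l = \<Sum>\<^sub>i \<phi>\<^sub>l\<^sub>i b\<^sub>i\<close> and \<open>g\<^sub>l = \<Sum>\<^sub>i \<psi>\<^sub>l\<^sub>i b\<^sub>i\<close> on \<open>M\<close> that almost commute with the operators and satisfy
  \<open>\<Sum>\<^sub>l g\<^sub>l f\<^sub>l = 1\<close>; \<open>Sg\<close> is a linear choice of representatives for sums of sequences with
  \<open>l\<close>-th term in the span of the \<open>b\<^sub>i\<close>, \<open>i \<in> I l\<close>.\<close>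

definition decomposition :: "(nat \<Rightarrow> (nat \<Rightarrow> complex) \<Rightarrow> nat \<Rightarrow> complex) \<Rightarrow> (nat \<Rightarrow> nat \<Rightarrow> complex) set \<Rightarrow> real \<Rightarrow> (nat \<Rightarrow> nat) \<Rightarrow> (nat \<Rightarrow> real)
   \<Rightarrow> (nat \<Rightarrow> nat set) \<Rightarrow> (nat \<Rightarrow> nat \<Rightarrow> nat \<Rightarrow> complex) \<Rightarrow> (nat \<Rightarrow> nat \<Rightarrow> (nat \<Rightarrow> nat \<Rightarrow> complex) \<Rightarrow> complex) \<Rightarrow> (nat \<Rightarrow> nat \<Rightarrow> (nat \<Rightarrow> nat \<Rightarrow> complex) \<Rightarrow> complex)
   \<Rightarrow> ((nat \<Rightarrow> nat \<Rightarrow> complex) \<Rightarrow> nat \<Rightarrow> nat \<Rightarrow> complex) \<Rightarrow> bool" where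
  "decomposition T M C K e I b \<phi> \<psi> Sg \<longleftrightarrow>
    (\<forall>l. finite (I l)) \<and> (\<forall>i. b i \<in> M) \<and>
    (\<forall>l i. bdd_op M un UNIV cmod (\<phi> l i)) \<and> (\<forall>l i. bdd_op M un UNIV cmod (\<psi> l i)) \<and>
    (\<forall>m\<in>M. \<forall>L. (\<Sum>l<L. un (comb b (I l) (\<lambda>i. \<phi> l i m)) powr p) \<le> (C * un m) powr p) \<and>
    (\<forall>m\<in>M. \<forall>l. un (comb b (I l) (\<lambda>i. \<psi> l i m)) \<le> C * un m) \<and>
    (\<forall>m\<in>M. (\<lambda>L. un (m - (\<Sum>l<L. comb b (I l) (\<lambda>i. \<psi> l i (comb b (I l) (\<lambda>i. \<phi> l i m)))))) \<longlonglongrightarrow> 0) \<and>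
    (\<forall>l. \<forall>a<K l. \<forall>m\<in>M. un (hatop (T a) (comb b (I l) (\<lambda>i. \<phi> l i m)) - comb b (I l) (\<lambda>i. \<phi> l i (hatop (T a) m))) \<le> e l * un m) \<and>
    (\<forall>l. \<forall>a<K l. \<forall>m\<in>M. un (hatop (T a) (comb b (I l) (\<lambda>i. \<psi> l i m)) - comb b (I l) (\<lambda>i. \<psi> l i (hatop (T a) m))) \<le> e l * un m) \<and>
    (\<forall>c. summable (\<lambda>l. un (comb b (I l) (c l)) powr p) \<longrightarrow>
       Sg c \<in> M \<and> (\<lambda>L. un (Sg c - (\<Sum>l<L. comb b (I l) (c l)))) \<longlonglongrightarrow> 0 \<and>
       un (Sg c) powr p \<le> C powr p * (\<Sum>l. un (comb b (I l) (c l)) powr p)) \<and>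
    (\<forall>c d. Sg c \<in> M \<longrightarrow> Sg d \<in> M \<longrightarrow> summable (\<lambda>l. un (comb b (I l) (c l)) powr p) \<longrightarrow> summable (\<lambda>l. un (comb b (I l) (d l)) powr p) \<longrightarrow>
       Sg (c + d) = Sg c + Sg d) \<and>
    (\<forall>c k. summable (\<lambda>l. un (comb b (I l) (c l)) powr p) \<longrightarrow> Sg (k *\<^sub>C c) = k *\<^sub>C Sg c)"

text \<open>The operators are transported to l^p by the isomorphism, the diagonal partition of unity
  is taken there and brought back. The vectors \<open>b\<close> are the images of the unit vectors.
  The constant is the condition number times the overlap 4.\<close>

lemma decomposition_of_lp_iso:
  assumes T: "\<And>a. bop (T a)" and M: "M \<subseteq> hat" "csubspace M" "\<And>a m. m \<in> M \<Longrightarrow> hatop (T a) m \<in> M"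
    and iso: "iso_data M un (lp p) (lpnorm p) \<Psi> \<Phi> \<alpha> \<beta>" "\<alpha> * \<beta> \<le> lam" and lam: "1 \<le> lam" and e: "\<And>l. e l > 0"
  obtains I b \<phi> \<psi> Sg where "decomposition T M (4 * lam) K e I b \<phi> \<psi> Sg"
proof -
  have sM: "seminormed M un" by (rule seminormed_subset[OF seminormed_hat M(2,1)])
  note mN = seminormedD[OF sM] note mS = csubspaceD[OF M(2)]
  have Psi: "clinear_on M \<Psi>" "\<And>m. m \<in> M \<Longrightarrow> \<Psi> m \<in> lp p" "\<And>m. m \<in> M \<Longrightarrow> lpnorm p (\<Psi> m) \<le> \<alpha> * un m"
    and Phi: "clinear_on (lp p) \<Phi>" "\<And>x. x \<in> lp p \<Longrightarrow> \<Phi> x \<in> M" "\<And>x. x \<in> lp p \<Longrightarrow> un (\<Phi> x) \<le> \<beta> * lpnorm p x"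
    and ab: "0 \<le> \<alpha>" "0 \<le> \<beta>" and RS: "\<And>m. m \<in> M \<Longrightarrow> un (\<Phi> (\<Psi> m) - m) = 0"
    and SR0: "\<And>x. x \<in> lp p \<Longrightarrow> lpnorm p (\<Psi> (\<Phi> x) - x) = 0"
    using iso(1) by (auto simp: iso_data_def op_bound_def)
  \<comment> \<open>On l^p the norm is definite, so this composition is exactly the identity; the
    other one is so only up to null vectors.\<close>
  have SR: "\<Psi> (\<Phi> x) = x" if x: "x \<in> lp p" for x
  proof -
    have "\<Psi> (\<Phi> x) - x \<in> lp p" using lpS(5) Psi(2) Phi(2) x by blast
    then have "\<Psi> (\<Phi> x) - x = 0" using lpnorm_zero_iff SR0[OF x] by blast
    then show ?thesis by simp
  qed
  note Phil = clinear_onD[OF Phi(1)] clinear_on_rules[OF Phi(1) lpD(1)]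
  note Psil = clinear_onD[OF Psi(1)] clinear_on_rules[OF Psi(1) M(2)]
  have ablam: "\<alpha> * t * \<beta> \<le> lam * t" if "t \<ge> 0" for t using mult_right_mono[OF iso(2) that] by (simp add: mult_ac)
  have Tl: "clinear_on M (hatop (T a))" for a
    by (rule clinear_on_subset[OF clinear_hatop[OF T]]) (use M(1) hat_upw in blast)
  define A where "A a x = \<Psi> (hatop (T a) (\<Phi> x))" for a x
  have A: "bop (A a)" for a
  proof -
    obtain C where C: "C > 0" "\<And>x. x \<in> lp p \<Longrightarrow> lpnorm p (T a x) \<le> C * lpnorm p x" using T by (rule bopE) (rule that)
    show ?thesis unfolding bop_def
    proof (rule bdd_opI[where C="\<alpha> * (C * \<beta>)"])
      have "clinear_on (lp p) (\<lambda>x. hatop (T a) (\<Phi> x))" by (rule clinear_on_compose[OF Phi(1) Tl]) (use Phi(2) in auto)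
      then show "clinear_on (lp p) (A a)" unfolding A_def by (rule clinear_on_compose[OF _ Psi(1)]) (use Phi(2) M(3) in auto)
      fix x assume x: "x \<in> lp p"
      show "A a x \<in> lp p" unfolding A_def by (intro Psi(2) M(3) Phi(2) x)
      have "lpnorm p (A a x) \<le> \<alpha> * un (hatop (T a) (\<Phi> x))" unfolding A_def by (intro Psi(3) M(3) Phi(2) x)
      also have "\<dots> \<le> \<alpha> * (C * un (\<Phi> x))"
        using hatop_bound[OF T C(2), of "\<Phi> x"] Phi(2)[OF x] M(1) hat_upw ab by (intro mult_left_mono) auto
      also have "\<dots> \<le> \<alpha> * (C * (\<beta> * lpnorm p x))" using C(1) ab by (intro mult_left_mono Phi(3)[OF x]) auto
      finally show "lpnorm p (A a x) \<le> \<alpha> * (C * \<beta>) * lpnorm p x" by (simp add: mult_ac)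
    qed
  qed
  \<comment> \<open>Conjugation with the isomorphism multiplies commutator norms by at most
    \<open>\<alpha> * \<beta> \<le> lam\<close>.\<close>
  have e': "e l / lam > 0" for l using e lam by simp
  obtain f g :: "nat \<Rightarrow> nat \<Rightarrow> real" and I :: "nat \<Rightarrow> nat set"
    where f0: "\<And>l i. 0 \<le> f l i" and g01: "\<And>l i. 0 \<le> g l i \<and> g l i \<le> 1" and finI: "\<And>l. finite (I l)"
    and fI: "\<And>l i. i \<notin> I l \<Longrightarrow> f l i = 0" and gI: "\<And>l i. i \<notin> I l \<Longrightarrow> g l i = 0" and fg: "\<And>l i. f l i \<noteq> 0 \<Longrightarrow> g l i = 1"
    and fsum: "\<And>L i. (\<Sum>l<L. f l i) \<le> 1" and fsum1: "\<And>L i. i < L \<Longrightarrow> (\<Sum>l<Suc L. f l i) = 1"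
    and finl: "\<And>i. finite {l. i \<in> I l}" and cardl: "\<And>i. card {l. i \<in> I l} \<le> 4"
    and fcomm: "\<And>l a x. a < K l \<Longrightarrow> x \<in> lp p \<Longrightarrow> lpnorm p (A a (diag_op (f l) x) - diag_op (f l) (A a x)) \<le> e l / lam * lpnorm p x"
    and gcomm: "\<And>l a x. a < K l \<Longrightarrow> x \<in> lp p \<Longrightarrow> lpnorm p (A a (diag_op (g l) x) - diag_op (g l) (A a x)) \<le> e l / lam * lpnorm p x"
    by (rule diagonal_partition[OF A e', of K]) (rule that; assumption)
  have f1: "f l i \<le> 1" for l i
  proof -
    have "f l i \<le> (\<Sum>l<Suc l. f l i)" using f0 by (simp add: sum_nonneg)
    then show ?thesis using fsum order_trans by blast
  qed
  define b where "b i = \<Phi> (unitv i)" for i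
  have bM: "b i \<in> M" for i by (simp add: b_def Phi(2))
  have Phi_supp: "\<Phi> x = comb b J x" if J: "finite J" "\<And>i. i \<notin> J \<Longrightarrow> x i = 0" for x J
  proof -
    have "x = (\<Sum>i\<in>J. x i *\<^sub>C unitv i)"
    proof
      fix j
      have "(\<Sum>i\<in>J. x i * unitv i j) = (\<Sum>i\<in>J. if i = j then x i else 0)" by (intro sum.cong) (auto simp: unitv_def)
      then show "x j = (\<Sum>i\<in>J. x i *\<^sub>C unitv i) j" using J by (simp add: sum_fun_apply)
    qed
    then have "\<Phi> x = \<Phi> (\<Sum>i\<in>J. x i *\<^sub>C unitv i)" by simp
    also have "\<dots> = (\<Sum>i\<in>J. \<Phi> (x i *\<^sub>C unitv i))" by (rule Phil(6)) (simp add: lpS(3))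
    finally show ?thesis by (simp add: Phil(2) comb_def b_def)
  qed
  have comb_Phi: "comb b (I l) c = \<Phi> (restr (I l) c)" for l c
    using Phi_supp[of "I l" "restr (I l) c"] finI by (simp add: restr_def comb_def)
  have restr_lp': "restr (I l) c \<in> lp p" for l c
  proof -
    obtain N where N: "\<forall>i\<in>I l. i < N" using finI[of l] unfolding finite_nat_set_iff_bounded by blast
    have "i \<notin> I l" if "N \<le> i" for i using N that by auto
    then show ?thesis by (intro finite_support_lp[of N]) (simp add: restr_def)
  qed
  define \<phi> where "\<phi> l i m = of_real (f l i) * \<Psi> m i" for l i m
  define \<psi> where "\<psi> l i m = of_real (g l i) * \<Psi> m i" for l i m
  have fc: "comb b (I l) (\<lambda>i. \<phi> l i m) = \<Phi> (diag_op (f l) (\<Psi> m))" for l m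
    using Phi_supp[of "I l" "diag_op (f l) (\<Psi> m)"] finI fI by (simp add: diag_op_def \<phi>_def)
  have gc: "comb b (I l) (\<lambda>i. \<psi> l i m) = \<Phi> (diag_op (g l) (\<Psi> m))" for l m
    using Phi_supp[of "I l" "diag_op (g l) (\<Psi> m)"] finI gI by (simp add: diag_op_def \<psi>_def)
  have dl: "diag_op (f l) x \<in> lp p" "lpnorm p (diag_op (f l) x) \<le> lpnorm p x"
    "diag_op (g l) x \<in> lp p" "lpnorm p (diag_op (g l) x) \<le> lpnorm p x" if "x \<in> lp p" for l x
    using diag_op_lp[OF that, of "f l"] diag_op_lp[OF that, of "g l"] f0 f1 g01 by (auto simp: abs_le_iff)
  have commute: "un (hatop (T a) (\<Phi> (diag_op h (\<Psi> m))) - \<Phi> (diag_op h (\<Psi> (hatop (T a) m)))) \<le> e l * un m"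
    if m: "m \<in> M" and h: "\<And>x. x \<in> lp p \<Longrightarrow> diag_op h x \<in> lp p"
      "\<And>x. x \<in> lp p \<Longrightarrow> lpnorm p (A a (diag_op h x) - diag_op h (A a x)) \<le> e l / lam * lpnorm p x" for h a l m
  proof -
    define x where "x = \<Psi> m"
    have x: "x \<in> lp p" using m Psi(2) by (simp add: x_def)
    define w where "w = hatop (T a) (\<Phi> (diag_op h x))"
    have w: "w \<in> M" unfolding w_def by (intro M(3) Phi(2) h x)
    have Ah: "A a (diag_op h x) \<in> lp p" "diag_op h (A a x) \<in> lp p" using h x bopD(2)[OF A] by auto
    \<comment> \<open>\<open>m\<close> and \<open>\<Phi> x\<close> differ by a null vector, which
      \<open>hatop\<close> preserves and \<Psi> sends to the zero vector.\<close>
    have "\<Psi> (hatop (T a) m) = A a x"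
    proof -
      have d: "\<Phi> x - m \<in> M" using mS(5) Phi(2) x m by blast
      have "un (hatop (T a) (\<Phi> x - m)) = 0" by (rule hatop_null[OF T]) (use d M(1) hat_upw RS[OF m] in \<open>auto simp: x_def\<close>)
      then have "lpnorm p (\<Psi> (hatop (T a) (\<Phi> x - m))) = 0"
        using Psi(3)[OF M(3)[OF d], of a] lpnorm_nonneg[of "\<Psi> (hatop (T a) (\<Phi> x - m))"] by simp
      then have "\<Psi> (hatop (T a) (\<Phi> x - m)) = 0" using lpnorm_zero_iff[OF Psi(2)[OF M(3)[OF d]]] by simp
      moreover have "\<Psi> (hatop (T a) (\<Phi> x - m)) = A a x - \<Psi> (hatop (T a) m)"
        using clinear_on_rules(3)[OF Tl M(2) Phi(2)[OF x] m] Psil(5)[OF M(3)[OF Phi(2)[OF x]] M(3)[OF m]] by (simp add: A_def)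
      ultimately show ?thesis by simp
    qed
    then have eq: "\<Phi> (diag_op h (\<Psi> (hatop (T a) m))) = \<Phi> (diag_op h (A a x))" by simp
    have wA: "\<Phi> (\<Psi> w) = \<Phi> (A a (diag_op h x))" by (simp add: w_def A_def)
    have "un (w - \<Phi> (diag_op h (A a x))) \<le> un (w - \<Phi> (\<Psi> w)) + un (\<Phi> (\<Psi> w) - \<Phi> (diag_op h (A a x)))"
      by (rule mN(10)[OF w]) (use Phi(2) Psi(2) w Ah in auto)
    also have "un (w - \<Phi> (\<Psi> w)) = 0" using RS[OF w] mN(8)[OF w Phi(2)[OF Psi(2)[OF w]]] by simp
    also have "\<Phi> (\<Psi> w) - \<Phi> (diag_op h (A a x)) = \<Phi> (A a (diag_op h x) - diag_op h (A a x))"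
      unfolding wA by (rule Phil(5)[symmetric]) (use Ah in auto)
    also have "un \<dots> \<le> \<beta> * lpnorm p (A a (diag_op h x) - diag_op h (A a x))" by (intro Phi(3) lpS(5) Ah)
    also have "\<dots> \<le> \<beta> * (e l / lam * lpnorm p x)" by (intro mult_left_mono h x ab)
    also have "\<dots> \<le> \<beta> * (e l / lam * (\<alpha> * un m))"
      using Psi(3)[OF m] e' ab unfolding x_def by (intro mult_left_mono) (auto simp: less_imp_le)
    also have "\<dots> = (\<alpha> * un m * \<beta>) * (e l / lam)" by simp
    also have "\<dots> \<le> (lam * un m) * (e l / lam)" using ablam[of "un m"] mN(2)[OF m] e' by (intro mult_right_mono) (auto simp: less_imp_le)
    also have "\<dots> = e l * un m" using lam by simp
    finally show ?thesis using eq by (simp add: w_def x_def fun_diff_def)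
  qed
  \<comment> \<open>Every \<open>i\<close> lies in finitely many windows, so the sum is finite at
    each coordinate, defined for all coefficients and linear in them without any
    convergence.\<close>
  define sg where "sg c = (\<lambda>i. \<Sum>l | i \<in> I l. c l i)" for c :: "nat \<Rightarrow> nat \<Rightarrow> complex"
  define Sg where "Sg c = \<Phi> (sg c)" for c
  have y_le: "lpnorm p (restr (I l) (c l)) \<le> \<alpha> * un (comb b (I l) (c l))" for l c
    using Psi(3)[OF Phi(2)[OF restr_lp']] SR[OF restr_lp'] by (simp add: comb_Phi)
  have sg_tail: "sg c - (\<Sum>l<L. restr (I l) (c l)) \<in> lp p \<and>
      lpnorm p (sg c - (\<Sum>l<L. restr (I l) (c l))) \<le> 4 * \<alpha> * ((\<Sum>l. un (comb b (I (l + L)) (c (l + L))) powr p) powr (1/p))"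
    if c: "summable (\<lambda>l. un (comb b (I l) (c l)) powr p)" for c L
  proof -
    define B where "B = 4 * \<alpha> * ((\<Sum>l. un (comb b (I (l + L)) (c (l + L))) powr p) powr (1/p))"
    have sL: "summable (\<lambda>l. un (comb b (I (l + L)) (c (l + L))) powr p)" using c by (rule summable_ignore_initial_segment)
    have B0: "0 \<le> B" using ab by (simp add: B_def)
    have Bp: "B powr p = 4 powr p * (\<alpha> powr p * (\<Sum>l. un (comb b (I (l + L)) (c (l + L))) powr p))"
      unfolding B_def using ab suminf_nonneg[OF sL] by (simp add: powr_mult powr_p_root)
    have tau: "(sg c - (\<Sum>l<L. restr (I l) (c l))) i = (\<Sum>l\<in>{l. i \<in> I l \<and> L \<le> l}. c l i)" for i
    proof -
      have "(\<Sum>l<L. restr (I l) (c l) i) = (\<Sum>l\<in>{l. i \<in> I l \<and> l < L}. c l i)"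
      proof -
        have "(\<Sum>l<L. restr (I l) (c l) i) = (\<Sum>l\<in>{..<L}. if i \<in> I l then c l i else 0)" by (simp add: restr_def)
        also have "\<dots> = (\<Sum>l\<in>{l \<in> {..<L}. i \<in> I l}. c l i)" by (rule sum.inter_filter[symmetric]) simp
        also have "{l \<in> {..<L}. i \<in> I l} = {l. i \<in> I l \<and> l < L}" by auto
        finally show ?thesis .
      qed
      moreover have "(\<Sum>l\<in>{l. i \<in> I l}. c l i) = (\<Sum>l\<in>{l. i \<in> I l \<and> L \<le> l}. c l i) + (\<Sum>l\<in>{l. i \<in> I l \<and> l < L}. c l i)"
        by (subst sum.union_disjoint[symmetric]) (auto intro!: sum.cong finite_subset[OF _ finl[of i]])
      ultimately show ?thesis by (simp add: sg_def sum_fun_apply)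
    qed
    \<comment> \<open>At most four summands, each bounded by the p-norm of all of them.\<close>
    have pw: "cmod ((sg c - (\<Sum>l<L. restr (I l) (c l))) i) powr p \<le> 4 powr p * (\<Sum>l\<in>{l. i \<in> I l \<and> L \<le> l}. cmod (c l i) powr p)" for i
    proof -
      define S where "S = {l. i \<in> I l \<and> L \<le> l}"
      have sub: "S \<subseteq> {l. i \<in> I l}" by (auto simp: S_def)
      have S: "finite S" "card S \<le> 4"
        using finite_subset[OF sub finl] card_mono[OF finl sub] cardl[of i] by auto
      have one: "cmod (c l i) \<le> (\<Sum>l\<in>S. cmod (c l i) powr p) powr (1/p)" if "l \<in> S" for l
      proof -
        have "cmod (c l i) powr p \<le> (\<Sum>l\<in>S. cmod (c l i) powr p)" using that S by (intro member_le_sum) auto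
        then have "(cmod (c l i) powr p) powr (1/p) \<le> (\<Sum>l\<in>S. cmod (c l i) powr p) powr (1/p)" using p_gt_1 by (intro powr_mono2) auto
        then show ?thesis by (simp add: powr_p_root)
      qed
      have "cmod (\<Sum>l\<in>S. c l i) \<le> (\<Sum>l\<in>S. (\<Sum>l\<in>S. cmod (c l i) powr p) powr (1/p))" by (rule sum_norm_le) (rule one)
      also have "\<dots> = card S * (\<Sum>l\<in>S. cmod (c l i) powr p) powr (1/p)" by simp
      also have "\<dots> \<le> 4 * (\<Sum>l\<in>S. cmod (c l i) powr p) powr (1/p)" using S by (intro mult_right_mono) auto
      finally have "cmod (\<Sum>l\<in>S. c l i) powr p \<le> (4 * (\<Sum>l\<in>S. cmod (c l i) powr p) powr (1/p)) powr p"
        using p_gt_1 by (intro powr_mono2) auto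
      also have "\<dots> = 4 powr p * (\<Sum>l\<in>S. cmod (c l i) powr p)" by (simp add: powr_mult powr_p_root sum_nonneg)
      finally show ?thesis unfolding tau S_def .
    qed
    have "(\<Sum>i<n. cmod ((sg c - (\<Sum>l<L. restr (I l) (c l))) i) powr p) \<le> B powr p" for n
    proof -
      define J where "J = (\<Union>i<n. {l. i \<in> I l \<and> L \<le> l})"
      have finJ: "finite J" unfolding J_def using finl by (auto intro!: finite_UN_I intro: finite_subset[OF _ finl])
      have JL: "L \<le> l" if "l \<in> J" for l using that by (auto simp: J_def)
      have "(\<Sum>i<n. cmod ((sg c - (\<Sum>l<L. restr (I l) (c l))) i) powr p) \<le> (\<Sum>i<n. 4 powr p * (\<Sum>l\<in>J. cmod (restr (I l) (c l) i) powr p))"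
      proof (rule sum_mono)
        fix i assume i: "i \<in> {..<n}"
        have "(\<Sum>l\<in>{l. i \<in> I l \<and> L \<le> l}. cmod (c l i) powr p) = (\<Sum>l\<in>{l. i \<in> I l \<and> L \<le> l}. cmod (restr (I l) (c l) i) powr p)"
          by (intro sum.cong) (auto simp: restr_def)
        also have "\<dots> \<le> (\<Sum>l\<in>J. cmod (restr (I l) (c l) i) powr p)"
          using i finJ by (intro sum_mono2) (auto simp: J_def)
        finally show "cmod ((sg c - (\<Sum>l<L. restr (I l) (c l))) i) powr p \<le> 4 powr p * (\<Sum>l\<in>J. cmod (restr (I l) (c l) i) powr p)"
          using pw[of i] by (smt (verit) mult_left_mono powr_ge_zero)
      qed
      also have "\<dots> = 4 powr p * (\<Sum>l\<in>J. \<Sum>i<n. cmod (restr (I l) (c l) i) powr p)"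
        by (simp add: sum_distrib_left[symmetric] sum.swap[of _ J])
      also have "\<dots> \<le> 4 powr p * (\<Sum>l\<in>J. \<alpha> powr p * un (comb b (I l) (c l)) powr p)"
      proof (intro mult_left_mono sum_mono)
        fix l
        have cM: "comb b (I l) (c l) \<in> M" by (rule comb_mem[OF M(2) bM])
        have "(\<Sum>i<n. cmod (restr (I l) (c l) i) powr p) \<le> lpnorm p (restr (I l) (c l)) powr p"
          by (rule sum_powr_le_lpnorm[OF restr_lp']) simp
        also have "\<dots> \<le> (\<alpha> * un (comb b (I l) (c l))) powr p" using y_le p_gt_1 by (intro powr_mono2) auto
        finally show "(\<Sum>i<n. cmod (restr (I l) (c l) i) powr p) \<le> \<alpha> powr p * un (comb b (I l) (c l)) powr p"
          using ab mN(2)[OF cM] by (simp add: powr_mult)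
      qed simp
      also have "(\<Sum>l\<in>J. \<alpha> powr p * un (comb b (I l) (c l)) powr p) = \<alpha> powr p * (\<Sum>l\<in>(\<lambda>l. l - L) ` J. un (comb b (I (l + L)) (c (l + L))) powr p)"
      proof -
        have "inj_on (\<lambda>l. l - L) J" using JL by (intro inj_onI) (metis le_add_diff_inverse2)
        then have "(\<Sum>l\<in>(\<lambda>l. l - L) ` J. un (comb b (I (l + L)) (c (l + L))) powr p) = (\<Sum>l\<in>J. un (comb b (I l) (c l)) powr p)"
          using JL by (simp add: sum.reindex)
        then show ?thesis by (simp add: sum_distrib_left)
      qed
      also have "4 powr p * (\<alpha> powr p * (\<Sum>l\<in>(\<lambda>l. l - L) ` J. un (comb b (I (l + L)) (c (l + L))) powr p)) \<le> B powr p"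
        unfolding Bp by (intro mult_left_mono sum_le_suminf[OF sL]) (use finJ in auto)
      finally show ?thesis .
    qed
    then show ?thesis using lp_criterion[OF B0] unfolding B_def by blast
  qed
  have sgl: "sg c \<in> lp p" if "summable (\<lambda>l. un (comb b (I l) (c l)) powr p)" for c
    using sg_tail[OF that, of 0] by simp
  have D2: "Sg c \<in> M \<and> (\<lambda>L. un (Sg c - (\<Sum>l<L. comb b (I l) (c l)))) \<longlonglongrightarrow> 0 \<and>
       un (Sg c) powr p \<le> (4 * lam) powr p * (\<Sum>l. un (comb b (I l) (c l)) powr p)"
    if c: "summable (\<lambda>l. un (comb b (I l) (c l)) powr p)" for c
  proof (intro conjI)
    show "Sg c \<in> M" unfolding Sg_def by (rule Phi(2)[OF sgl[OF c]])
    define S where "S L = (\<Sum>l. un (comb b (I (l + L)) (c (l + L))) powr p) powr (1/p)" for L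
    have bnd: "un (Sg c - (\<Sum>l<L. comb b (I l) (c l))) \<le> \<beta> * (4 * \<alpha> * S L)" for L
    proof -
      have "(\<Sum>l<L. comb b (I l) (c l)) = \<Phi> (\<Sum>l<L. restr (I l) (c l))"
        by (subst Phil(6)) (auto simp: comb_Phi restr_lp')
      then have "Sg c - (\<Sum>l<L. comb b (I l) (c l)) = \<Phi> (sg c - (\<Sum>l<L. restr (I l) (c l)))"
      proof -
        have "(\<Sum>l<L. restr (I l) (c l)) \<in> lp p" by (intro csubspace_sum[OF lpD(1)] restr_lp')
        from Phil(5)[OF sgl[OF c] this] show ?thesis
          using \<open>(\<Sum>l<L. comb b (I l) (c l)) = \<Phi> (\<Sum>l<L. restr (I l) (c l))\<close> unfolding Sg_def by simp
      qed
      then have "un (Sg c - (\<Sum>l<L. comb b (I l) (c l))) \<le> \<beta> * lpnorm p (sg c - (\<Sum>l<L. restr (I l) (c l)))"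
        using Phi(3) sg_tail[OF c, of L] by simp
      also have "\<dots> \<le> \<beta> * (4 * \<alpha> * S L)" using sg_tail[OF c, of L] ab unfolding S_def by (intro mult_left_mono) auto
      finally show ?thesis .
    qed
    have "(\<lambda>L. \<Sum>l. un (comb b (I (l + L)) (c (l + L))) powr p) \<longlonglongrightarrow> 0"
      using suminf_exist_split2[OF c] by simp
    then have "S \<longlonglongrightarrow> 0 powr (1/p)" unfolding S_def using p_gt_1
      by (intro tendsto_powr2) (auto intro!: always_eventually suminf_nonneg summable_ignore_initial_segment[OF c])
    then have "(\<lambda>L. \<beta> * (4 * \<alpha> * S L)) \<longlonglongrightarrow> \<beta> * (4 * \<alpha> * 0)" by (intro tendsto_intros) simp
    then have 0: "(\<lambda>L. \<beta> * (4 * \<alpha> * S L)) \<longlonglongrightarrow> 0" by simp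
    have mem: "Sg c - (\<Sum>l<L. comb b (I l) (c l)) \<in> M" for L
      using \<open>Sg c \<in> M\<close> by (intro mS(5) csubspace_sum[OF M(2)] comb_mem[OF M(2)] bM)
    show "(\<lambda>L. un (Sg c - (\<Sum>l<L. comb b (I l) (c l)))) \<longlonglongrightarrow> 0"
      by (rule tendsto_sandwich[OF _ _ tendsto_const 0]) (use mN(2)[OF mem] bnd in auto)
    have "un (Sg c) \<le> 4 * (\<alpha> * S 0 * \<beta>)" using bnd[of 0] by (simp add: mult_ac)
    also have "\<dots> \<le> 4 * (lam * S 0)" using ablam[of "S 0"] by (simp add: S_def)
    finally have "un (Sg c) powr p \<le> (4 * lam * S 0) powr p"
      using mN(2)[OF \<open>Sg c \<in> M\<close>] p_gt_1 by (intro powr_mono2) auto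
    also have "\<dots> = (4 * lam) powr p * (\<Sum>l. un (comb b (I l) (c l)) powr p)"
      using lam suminf_nonneg[OF c] by (simp add: S_def powr_mult powr_p_root)
    finally show "un (Sg c) powr p \<le> (4 * lam) powr p * (\<Sum>l. un (comb b (I l) (c l)) powr p)" .
  qed
  have D3: "(\<lambda>L. un (m - (\<Sum>l<L. comb b (I l) (\<lambda>i. \<psi> l i (comb b (I l) (\<lambda>i. \<phi> l i m)))))) \<longlonglongrightarrow> 0" if m: "m \<in> M" for m
  proof -
    define x where "x = \<Psi> m"
    have x: "x \<in> lp p" using m Psi(2) by (simp add: x_def)
    \<comment> \<open>Here \<open>g l = 1\<close> on the support of \<open>f l\<close> is used,
      together with the exactness of \<Psi> after \<Phi>.\<close>
    have gf: "comb b (I l) (\<lambda>i. \<psi> l i (comb b (I l) (\<lambda>i. \<phi> l i m))) = \<Phi> (diag_op (f l) x)" for l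
    proof -
      have "diag_op (g l) (diag_op (f l) x) = diag_op (f l) x"
        using fg[of l] by (auto simp: fun_eq_iff diag_op_def)
      then show ?thesis by (simp add: fc gc SR dl x x_def[symmetric])
    qed
    have mem: "m - (\<Sum>l<L. \<Phi> (diag_op (f l) x)) \<in> M" for L
      using m by (intro mS(5) csubspace_sum[OF M(2)] Phi(2) dl x)
    have bnd: "un (m - (\<Sum>l<Suc L. \<Phi> (diag_op (f l) x))) \<le> \<beta> * lpnorm p (restr {L..} x)" for L
    proof -
      define y where "y = (\<Sum>l<Suc L. diag_op (f l) x)"
      have yl: "y \<in> lp p" unfolding y_def by (intro csubspace_sum[OF lpD(1)] dl x)
      have Py: "(\<Sum>l<Suc L. \<Phi> (diag_op (f l) x)) = \<Phi> y" unfolding y_def by (subst Phil(6)) (auto simp: dl x)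
      have yi: "y i = of_real (\<Sum>l<Suc L. f l i) * x i" for i
        by (simp add: y_def sum_fun_apply diag_op_def sum_distrib_right del: sum.lessThan_Suc)
      have "un (m - \<Phi> y) \<le> un (m - \<Phi> x) + un (\<Phi> x - \<Phi> y)" by (rule mN(10)[OF m Phi(2)[OF x] Phi(2)[OF yl]])
      also have "un (m - \<Phi> x) = 0" using RS[OF m] mN(8)[OF m Phi(2)[OF x]] by (simp add: x_def)
      also have "\<Phi> x - \<Phi> y = \<Phi> (x - y)" using Phil(5)[OF x yl] by simp
      also have "un (\<Phi> (x - y)) \<le> \<beta> * lpnorm p (x - y)" by (intro Phi(3) lpS(5) x yl)
      also have "lpnorm p (x - y) \<le> lpnorm p (restr {L..} x)"
      proof (rule lp_mono(2)[OF restr_lp[OF x]])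
        fix i
        show "cmod ((x - y) i) \<le> cmod (restr {L..} x i)"
        proof (cases "i < L")
          case True
          then show ?thesis using fsum1[OF True] by (simp add: yi restr_def del: sum.lessThan_Suc)
        next
          case False
          have "(x - y) i = of_real (1 - (\<Sum>l<Suc L. f l i)) * x i" by (simp add: yi algebra_simps del: sum.lessThan_Suc)
          moreover have "\<bar>1 - (\<Sum>l<Suc L. f l i)\<bar> \<le> 1" using fsum[where L="Suc L" and i=i] f0 by (simp add: sum_nonneg abs_le_iff del: sum.lessThan_Suc)
          ultimately have "cmod ((x - y) i) \<le> cmod (x i)" by (simp only: norm_mult norm_of_real) (simp add: mult_left_le_one_le)
          then show ?thesis using False by (simp add: restr_def)
        qed
      qed
      finally show ?thesis using ab by (simp add: Py mult_left_mono fun_diff_def del: sum.lessThan_Suc)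
    qed
    have "(\<lambda>L. \<beta> * lpnorm p (restr {L..} x)) \<longlonglongrightarrow> \<beta> * 0" by (intro tendsto_intros tail_tendsto x)
    then have 0: "(\<lambda>L. \<beta> * lpnorm p (restr {L..} x)) \<longlonglongrightarrow> 0" by simp
    have "(\<lambda>L. un (m - (\<Sum>l<Suc L. \<Phi> (diag_op (f l) x)))) \<longlonglongrightarrow> 0"
      by (rule tendsto_sandwich[OF _ _ tendsto_const 0]) (use mN(2)[OF mem] bnd in \<open>auto simp del: sum.lessThan_Suc\<close>)
    then show ?thesis unfolding gf by (rule LIMSEQ_imp_Suc)
  qed
  have D1: "(\<Sum>l<L. un (comb b (I l) (\<lambda>i. \<phi> l i m)) powr p) \<le> (4 * lam * un m) powr p" if m: "m \<in> M" for m L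
  proof -
    define x where "x = \<Psi> m"
    have x: "x \<in> lp p" using m Psi(2) by (simp add: x_def)
    have "(\<Sum>l<L. un (comb b (I l) (\<lambda>i. \<phi> l i m)) powr p) \<le> (\<Sum>l<L. \<beta> powr p * lpnorm p (diag_op (f l) x) powr p)"
    proof (rule sum_mono)
      fix l
      have "un (\<Phi> (diag_op (f l) x)) powr p \<le> (\<beta> * lpnorm p (diag_op (f l) x)) powr p"
        using p_gt_1 mN(2)[OF Phi(2)] dl x by (intro powr_mono2 Phi(3)) auto
      then show "un (comb b (I l) (\<lambda>i. \<phi> l i m)) powr p \<le> \<beta> powr p * lpnorm p (diag_op (f l) x) powr p"
        using ab by (simp add: fc x_def powr_mult)
    qed
    also have "\<dots> = \<beta> powr p * (\<Sum>l<L. lpnorm p (diag_op (f l) x) powr p)" by (simp add: sum_distrib_left)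
    also have "(\<Sum>l<L. lpnorm p (diag_op (f l) x) powr p) \<le> lpnorm p x powr p"
    proof (rule sum_le_lpnorm_powr[OF x])
      fix i
      have "(\<Sum>l<L. cmod (diag_op (f l) x i) powr p) = (\<Sum>l<L. f l i powr p) * cmod (x i) powr p"
        using f0 by (simp add: diag_op_def norm_mult powr_mult sum_distrib_right)
      \<comment> \<open>Values in the unit interval only decrease when raised to a power p > 1, so a
        partition of unity is also bounded in the sense of p-th powers.\<close>
      also have "(\<Sum>l<L. f l i powr p) \<le> (\<Sum>l<L. f l i)"
      proof (rule sum_mono)
        fix l
        have "f l i powr p \<le> f l i powr 1" if "f l i \<noteq> 0" using p_gt_1 f0[of l i] f1[of l i] that by (intro powr_mono') auto
        then show "f l i powr p \<le> f l i" using f0[of l i] by (cases "f l i = 0") auto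
      qed
      also have "(\<Sum>l<L. f l i) \<le> 1" by (rule fsum)
      finally show "(\<Sum>l<L. cmod (diag_op (f l) x i) powr p) \<le> cmod (x i) powr p"
        by (simp add: mult_right_mono mult_left_le_one_le)
    qed (use dl x in auto)
    finally have "(\<Sum>l<L. un (comb b (I l) (\<lambda>i. \<phi> l i m)) powr p) \<le> (\<beta> * lpnorm p x) powr p"
      using ab by (simp add: powr_mult mult_left_mono)
    also have "\<dots> \<le> (4 * lam * un m) powr p"
    proof (intro powr_mono2)
      have "\<beta> * lpnorm p x \<le> \<beta> * (\<alpha> * un m)" unfolding x_def by (intro mult_left_mono Psi(3) m ab)
      also have "\<dots> \<le> lam * un m" using ablam[OF mN(2)[OF m]] by (simp add: mult_ac)
      also have "\<dots> \<le> 4 * lam * un m" using lam mN(2)[OF m] by simp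
      finally show "\<beta> * lpnorm p x \<le> 4 * lam * un m" .
    qed (use p_gt_1 ab in auto)
    finally show ?thesis .
  qed
  have D1': "un (comb b (I l) (\<lambda>i. \<psi> l i m)) \<le> 4 * lam * un m" if m: "m \<in> M" for m l
  proof -
    have "un (comb b (I l) (\<lambda>i. \<psi> l i m)) \<le> \<beta> * lpnorm p (diag_op (g l) (\<Psi> m))" unfolding gc by (intro Phi(3) dl Psi(2) m)
    also have "\<dots> \<le> \<beta> * lpnorm p (\<Psi> m)" by (intro mult_left_mono dl Psi(2) m ab)
    also have "\<dots> \<le> \<beta> * (\<alpha> * un m)" by (intro mult_left_mono Psi(3) m ab)
    also have "\<dots> \<le> lam * un m" using ablam[OF mN(2)[OF m]] by (simp add: mult_ac)
    also have "\<dots> \<le> 4 * lam * un m" using lam mN(2)[OF m] by simp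
    finally show ?thesis .
  qed
  have fun_bd: "bdd_op M un UNIV cmod (\<lambda>m. of_real h * \<Psi> m i)" if "\<bar>h\<bar> \<le> 1" for h i
  proof (rule bdd_opI[where C=\<alpha>])
    show "clinear_on M (\<lambda>m. of_real h * \<Psi> m i)" using Psil(1,2) by (simp add: clinear_on_def algebra_simps)
    fix m assume m: "m \<in> M"
    have "cmod (of_real h * \<Psi> m i) \<le> 1 * lpnorm p (\<Psi> m)"
      unfolding norm_mult norm_of_real by (intro mult_mono coord_le_lpnorm Psi(2) m that) auto
    then show "cmod (of_real h * \<Psi> m i) \<le> \<alpha> * un m" using Psi(3)[OF m] by simp
  qed simp
  have "decomposition T M (4 * lam) K e I b \<phi> \<psi> Sg"
    unfolding decomposition_def
  proof (intro conjI allI ballI impI)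
    show "bdd_op M un UNIV cmod (\<phi> l i)" "bdd_op M un UNIV cmod (\<psi> l i)" for l i
      using fun_bd[of "f l i" i] fun_bd[of "g l i" i] f0[of l i] f1[of l i] g01[of l i]
      unfolding \<phi>_def[abs_def] \<psi>_def[abs_def] by (simp_all add: abs_le_iff)
    show "un (hatop (T a) (comb b (I l) (\<lambda>i. \<phi> l i m)) - comb b (I l) (\<lambda>i. \<phi> l i (hatop (T a) m))) \<le> e l * un m" if "a < K l" "m \<in> M" for l a m
      unfolding fc by (rule commute[OF that(2) dl(1) fcomm[OF that(1)]])
    show "un (hatop (T a) (comb b (I l) (\<lambda>i. \<psi> l i m)) - comb b (I l) (\<lambda>i. \<psi> l i (hatop (T a) m))) \<le> e l * un m" if "a < K l" "m \<in> M" for l a m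
      unfolding gc by (rule commute[OF that(2) dl(3) gcomm[OF that(1)]])
    show "Sg (c + d) = Sg c + Sg d" if "summable (\<lambda>l. un (comb b (I l) (c l)) powr p)" "summable (\<lambda>l. un (comb b (I l) (d l)) powr p)" for c d
    proof -
      have "sg (c + d) = sg c + sg d" by (simp add: sg_def fun_eq_iff sum.distrib)
      then show ?thesis using Phil(1) sgl that by (simp add: Sg_def)
    qed
    show "Sg (k *\<^sub>C c) = k *\<^sub>C Sg c" if "summable (\<lambda>l. un (comb b (I l) (c l)) powr p)" for c k
    proof -
      have "sg (k *\<^sub>C c) = k *\<^sub>C sg c" by (simp add: sg_def fun_eq_iff sum_distrib_left)
      then show ?thesis using Phil(2) sgl that by (simp add: Sg_def)
    qed
  qed (use finI bM D1 D1' D2 D3 in auto)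
  then show ?thesis using that by blast
qed

end

section \<open>Finite-dimensional ranges\<close>

context ultra
begin

text \<open>A basis with bounded coordinate functionals, everything modulo null vectors. Vectors and
  functionals are indexed by all naturals to fit the format of \<open>decomposition\<close>.\<close>

lemma fin_dim_mod_basis:
  assumes M: "M \<subseteq> hat" "csubspace M" and fd: "fin_dim_mod M un"
  obtains n :: nat and b and \<phi> and K where "\<And>i. b i \<in> M" "\<And>i. clinear_on M (\<phi> i)" "\<And>i m. m \<in> M \<Longrightarrow> cmod (\<phi> i m) \<le> K * un m"
    "\<And>m. m \<in> M \<Longrightarrow> un (m - comb b {..<n} (\<lambda>i. \<phi> i m)) = 0"
proof -
  have sM: "seminormed M un" by (rule seminormed_subset[OF seminormed_hat M(2,1)])
  note mN = seminormedD[OF sM] note mS = csubspaceD[OF M(2)]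
  define span where "span B \<longleftrightarrow> finite B \<and> B \<subseteq> M \<and> (\<forall>y\<in>M. \<exists>c. un (y - comb (\<lambda>b. b) B c) = 0)" for B
  obtain B0 where "span B0" using fd by (auto simp: fin_dim_mod_def span_def comb_def)
  then have ex: "\<exists>k. \<exists>B. span B \<and> card B = k" by blast
  \<comment> \<open>A spanning set of minimal cardinality is independent modulo null
    vectors.\<close>
  define k where "k = (LEAST k. \<exists>B. span B \<and> card B = k)"
  obtain B where B: "span B" "card B = k" using LeastI_ex[OF ex] unfolding k_def by blast
  have min: "k \<le> card B'" if "span B'" for B' unfolding k_def using that by (intro Least_le) blast
  have finB: "finite B" and BM: "B \<subseteq> M" and sp: "\<And>y. y \<in> M \<Longrightarrow> \<exists>c. un (y - comb (\<lambda>b. b) B c) = 0" using B(1) by (auto simp: span_def)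
  have cM: "comb (\<lambda>b. b) B' c \<in> M" if "B' \<subseteq> B" for B' c using that BM by (intro comb_mem[OF M(2)]) auto
  have indep: "c x = 0" if c: "un (comb (\<lambda>b. b) B c) = 0" and x: "x \<in> B" for c x
  proof (rule ccontr)
    assume cx: "c x \<noteq> 0"
    have "span (B - {x})" unfolding span_def
    proof (intro conjI ballI)
      fix y assume y: "y \<in> M"
      obtain d where d: "un (y - comb (\<lambda>b. b) B d) = 0" using sp[OF y] by blast
      define d' where "d' = (\<lambda>b. d b - d x / c x * c b)"
      have eq: "comb (\<lambda>b. b) (B - {x}) d' = comb (\<lambda>b. b) B d - (d x / c x) *\<^sub>C comb (\<lambda>b. b) B c"
      proof -
        have 1: "comb (\<lambda>b. b) B d - (d x / c x) *\<^sub>C comb (\<lambda>b. b) B c = comb (\<lambda>b. b) B d'"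
          unfolding d'_def comb_diff comb_cscale ..
        have 2: "comb (\<lambda>b. b) B d' = d' x *\<^sub>C x + comb (\<lambda>b. b) (B - {x}) d'" unfolding comb_def by (rule sum.remove[OF finB x])
        have "d' x = 0" using cx by (simp add: d'_def)
        then show ?thesis unfolding 1 2 by simp
      qed
      have 1: "un (y - comb (\<lambda>b. b) (B - {x}) d') \<le> un (y - comb (\<lambda>b. b) B d) + un (comb (\<lambda>b. b) B d - comb (\<lambda>b. b) (B - {x}) d')"
        by (rule mN(10)[OF y]) (auto intro: cM)
      have 2: "comb (\<lambda>b. b) B d - comb (\<lambda>b. b) (B - {x}) d' = (d x / c x) *\<^sub>C comb (\<lambda>b. b) B c" unfolding eq by simp
      have "un ((d x / c x) *\<^sub>C comb (\<lambda>b. b) B c) = 0" using mN(4)[OF cM[OF order_refl], of "d x / c x" c] c by simp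
      then have "un (y - comb (\<lambda>b. b) (B - {x}) d') \<le> 0" using 1 d unfolding 2 by linarith
      then show "\<exists>c. un (y - comb (\<lambda>b. b) (B - {x}) c) = 0"
        using mN(2)[OF mS(5)[OF y cM[of "B - {x}"]]] by (metis Diff_subset order_antisym)
    qed (use finB BM in auto)
    then show False using min[of "B - {x}"] B(2) card_Diff1_less[OF finB x] by simp
  qed
  \<comment> \<open>Equivalence of norms in finite dimension: otherwise normalised coefficient
    vectors with norms tending to 0 have a limit along \<open>U\<close>, a nonzero coefficient
    vector whose combination is null, against independence.\<close>
  have bound: "\<exists>K. \<forall>c. \<forall>x\<in>B. cmod (c x) \<le> K * un (comb (\<lambda>b. b) B c)"
  proof (rule ccontr)
    assume "\<not> ?thesis"
    then have "\<forall>k::nat. \<exists>c x. x \<in> B \<and> real k * un (comb (\<lambda>b. b) B c) < cmod (c x)" by (meson not_le)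
    then obtain c x where cx: "\<And>k. x k \<in> B" "\<And>k. real k * un (comb (\<lambda>b. b) B (c k)) < cmod (c k (x k))" by metis
    define s where "s k = (\<Sum>b\<in>B. cmod (c k b))" for k
    have le_s: "cmod (c k y) \<le> s k" if "y \<in> B" for k y unfolding s_def using that finB by (intro member_le_sum) auto
    have spos: "s k > 0" for k
    proof -
      have "0 \<le> real k * un (comb (\<lambda>b. b) B (c k))" using mN(2)[OF cM[OF order_refl]] by simp
      then show ?thesis using cx(2)[of k] le_s[OF cx(1)[of k], of k] by linarith
    qed
    define d where "d k b = c k b / of_real (s k)" for k b
    have dn: "(\<Sum>b\<in>B. cmod (d k b)) = 1" for k
      using spos[of k] by (simp add: d_def norm_divide sum_divide_distrib[symmetric] s_def[symmetric])
    have d1: "cmod (d k b) \<le> 1" if "b \<in> B" for k b using le_s[OF that, of k] spos[of k] by (simp add: d_def norm_divide)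
    have du: "real k * un (comb (\<lambda>b. b) B (d k)) \<le> 1" for k
    proof -
      have "comb (\<lambda>b. b) B (d k) = (1 / of_real (s k)) *\<^sub>C comb (\<lambda>b. b) B (c k)"
        unfolding comb_cscale[symmetric] by (simp add: d_def comb_def)
      then have "un (comb (\<lambda>b. b) B (d k)) = un (comb (\<lambda>b. b) B (c k)) / s k"
        using mN(4)[OF cM[OF order_refl], of "1 / of_real (s k)" "c k"] spos[of k] by (simp add: norm_divide)
      moreover have "real k * un (comb (\<lambda>b. b) B (c k)) \<le> s k" using cx(2)[of k] le_s[OF cx(1)[of k], of k] by linarith
      ultimately show ?thesis using spos[of k] by simp
    qed
    have "\<exists>l. ((\<lambda>k. d k b) \<longlongrightarrow> l) U" if "b \<in> B" for b
      by (rule U_convergent[of "\<lambda>k. d k b" 1]) (use d1[OF that] in auto)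
    then obtain l where l: "\<And>b. b \<in> B \<Longrightarrow> ((\<lambda>k. d k b) \<longlongrightarrow> l b) U" by metis
    have "((\<lambda>k. \<Sum>b\<in>B. cmod (d k b)) \<longlongrightarrow> (\<Sum>b\<in>B. cmod (l b))) U" by (intro tendsto_sum tendsto_norm l)
    then have l1: "(\<Sum>b\<in>B. cmod (l b)) = 1" using dn tendsto_unique[OF U_ne_bot _ tendsto_const] by simp
    have "un (comb (\<lambda>b. b) B l) = 0"
    proof (rule ccontr)
      assume "un (comb (\<lambda>b. b) B l) \<noteq> 0"
      then have pos: "un (comb (\<lambda>b. b) B l) > 0" using mN(2)[OF cM[OF order_refl], of l] by linarith
      have b1: "un (comb (\<lambda>b. b) B l) \<le> 1 / real k + (\<Sum>b\<in>B. cmod (l b - d k b) * un b)" if "k > 0" for k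
      proof -
        have "un (comb (\<lambda>b. b) B l) \<le> un (comb (\<lambda>b. b) B (d k)) + un (comb (\<lambda>b. b) B l - comb (\<lambda>b. b) B (d k))"
          by (rule mN(9)) (auto intro: cM)
        moreover have "un (comb (\<lambda>b. b) B l - comb (\<lambda>b. b) B (d k)) \<le> (\<Sum>b\<in>B. cmod (l b - d k b) * un b)"
          using seminormed_sum_cscale[OF sM, of B "\<lambda>b. b" "\<lambda>b. l b - d k b"] BM comb_diff[of "\<lambda>b. b" B l "d k"]
          unfolding comb_def by (metis subsetD)
        moreover have "un (comb (\<lambda>b. b) B (d k)) \<le> 1 / real k" using du[of k] that by (simp add: field_simps)
        ultimately show ?thesis by linarith
      qed
      have "((\<lambda>k. 1 / real k + (\<Sum>b\<in>B. cmod (l b - d k b) * un b)) \<longlongrightarrow> 0 + (\<Sum>b\<in>B. cmod (l b - l b) * un b)) U"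
        by (intro tendsto_intros l tendsto_U[OF lim_1_over_n])
      then have "eventually (\<lambda>k. 1 / real k + (\<Sum>b\<in>B. cmod (l b - d k b) * un b) < un (comb (\<lambda>b. b) B l)) U"
        by (rule order_tendstoD) (use pos in simp)
      moreover have "eventually (\<lambda>k. k > 0) U" using U_le_sequentially eventually_gt_at_top[of 0] by (auto simp: le_filter_def)
      ultimately have "eventually (\<lambda>k. False) U"
      proof eventually_elim
        case (elim k)
        then show ?case using b1[of k] by linarith
      qed
      then show False by simp
    qed
    from indep[OF this] have "(\<Sum>b\<in>B. cmod (l b)) = 0" by simp
    then show False using l1 by simp
  qed
  then obtain K where K: "\<And>c x. x \<in> B \<Longrightarrow> cmod (c x) \<le> K * un (comb (\<lambda>b. b) B c)" by blast
  \<comment> \<open>The coordinates are chosen arbitrarily; linearity follows from their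
    uniqueness.\<close>
  obtain co where co: "\<And>y. y \<in> M \<Longrightarrow> un (y - comb (\<lambda>b. b) B (co y)) = 0" using sp by metis
  have uniq: "c x = co y x" if y: "y \<in> M" "un (y - comb (\<lambda>b. b) B c) = 0" "x \<in> B" for y c x
  proof -
    have "un (comb (\<lambda>b. b) B c - comb (\<lambda>b. b) B (co y)) \<le> un (comb (\<lambda>b. b) B c - y) + un (y - comb (\<lambda>b. b) B (co y))"
      by (rule mN(10)) (auto intro: cM y)
    also have "\<dots> = 0" using co[OF y(1)] y(2) mN(8)[OF y(1) cM[OF order_refl], of c] by simp
    finally have "un (comb (\<lambda>b. b) B (\<lambda>b. c b - co y b)) = 0"
      using mN(2)[OF cM[OF order_refl], of "\<lambda>b. c b - co y b"] by (simp add: comb_diff)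
    from indep[OF this y(3)] show ?thesis by simp
  qed
  have co_add: "co (x + y) b = co x b + co y b" if "x \<in> M" "y \<in> M" "b \<in> B" for x y b
  proof (rule uniq[where y="x + y" and c="\<lambda>b. co x b + co y b" and x=b, symmetric])
    have eq: "(x + y) - comb (\<lambda>b. b) B (\<lambda>b. co x b + co y b) = (x - comb (\<lambda>b. b) B (co x)) + (y - comb (\<lambda>b. b) B (co y))"
      by (simp add: comb_add)
    have "un ((x + y) - comb (\<lambda>b. b) B (\<lambda>b. co x b + co y b)) \<le> 0"
      using mN(3)[OF mS(5)[OF that(1) cM[OF order_refl], of "co x"] mS(5)[OF that(2) cM[OF order_refl], of "co y"]]
        co[OF that(1)] co[OF that(2)] unfolding eq by linarith
    moreover have "0 \<le> un ((x + y) - comb (\<lambda>b. b) B (\<lambda>b. co x b + co y b))"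
      by (intro mN(2) mS(5) mS(2) that cM order_refl)
    ultimately show "un ((x + y) - comb (\<lambda>b. b) B (\<lambda>b. co x b + co y b)) = 0" by (rule order_antisym)
  qed (use that mS(2) in blast)+
  have co_sc: "co (k *\<^sub>C x) b = k * co x b" if "x \<in> M" "b \<in> B" for x k b
  proof (rule uniq[where y="k *\<^sub>C x" and c="\<lambda>b. k * co x b" and x=b, symmetric])
    have eq: "k *\<^sub>C x - comb (\<lambda>b. b) B (\<lambda>b. k * co x b) = k *\<^sub>C (x - comb (\<lambda>b. b) B (co x))"
      by (simp add: comb_cscale cscale_right_diff_distrib)
    show "un (k *\<^sub>C x - comb (\<lambda>b. b) B (\<lambda>b. k * co x b)) = 0"
      unfolding eq using mN(4)[OF mS(5)[OF that(1) cM[OF order_refl], of "co x"], of k] co that by simp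
  qed (use that mS(3) in blast)+
  have co_bd: "cmod (co y x) \<le> K * un y" if y: "y \<in> M" "x \<in> B" for y x
  proof -
    have "y \<in> upw p" "comb (\<lambda>b. b) B (co y) \<in> upw p" using y(1) cM[OF order_refl, of "co y"] M(1) hat_upw by blast+
    then have "un (comb (\<lambda>b. b) B (co y)) = un y"
      using unorm_eq_of_null[of y "comb (\<lambda>b. b) B (co y)"] co[OF y(1)] by simp
    then show ?thesis using K[OF y(2), of "co y"] by simp
  qed
  obtain h where h: "bij_betw h {0..<card B} B" using ex_bij_betw_nat_finite[OF finB] by blast
  define n where "n = card B"
  have hB: "h i \<in> B" if "i < n" for i using h that by (auto simp: bij_betw_def n_def)
  \<comment> \<open>Indices beyond the dimension are padded with zero vectors and zero
    functionals.\<close>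
  show ?thesis
  proof (rule that[of "\<lambda>i. if i < n then h i else 0" "\<lambda>i m. if i < n then co m (h i) else 0" "\<bar>K\<bar>" n])
    show "(if i < n then h i else 0) \<in> M" for i using hB BM mS(1) by auto
    show "clinear_on M (\<lambda>m. if i < n then co m (h i) else 0)" for i
      using co_add co_sc hB by (auto simp: clinear_on_def)
    fix m assume m: "m \<in> M"
    show "cmod (if i < n then co m (h i) else 0) \<le> \<bar>K\<bar> * un m" for i
    proof (cases "i < n")
      case True
      have "K * un m \<le> \<bar>K\<bar> * un m" using mN(2)[OF m] by (intro mult_right_mono) auto
      then show ?thesis using co_bd[OF m hB[OF True]] True by simp
    qed (use mN(2)[OF m] in simp)
    have "comb (\<lambda>i. if i < n then h i else 0) {..<n} (\<lambda>i. if i < n then co m (h i) else 0) = (\<Sum>i\<in>{0..<n}. co m (h i) *\<^sub>C h i)"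
      unfolding comb_def by (intro sum.cong) auto
    also have "\<dots> = comb (\<lambda>b. b) B (co m)"
      unfolding comb_def n_def by (rule sum.reindex_bij_betw[OF h, of "\<lambda>b. co m b *\<^sub>C b"])
    finally show "un (m - comb (\<lambda>i. if i < n then h i else 0) {..<n} (\<lambda>i. if i < n then co m (h i) else 0)) = 0"
      using co[OF m] by (simp only:)
  qed
qed

text \<open>A single piece suffices: f = g is the expansion in a basis, hence the identity up to
  null vectors, and it commutes with every operator up to null vectors.\<close>

lemma decomposition_of_fin_dim:
  assumes T: "\<And>a. bop (T a)" and M: "M \<subseteq> hat" "csubspace M" "\<And>a m. m \<in> M \<Longrightarrow> hatop (T a) m \<in> M"
    and fd: "fin_dim_mod M un" and C: "1 \<le> C" and e: "\<And>l. e l > 0"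
  obtains I b \<phi> \<psi> Sg where "decomposition T M C K e I b \<phi> \<psi> Sg"
proof -
  have sM: "seminormed M un" by (rule seminormed_subset[OF seminormed_hat M(2,1)])
  note mN = seminormedD[OF sM] note mS = csubspaceD[OF M(2)]
  have up: "m \<in> upw p" if "m \<in> M" for m using that M(1) hat_upw by blast
  obtain n :: nat and b ph Kb where b: "\<And>i. b i \<in> M" and ph: "\<And>i. clinear_on M (ph i)" "\<And>i m. m \<in> M \<Longrightarrow> cmod (ph i m) \<le> Kb * un m"
    and null: "\<And>m. m \<in> M \<Longrightarrow> un (m - comb b {..<n} (\<lambda>i. ph i m)) = 0"
    by (rule fin_dim_mod_basis[OF M(1,2) fd]) (rule that; assumption)
  \<comment> \<open>Pieces with \<open>l > 0\<close> have an empty index set and are zero.\<close>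
  define I where "I l = (if l = 0 then {..<n} else {})" for l :: nat
  define F where "F m = comb b {..<n} (\<lambda>i. ph i m)" for m
  have F: "F m \<in> M" "un (m - F m) = 0" "un (F m) = un m" if "m \<in> M" for m
  proof -
    show FM: "F m \<in> M" unfolding F_def by (rule comb_mem[OF M(2) b])
    show n0: "un (m - F m) = 0" unfolding F_def by (rule null[OF that])
    show "un (F m) = un m" using unorm_eq_of_null[OF up[OF that] up[OF FM] n0] by simp
  qed
  have cl: "comb b (I l) c = (if l = 0 then comb b {..<n} c else 0)" for l c by (simp add: I_def comb_def)
  have cl': "un (comb b (I l) c) = (if l = 0 then un (comb b {..<n} c) else 0)" for l c by (simp add: cl mN(5))
  have hn: "un (hatop (T a) (F m) - F (hatop (T a) m)) = 0" if m: "m \<in> M" for a m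
  proof -
    note Tm = M(3)[OF m, of a] M(3)[OF F(1)[OF m], of a]
    have "hatop (T a) (F m) - hatop (T a) m = hatop (T a) (F m - m)"
      by (rule clinear_on_rules(3)[OF clinear_hatop[OF T] upN(1), symmetric]) (use up F m in auto)
    moreover have "un (hatop (T a) (F m - m)) = 0"
      using hatop_null[OF T up[OF mS(5)[OF F(1)[OF m] m]], of a] F(2)[OF m] mN(8)[OF F(1)[OF m] m] by simp
    ultimately have "un (hatop (T a) (F m) - hatop (T a) m) = 0" by simp
    then have "un (hatop (T a) (F m) - F (hatop (T a) m)) \<le> 0"
      using mN(10)[OF Tm(2) Tm(1) F(1)[OF Tm(1)]] F(2)[OF Tm(1)] by simp
    then show ?thesis using mN(2)[OF mS(5)[OF Tm(2) F(1)[OF Tm(1)]]] by simp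
  qed
  define \<phi> where "\<phi> l i m = (if l = 0 then ph i m else 0)" for l :: nat and i m
  define Sg where "Sg c = comb b {..<n} (c 0)" for c :: "nat \<Rightarrow> nat \<Rightarrow> complex"
  have Fc: "comb b (I l) (\<lambda>i. \<phi> l i m) = (if l = 0 then F m else 0)" for l m by (simp add: cl \<phi>_def F_def)
  have sum0: "(\<Sum>l<L. if l = 0 then x else 0) = (if L = 0 then 0 else x)" for L :: nat and x :: "'z::comm_monoid_add"
    by (simp add: sum.delta)
  have sum0': "(\<Sum>l<L. if l = 0 then x l else 0) = (if L = 0 then 0 else x 0)" for L :: nat and x :: "nat \<Rightarrow> 'z::comm_monoid_add"
    by (simp add: sum.delta)
  have "decomposition T M C K e I b \<phi> \<phi> Sg"
    unfolding decomposition_def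
  proof (intro conjI allI ballI impI)
    show "finite (I l)" for l by (simp add: I_def)
    show "b i \<in> M" for i by (rule b)
    show bd: "bdd_op M un UNIV cmod (\<phi> l i)" "bdd_op M un UNIV cmod (\<phi> l i)" for l i
    proof -
      show "bdd_op M un UNIV cmod (\<phi> l i)"
      proof (cases "l = 0")
        case True
        have "bdd_op M un UNIV cmod (ph i)" by (rule bdd_opI[where C=Kb, OF ph(1)]) (auto simp: ph(2))
        then show ?thesis using True by (simp add: \<phi>_def[abs_def])
      next
        case False
        then show ?thesis unfolding \<phi>_def[abs_def] by (intro bdd_opI[where C=0]) (auto simp: clinear_on_def)
      qed
      then show "bdd_op M un UNIV cmod (\<phi> l i)" .
    qed
    have un1: "un m \<le> C * un m" if "m \<in> M" for m using C mN(2)[OF that] by (simp add: mult_le_cancel_right1)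
    show "(\<Sum>l<L. un (comb b (I l) (\<lambda>i. \<phi> l i m)) powr p) \<le> (C * un m) powr p" if m: "m \<in> M" for m L
    proof -
      have "un (comb b (I l) (\<lambda>i. \<phi> l i m)) powr p = (if l = 0 then un m powr p else 0)" for l using F(3)[OF m] mN(5) by (simp add: Fc)
      moreover have "un m powr p \<le> (C * un m) powr p" using un1[OF m] mN(2)[OF m] p_gt_1 by (intro powr_mono2) auto
      ultimately show ?thesis by (simp add: sum0)
    qed
    show "un (comb b (I l) (\<lambda>i. \<phi> l i m)) \<le> C * un m" if m: "m \<in> M" for m l
      using un1[OF m] F(3)[OF m] mN(2)[OF m] mN(5) C by (simp add: Fc)
    show "(\<lambda>L. un (m - (\<Sum>l<L. comb b (I l) (\<lambda>i. \<phi> l i (comb b (I l) (\<lambda>i. \<phi> l i m)))))) \<longlonglongrightarrow> 0" if m: "m \<in> M" for m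
    proof (rule tendsto_eventually)
      have gf: "comb b (I l) (\<lambda>i. \<phi> l i (comb b (I l) (\<lambda>i. \<phi> l i m))) = (if l = 0 then F (F m) else 0)" for l
        unfolding Fc by simp
      have "un (m - F (F m)) \<le> un (m - F m) + un (F m - F (F m))" by (rule mN(10)[OF m F(1)[OF m] F(1)[OF F(1)[OF m]]])
      then have "un (m - F (F m)) = 0" using F(2)[OF m] F(2)[OF F(1)[OF m]] mN(2)[OF mS(5)[OF m F(1)[OF F(1)[OF m]]]] by simp
      then show "eventually (\<lambda>L. un (m - (\<Sum>l<L. comb b (I l) (\<lambda>i. \<phi> l i (comb b (I l) (\<lambda>i. \<phi> l i m))))) = 0) sequentially"
        unfolding gf sum0 by (intro eventually_sequentiallyI[of 1]) auto
    qed
    show "un (hatop (T a) (comb b (I l) (\<lambda>i. \<phi> l i m)) - comb b (I l) (\<lambda>i. \<phi> l i (hatop (T a) m))) \<le> e l * un m"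
      "un (hatop (T a) (comb b (I l) (\<lambda>i. \<phi> l i m)) - comb b (I l) (\<lambda>i. \<phi> l i (hatop (T a) m))) \<le> e l * un m" if "a < K l" "m \<in> M" for l a m
    proof -
      have "hatop (T a) 0 = 0" by (rule clinear_on_rules(1)[OF clinear_hatop[OF T] upN(1)])
      then show "un (hatop (T a) (comb b (I l) (\<lambda>i. \<phi> l i m)) - comb b (I l) (\<lambda>i. \<phi> l i (hatop (T a) m))) \<le> e l * un m"
        using hn[OF that(2), of a] mN(5) mult_nonneg_nonneg[OF less_imp_le[OF e[of l]] mN(2)[OF that(2)]] by (cases "l = 0") (simp_all add: Fc)
      then show "un (hatop (T a) (comb b (I l) (\<lambda>i. \<phi> l i m)) - comb b (I l) (\<lambda>i. \<phi> l i (hatop (T a) m))) \<le> e l * un m" .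
    qed
    fix c :: "nat \<Rightarrow> nat \<Rightarrow> complex"
    show "Sg c \<in> M" unfolding Sg_def by (rule comb_mem[OF M(2) b])
    show "(\<lambda>L. un (Sg c - (\<Sum>l<L. comb b (I l) (c l)))) \<longlonglongrightarrow> 0"
    proof (rule tendsto_eventually)
      show "eventually (\<lambda>L. un (Sg c - (\<Sum>l<L. comb b (I l) (c l))) = 0) sequentially"
        unfolding cl sum0' by (intro eventually_sequentiallyI[of 1]) (auto simp: Sg_def mN(5))
    qed
    show "un (Sg c) powr p \<le> C powr p * (\<Sum>l. un (comb b (I l) (c l)) powr p)"
    proof -
      have "(\<Sum>l. un (comb b (I l) (c l)) powr p) = (\<Sum>l\<in>{0}. un (comb b (I l) (c l)) powr p)"
        by (rule suminf_finite) (auto simp: cl')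
      also have "\<dots> = un (Sg c) powr p" by (simp add: cl' Sg_def)
      finally have "(\<Sum>l. un (comb b (I l) (c l)) powr p) = un (Sg c) powr p" .
      moreover have "1 powr p \<le> C powr p" using C p_gt_1 by (intro powr_mono2) auto
      ultimately show ?thesis by (simp add: mult_le_cancel_right1)
    qed
    show "Sg (c + d) = Sg c + Sg d" for d
    proof -
      have "(c + d) 0 = (\<lambda>i. c 0 i + d 0 i)" by (simp add: fun_eq_iff)
      then show ?thesis unfolding Sg_def by (metis comb_add)
    qed
    show "Sg (k *\<^sub>C c) = k *\<^sub>C Sg c" for k
    proof -
      have "(k *\<^sub>C c) 0 = (\<lambda>i. k * c 0 i)" by (simp add: fun_eq_iff)
      then show ?thesis unfolding Sg_def by (metis comb_cscale)
    qed
  qed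
  then show ?thesis using that by blast
qed

end

section \<open>Localizing the ranges in \<open>l\<^sup>p\<close>\<close>

lemma cpair_sum: "cpair z (\<Sum>i\<in>I. c i *\<^sub>C y i) = (\<Sum>i\<in>I. c i * cpair z (y i))"
  using clinear_on_rules(4)[OF clinear_cpair[of UNIV z] csubspace_UNIV, of I "\<lambda>i. c i *\<^sub>C y i"]
    clinear_onD(2)[OF clinear_cpair[of UNIV z]] by simp

context ultra
begin

lemma rng_csubspace:
  assumes P: "bdd_op hat un hat un P" shows "csubspace (rng U p P)"
  unfolding csubspace_def
proof (intro conjI ballI allI)
  note lin = clinear_onD[OF bdd_opD(1)[OF P]] clinear_on_rules[OF bdd_opD(1)[OF P] csubspace_hat]
  have Ph: "P X \<in> hat" if "X \<in> hat" for X using bdd_opD(2)[OF P that] .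
  show "0 \<in> rng U p P" unfolding rng_def using haS(1) lin(3) haN(5) by (auto intro!: bexI[of _ 0])
  fix Y assume "Y \<in> rng U p P"
  then obtain X where X: "Y \<in> hat" "X \<in> hat" "un (Y - P X) = 0" by (auto simp: rng_def)
  show "c *\<^sub>C Y \<in> rng U p P" for c
  proof -
    have eq: "c *\<^sub>C Y - P (c *\<^sub>C X) = c *\<^sub>C (Y - P X)" using X by (simp only: lin(2) cscale_right_diff_distrib)
    have "un (c *\<^sub>C Y - P (c *\<^sub>C X)) = 0" unfolding eq using haN(4)[OF haS(5)[OF X(1) Ph[OF X(2)]], of c] X(3) by simp
    then show ?thesis using X haS(3) unfolding rng_def by blast
  qed
  fix Y' assume "Y' \<in> rng U p P"
  then obtain X' where X': "Y' \<in> hat" "X' \<in> hat" "un (Y' - P X') = 0" by (auto simp: rng_def)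
  have eq: "(Y + Y') - P (X + X') = (Y - P X) + (Y' - P X')" using lin(1)[OF X(2) X'(2)] by simp
  have d: "Y - P X \<in> hat" "Y' - P X' \<in> hat" using X X' Ph haS(5) by blast+
  have "un ((Y + Y') - P (X + X')) \<le> 0" unfolding eq using haN(3)[OF d] X(3) X'(3) by linarith
  moreover have "0 \<le> un ((Y + Y') - P (X + X'))" unfolding eq by (rule haN(2)[OF haS(2)[OF d]])
  ultimately have "un ((Y + Y') - P (X + X')) = 0" by linarith
  then show "Y + Y' \<in> rng U p P" using X X' haS(2) unfolding rng_def by blast
qed

lemma rng_fixed:
  assumes P: "bdd_op hat un hat un P" and id: "\<And>X. X \<in> hat \<Longrightarrow> un (P (P X) - P X) = 0" and Y: "Y \<in> rng U p P"
  shows "un (P Y - Y) = 0"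
proof -
  note lin = clinear_onD[OF bdd_opD(1)[OF P]] clinear_on_rules[OF bdd_opD(1)[OF P] csubspace_hat]
  have Ph: "P X \<in> hat" if "X \<in> hat" for X using bdd_opD(2)[OF P that] .
  obtain C where C: "C > 0" "\<And>x. x \<in> hat \<Longrightarrow> un (P x) \<le> C * un x" by (rule bdd_opE[OF P]) (auto simp: haN(2))
  obtain X where X: "Y \<in> hat" "X \<in> hat" "un (Y - P X) = 0" using Y by (auto simp: rng_def)
  have d: "Y - P X \<in> hat" using X Ph haS(5) by blast
  have "P Y - P (P X) = P (Y - P X)" using lin(5)[OF X(1) Ph[OF X(2)]] by simp
  then have 1: "un (P Y - P (P X)) = 0" using C(2)[OF d] X(3) haN(2)[OF Ph[OF d]] by simp
  have "un (P Y - Y) \<le> un (P Y - P (P X)) + un (P (P X) - Y)" by (intro haN(10) Ph X)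
  moreover have "un (P (P X) - Y) \<le> un (P (P X) - P X) + un (P X - Y)" by (intro haN(10) Ph X)
  moreover have "un (P X - Y) = 0" using haN(8)[OF X(1) Ph[OF X(2)]] X(3) by simp
  ultimately have "un (P Y - Y) \<le> 0" using 1 id[OF X(2)] by linarith
  then show ?thesis using haN(2)[OF haS(5)[OF Ph[OF X(1)] X(1)]] by simp
qed

lemma rng_invariant:
  assumes P: "bdd_op hat un hat un P" and T: "bop T"
    and comm: "\<And>X. X \<in> hat \<Longrightarrow> un (P (hatop T X) - hatop T (P X)) = 0" and Y: "Y \<in> rng U p P"
  shows "hatop T Y \<in> rng U p P"
proof -
  have Ph: "P X \<in> hat" if "X \<in> hat" for X using bdd_opD(2)[OF P that] .
  have Th: "hatop T X \<in> hat" if "X \<in> hat" for X using hatop_hat[OF T that] .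
  obtain X where X: "Y \<in> hat" "X \<in> hat" "un (Y - P X) = 0" using Y by (auto simp: rng_def)
  have d: "Y - P X \<in> hat" using X Ph haS(5) by blast
  have "hatop T Y - hatop T (P X) = hatop T (Y - P X)"
    using clinear_on_rules(3)[OF clinear_hatop[OF T] upN(1), of Y "P X"] X Ph hat_upw by simp
  then have "un (hatop T Y - hatop T (P X)) = 0" using hatop_null[OF T hat_upw[OF d] X(3)] by simp
  moreover have "un (hatop T (P X) - P (hatop T X)) = 0" using comm[OF X(2)] haN(8)[OF Ph[OF Th[OF X(2)]] Th[OF Ph[OF X(2)]]] by simp
  moreover have "un (hatop T Y - P (hatop T X)) \<le> un (hatop T Y - hatop T (P X)) + un (hatop T (P X) - P (hatop T X))"
    by (intro haN(10) Ph Th X)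
  ultimately have "un (hatop T Y - P (hatop T X)) = 0" using haN(2)[OF haS(5)[OF Th[OF X(1)] Ph[OF Th[OF X(2)]]]] by simp
  then show ?thesis using Th X unfolding rng_def by blast
qed

lemma rng_mem: "bdd_op hat un hat un P \<Longrightarrow> X \<in> hat \<Longrightarrow> P X \<in> rng U p P"
  using bdd_opD(2)[of hat un hat un P X] haN(5) unfolding rng_def by (auto intro!: bexI[of _ X])

text \<open>The functionals tend to 0 in the weak* sense: finitely many coordinates do so by
  hypothesis, and the uniform bound handles the tail of \<open>y\<close>. Consequently constant
  sequences are asymptotically invisible to them.\<close>

lemma cpair_weakly_null:
  assumes supp: "\<And>k. \<exists>N'. \<forall>s\<ge>N'. z k s = 0" and bd: "\<And>k y. y \<in> lp p \<Longrightarrow> cmod (cpair (z k) y) \<le> C * lpnorm p y"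
    and lim: "\<And>s. ((\<lambda>k. z k s) \<longlongrightarrow> 0) U" and y: "y \<in> lp p"
  shows "((\<lambda>k. cpair (z k) y) \<longlongrightarrow> 0) U"
proof (rule tendstoI)
  fix \<epsilon> :: real assume \<epsilon>: "\<epsilon> > 0"
  have "(\<lambda>n. C * lpnorm p (restr {n..} y)) \<longlonglongrightarrow> C * 0" by (intro tendsto_intros tail_tendsto y)
  then have "eventually (\<lambda>n. C * lpnorm p (restr {n..} y) < \<epsilon> / 2) sequentially" by (rule order_tendstoD) (use \<epsilon> in simp)
  then obtain n where n: "C * lpnorm p (restr {n..} y) < \<epsilon> / 2" by (auto simp: eventually_sequentially)
  have "((\<lambda>k. \<Sum>s<n. z k s * y s) \<longlongrightarrow> (\<Sum>s<n. 0 * y s)) U" by (intro tendsto_intros lim)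
  then have "eventually (\<lambda>k. dist (\<Sum>s<n. z k s * y s) 0 < \<epsilon> / 2) U"
    using \<epsilon> by (intro tendstoD) auto
  then show "eventually (\<lambda>k. dist (cpair (z k) y) 0 < \<epsilon>) U"
  proof eventually_elim
    case (elim k)
    obtain N' where N': "\<forall>s\<ge>N'. z k s = 0" using supp by blast
    have "cpair (z k) y = cpair (z k) (restr {..<n} y) + cpair (z k) (restr {n..} y)"
      using clinear_onD(1)[OF clinear_cpair[of UNIV], of "restr {..<n} y" "restr {n..} y"] restr_split[of y n] by simp
    moreover have "cpair (z k) (restr {..<n} y) = (\<Sum>s<n. z k s * y s)"
    proof -
      have "cpair (z k) (restr {..<n} y) = (\<Sum>s<max n N'. z k s * restr {..<n} y s)"
        using N' by (intro cpair_eq) auto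
      also have "\<dots> = (\<Sum>s<n. z k s * y s)" by (rule sum.mono_neutral_cong_right) (auto simp: restr_def)
      finally show ?thesis .
    qed
    moreover have "cmod (cpair (z k) (restr {n..} y)) < \<epsilon> / 2" using bd[OF restr_lp[OF y], of k "{n..}"] n by simp
    ultimately show ?case using elim norm_triangle_ineq[of "\<Sum>s<n. z k s * y s" "cpair (z k) (restr {n..} y)"] by simp
  qed
qed

lemma unit_ball_bound:
  assumes F: "clinear_on (lp p) F" "\<And>y. y \<in> lp p \<Longrightarrow> F y \<in> hat" and B: "\<And>y. y \<in> lp p \<Longrightarrow> lpnorm p y \<le> 1 \<Longrightarrow> un (F y) \<le> B"
    and y: "y \<in> lp p"
  shows "un (F y) \<le> B * lpnorm p y"
proof (cases "y = 0")
  case True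
  have "F 0 = 0" by (rule clinear_on_rules(1)[OF F(1) lpD(1)])
  then show ?thesis using True haN(5) lpD(5) by simp
next
  case False
  define r where "r = lpnorm p y"
  have r: "r > 0" using False lpnorm_zero_iff[OF y] lpnorm_nonneg[of y] by (simp add: r_def less_le)
  have 1: "(1 / of_real r) *\<^sub>C y \<in> lp p" "lpnorm p ((1 / of_real r) *\<^sub>C y) \<le> 1"
    using lpS(3)[OF y] lpD(4)[OF y, of "1 / of_real r"] r by (auto simp: r_def norm_divide)
  have "un (F ((1 / of_real r) *\<^sub>C y)) = un (F y) / r"
    using clinear_onD(2)[OF F(1) y, of "1 / of_real r"] haN(4)[OF F(2)[OF y], of "1 / of_real r"] r by (simp add: norm_divide)
  then have "un (F y) / r \<le> B" using B[OF 1] by simp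
  then show ?thesis using r by (simp add: r_def pos_divide_le_eq)
qed

text \<open>One finite-rank piece is copied into the coordinates from \<open>N\<close> to
  \<open>N'\<close>: \<open>v\<close> consists of k-th terms of truncated representatives of the
  \<open>b i\<close>, and \<open>z\<close> of finitely supported vectors that represent the
  functionals \<psi> i after \<open>P\<close>. Each conclusion holds for \<open>U\<close>-almost
  every \<open>k\<close>, so one \<open>k\<close> serves them all. For estimates over
  \<open>y\<close> in l^p, a unit vector is replaced by an element of \<open>hat\<close> of norm at
  most 2 with nearly the same functional values; applying \<open>P\<close> gives norm
  \<open>2 * lam\<close>, hence that factor.\<close>

lemma localized_piece:
  fixes T :: "nat \<Rightarrow> (nat \<Rightarrow> complex) \<Rightarrow> nat \<Rightarrow> complex" and I :: "nat set" and b :: "nat \<Rightarrow> nat \<Rightarrow> nat \<Rightarrow> complex"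
    and \<phi> \<psi> :: "nat \<Rightarrow> (nat \<Rightarrow> nat \<Rightarrow> complex) \<Rightarrow> complex" and N K :: nat
  assumes T: "\<And>a. bop (T a)" and P: "bdd_op hat un hat un P" and id: "\<And>X. X \<in> hat \<Longrightarrow> un (P (P X) - P X) = 0"
    and Pn: "\<And>X. X \<in> hat \<Longrightarrow> un (P X) \<le> lam * un X" and lam: "1 \<le> lam"
    and comm: "\<And>a X. X \<in> hat \<Longrightarrow> un (P (hatop (T a) X) - hatop (T a) (P X)) = 0" and M: "M = rng U p P"
    and I: "finite I" and b: "\<And>i. b i \<in> M"
    and \<phi>: "\<And>i. bdd_op M un UNIV cmod (\<phi> i)" and \<psi>: "\<And>i. bdd_op M un UNIV cmod (\<psi> i)" and C: "0 \<le> C" and e: "0 \<le> e"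
    and gC: "\<And>m. m \<in> M \<Longrightarrow> un (comb b I (\<lambda>i. \<psi> i m)) \<le> C * un m"
    and fc: "\<And>a m. a < K \<Longrightarrow> m \<in> M \<Longrightarrow> un (hatop (T a) (comb b I (\<lambda>i. \<phi> i m)) - comb b I (\<lambda>i. \<phi> i (hatop (T a) m))) \<le> e * un m"
    and gc: "\<And>a m. a < K \<Longrightarrow> m \<in> M \<Longrightarrow> un (hatop (T a) (comb b I (\<lambda>i. \<psi> i m)) - comb b I (\<lambda>i. \<psi> i (hatop (T a) m))) \<le> e * un m"
    and \<epsilon>: "\<epsilon> > 0"
  shows "\<exists>N' v z. N < N' \<and> (\<forall>i s. i \<in> I \<longrightarrow> (s < N \<or> N' \<le> s) \<longrightarrow> v i s = 0 \<and> z i s = 0) \<and>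
    (\<forall>m\<in>M. lpnorm p (comb v I (\<lambda>i. \<phi> i m)) \<le> un (comb b I (\<lambda>i. \<phi> i m)) + \<epsilon> * un m) \<and>
    (\<forall>y\<in>lp p. un (comb b I (\<lambda>i. cpair (z i) y)) \<le> (2 * lam * C + \<epsilon>) * lpnorm p y) \<and>
    (\<forall>m\<in>M. un (comb b I (\<lambda>i. cpair (z i) (comb v I (\<lambda>i. \<phi> i m))) - comb b I (\<lambda>i. \<psi> i (comb b I (\<lambda>i. \<phi> i m)))) \<le> \<epsilon> * un m) \<and>
    (\<forall>a<K. \<forall>m\<in>M. lpnorm p (T a (comb v I (\<lambda>i. \<phi> i m)) - comb v I (\<lambda>i. \<phi> i (hatop (T a) m))) \<le> (e + \<epsilon>) * un m) \<and>
    (\<forall>a<K. \<forall>y\<in>lp p. un (hatop (T a) (comb b I (\<lambda>i. cpair (z i) y)) - comb b I (\<lambda>i. cpair (z i) (T a y))) \<le> (2 * lam * e + \<epsilon>) * lpnorm p y)"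
proof -
  have Mh: "M \<subseteq> hat" unfolding M rng_def by auto
  have cM: "csubspace M" unfolding M by (rule rng_csubspace[OF P])
  have TM: "hatop (T a) m \<in> M" if "m \<in> M" for a m using that unfolding M by (intro rng_invariant[OF P T comm])
  have PM: "P X \<in> M" if "X \<in> hat" for X unfolding M by (rule rng_mem[OF P that])
  have PI: "un (P m - m) = 0" if "m \<in> M" for m using that unfolding M by (intro rng_fixed[OF P id])
  have sM: "seminormed M un" by (rule seminormed_subset[OF seminormed_hat cM Mh])
  note mN = seminormedD[OF sM] note mS = csubspaceD[OF cM]
  have bh: "b i \<in> hat" for i using b Mh by blast
  have bu: "b i \<in> upw p" for i using bh hat_upw by blast
  have Thh: "hatop (T a) X \<in> hat" if "X \<in> hat" for a X using hatop_hat[OF T that] .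
  have cbM: "comb b I c \<in> M" for c by (rule comb_mem[OF cM b])
  have cbh: "comb b I c \<in> hat" for c using cbM Mh by blast
  have "\<exists>k. k \<ge> 0 \<and> (\<forall>m\<in>M. cmod (\<phi> i m) \<le> k * un m \<and> cmod (\<psi> i m) \<le> k * un m)" for i
  proof -
    obtain c where c: "c > 0" "\<And>m. m \<in> M \<Longrightarrow> cmod (\<phi> i m) \<le> c * un m" by (rule bdd_opE[OF \<phi>[of i]]) (auto simp: mN(2))
    obtain d where d: "d > 0" "\<And>m. m \<in> M \<Longrightarrow> cmod (\<psi> i m) \<le> d * un m" by (rule bdd_opE[OF \<psi>[of i]]) (auto simp: mN(2))
    have "c * un m \<le> (c + d) * un m" "d * un m \<le> (c + d) * un m" if "m \<in> M" for m
      using mN(2)[OF that] c d by (auto intro: mult_right_mono)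
    then have "cmod (\<phi> i m) \<le> (c + d) * un m \<and> cmod (\<psi> i m) \<le> (c + d) * un m" if "m \<in> M" for m
      using c(2)[OF that] d(2)[OF that] that by (meson order_trans)
    then show ?thesis using c(1) d(1) by (intro exI[of _ "c + d"]) simp
  qed
  then obtain kk where kk: "\<And>i. kk i \<ge> 0" "\<And>i m. m \<in> M \<Longrightarrow> cmod (\<phi> i m) \<le> kk i * un m" "\<And>i m. m \<in> M \<Longrightarrow> cmod (\<psi> i m) \<le> kk i * un m" by metis
  define Kb where "Kb = (\<Sum>i\<in>I. kk i)"
  have Kb0: "0 \<le> Kb" unfolding Kb_def by (rule sum_nonneg) (use kk in auto)
  have kKb: "kk i \<le> Kb" if "i \<in> I" for i unfolding Kb_def by (rule member_le_sum[OF that]) (use kk I in auto)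
  have ph: "cmod (\<phi> i m) \<le> Kb * un m" and ps: "cmod (\<psi> i m) \<le> Kb * un m" if "i \<in> I" "m \<in> M" for i m
    using kk(2)[OF that(2), of i] kk(3)[OF that(2), of i] mult_right_mono[OF kKb[OF that(1)] mN(2)[OF that(2)]] by linarith+
  have "\<forall>a. \<exists>c. c > 0 \<and> (\<forall>x\<in>lp p. lpnorm p (T a x) \<le> c * lpnorm p x)" using T bopE by metis
  then obtain Ca where Ca: "\<And>a. Ca a > 0" "\<And>a x. x \<in> lp p \<Longrightarrow> lpnorm p (T a x) \<le> Ca a * lpnorm p x" by metis
  define Cs where "Cs = (\<Sum>a<K. Ca a)"
  have Cs: "Ca a \<le> Cs" if "a < K" for a unfolding Cs_def by (rule member_le_sum) (use that Ca(1) less_imp_le in auto)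
  have Cs0: "0 \<le> Cs" unfolding Cs_def by (rule sum_nonneg) (use Ca(1) less_imp_le in auto)
  have hT: "un (hatop (T a) X) \<le> Ca a * un X" if "X \<in> upw p" for a X by (rule hatop_bound[OF T Ca(2) that])
  define H where "H = (\<Sum>i\<in>I. un (b i) + 1)"
  have H0: "0 \<le> H" unfolding H_def by (rule sum_nonneg) (use mN(2)[OF b] in auto)
  have Hsum: "(\<Sum>i\<in>I. c * un (b i)) \<le> c * H" if "c \<ge> 0" for c
    unfolding H_def sum_distrib_left using that by (intro sum_mono mult_left_mono) auto
  \<comment> \<open>\<open>D\<close> bounds \<open>un S + 2\<close> for \<open>S\<close> equal to
    \<open>X\<close> or to \<open>hatop (T a) X\<close> with \<open>un X \<le> 2\<close>. Next,
    \<open>q\<close> collects the factors that multiply \<epsilon>1 further on, so that all these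
    errors end below \<epsilon>.\<close>
  define D where "D = 2 * Cs + 4"
  define q where "q = 1 + Kb * H * H + D * H * (Cs + 1)"
  have q: "q > 0" using Kb0 H0 Cs0 unfolding q_def D_def by (intro add_pos_nonneg mult_nonneg_nonneg) auto
  define \<epsilon>1 where "\<epsilon>1 = \<epsilon> / q"
  have e1: "\<epsilon>1 > 0" using \<epsilon> q by (simp add: \<epsilon>1_def)
  have small1: "\<epsilon>1 * (Kb * H * H) \<le> \<epsilon>" and small2: "\<epsilon>1 * (D * H * (Cs + 1)) \<le> \<epsilon>"
  proof -
    have "0 \<le> Kb * H * H" "0 \<le> D * H * (Cs + 1)" using Kb0 H0 Cs0 by (auto simp: D_def)
    then have "Kb * H * H \<le> q" "D * H * (Cs + 1) \<le> q" by (auto simp: q_def)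
    then have "\<epsilon>1 * (Kb * H * H) \<le> \<epsilon>1 * q" "\<epsilon>1 * (D * H * (Cs + 1)) \<le> \<epsilon>1 * q" using e1 by (auto intro: mult_left_mono)
    moreover have "\<epsilon>1 * q = \<epsilon>" using q by (simp add: \<epsilon>1_def)
    ultimately show "\<epsilon>1 * (Kb * H * H) \<le> \<epsilon>" "\<epsilon>1 * (D * H * (Cs + 1)) \<le> \<epsilon>" by auto
  qed
  define \<epsilon>2 where "\<epsilon>2 = \<epsilon>1 * D"
  have e2: "\<epsilon>2 \<ge> 0" using e1 Cs0 by (simp add: \<epsilon>2_def D_def)
  have small3: "\<epsilon>2 * H * (Ca a + 1) \<le> \<epsilon>" if "a < K" for a
  proof -
    have "\<epsilon>2 * H * (Ca a + 1) \<le> \<epsilon>2 * H * (Cs + 1)" using e2 H0 Cs[OF that] by (intro mult_left_mono) auto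
    then show ?thesis using small2 by (simp add: \<epsilon>2_def mult_ac)
  qed
  have small4: "\<epsilon>2 * H \<le> \<epsilon>"
  proof -
    have "\<epsilon>2 * H * 1 \<le> \<epsilon>2 * H * (Cs + 1)" using e2 H0 Cs0 by (intro mult_left_mono) auto
    then show ?thesis using small2 by (simp add: \<epsilon>2_def mult_ac)
  qed
  have "\<forall>i. \<exists>X'. X' \<in> hat \<and> un (X' - b i) = 0 \<and> (\<forall>k. \<exists>N'. \<forall>s. s < N \<or> N' \<le> s \<longrightarrow> X' k s = 0)"
    using hat_truncate[OF bh] by metis
  then obtain b' where b': "\<And>i. b' i \<in> hat" "\<And>i. un (b' i - b i) = 0" "\<And>i k. \<exists>N'. \<forall>s. s < N \<or> N' \<le> s \<longrightarrow> b' i k s = 0" by metis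
  have b'u: "b' i \<in> upw p" for i using b'(1) hat_upw by blast
  have psl: "clinear_on M (\<psi> i)" for i using bdd_opD(1)[OF \<psi>] .
  \<comment> \<open>\<psi> i is known to be linear and bounded on \<open>M\<close> only; composed
    with \<open>P\<close> it becomes a functional on all of \<open>hat\<close>, of norm at most
    \<open>Kb * lam\<close>, to which the approximation by finitely supported vectors
    applies.\<close>
  define ZP where "ZP i z \<longleftrightarrow> (\<forall>k. \<exists>N'. \<forall>s. s < N \<or> N' \<le> s \<longrightarrow> z k s = 0) \<and>
    (\<forall>k y. y \<in> lp p \<longrightarrow> cmod (cpair (z k) y) \<le> Kb * lam * lpnorm p y) \<and> (\<forall>s. ((\<lambda>k. z k s) \<longlongrightarrow> 0) U) \<and>
    (\<forall>X\<in>hat. eventually (\<lambda>k. cmod (\<psi> i (P X) - cpair (z k) (X k)) \<le> \<epsilon>1 * (un X + 1)) U)" for i z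
  have "\<forall>i. \<exists>z. i \<in> I \<longrightarrow> ZP i z"
  proof
    fix i
    show "\<exists>z. i \<in> I \<longrightarrow> ZP i z"
    proof (cases "i \<in> I")
      case True
      have l: "clinear_on hat (\<lambda>X. \<psi> i (P X))"
        by (rule clinear_on_compose[OF bdd_opD(1)[OF P] psl]) (use PM in auto)
      have bd: "cmod (\<psi> i (P X)) \<le> Kb * lam * un X" if "X \<in> hat" for X
        using ps[OF True PM[OF that]] mult_left_mono[OF Pn[OF that] Kb0] by simp
      have "0 \<le> Kb * lam" using Kb0 lam by simp
      obtain z where z1: "\<And>k. \<exists>N'. \<forall>s. s < N \<or> N' \<le> s \<longrightarrow> z k s = 0"
        and z2: "\<And>k y. y \<in> lp p \<Longrightarrow> cmod (cpair (z k) y) \<le> Kb * lam * lpnorm p y" and z3: "\<And>s. ((\<lambda>k. z k s) \<longlongrightarrow> 0) U"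
        and z4: "\<And>X. X \<in> hat \<Longrightarrow> eventually (\<lambda>k. cmod (\<psi> i (P X) - cpair (z k) (X k)) \<le> \<epsilon>1 * (un X + 1)) U"
        by (rule hat_functional_approx[OF l bd \<open>0 \<le> Kb * lam\<close> e1, where N=N]) (assumption, (rule that; assumption))
      have "ZP i z" unfolding ZP_def using z1 z2 z3 z4 by simp
      then show ?thesis by blast
    qed simp
  qed
  from choice[OF this] obtain z where ZP: "\<And>i. i \<in> I \<Longrightarrow> ZP i (z i)" by blast
  have z: "\<exists>N'. \<forall>s. s < N \<or> N' \<le> s \<longrightarrow> z i k s = 0"
    "y \<in> lp p \<Longrightarrow> cmod (cpair (z i k) y) \<le> Kb * lam * lpnorm p y"
    "((\<lambda>k. z i k s) \<longlongrightarrow> 0) U"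
    "X \<in> hat \<Longrightarrow> eventually (\<lambda>k. cmod (\<psi> i (P X) - cpair (z i k) (X k)) \<le> \<epsilon>1 * (un X + 1)) U" if "i \<in> I" for i k y s X
    using ZP[OF that] unfolding ZP_def by simp_all
  have zn: "((\<lambda>k. cpair (z i k) y) \<longlongrightarrow> 0) U" if i: "i \<in> I" and y: "y \<in> lp p" for i y
    by (rule cpair_weakly_null[where C="Kb * lam", OF _ z(2)[OF i] z(3)[OF i] y]) (use z(1)[OF i] in blast)
  have null_comb: "un (comb b' I c - comb b I c) = 0" for c
  proof -
    have eq: "comb b' I c - comb b I c = (\<Sum>i\<in>I. c i *\<^sub>C (b' i - b i))"
      by (simp only: comb_def sum_subtractf[symmetric] cscale_right_diff_distrib)
    have mem: "(\<Sum>i\<in>I. c i *\<^sub>C (b' i - b i)) \<in> hat" by (intro csubspace_sum[OF csubspace_hat] haS(3) haS(5) b' bh)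
    have "un (\<Sum>i\<in>I. c i *\<^sub>C (b' i - b i)) \<le> (\<Sum>i\<in>I. cmod (c i) * un (b' i - b i))"
      by (rule seminormed_sum_cscale[OF seminormed_hat]) (intro haS(5) b' bh)
    then show ?thesis unfolding eq using haN(2)[OF mem] b'(2) by simp
  qed
  have cb'h: "comb b' I c \<in> hat" for c by (rule comb_mem[OF csubspace_hat b'(1)])
  have un_comb: "un (comb b' I c) = un (comb b I c)" for c
    by (rule unorm_eq_of_null[OF hat_upw[OF cb'h] hat_upw[OF cbh] null_comb])
  \<comment> \<open>The coefficients \<phi> i m are bounded by \<open>Kb * un m\<close>, so the
    homogeneous evaluation bound with \<open>r = un m\<close> covers all \<open>m\<close> with the
    same \<open>k\<close>.\<close>
  have evA: "eventually (\<lambda>k. \<forall>m\<in>M. lpnorm p (comb (\<lambda>i. b' i k) I (\<lambda>i. \<phi> i m)) \<le> un (comb b I (\<lambda>i. \<phi> i m)) + \<epsilon> * un m) U"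
  proof -
    have "eventually (\<lambda>k. \<forall>c r. 0 \<le> r \<longrightarrow> (\<forall>i\<in>I. cmod (c i) \<le> Kb * r) \<longrightarrow>
       lpnorm p (\<Sum>i\<in>I. c i *\<^sub>C b' i k) \<le> un (\<Sum>i\<in>I. c i *\<^sub>C b' i) + \<epsilon> * r) U"
      by (intro eval_combination_bound_homogeneous I b'u \<epsilon>)
    then show ?thesis
    proof (eventually_elim, intro ballI)
      fix k m assume ev: "\<forall>c r. 0 \<le> r \<longrightarrow> (\<forall>i\<in>I. cmod (c i) \<le> Kb * r) \<longrightarrow>
       lpnorm p (\<Sum>i\<in>I. c i *\<^sub>C b' i k) \<le> un (\<Sum>i\<in>I. c i *\<^sub>C b' i) + \<epsilon> * r" and m: "m \<in> M"
      have "lpnorm p (comb (\<lambda>i. b' i k) I (\<lambda>i. \<phi> i m)) \<le> un (comb b' I (\<lambda>i. \<phi> i m)) + \<epsilon> * un m"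
      proof -
        have "\<forall>i\<in>I. cmod (\<phi> i m) \<le> Kb * un m" using ph[OF _ m] by blast
        then show ?thesis unfolding comb_def using spec[OF spec[OF ev, of "\<lambda>i. \<phi> i m"], of "un m"] mN(2)[OF m] by simp
      qed
      then show "lpnorm p (comb (\<lambda>i. b' i k) I (\<lambda>i. \<phi> i m)) \<le> un (comb b I (\<lambda>i. \<phi> i m)) + \<epsilon> * un m" by (simp only: un_comb)
    qed
  qed
  have evD: "eventually (\<lambda>k. \<forall>m\<in>M. lpnorm p (T a (comb (\<lambda>i. b' i k) I (\<lambda>i. \<phi> i m)) - comb (\<lambda>i. b' i k) I (\<lambda>i. \<phi> i (hatop (T a) m))) \<le> (e + \<epsilon>) * un m) U" if a: "a < K" for a
  proof -
    \<comment> \<open>Doubling the index set turns the difference of the two combinations, one of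
      them under the operator, into a single combination, to which the evaluation bound
      applies.\<close>
    define g where "g = case_sum (\<lambda>i. hatop (T a) (b' i)) b'"
    have gu: "g j \<in> upw p" for j using b'u hatop_upw[OF T] by (simp add: g_def split: sum.split)
    define K' where "K' = Kb * (1 + Ca a)"
    have "eventually (\<lambda>k. \<forall>c r. 0 \<le> r \<longrightarrow> (\<forall>i\<in>I <+> I. cmod (c i) \<le> K' * r) \<longrightarrow>
       lpnorm p (\<Sum>i\<in>I <+> I. c i *\<^sub>C g i k) \<le> un (\<Sum>i\<in>I <+> I. c i *\<^sub>C g i) + \<epsilon> * r) U"
      by (intro eval_combination_bound_homogeneous gu \<epsilon> finite_Plus I)
    then show ?thesis
    proof (eventually_elim, intro ballI)
      fix k m assume ev: "\<forall>c r. 0 \<le> r \<longrightarrow> (\<forall>i\<in>I <+> I. cmod (c i) \<le> K' * r) \<longrightarrow>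
       lpnorm p (\<Sum>i\<in>I <+> I. c i *\<^sub>C g i k) \<le> un (\<Sum>i\<in>I <+> I. c i *\<^sub>C g i) + \<epsilon> * r" and m: "m \<in> M"
      define c where "c = case_sum (\<lambda>i. \<phi> i m) (\<lambda>i. - \<phi> i (hatop (T a) m))"
      have um: "0 \<le> un m" by (rule mN(2)[OF m])
      have cK: "\<forall>i\<in>I <+> I. cmod (c i) \<le> K' * un m"
      proof
        fix j assume j: "j \<in> I <+> I"
        have k1: "Kb * un m \<le> K' * un m" unfolding K'_def
          by (rule mult_right_mono[OF _ um]) (use Kb0 Ca(1)[of a] in \<open>simp add: mult_le_cancel_left1\<close>)
        have k2: "Kb * (Ca a * un m) \<le> K' * un m" unfolding K'_def
          using Kb0 Ca(1)[of a] um by (simp add: algebra_simps)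
        have "Kb * un (hatop (T a) m) \<le> Kb * (Ca a * un m)" by (rule mult_left_mono[OF hT Kb0]) (use m Mh hat_upw in blast)
        then have k3: "Kb * un (hatop (T a) m) \<le> K' * un m" using k2 by linarith
        show "cmod (c j) \<le> K' * un m"
        proof (cases j)
          case (Inl i)
          then have "i \<in> I" using j by auto
          from ph[OF this m] show ?thesis using k1 Inl by (simp add: c_def)
        next
          case (Inr i)
          then have "i \<in> I" using j by auto
          from ph[OF this TM[OF m], of a] show ?thesis using k3 Inr by (simp add: c_def)
        qed
      qed
      have s1: "(\<Sum>i\<in>I <+> I. c i *\<^sub>C g i k) = T a (comb (\<lambda>i. b' i k) I (\<lambda>i. \<phi> i m)) - comb (\<lambda>i. b' i k) I (\<lambda>i. \<phi> i (hatop (T a) m))"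
      proof -
        have "T a (comb (\<lambda>i. b' i k) I (\<lambda>i. \<phi> i m)) = (\<Sum>i\<in>I. \<phi> i m *\<^sub>C T a (b' i k))"
          unfolding comb_def
          using clinear_on_rules(4)[OF bopD(1)[OF T] lpD(1), of I "\<lambda>i. \<phi> i m *\<^sub>C b' i k" a] clinear_onD(2)[OF bopD(1)[OF T] upwD[OF b'u]] lpS(3)[OF upwD[OF b'u]] by simp
        then show ?thesis by (simp add: sum.Plus I c_def g_def hatop_def comb_def sum_negf)
      qed
      have s2: "(\<Sum>i\<in>I <+> I. c i *\<^sub>C g i) = hatop (T a) (comb b' I (\<lambda>i. \<phi> i m)) - comb b' I (\<lambda>i. \<phi> i (hatop (T a) m))"
      proof -
        have "hatop (T a) (comb b' I (\<lambda>i. \<phi> i m)) = (\<Sum>i\<in>I. \<phi> i m *\<^sub>C hatop (T a) (b' i))"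
          unfolding comb_def
          using clinear_on_rules(4)[OF clinear_hatop[OF T] upN(1), of I "\<lambda>i. \<phi> i m *\<^sub>C b' i" a] clinear_onD(2)[OF clinear_hatop[OF T] b'u] upS(3)[OF b'u] by simp
        then show ?thesis by (simp add: sum.Plus I c_def g_def comb_def sum_negf)
      qed
      define f1 f2 where "f1 = comb b I (\<lambda>i. \<phi> i m)" and "f2 = comb b I (\<lambda>i. \<phi> i (hatop (T a) m))"
      define f1' f2' where "f1' = comb b' I (\<lambda>i. \<phi> i m)" and "f2' = comb b' I (\<lambda>i. \<phi> i (hatop (T a) m))"
      have fh: "f1 \<in> hat" "f2 \<in> hat" "f1' \<in> hat" "f2' \<in> hat" unfolding f1_def f2_def f1'_def f2'_def by (intro cbh cb'h)+
      have "un (hatop (T a) f1' - f2') \<le> un (hatop (T a) f1' - hatop (T a) f1) + un (hatop (T a) f1 - f2')" by (intro haN(10) Thh fh)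
      moreover have "un (hatop (T a) f1 - f2') \<le> un (hatop (T a) f1 - f2) + un (f2 - f2')" by (intro haN(10) Thh fh)
      moreover have "un (f2 - f2') = 0" using null_comb haN(8)[OF fh(2,4)] unfolding f2_def f2'_def by simp
      moreover have "un (hatop (T a) f1' - hatop (T a) f1) = 0"
      proof -
        have "hatop (T a) f1' - hatop (T a) f1 = hatop (T a) (f1' - f1)"
          using clinear_on_rules(3)[OF clinear_hatop[OF T] upN(1) hat_upw[OF fh(3)] hat_upw[OF fh(1)]] by simp
        moreover have "un (hatop (T a) (f1' - f1)) = 0"
          by (rule hatop_null[OF T hat_upw[OF haS(5)[OF fh(3,1)]]]) (use null_comb in \<open>simp add: f1_def f1'_def\<close>)
        ultimately show ?thesis by simp
      qed
      moreover have "un (hatop (T a) f1 - f2) \<le> e * un m" unfolding f1_def f2_def by (rule fc[OF a m])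
      ultimately have "un (hatop (T a) f1' - f2') \<le> e * un m" by linarith
      moreover have "lpnorm p (\<Sum>i\<in>I <+> I. c i *\<^sub>C g i k) \<le> un (\<Sum>i\<in>I <+> I. c i *\<^sub>C g i) + \<epsilon> * un m"
        using spec[OF spec[OF ev, of c], of "un m"] um cK by simp
      ultimately have "lpnorm p (T a (comb (\<lambda>i. b' i k) I (\<lambda>i. \<phi> i m)) - comb (\<lambda>i. b' i k) I (\<lambda>i. \<phi> i (hatop (T a) m))) \<le> e * un m + \<epsilon> * un m"
        unfolding s1 s2 f1'_def f2'_def by linarith
      then show "lpnorm p (T a (comb (\<lambda>i. b' i k) I (\<lambda>i. \<phi> i m)) - comb (\<lambda>i. b' i k) I (\<lambda>i. \<phi> i (hatop (T a) m))) \<le> (e + \<epsilon>) * un m"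
        by (simp only: distrib_right)
    qed
  qed
  have evC: "eventually (\<lambda>k. \<forall>i\<in>I. \<forall>j\<in>I. cmod (cpair (z i k) (b' j k) - \<psi> i (b j)) \<le> \<epsilon>1 * (un (b j) + 1)) U"
  proof (intro eventually_ball_finite I ballI)
    fix i j assume i: "i \<in> I" and j: "j \<in> I"
    have "un (b' j) = un (b j)" by (rule unorm_eq_of_null[OF b'u bu b'(2)])
    moreover have "\<psi> i (P (b' j)) = \<psi> i (b j)"
    proof -
      have Pb: "P (b' j) \<in> M" by (rule PM[OF b'(1)])
      have "un (P (b' j) - b j) \<le> un (P (b' j) - P (b j)) + un (P (b j) - b j)" by (intro haN(10) bdd_opD(2)[OF P] b' bh)
      moreover have "P (b' j) - P (b j) = P (b' j - b j)" using clinear_on_rules(3)[OF bdd_opD(1)[OF P] csubspace_hat b'(1) bh] by simp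
      moreover have "un (P (b' j - b j)) \<le> 0" using Pn[OF haS(5)[OF b'(1) bh], of j j] b'(2)[of j] by simp
      ultimately have "un (P (b' j) - b j) \<le> 0" using PI[OF b, of j] by simp
      then have "cmod (\<psi> i (P (b' j) - b j)) \<le> 0" using kk(3)[OF mS(5)[OF Pb b], of i j] kk(1)[of i] by (smt (verit) mult_nonneg_nonpos)
      then show ?thesis using clinear_on_rules(3)[OF psl cM Pb b, of i j] by simp
    qed
    ultimately show "eventually (\<lambda>k. cmod (cpair (z i k) (b' j k) - \<psi> i (b j)) \<le> \<epsilon>1 * (un (b j) + 1)) U"
      using z(4)[OF i b'(1)[of j]] by (simp add: norm_minus_commute)
  qed
  \<comment> \<open>Uniformity over the unit ball, by contradiction. Bad vectors chosen for almost
    every \<open>k\<close> form a bounded sequence, which is a constant plus an element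
    \<open>X\<close> of \<open>hat\<close>; on \<open>X\<close> the functionals are under control
    and the constant part does not count, so \<open>X\<close> itself refutes badness.\<close>
  have evT: "eventually (\<lambda>k. \<forall>y. y \<in> lp p \<longrightarrow> lpnorm p y \<le> 1 \<longrightarrow> (\<exists>X. X \<in> hat \<and> un X \<le> 2 \<and>
      (\<forall>i\<in>I. cmod (cpair (z i k) y - \<psi> i (P X)) \<le> \<epsilon>2) \<and>
      (\<forall>i\<in>I. \<forall>a\<in>{..<K}. cmod (cpair (z i k) (T a y) - \<psi> i (P (hatop (T a) X))) \<le> \<epsilon>2))) U"
  proof (rule ccontr)
    define G where "G k y X \<longleftrightarrow> X \<in> hat \<and> un X \<le> 2 \<and> (\<forall>i\<in>I. cmod (cpair (z i k) y - \<psi> i (P X)) \<le> \<epsilon>2) \<and>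
      (\<forall>i\<in>I. \<forall>a\<in>{..<K}. cmod (cpair (z i k) (T a y) - \<psi> i (P (hatop (T a) X))) \<le> \<epsilon>2)" for k y X
    assume "\<not> ?thesis"
    then have "\<not> eventually (\<lambda>k. \<forall>y. y \<in> lp p \<longrightarrow> lpnorm p y \<le> 1 \<longrightarrow> (\<exists>X. G k y X)) U" unfolding G_def .
    then have bad: "eventually (\<lambda>k. \<exists>y. y \<in> lp p \<and> lpnorm p y \<le> 1 \<and> \<not> (\<exists>X. G k y X)) U"
      by (drule_tac eventually_not_U) (simp only: not_all not_imp)
    define Bd where "Bd k y \<longleftrightarrow> y \<in> lp p \<and> lpnorm p y \<le> 1 \<and> \<not> (\<exists>X. G k y X)" for k y
    \<comment> \<open>The value 0 at indices without a bad vector keeps the sequence in the unit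
      ball.\<close>
    define Y where "Y k = (if \<exists>y. Bd k y then (SOME y. Bd k y) else 0)" for k
    have YB: "Bd k (Y k)" if "\<exists>y. Bd k y" for k using someI_ex[OF that] that by (simp add: Y_def)
    have Yl: "Y k \<in> lp p \<and> lpnorm p (Y k) \<le> 1" for k
    proof (cases "\<exists>y. Bd k y")
      case True
      then show ?thesis using YB[OF True] by (simp add: Bd_def)
    next
      case False
      then show ?thesis using lpS(1) lpD(5) by (simp add: Y_def)
    qed
    obtain y where y: "y \<in> lp p" and X: "(\<lambda>k. Y k - y) \<in> hat" "un (\<lambda>k. Y k - y) \<le> 2 * 1"
      by (rule weak_limit[of Y 1]) (use Yl in auto)
    define X where "X = (\<lambda>k. Y k - y)"
    have Xh: "X \<in> hat" "un X \<le> 2" using X by (simp_all add: X_def)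
    \<comment> \<open>\<open>w\<close> is the constant part of the sequence; its pairing tends to 0
      and uses up one further \<epsilon>1.\<close>
    have key: "eventually (\<lambda>k. cmod (cpair (z i k) (S k + w) - \<psi> i (P S)) \<le> \<epsilon>2) U"
      if i: "i \<in> I" and S: "S \<in> hat" "un S + 2 \<le> D" and w: "w \<in> lp p" for i S w
    proof -
      have "eventually (\<lambda>k. dist (cpair (z i k) w) 0 < \<epsilon>1) U" by (rule tendstoD[OF zn[OF i w] e1])
      with z(4)[OF i S(1)] show ?thesis
      proof eventually_elim
        case (elim k)
        have "cpair (z i k) (S k + w) = cpair (z i k) (S k) + cpair (z i k) w" using clinear_onD(1)[OF clinear_cpair[of UNIV]] by simp
        then have "cmod (cpair (z i k) (S k + w) - \<psi> i (P S)) \<le> cmod (cpair (z i k) (S k) - \<psi> i (P S)) + cmod (cpair (z i k) w)"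
          using norm_triangle_ineq[of "cpair (z i k) (S k) - \<psi> i (P S)" "cpair (z i k) w"] by (simp add: algebra_simps)
        also have "\<dots> \<le> \<epsilon>1 * (un S + 1) + \<epsilon>1" using elim by (simp add: norm_minus_commute)
        also have "\<dots> = \<epsilon>1 * (un S + 2)" by (simp add: algebra_simps)
        also have "\<dots> \<le> \<epsilon>2" unfolding \<epsilon>2_def using S(2) e1 by (intro mult_left_mono) auto
        finally show ?case .
      qed
    qed
    have e1': "eventually (\<lambda>k. \<forall>i\<in>I. cmod (cpair (z i k) (Y k) - \<psi> i (P X)) \<le> \<epsilon>2) U"
    proof (intro eventually_ball_finite I ballI)
      fix i assume i: "i \<in> I"
      have "eventually (\<lambda>k. cmod (cpair (z i k) (X k + y) - \<psi> i (P X)) \<le> \<epsilon>2) U"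
        by (rule key[OF i Xh(1) _ y]) (use Xh(2) Cs0 in \<open>simp add: D_def\<close>)
      then show "eventually (\<lambda>k. cmod (cpair (z i k) (Y k) - \<psi> i (P X)) \<le> \<epsilon>2) U" by (simp add: X_def)
    qed
    have e2': "eventually (\<lambda>k. \<forall>i\<in>I. \<forall>a\<in>{..<K}. cmod (cpair (z i k) (T a (Y k)) - \<psi> i (P (hatop (T a) X))) \<le> \<epsilon>2) U"
    proof (intro eventually_ball_finite I ballI finite_lessThan)
      fix i a assume i: "i \<in> I" and a: "a \<in> {..<K}"
      have "un (hatop (T a) X) \<le> Ca a * un X" by (rule hT[OF hat_upw[OF Xh(1)]])
      also have "\<dots> \<le> Cs * 2" using Cs[of a] a Xh(2) Ca(1)[of a] haN(2)[OF Xh(1)] Cs0 by (intro mult_mono) auto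
      finally have uS: "un (hatop (T a) X) + 2 \<le> D" by (simp add: D_def)
      have "eventually (\<lambda>k. cmod (cpair (z i k) (hatop (T a) X k + T a y) - \<psi> i (P (hatop (T a) X))) \<le> \<epsilon>2) U"
        by (rule key[OF i Thh[OF Xh(1)] uS bopD(2)[OF T y]])
      moreover have "hatop (T a) X k + T a y = T a (Y k)" for k
        using clinear_on_rules(3)[OF bopD(1)[OF T] lpD(1), of "Y k" y a] Yl[of k] y by (simp add: hatop_def X_def)
      ultimately show "eventually (\<lambda>k. cmod (cpair (z i k) (T a (Y k)) - \<psi> i (P (hatop (T a) X))) \<le> \<epsilon>2) U" by simp
    qed
    have "eventually (\<lambda>k. False) U" using bad e1' e2'
    proof eventually_elim
      case (elim k)
      have "Bd k (Y k)" by (rule YB) (use elim(1) in \<open>simp add: Bd_def\<close>)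
      moreover have "G k (Y k) X" using elim(2,3) Xh by (simp add: G_def)
      ultimately show ?case by (auto simp: Bd_def)
    qed
    then show False by simp
  qed
  have evD': "eventually (\<lambda>k. \<forall>a\<in>{..<K}. \<forall>m\<in>M. lpnorm p (T a (comb (\<lambda>i. b' i k) I (\<lambda>i. \<phi> i m)) - comb (\<lambda>i. b' i k) I (\<lambda>i. \<phi> i (hatop (T a) m))) \<le> (e + \<epsilon>) * un m) U"
    by (rule eventually_ball_finite[OF finite_lessThan]) (use evD in auto)
  obtain k where kA: "\<forall>m\<in>M. lpnorm p (comb (\<lambda>i. b' i k) I (\<lambda>i. \<phi> i m)) \<le> un (comb b I (\<lambda>i. \<phi> i m)) + \<epsilon> * un m"
    and kD: "\<forall>a\<in>{..<K}. \<forall>m\<in>M. lpnorm p (T a (comb (\<lambda>i. b' i k) I (\<lambda>i. \<phi> i m)) - comb (\<lambda>i. b' i k) I (\<lambda>i. \<phi> i (hatop (T a) m))) \<le> (e + \<epsilon>) * un m"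
    and kC: "\<forall>i\<in>I. \<forall>j\<in>I. cmod (cpair (z i k) (b' j k) - \<psi> i (b j)) \<le> \<epsilon>1 * (un (b j) + 1)"
    and kT: "\<forall>y. y \<in> lp p \<longrightarrow> lpnorm p y \<le> 1 \<longrightarrow> (\<exists>X. X \<in> hat \<and> un X \<le> 2 \<and>
      (\<forall>i\<in>I. cmod (cpair (z i k) y - \<psi> i (P X)) \<le> \<epsilon>2) \<and>
      (\<forall>i\<in>I. \<forall>a\<in>{..<K}. cmod (cpair (z i k) (T a y) - \<psi> i (P (hatop (T a) X))) \<le> \<epsilon>2))"
    using eventually_happens'[OF U_ne_bot eventually_conj[OF eventually_conj[OF evA evD'] eventually_conj[OF evC evT]]] by blast
  have "\<forall>i. \<exists>n. i \<in> I \<longrightarrow> (\<forall>s. s < N \<or> n \<le> s \<longrightarrow> b' i k s = 0 \<and> z i k s = 0)"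
  proof
    fix i
    show "\<exists>n. i \<in> I \<longrightarrow> (\<forall>s. s < N \<or> n \<le> s \<longrightarrow> b' i k s = 0 \<and> z i k s = 0)"
    proof (cases "i \<in> I")
      case True
      obtain n1 n2 where "\<forall>s. s < N \<or> n1 \<le> s \<longrightarrow> b' i k s = 0" "\<forall>s. s < N \<or> n2 \<le> s \<longrightarrow> z i k s = 0"
        using b'(3)[of i k] z(1)[OF True, of k] by blast
      then show ?thesis by (intro exI[of _ "max n1 n2"]) auto
    qed simp
  qed
  then obtain n where n: "\<And>i s. i \<in> I \<Longrightarrow> s < N \<or> n i \<le> s \<Longrightarrow> b' i k s = 0 \<and> z i k s = 0" by metis
  \<comment> \<open>The additional 1 makes the block nonempty even if \<open>I\<close> is empty, so
    that the block boundaries increase strictly.\<close>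
  define N' where "N' = N + 1 + (\<Sum>i\<in>I. n i)"
  have nN: "n i \<le> N'" if "i \<in> I" for i using member_le_sum[OF that, of n] I by (simp add: N'_def)
  define v where "v i = b' i k" for i
  define zz where "zz i = z i k" for i
  define u where "u y = comb b I (\<lambda>i. cpair (zz i) y)" for y
  have ulin: "clinear_on V u" for V unfolding u_def[abs_def] by (rule clinear_comb) (rule clinear_cpair)
  have uM: "u y \<in> M" for y unfolding u_def by (rule cbM)
  have uh: "u y \<in> hat" for y using uM Mh by blast
  have comb_bd: "un (comb b I c) \<le> t * H" if "\<And>i. i \<in> I \<Longrightarrow> cmod (c i) \<le> t" "t \<ge> 0" for c t
  proof -
    have "un (comb b I c) \<le> (\<Sum>i\<in>I. cmod (c i) * un (b i))" unfolding comb_def by (rule seminormed_sum_cscale[OF sM b])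
    also have "\<dots> \<le> (\<Sum>i\<in>I. t * un (b i))" by (intro sum_mono mult_right_mono that mN(2) b)
    also have "\<dots> \<le> t * H" by (rule Hsum[OF that(2)])
    finally show ?thesis .
  qed
  have PX: "un (P X) \<le> 2 * lam" if "X \<in> hat" "un X \<le> 2" for X
    using order_trans[OF Pn[OF that(1)] mult_left_mono[OF that(2), of lam]] lam by (simp add: mult.commute)
  have B: "un (u y) \<le> (2 * lam * C + \<epsilon>) * lpnorm p y" if "y \<in> lp p" for y
  proof (rule unit_ball_bound[OF ulin uh _ that])
    fix y assume y: "y \<in> lp p" "lpnorm p y \<le> 1"
    obtain X where X: "X \<in> hat" "un X \<le> 2" "\<And>i. i \<in> I \<Longrightarrow> cmod (cpair (z i k) y - \<psi> i (P X)) \<le> \<epsilon>2" using kT y by blast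
    have "un (u y - comb b I (\<lambda>i. \<psi> i (P X))) \<le> \<epsilon>2 * H"
      unfolding u_def comb_diff[symmetric] zz_def by (rule comb_bd[OF X(3) e2])
    moreover have "un (comb b I (\<lambda>i. \<psi> i (P X))) \<le> C * (2 * lam)"
      by (rule order_trans[OF gC[OF PM[OF X(1)]] mult_left_mono[OF PX[OF X(1,2)] C]])
    ultimately show "un (u y) \<le> 2 * lam * C + \<epsilon>" using small4 haN(9)[OF uh cbh, of y "\<lambda>i. \<psi> i (P X)"] by (simp add: mult_ac)
  qed
  have E: "un (hatop (T a) (u y) - u (T a y)) \<le> (2 * lam * e + \<epsilon>) * lpnorm p y" if a: "a < K" and "y \<in> lp p" for a y
  proof (rule unit_ball_bound[where F="\<lambda>y. hatop (T a) (u y) - u (T a y)", OF _ _ _ that(2)])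
    have "clinear_on (lp p) (\<lambda>y. hatop (T a) (u y))"
      by (rule clinear_on_compose[OF ulin clinear_hatop[OF T]]) (use uh hat_upw in blast)
    moreover have "clinear_on (lp p) (\<lambda>y. u (T a y))" by (rule clinear_on_compose[OF bopD(1)[OF T] ulin[of UNIV]]) simp
    ultimately show "clinear_on (lp p) (\<lambda>y. hatop (T a) (u y) - u (T a y))" by (rule clinear_on_diff)
    show "hatop (T a) (u y) - u (T a y) \<in> hat" for y by (intro haS(5) Thh uh)
    fix y assume y: "y \<in> lp p" "lpnorm p y \<le> 1"
    obtain X where X: "X \<in> hat" "un X \<le> 2" "\<And>i. i \<in> I \<Longrightarrow> cmod (cpair (z i k) y - \<psi> i (P X)) \<le> \<epsilon>2"
      "\<And>i. i \<in> I \<Longrightarrow> cmod (cpair (z i k) (T a y) - \<psi> i (P (hatop (T a) X))) \<le> \<epsilon>2" using kT y a by blast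
    define m where "m = P X"
    have m: "m \<in> M" unfolding m_def by (rule PM[OF X(1)])
    define w1 w2 where "w1 = comb b I (\<lambda>i. \<psi> i m)" and "w2 = comb b I (\<lambda>i. \<psi> i (hatop (T a) m))"
    have wh: "w1 \<in> hat" "w2 \<in> hat" unfolding w1_def w2_def by (intro cbh)+
    have pe: "\<psi> i (P (hatop (T a) X)) = \<psi> i (hatop (T a) m)" for i
    proof -
      have PTX: "P (hatop (T a) X) \<in> M" by (rule PM[OF Thh[OF X(1)]])
      have "un (P (hatop (T a) X) - hatop (T a) m) = 0" unfolding m_def by (rule comm[OF X(1)])
      then have "cmod (\<psi> i (P (hatop (T a) X) - hatop (T a) m)) \<le> 0" using kk(3)[OF mS(5)[OF PTX TM[OF m]], of i a] by simp
      then show ?thesis using clinear_on_rules(3)[OF psl cM PTX TM[OF m], of i] by simp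
    qed
    have "un (u y - w1) \<le> \<epsilon>2 * H"
      unfolding u_def comb_diff[symmetric] zz_def w1_def m_def by (rule comb_bd[OF X(3) e2])
    then have "Ca a * un (u y - w1) \<le> Ca a * (\<epsilon>2 * H)" using Ca(1)[of a] by (intro mult_left_mono) auto
    then have "un (hatop (T a) (u y - w1)) \<le> Ca a * (\<epsilon>2 * H)" using hT[OF hat_upw[OF haS(5)[OF uh wh(1)]]] by (rule order_trans[rotated])
    moreover have "hatop (T a) (u y - w1) = hatop (T a) (u y) - hatop (T a) w1"
      by (rule clinear_on_rules(3)[OF clinear_hatop[OF T] upN(1)]) (intro hat_upw uh wh)+
    ultimately have 1: "un (hatop (T a) (u y) - hatop (T a) w1) \<le> Ca a * (\<epsilon>2 * H)" by simp
    have 2: "un (u (T a y) - w2) \<le> \<epsilon>2 * H"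
      unfolding u_def comb_diff[symmetric] zz_def w2_def pe[symmetric] by (rule comb_bd[OF X(4) e2])
    have 3: "un (hatop (T a) w1 - w2) \<le> e * (2 * lam)"
      unfolding w1_def w2_def by (rule order_trans[OF gc[OF a m]]) (use PX[OF X(1,2)] e in \<open>auto simp: m_def intro: mult_left_mono\<close>)
    have "un (hatop (T a) (u y) - u (T a y)) \<le> un (hatop (T a) (u y) - hatop (T a) w1) + un (hatop (T a) w1 - u (T a y))" by (intro haN(10) Thh uh wh)
    moreover have "un (hatop (T a) w1 - u (T a y)) \<le> un (hatop (T a) w1 - w2) + un (w2 - u (T a y))" by (intro haN(10) Thh uh wh)
    moreover have "un (w2 - u (T a y)) = un (u (T a y) - w2)" by (intro haN(8) uh wh)
    moreover have "Ca a * (\<epsilon>2 * H) + \<epsilon>2 * H = \<epsilon>2 * H * (Ca a + 1)" by (simp add: algebra_simps)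
    moreover have "e * (2 * lam) = 2 * lam * e" by simp
    ultimately show "un (hatop (T a) (u y) - u (T a y)) \<le> 2 * lam * e + \<epsilon>" using 1 2 3 small3[OF a] by linarith
  qed
  have Cc: "un (u (comb v I (\<lambda>i. \<phi> i m)) - comb b I (\<lambda>i. \<psi> i (comb b I (\<lambda>i. \<phi> i m)))) \<le> \<epsilon> * un m" if m: "m \<in> M" for m
  proof -
    have um: "0 \<le> un m" by (rule mN(2)[OF m])
    define t where "t = \<epsilon>1 * (Kb * H) * un m"
    have t0: "t \<ge> 0" using e1 Kb0 H0 um by (simp add: t_def)
    have "cmod (cpair (zz i) (comb v I (\<lambda>i. \<phi> i m)) - \<psi> i (comb b I (\<lambda>i. \<phi> i m))) \<le> t" if i: "i \<in> I" for i
    proof -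
      have 1: "cpair (zz i) (comb v I (\<lambda>i. \<phi> i m)) = (\<Sum>j\<in>I. \<phi> j m * cpair (z i k) (b' j k))"
        unfolding comb_def v_def zz_def by (rule cpair_sum)
      have 2: "\<psi> i (comb b I (\<lambda>i. \<phi> i m)) = (\<Sum>j\<in>I. \<phi> j m * \<psi> i (b j))"
        unfolding comb_def using clinear_on_rules(4)[OF psl cM, of I "\<lambda>j. \<phi> j m *\<^sub>C b j" i] clinear_onD(2)[OF psl b] mS(3)[OF b] by simp
      have "cmod (cpair (zz i) (comb v I (\<lambda>i. \<phi> i m)) - \<psi> i (comb b I (\<lambda>i. \<phi> i m))) \<le> (\<Sum>j\<in>I. (Kb * un m) * (\<epsilon>1 * (un (b j) + 1)))"
        unfolding 1 2 sum_subtractf[symmetric] right_diff_distrib[symmetric]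
        by (rule sum_norm_le, unfold norm_mult, rule mult_mono) (use ph[OF _ m] kC i Kb0 um in auto)
      also have "\<dots> = t" by (simp add: t_def H_def sum_distrib_left mult_ac)
      finally show ?thesis .
    qed
    then have "un (u (comb v I (\<lambda>i. \<phi> i m)) - comb b I (\<lambda>i. \<psi> i (comb b I (\<lambda>i. \<phi> i m)))) \<le> t * H"
      unfolding u_def comb_diff[symmetric] by (rule comb_bd[OF _ t0])
    also have "\<dots> = \<epsilon>1 * (Kb * H * H) * un m" by (simp add: t_def mult_ac)
    also have "\<dots> \<le> \<epsilon> * un m" by (rule mult_right_mono[OF small1 um])
    finally show ?thesis .
  qed
  show ?thesis
  proof (intro exI conjI)
    show "N < N'" by (simp add: N'_def)
    show "\<forall>i s. i \<in> I \<longrightarrow> (s < N \<or> N' \<le> s) \<longrightarrow> v i s = 0 \<and> zz i s = 0"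
      using n nN unfolding v_def zz_def by (meson order_trans)
    show "\<forall>m\<in>M. lpnorm p (comb v I (\<lambda>i. \<phi> i m)) \<le> un (comb b I (\<lambda>i. \<phi> i m)) + \<epsilon> * un m" using kA by (simp add: v_def[abs_def])
    show "\<forall>y\<in>lp p. un (comb b I (\<lambda>i. cpair (zz i) y)) \<le> (2 * lam * C + \<epsilon>) * lpnorm p y" using B by (simp add: u_def)
    show "\<forall>m\<in>M. un (comb b I (\<lambda>i. cpair (zz i) (comb v I (\<lambda>i. \<phi> i m))) - comb b I (\<lambda>i. \<psi> i (comb b I (\<lambda>i. \<phi> i m)))) \<le> \<epsilon> * un m" using Cc by (simp add: u_def)
    show "\<forall>a<K. \<forall>m\<in>M. lpnorm p (T a (comb v I (\<lambda>i. \<phi> i m)) - comb v I (\<lambda>i. \<phi> i (hatop (T a) m))) \<le> (e + \<epsilon>) * un m" using kD by (simp add: v_def[abs_def])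
    show "\<forall>a<K. \<forall>y\<in>lp p. un (hatop (T a) (comb b I (\<lambda>i. cpair (zz i) y)) - comb b I (\<lambda>i. cpair (zz i) (T a y))) \<le> (2 * lam * e + \<epsilon>) * lpnorm p y" using E by (simp add: u_def)
  qed
qed

end

section \<open>Gluing the localized pieces\<close>

context lp_space
begin

text \<open>If \<open>q y\<close> is the norm of \<open>K y\<close>, this is complete continuity of
  \<open>K\<close>, which gives compactness by \<open>weak_seq_compact\<close>. The notion is stated
  for plain real functions so that majorants can be used in place of operator norms.\<close>

definition vanishing :: "((nat \<Rightarrow> complex) \<Rightarrow> real) \<Rightarrow> bool" where
  "vanishing q \<longleftrightarrow> (\<forall>w B. (\<forall>s. w s \<in> lp p \<and> lpnorm p (w s) \<le> B) \<longrightarrow> wnull sequentially p w \<longrightarrow> (\<lambda>s. q (w s)) \<longlonglongrightarrow> 0)"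

lemma vanishingI:
  "(\<And>w B. (\<And>s. w s \<in> lp p) \<Longrightarrow> (\<And>s. lpnorm p (w s) \<le> B) \<Longrightarrow> wnull sequentially p w \<Longrightarrow> (\<lambda>s. q (w s)) \<longlonglongrightarrow> 0) \<Longrightarrow> vanishing q"
  unfolding vanishing_def by blast

lemma vanishingD:
  "vanishing q \<Longrightarrow> (\<And>s. w s \<in> lp p) \<Longrightarrow> (\<And>s. lpnorm p (w s) \<le> B) \<Longrightarrow> wnull sequentially p w \<Longrightarrow> (\<lambda>s. q (w s)) \<longlonglongrightarrow> 0"
  unfolding vanishing_def by blast

lemma vanishing_functional:
  "bdd_op (lp p) (lpnorm p) (UNIV::complex set) cmod f \<Longrightarrow> vanishing (\<lambda>y. cmod (f y))"
  by (rule vanishingI, rule tendsto_norm_zero) (simp add: wnull_def)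

lemma vanishing_add: "vanishing q \<Longrightarrow> vanishing r \<Longrightarrow> vanishing (\<lambda>y. q y + r y)"
  by (rule vanishingI, rule tendsto_add_zero) (rule vanishingD; assumption)+

lemma vanishing_cmult: "vanishing q \<Longrightarrow> vanishing (\<lambda>y. c * q y)"
  by (rule vanishingI, rule tendsto_mult_right_zero) (rule vanishingD; assumption)

lemma vanishing_sum: "(\<And>i. i \<in> I \<Longrightarrow> vanishing (q i)) \<Longrightarrow> vanishing (\<lambda>y. \<Sum>i\<in>I. q i y)"
  by (induction I rule: infinite_finite_induct) (auto intro: vanishing_add simp: vanishing_def[of "\<lambda>y. 0"])

lemma vanishing_mono:
  assumes "vanishing q" "\<And>y. y \<in> lp p \<Longrightarrow> 0 \<le> r y \<and> r y \<le> q y" shows "vanishing r"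
  unfolding vanishing_def
proof (intro allI impI)
  fix w B assume w: "\<forall>s. w s \<in> lp p \<and> lpnorm p (w s) \<le> B" "wnull sequentially p w"
  have lim: "(\<lambda>s. q (w s)) \<longlonglongrightarrow> 0" by (rule vanishingD[OF assms(1) _ _ w(2), where B=B]) (use w(1) in auto)
  show "(\<lambda>s. r (w s)) \<longlonglongrightarrow> 0"
    by (rule tendsto_sandwich[OF _ _ tendsto_const lim]) (use assms(2) w in auto)
qed

text \<open>Dominated convergence for series. The domination is required only from \<open>R0\<close>
  on, since a given operator is controlled by all pieces except finitely many.\<close>

lemma vanishing_suminf:
  assumes q: "\<And>r. vanishing (q r)" "\<And>r y. y \<in> lp p \<Longrightarrow> 0 \<le> q r y" "\<And>r y. R0 \<le> r \<Longrightarrow> y \<in> lp p \<Longrightarrow> q r y \<le> \<beta> r * lpnorm p y"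
    and \<beta>: "summable \<beta>" "\<And>r. 0 \<le> \<beta> r"
  shows "\<And>y. y \<in> lp p \<Longrightarrow> summable (\<lambda>r. q r y)" "vanishing (\<lambda>y. \<Sum>r. q r y)"
proof -
  show sm: "summable (\<lambda>r. q r y)" if y: "y \<in> lp p" for y
    by (rule summable_comparison_test'[of "\<lambda>r. \<beta> r * lpnorm p y" R0]) (use q(2,3) y \<beta>(1) in \<open>auto intro: summable_mult2\<close>)
  show "vanishing (\<lambda>y. \<Sum>r. q r y)"
    unfolding vanishing_def
  proof (intro allI impI)
    fix w B assume w: "\<forall>s. w s \<in> lp p \<and> lpnorm p (w s) \<le> B" "wnull sequentially p w"
    have B: "0 \<le> B" using w(1) lpnorm_nonneg order_trans by blast
    show "(\<lambda>s. \<Sum>r. q r (w s)) \<longlonglongrightarrow> 0"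
    proof (rule tendstoI)
      fix \<epsilon> :: real assume \<epsilon>: "\<epsilon> > 0"
      have "(\<lambda>R. (\<Sum>r. \<beta> (r + R)) * B) \<longlonglongrightarrow> 0 * B"
        by (intro tendsto_mult tendsto_const suminf_exist_split2[OF \<beta>(1)])
      then have "eventually (\<lambda>R. (\<Sum>r. \<beta> (r + R)) * B < \<epsilon> / 2) sequentially" by (rule order_tendstoD) (use \<epsilon> in simp)
      then have "eventually (\<lambda>R. (\<Sum>r. \<beta> (r + R)) * B < \<epsilon> / 2 \<and> R0 \<le> R) sequentially"
        using eventually_ge_at_top by (rule eventually_conj)
      then obtain R where R: "(\<Sum>r. \<beta> (r + R)) * B < \<epsilon> / 2" "R0 \<le> R" by (auto simp: eventually_sequentially)
      have "vanishing (\<lambda>y. \<Sum>r<R. q r y)" by (rule vanishing_sum) (rule q(1))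
      then have "(\<lambda>s. \<Sum>r<R. q r (w s)) \<longlonglongrightarrow> 0" by (rule vanishingD[OF _ _ _ w(2), where B=B]) (use w(1) in auto)
      then have "eventually (\<lambda>s. dist (\<Sum>r<R. q r (w s)) 0 < \<epsilon> / 2) sequentially" by (rule tendstoD) (use \<epsilon> in simp)
      then show "eventually (\<lambda>s. dist (\<Sum>r. q r (w s)) 0 < \<epsilon>) sequentially"
      proof eventually_elim
        case (elim s)
        have ws: "w s \<in> lp p" "lpnorm p (w s) \<le> B" using w(1) by auto
        have sR: "summable (\<lambda>r. \<beta> (r + R))" using \<beta>(1) by (rule summable_ignore_initial_segment)
        have "(\<Sum>r. q (r + R) (w s)) \<le> (\<Sum>r. \<beta> (r + R) * B)"
        proof (rule suminf_le)
          show "q (r + R) (w s) \<le> \<beta> (r + R) * B" for r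
            using q(3)[of "r + R" "w s"] R(2) ws mult_left_mono[OF ws(2) \<beta>(2), of "r + R"] by simp
          show "summable (\<lambda>r. q (r + R) (w s))" using sm[OF ws(1)] by (rule summable_ignore_initial_segment)
          show "summable (\<lambda>r. \<beta> (r + R) * B)" using sR by (rule summable_mult2)
        qed
        also have "\<dots> = (\<Sum>r. \<beta> (r + R)) * B" using suminf_mult2[OF sR, of B] by simp
        finally have "(\<Sum>r. q (r + R) (w s)) < \<epsilon> / 2" using R(1) by simp
        moreover have "(\<Sum>r. q r (w s)) = (\<Sum>r. q (r + R) (w s)) + (\<Sum>r<R. q r (w s))"
          by (rule suminf_split_initial_segment[OF sm[OF ws(1)]])
        moreover have "0 \<le> (\<Sum>r. q r (w s))" using q(2) ws by (intro suminf_nonneg sm) auto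
        ultimately show ?case using elim by simp
      qed
    qed
  qed
qed

lemma block_criterion:
  assumes n: "strict_mono n" "n 0 = (0::nat)" and B: "0 \<le> B"
    and bd: "\<And>R. (\<Sum>r<R. lpnorm p (restr {n r..<n (Suc r)} y) powr p) \<le> B powr p"
  shows "y \<in> lp p" "lpnorm p y \<le> B"
proof -
  have fl: "restr {n r..<n (Suc r)} y \<in> lp p" for r by (rule finite_support_lp[of "n (Suc r)"]) (simp add: restr_def)
  have sec: "(\<Sum>i<n R. cmod (y i) powr p) \<le> (\<Sum>r<R. lpnorm p (restr {n r..<n (Suc r)} y) powr p)" for R
  proof (induction R)
    case (Suc R)
    have "n R \<le> n (Suc R)" using n(1) by (simp add: strict_mono_less_eq)
    then have "{..<n (Suc R)} = {..<n R} \<union> {n R..<n (Suc R)}" by auto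
    then have "(\<Sum>i<n (Suc R). cmod (y i) powr p) = (\<Sum>i<n R. cmod (y i) powr p) + (\<Sum>i\<in>{n R..<n (Suc R)}. cmod (y i) powr p)"
      by (simp add: sum.union_disjoint ivl_disj_int)
    also have "(\<Sum>i\<in>{n R..<n (Suc R)}. cmod (y i) powr p) = (\<Sum>i\<in>{n R..<n (Suc R)}. cmod (restr {n R..<n (Suc R)} y i) powr p)"
      by (intro sum.cong) (auto simp: restr_def)
    also have "\<dots> \<le> lpnorm p (restr {n R..<n (Suc R)} y) powr p" by (rule sum_powr_le_lpnorm[OF fl]) simp
    finally show ?case using Suc by simp
  qed (simp add: n)
  have "(\<Sum>i<k. cmod (y i) powr p) \<le> B powr p" for k
  proof -
    have "k \<le> n k" by (rule strict_mono_imp_increasing[OF n(1)])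
    then have "(\<Sum>i<k. cmod (y i) powr p) \<le> (\<Sum>i<n k. cmod (y i) powr p)" by (intro sum_mono2) auto
    then show ?thesis using sec[of k] bd[of k] by linarith
  qed
  then show "y \<in> lp p" "lpnorm p y \<le> B" using lp_criterion[OF B] by auto
qed

lemma sum_blocks_le:
  assumes n: "strict_mono n" and y: "y \<in> lp p" and F: "finite F"
  shows "(\<Sum>r\<in>F. lpnorm p (restr {n r..<n (Suc r)} y) powr p) \<le> lpnorm p y powr p"
proof (rule restr_disjoint_sum_le[OF y F])
  have "{n r..<n (Suc r)} \<inter> {n t..<n (Suc t)} = {}" if "r < t" for r t
  proof -
    have "n (Suc r) \<le> n t" using n that by (simp add: strict_mono_less_eq)
    then show ?thesis by auto
  qed
  then have "{n r..<n (Suc r)} \<inter> {n t..<n (Suc t)} = {}" if "r \<noteq> t" for r t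
    using that by (metis inf_commute nat_neq_iff)
  then show "disjoint_family_on (\<lambda>r. {n r..<n (Suc r)}) F" by (auto simp: disjoint_family_on_def)
qed

end

text \<open>The code of a pair is at least each of its entries, so the first \<open>R\<close> codes
  lie in a square of side \<open>R\<close>.\<close>

lemma sum_pairs_le:
  fixes h :: "nat \<Rightarrow> nat \<Rightarrow> real"
  assumes "\<And>j l. 0 \<le> h j l"
  shows "(\<Sum>r<R. h (fst (prod_decode r)) (snd (prod_decode r))) \<le> (\<Sum>j<R. \<Sum>l<R. h j l)"
proof -
  have inj: "inj_on prod_decode {..<R}" by (rule inj_on_subset[OF inj_prod_decode subset_UNIV])
  have sub: "prod_decode ` {..<R} \<subseteq> {..<R} \<times> {..<R}"
  proof (clarify)
    fix r j l assume r: "r < R" and d: "(j, l) = prod_decode r"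
    have "r = prod_encode (j, l)" by (simp add: d)
    then show "j \<in> {..<R} \<and> l \<in> {..<R}" using le_prod_encode_1[of j l] le_prod_encode_2[of l j] r by auto
  qed
  have "(\<Sum>r<R. h (fst (prod_decode r)) (snd (prod_decode r))) = (\<Sum>(j,l)\<in>prod_decode ` {..<R}. h j l)"
    by (simp add: sum.reindex[OF inj] case_prod_beta)
  also have "\<dots> \<le> (\<Sum>(j,l)\<in>{..<R} \<times> {..<R}. h j l)" using sub assms by (intro sum_mono2) auto
  also have "\<dots> = (\<Sum>j<R. \<Sum>l<R. h j l)" by (simp add: sum.cartesian_product)
  finally show ?thesis .
qed

lemma sum_pairs_ge:
  fixes h :: "nat \<Rightarrow> real"
  shows "(\<Sum>j<J. \<Sum>l<L. h (prod_encode (j, l))) = sum h (prod_encode ` ({..<J} \<times> {..<L}))"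
proof -
  have "inj_on prod_encode ({..<J} \<times> {..<L})" by (rule inj_on_subset[OF inj_prod_encode subset_UNIV])
  then show ?thesis by (simp add: sum.reindex sum.cartesian_product case_prod_beta)
qed

text \<open>Weights of total mass 1 over all piece numbers, hence of mass at most 1 over the pieces
  of any single copy.\<close>

definition half :: "nat \<Rightarrow> real" where "half r = (1/2) ^ Suc r"

lemma half_pos [simp]: "0 < half r" and half_sums: "half sums 1"
  using power_half_series by (simp_all add: half_def[abs_def])

lemma half_le_1: "half r \<le> 1"
  unfolding half_def by (rule power_le_one) auto

lemma sum_half_le: "finite F \<Longrightarrow> sum half F \<le> 1"
  using sum_le_suminf[of half F] half_sums by (auto simp: sums_iff less_imp_le)

lemma sum_half_row_le: "(\<Sum>l<L. half (prod_encode (j, l))) \<le> 1"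
proof -
  have "inj_on (\<lambda>l. prod_encode (j, l)) {..<L}" by (auto simp: inj_on_def)
  then have "(\<Sum>l<L. half (prod_encode (j, l))) = sum half ((\<lambda>l. prod_encode (j, l)) ` {..<L})" by (simp add: sum.reindex)
  then show ?thesis using sum_half_le[of "(\<lambda>l. prod_encode (j, l)) ` {..<L}"] by simp
qed

section \<open>Sums in the sense of l^p of subspaces of the ultrapower\<close>

context ultra
begin

text \<open>Membership and norm are read off the scalar sequence of norms, which makes Minkowski's
  inequality and the summation lemmas for l^p available.\<close>

definition psum :: "(nat \<Rightarrow> (nat \<Rightarrow> nat \<Rightarrow> complex) set) \<Rightarrow> (nat \<Rightarrow> nat \<Rightarrow> nat \<Rightarrow> complex) set" where
  "psum M = {m. (\<forall>j. m j \<in> M j) \<and> (\<lambda>j. complex_of_real (un (m j))) \<in> lp p}"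

definition pnorm :: "(nat \<Rightarrow> nat \<Rightarrow> nat \<Rightarrow> complex) \<Rightarrow> real" where
  "pnorm m = lpnorm p (\<lambda>j. complex_of_real (un (m j)))"

lemma psumD: "m \<in> psum M \<Longrightarrow> m j \<in> M j" by (simp add: psum_def)

lemma pnorm_nonneg [simp]: "0 \<le> pnorm m" by (simp add: pnorm_def)

lemma psum_criterion:
  assumes M: "\<And>j. M j \<subseteq> hat" and m: "\<And>j. m j \<in> M j" and B: "0 \<le> B" "\<And>J. (\<Sum>j<J. un (m j) powr p) \<le> B powr p"
  shows "m \<in> psum M" "pnorm m \<le> B"
proof -
  have "cmod (complex_of_real (un (m j))) = un (m j)" for j using m[of j] M[of j] haN(2) by auto
  then have "(\<Sum>i<n. cmod (complex_of_real (un (m i))) powr p) \<le> B powr p" for n using B(2)[of n] by simp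
  from lp_criterion[OF B(1) this] show "m \<in> psum M" "pnorm m \<le> B" using m by (auto simp: psum_def pnorm_def)
qed

lemma psum_sum_le:
  assumes "m \<in> psum M" "\<And>j. M j \<subseteq> hat" "finite F"
  shows "(\<Sum>j\<in>F. un (m j) powr p) \<le> pnorm m powr p"
proof -
  have "cmod (complex_of_real (un (m j))) = un (m j)" for j using psumD[OF assms(1), of j] assms(2)[of j] haN(2) by auto
  then show ?thesis using sum_powr_le_lpnorm[of "\<lambda>j. complex_of_real (un (m j))" F] assms(1,3) by (simp add: psum_def pnorm_def)
qed

lemma psum_coord_le:
  assumes "m \<in> psum M" "\<And>j. M j \<subseteq> hat" shows "un (m j) \<le> pnorm m"
  using psum_sum_le[OF assms, of "{j}"] powr_p_le_iff[of "un (m j)" "pnorm m"] haN(2)[of "m j"] psumD[OF assms(1), of j] assms(2)[of j] by auto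

lemma psum_mono:
  assumes M: "\<And>j. M j \<subseteq> hat" and M': "\<And>j. M' j \<subseteq> hat" and m: "m \<in> psum M" and m': "\<And>j. m' j \<in> M' j"
    and c: "0 \<le> c" "\<And>j. un (m' j) \<le> c * un (m j)"
  shows "m' \<in> psum M'" "pnorm m' \<le> c * pnorm m"
proof -
  have "(\<Sum>j<J. un (m' j) powr p) \<le> (c * pnorm m) powr p" for J
  proof -
    have "(\<Sum>j<J. un (m' j) powr p) \<le> (\<Sum>j<J. c powr p * un (m j) powr p)"
    proof (rule sum_mono)
      fix j
      have "un (m' j) powr p \<le> (c * un (m j)) powr p" using c(2)[of j] haN(2)[of "m' j"] m'[of j] M'[of j] p_gt_1 by (intro powr_mono2) auto
      then show "un (m' j) powr p \<le> c powr p * un (m j) powr p" using c(1) haN(2)[of "m j"] psumD[OF m, of j] M[of j] by (simp add: powr_mult subsetD)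
    qed
    also have "\<dots> \<le> c powr p * pnorm m powr p" unfolding sum_distrib_left[symmetric]
      by (intro mult_left_mono psum_sum_le[OF m M]) auto
    finally show ?thesis using c(1) by (simp add: powr_mult)
  qed
  then show "m' \<in> psum M'" "pnorm m' \<le> c * pnorm m" using psum_criterion[OF M' m', of "c * pnorm m"] c(1) by auto
qed

lemma seminormed_psum:
  assumes M: "\<And>j. M j \<subseteq> hat" and S: "\<And>j. csubspace (M j)"
  shows "seminormed (psum M) pnorm"
proof -
  have sM: "seminormed (M j) un" for j by (rule seminormed_subset[OF seminormed_hat S M])
  have add: "m + m' \<in> psum M \<and> pnorm (m + m') \<le> pnorm m + pnorm m'" if m: "m \<in> psum M" and m': "m' \<in> psum M" for m m'
  proof -
    let ?a = "\<lambda>j. complex_of_real (un (m j))" let ?b = "\<lambda>j. complex_of_real (un (m' j))"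
    have ab: "?a \<in> lp p" "?b \<in> lp p" using m m' by (auto simp: psum_def)
    have s: "(m + m') j \<in> M j" for j using csubspaceD(2)[OF S psumD[OF m] psumD[OF m']] by simp
    have nn: "0 \<le> un (m j)" "0 \<le> un (m' j)" "0 \<le> un ((m + m') j)" for j
      using seminormedD(2)[OF sM psumD[OF m]] seminormedD(2)[OF sM psumD[OF m']] seminormedD(2)[OF sM s] by auto
    have le: "cmod (complex_of_real (un ((m + m') j))) \<le> cmod ((?a + ?b) j)" for j
    proof -
      have "(?a + ?b) j = complex_of_real (un (m j) + un (m' j))" by simp
      then have "cmod ((?a + ?b) j) = un (m j) + un (m' j)" using nn[of j] by (simp only: norm_of_real)
      then show ?thesis using seminormedD(3)[OF sM psumD[OF m] psumD[OF m'], of j] nn[of j] by simp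
    qed
    have "(\<lambda>j. complex_of_real (un ((m + m') j))) \<in> lp p" "lpnorm p (\<lambda>j. complex_of_real (un ((m + m') j))) \<le> lpnorm p (?a + ?b)"
      by (rule lp_mono[OF lpS(2)[OF ab] le])+
    moreover have "lpnorm p (?a + ?b) \<le> lpnorm p ?a + lpnorm p ?b" by (rule lpD(3)[OF ab])
    ultimately show ?thesis using s unfolding psum_def pnorm_def by auto
  qed
  have sc: "c *\<^sub>C m \<in> psum M \<and> pnorm (c *\<^sub>C m) = cmod c * pnorm m" if m: "m \<in> psum M" for m c
  proof -
    let ?a = "\<lambda>j. complex_of_real (un (m j))"
    have a: "?a \<in> lp p" using m by (auto simp: psum_def)
    have s: "(c *\<^sub>C m) j \<in> M j" for j using csubspaceD(3)[OF S psumD[OF m]] by simp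
    have eq: "(\<lambda>j. complex_of_real (un ((c *\<^sub>C m) j))) = complex_of_real (cmod c) *\<^sub>C ?a"
      using seminormedD(4)[OF sM psumD[OF m]] by (simp add: fun_eq_iff)
    have "(\<lambda>j. complex_of_real (un ((c *\<^sub>C m) j))) \<in> lp p" "pnorm (c *\<^sub>C m) = cmod c * pnorm m"
      unfolding pnorm_def eq using lp_cscale[OF a, of "complex_of_real (cmod c)"] by simp_all
    then show ?thesis using s unfolding psum_def by blast
  qed
  have "0 \<in> psum M" using csubspaceD(1)[OF S] haN(5) lpS(1) by (simp add: psum_def zero_fun_def[symmetric])
  then show ?thesis using add sc by (simp add: seminormed_def csubspace_def)
qed

end

text \<open>The setting of the theorem with the operators enumerated by all naturals, repetitions
  allowed.\<close>

locale absorb = ultra +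
  fixes T :: "nat \<Rightarrow> (nat \<Rightarrow> complex) \<Rightarrow> nat \<Rightarrow> complex" and P :: "nat \<Rightarrow> (nat \<Rightarrow> nat \<Rightarrow> complex) \<Rightarrow> nat \<Rightarrow> nat \<Rightarrow> complex" and lam :: real
  assumes T: "\<And>a. bop (T a)" and lam: "1 \<le> lam"
    and P_bdd: "\<And>n. bdd_op (hatlp U p) (unorm U p) (hatlp U p) (unorm U p) (P n)"
    and P_idem: "\<And>n X. X \<in> hatlp U p \<Longrightarrow> unorm U p (P n (P n X) - P n X) = 0"
    and P_norm: "\<And>n X. X \<in> hatlp U p \<Longrightarrow> unorm U p (P n X) \<le> lam * unorm U p X"
    and P_comm: "\<And>n a X. X \<in> hatlp U p \<Longrightarrow> unorm U p (P n (hatop (T a) X) - hatop (T a) (P n X)) = 0"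
    and rng_cases: "\<And>n. fin_dim_mod (rng U p (P n)) (unorm U p) \<or> lambda_iso (rng U p (P n)) (unorm U p) (lp p) (lpnorm p) lam"
begin

text \<open>Every \<open>M\<^sub>n\<close> occurs infinitely often among the \<open>MM j\<close>, namely for \<open>j = prod_encode (n, i)\<close>.\<close>

abbreviation "MM \<equiv> \<lambda>j. rng U p (P (fst (prod_decode j)))"

lemma rng_hat: "rng U p (P n) \<subseteq> hat" by (auto simp: rng_def)

lemma rng_sub: "csubspace (rng U p (P n))" by (rule rng_csubspace[OF P_bdd])

lemma rng_T: "m \<in> rng U p (P n) \<Longrightarrow> hatop (T a) m \<in> rng U p (P n)"
  by (rule rng_invariant[OF P_bdd T P_comm])

lemma rng_decomposition:
  assumes "\<And>l. e l > 0"
  shows "\<exists>I b \<phi> \<psi> Sg. decomposition T (rng U p (P n)) (4 * lam) K e I b \<phi> \<psi> Sg"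
proof (cases "fin_dim_mod (rng U p (P n)) un")
  case True
  have l4: "1 \<le> 4 * lam" using lam by simp
  show ?thesis
  proof (rule decomposition_of_fin_dim[where T=T and K=K and e=e, OF T rng_hat rng_sub _ True l4 assms])
    show "hatop (T a) m \<in> rng U p (P n)" if "m \<in> rng U p (P n)" for a m by (rule rng_T[OF that])
    fix I b \<phi> \<psi> Sg assume "decomposition T (rng U p (P n)) (4 * lam) K e I b \<phi> \<psi> Sg"
    then show ?thesis by (intro exI)
  qed
next
  case False
  then obtain S R a b where iso: "iso_data (rng U p (P n)) un (lp p) (lpnorm p) S R a b" "a * b \<le> lam"
    using rng_cases[of n] by (auto simp: lambda_iso_def)
  show ?thesis
  proof (rule decomposition_of_lp_iso[where T=T and K=K and e=e, OF T rng_hat rng_sub _ iso lam assms])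
    show "hatop (T a) m \<in> rng U p (P n)" if "m \<in> rng U p (P n)" for a m by (rule rng_T[OF that])
    fix I b \<phi> \<psi> Sg assume "decomposition T (rng U p (P n)) (4 * lam) K e I b \<phi> \<psi> Sg"
    then show ?thesis by (intro exI)
  qed
qed

lemma seminormed_MM: "seminormed (psum MM) pnorm"
  by (rule seminormed_psum[OF rng_hat rng_sub])

definition hatA :: "nat \<Rightarrow> (nat \<Rightarrow> nat \<Rightarrow> nat \<Rightarrow> complex) \<Rightarrow> nat \<Rightarrow> nat \<Rightarrow> nat \<Rightarrow> complex" where
  "hatA a m = (\<lambda>j. hatop (T a) (m j))"

lemma hatA_psum:
  assumes M: "\<And>j. M j \<subseteq> hat" "\<And>j m. m \<in> M j \<Longrightarrow> hatop (T a) m \<in> M j" and m: "m \<in> psum M"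
    and C: "0 \<le> C" "\<And>x. x \<in> lp p \<Longrightarrow> lpnorm p (T a x) \<le> C * lpnorm p x"
  shows "hatA a m \<in> psum M" "pnorm (hatA a m) \<le> C * pnorm m"
proof -
  have mem: "hatA a m j \<in> M j" for j unfolding hatA_def by (rule M(2)[OF psumD[OF m]])
  have bd: "un (hatA a m j) \<le> C * un (m j)" for j
    unfolding hatA_def using hatop_bound[OF T C(2), of "m j"] psumD[OF m, of j] M(1) hat_upw by blast
  show "hatA a m \<in> psum M" "pnorm (hatA a m) \<le> C * pnorm m"
    by (rule psum_mono[OF M(1) M(1) m mem C(1) bd])+
qed

lemma clinear_hatA:
  assumes M: "\<And>j. M j \<subseteq> hat" shows "clinear_on (psum M) (hatA a)"
  unfolding clinear_on_def
proof (intro conjI ballI allI)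
  note lin = clinear_onD[OF clinear_hatop[OF T]]
  have up: "m j \<in> upw p" if "m \<in> psum M" for m j using psumD[OF that] M hat_upw by blast
  fix m assume m: "m \<in> psum M"
  show "hatA a (m + m') = hatA a m + hatA a m'" if "m' \<in> psum M" for m'
    by (rule ext) (simp add: hatA_def lin(1)[OF up[OF m] up[OF that]])
  show "hatA a (c *\<^sub>C m) = c *\<^sub>C hatA a m" for c
    by (rule ext) (simp add: hatA_def lin(2)[OF up[OF m]])
qed

end

text \<open>Piece \<open>r\<close> is piece \<open>l\<close> of copy \<open>j\<close> for
  \<open>r = prod_encode (j, l)\<close>, placed in the block from \<open>n r\<close> to
  \<open>n (Suc r)\<close>. It controls the operators with index below \<open>\<nu> + r\<close>: the
  first \<nu> operators are controlled by all pieces, with total error of order \<delta>, and every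
  other operator by all but finitely many. The auxiliary families are fixed by equations so that
  they can be named in the assumptions.\<close>

locale glue = absorb +
  fixes \<delta> :: real and \<nu> :: nat and I :: "nat \<Rightarrow> nat \<Rightarrow> nat set" and b :: "nat \<Rightarrow> nat \<Rightarrow> nat \<Rightarrow> nat \<Rightarrow> complex"
    and \<phi> \<psi> :: "nat \<Rightarrow> nat \<Rightarrow> nat \<Rightarrow> (nat \<Rightarrow> nat \<Rightarrow> complex) \<Rightarrow> complex"
    and Sg :: "nat \<Rightarrow> (nat \<Rightarrow> nat \<Rightarrow> complex) \<Rightarrow> nat \<Rightarrow> nat \<Rightarrow> complex"
    and n :: "nat \<Rightarrow> nat" and v z :: "nat \<Rightarrow> nat \<Rightarrow> nat \<Rightarrow> complex"
    and Jr Lr :: "nat \<Rightarrow> nat" and Ir :: "nat \<Rightarrow> nat set" and br :: "nat \<Rightarrow> nat \<Rightarrow> nat \<Rightarrow> nat \<Rightarrow> complex" and fr gr :: "nat \<Rightarrow> nat \<Rightarrow> (nat \<Rightarrow> nat \<Rightarrow> complex) \<Rightarrow> complex" and er :: "nat \<Rightarrow> real"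
  assumes \<delta>: "0 < \<delta>" "\<delta> \<le> 1"
    and Jr_def: "Jr r = fst (prod_decode r)" and Lr_def: "Lr r = snd (prod_decode r)" and Ir_def: "Ir r = I (Jr r) (Lr r)"
    and br_def: "br r = b (Jr r)" and fr_def: "fr r = \<phi> (Jr r) (Lr r)" and gr_def: "gr r = \<psi> (Jr r) (Lr r)" and er_def: "er r = \<delta> * half r"
    and dec: "\<And>j. decomposition T (MM j) (4 * lam) (\<lambda>l. \<nu> + prod_encode (j, l)) (\<lambda>l. er (prod_encode (j, l))) (I j) (b j) (\<phi> j) (\<psi> j) (Sg j)"
    and n: "strict_mono n" "n 0 = 0"
    and supp: "\<And>r i s. i \<in> Ir r \<Longrightarrow> s < n r \<or> n (Suc r) \<le> s \<Longrightarrow> v r i s = 0 \<and> z r i s = 0"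
    and pA: "\<And>r m. m \<in> MM (Jr r) \<Longrightarrow> lpnorm p (comb (v r) (Ir r) (\<lambda>i. fr r i m)) \<le> unorm U p (comb (br r) (Ir r) (\<lambda>i. fr r i m)) + er r * unorm U p m"
    and pB: "\<And>r y. y \<in> lp p \<Longrightarrow> unorm U p (comb (br r) (Ir r) (\<lambda>i. cpair (z r i) y)) \<le> (2 * lam * (4 * lam) + er r) * lpnorm p y"
    and pC: "\<And>r m. m \<in> MM (Jr r) \<Longrightarrow> unorm U p (comb (br r) (Ir r) (\<lambda>i. cpair (z r i) (comb (v r) (Ir r) (\<lambda>i. fr r i m)))
        - comb (br r) (Ir r) (\<lambda>i. gr r i (comb (br r) (Ir r) (\<lambda>i. fr r i m)))) \<le> er r * unorm U p m"
    and pD: "\<And>r a m. a < \<nu> + r \<Longrightarrow> m \<in> MM (Jr r) \<Longrightarrow> lpnorm p (T a (comb (v r) (Ir r) (\<lambda>i. fr r i m)) - comb (v r) (Ir r) (\<lambda>i. fr r i (hatop (T a) m))) \<le> (er r + er r) * unorm U p m"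
    and pE: "\<And>r a y. a < \<nu> + r \<Longrightarrow> y \<in> lp p \<Longrightarrow> unorm U p (hatop (T a) (comb (br r) (Ir r) (\<lambda>i. cpair (z r i) y)) - comb (br r) (Ir r) (\<lambda>i. cpair (z r i) (T a y))) \<le> (2 * lam * er r + er r) * lpnorm p y"
begin

definition "C0 = 4 * lam"
definition "vr r m = comb (v r) (Ir r) (\<lambda>i. fr r i (m (Jr r)))"
definition "ur r y = comb (br r) (Ir r) (\<lambda>i. cpair (z r i) y)"
text \<open>The least \<open>r\<close> with \<open>s < n (Suc r)\<close> is the block containing
  \<open>s\<close>; \<open>V\<close> is assembled coordinate by coordinate, without a convergence
  question.\<close>

definition "V m = (\<lambda>s. vr (LEAST r. s < n (Suc r)) m s)"
definition "W y = (\<lambda>j. Sg j (\<lambda>l i. cpair (z (prod_encode (j, l)) i) y))"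
abbreviation "blk r \<equiv> {n r..<n (Suc r)}"
definition "gf j l m = comb (b j) (I j l) (\<lambda>i. \<psi> j l i (comb (b j) (I j l) (\<lambda>i. \<phi> j l i m)))"

lemma C0: "4 \<le> C0" using lam by (simp add: C0_def)

lemmas decD = dec[unfolded decomposition_def C0_def[symmetric]]

lemma dec_b: "b j i \<in> MM j" by (rule decD[THEN conjunct2, THEN conjunct1, rule_format])
lemma dec_phi: "bdd_op (MM j) un UNIV cmod (\<phi> j l i)" by (rule decD[THEN conjunct2, THEN conjunct2, THEN conjunct1, rule_format])
lemma dec_sum_f: "m \<in> MM j \<Longrightarrow> (\<Sum>l<L. un (comb (b j) (I j l) (\<lambda>i. \<phi> j l i m)) powr p) \<le> (C0 * un m) powr p" by (rule decD[THEN conjunct2, THEN conjunct2, THEN conjunct2, THEN conjunct2, THEN conjunct1, rule_format])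
lemma dec_gf: "m \<in> MM j \<Longrightarrow> (\<lambda>L. un (m - (\<Sum>l<L. gf j l m))) \<longlonglongrightarrow> 0" unfolding gf_def by (rule decD[THEN conjunct2, THEN conjunct2, THEN conjunct2, THEN conjunct2, THEN conjunct2, THEN conjunct2, THEN conjunct1, rule_format])

definition "dsm j c \<longleftrightarrow> summable (\<lambda>l. un (comb (b j) (I j l) (c l)) powr p)"

lemma dec_Sg:
  assumes "dsm j c"
  shows "Sg j c \<in> MM j" "(\<lambda>L. un (Sg j c - (\<Sum>l<L. comb (b j) (I j l) (c l)))) \<longlonglongrightarrow> 0"
    "un (Sg j c) powr p \<le> C0 powr p * (\<Sum>l. un (comb (b j) (I j l) (c l)) powr p)"
  using decD[of j, THEN conjunct2, THEN conjunct2, THEN conjunct2, THEN conjunct2, THEN conjunct2, THEN conjunct2, THEN conjunct2, THEN conjunct2, THEN conjunct2, THEN conjunct1, rule_format, of c] assms[unfolded dsm_def] by auto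

lemma dec_Sg_add:
  assumes "dsm j c" "dsm j d" shows "Sg j (c + d) = Sg j c + Sg j d"
proof -
  note * = decD[of j, THEN conjunct2, THEN conjunct2, THEN conjunct2, THEN conjunct2, THEN conjunct2, THEN conjunct2, THEN conjunct2, THEN conjunct2, THEN conjunct2, THEN conjunct2, THEN conjunct1]
  from *[THEN spec, of c, THEN spec, of d] dec_Sg(1)[OF assms(1)] dec_Sg(1)[OF assms(2)] assms[unfolded dsm_def]
  show ?thesis by simp
qed

lemma dec_Sg_cscale:
  assumes "dsm j c" shows "Sg j (k *\<^sub>C c) = k *\<^sub>C Sg j c"
proof -
  note * = decD[of j, THEN conjunct2, THEN conjunct2, THEN conjunct2, THEN conjunct2, THEN conjunct2, THEN conjunct2, THEN conjunct2, THEN conjunct2, THEN conjunct2, THEN conjunct2, THEN conjunct2]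
  from *[THEN spec, of c, THEN spec, of k] assms[unfolded dsm_def] show ?thesis by simp
qed

lemma er_pos: "0 < er r" using \<delta> by (simp add: er_def)
lemma er_le_half: "er r \<le> half r" using \<delta> mult_right_mono[of \<delta> 1 "half r"] by (simp add: er_def less_imp_le)
lemma er_le_1: "er r \<le> 1" using er_le_half half_le_1 order_trans by blast
lemma er_sums: "er sums \<delta>" using sums_mult[OF half_sums, of \<delta>] by (simp add: er_def[abs_def])

lemma sum_er_row_le: "(\<Sum>l<L. er (prod_encode (j, l))) \<le> \<delta>"
  using mult_left_mono[OF sum_half_row_le[of j L], of \<delta>] \<delta> by (simp add: er_def sum_distrib_left)

lemma enc: "Jr (prod_encode (j, l)) = j" "Lr (prod_encode (j, l)) = l" "Ir (prod_encode (j, l)) = I j l" "br (prod_encode (j, l)) = b j"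
  "fr (prod_encode (j, l)) = \<phi> j l" "gr (prod_encode (j, l)) = \<psi> j l"
  by (simp_all add: Jr_def Lr_def Ir_def br_def fr_def gr_def)

lemma seminormed_MMj: "seminormed (MM j) un" by (rule seminormed_subset[OF seminormed_hat rng_sub rng_hat])

lemma MM_up: "m \<in> MM j \<Longrightarrow> m \<in> upw p" using rng_hat hat_upw by blast

lemma br_MM: "br r i \<in> MM (Jr r)" by (simp add: br_def dec_b)

lemma ur_MM: "ur r y \<in> MM (Jr r)" unfolding ur_def by (rule comb_mem[OF rng_sub br_MM])

lemma v_lp: "i \<in> Ir r \<Longrightarrow> v r i \<in> lp p" by (rule finite_support_lp[of "n (Suc r)"]) (use supp in blast)

lemma comb_v_lp: "comb (v r) (Ir r) c \<in> lp p" by (rule comb_mem[OF lpD(1) v_lp])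

lemma vr_lp: "vr r m \<in> lp p" unfolding vr_def by (rule comb_v_lp)

lemma comb_v_supp: "s \<notin> blk r \<Longrightarrow> comb (v r) (Ir r) c s = 0"
  unfolding comb_def sum_fun_apply using supp by (intro sum.neutral) auto

lemma cpair_blk: "i \<in> Ir r \<Longrightarrow> cpair (z r i) y = cpair (z r i) (restr (blk r) y)"
  unfolding cpair_def using supp by (intro sum.cong) (auto simp: restr_def not_less)

lemma ur_blk: "ur r y = ur r (restr (blk r) y)"
  unfolding ur_def comb_def
proof (rule sum.cong[OF refl])
  fix i assume "i \<in> Ir r"
  then have "cpair (z r i) y = cpair (z r i) (restr (blk r) y)" by (rule cpair_blk)
  then show "cpair (z r i) y *\<^sub>C br r i = cpair (z r i) (restr (blk r) y) *\<^sub>C br r i" by (rule arg_cong)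
qed

lemma restr_V: "restr (blk r) (V m) = vr r m"
proof
  fix s
  show "restr (blk r) (V m) s = vr r m s"
  proof (cases "s \<in> blk r")
    case True
    have "(LEAST r. s < n (Suc r)) = r"
    proof (rule Least_equality)
      show "s < n (Suc r)" using True by simp
      fix t assume t: "s < n (Suc t)"
      show "r \<le> t"
      proof (rule ccontr)
        assume "\<not> r \<le> t"
        then have "n (Suc t) \<le> n r" using n(1) by (simp add: strict_mono_less_eq)
        then show False using t True by simp
      qed
    qed
    then show ?thesis using True by (simp add: restr_def V_def)
  next
    case False
    then show ?thesis using comb_v_supp by (auto simp: restr_def vr_def)
  qed
qed

lemma clinear_fr: "clinear_on (MM (Jr r)) (fr r i)" using bdd_opD(1)[OF dec_phi] by (simp add: fr_def)

lemma clinear_coord: "clinear_on (psum M) (\<lambda>m. m j)" by (simp add: clinear_on_def)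

lemma clinear_vr: "clinear_on (psum MM) (vr r)"
  unfolding vr_def[abs_def]
  by (intro clinear_comb clinear_on_compose[OF clinear_coord clinear_fr] image_subsetI) (rule psumD[where M=MM])

lemma clinear_V: "clinear_on (psum MM) V"
  unfolding clinear_on_def using clinear_onD[OF clinear_vr] by (simp add: V_def fun_eq_iff)

definition "CV = 4 * (C0 + 1)"

lemma add_powr_le: "0 \<le> x \<Longrightarrow> 0 \<le> y \<Longrightarrow> (x + y) powr p \<le> 2 powr p * (x powr p + y powr p)"
proof -
  assume xy: "0 \<le> x" "0 \<le> y"
  have "(x + y) powr p \<le> (2 * max x y) powr p" using xy p_gt_1 by (intro powr_mono2) auto
  also have "\<dots> = 2 powr p * max x y powr p" using xy by (simp add: powr_mult)
  also have "max x y powr p \<le> x powr p + y powr p" by (simp add: max_def)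
  finally show ?thesis by simp
qed

text \<open>The blocks are disjoint, so p-th powers of norms of pieces add up. They are regrouped by
  copies, and within a copy the decomposition bounds the sum. The factor 4 in \<open>CV\<close> is
  two applications of the factor 2: one separates the localization error, one combines the bounds of
  both parts.\<close>

lemma V_bound:
  assumes m: "m \<in> psum MM" shows "V m \<in> lp p" "lpnorm p (V m) \<le> CV * pnorm m"
proof -
  have CV0: "0 \<le> CV" using C0 by (simp add: CV_def)
  have mj: "m j \<in> MM j" for j by (rule psumD[OF m])
  have u0: "0 \<le> un (m j)" for j by (rule seminormedD(2)[OF seminormed_MMj mj])
  \<comment> \<open>The error appears with weight \<open>half\<close> to the first power: as
    \<open>er r \<le> 1\<close> and p > 1, raising it to the power p only decreases it.\<close>
  define h where "h j l = 2 powr p * (un (comb (b j) (I j l) (\<lambda>i. \<phi> j l i (m j))) powr p + half (prod_encode (j, l)) * un (m j) powr p)" for j l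
  have h0: "0 \<le> h j l" for j l unfolding h_def by (intro mult_nonneg_nonneg add_nonneg_nonneg) (auto simp: less_imp_le)
  have one: "lpnorm p (vr r m) powr p \<le> h (Jr r) (Lr r)" for r
  proof -
    have r: "prod_encode (Jr r, Lr r) = r" by (simp add: Jr_def Lr_def)
    have c0: "0 \<le> un (comb (br r) (Ir r) (\<lambda>i. fr r i (m (Jr r))))"
      by (rule seminormedD(2)[OF seminormed_MMj comb_mem[OF rng_sub br_MM]])
    have "lpnorm p (vr r m) powr p \<le> (un (comb (br r) (Ir r) (\<lambda>i. fr r i (m (Jr r)))) + er r * un (m (Jr r))) powr p"
      unfolding vr_def using pA[OF mj] p_gt_1 by (intro powr_mono2) auto
    also have "\<dots> \<le> 2 powr p * (un (comb (br r) (Ir r) (\<lambda>i. fr r i (m (Jr r)))) powr p + (er r * un (m (Jr r))) powr p)"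
      by (rule add_powr_le[OF c0]) (use er_pos[of r] u0[of "Jr r"] in simp)
    also have "(er r * un (m (Jr r))) powr p \<le> half r * un (m (Jr r)) powr p"
    proof -
      have "er r powr p \<le> er r powr 1" using er_pos[of r] er_le_1[of r] p_gt_1 by (intro powr_mono') auto
      then have "er r powr p \<le> half r" using er_pos[of r] er_le_half[of r] by simp
      then show ?thesis using er_pos[of r] u0[of "Jr r"] by (simp add: powr_mult mult_right_mono)
    qed
    finally show ?thesis unfolding h_def r by (simp add: br_def Ir_def fr_def)
  qed
  have row: "(\<Sum>l<R. h j l) \<le> CV powr p * un (m j) powr p" for j R
  proof -
    have "(\<Sum>l<R. h j l) = 2 powr p * ((\<Sum>l<R. un (comb (b j) (I j l) (\<lambda>i. \<phi> j l i (m j))) powr p) + (\<Sum>l<R. half (prod_encode (j, l))) * un (m j) powr p)"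
      by (simp add: h_def sum.distrib sum_distrib_left sum_distrib_right distrib_left)
    also have "\<dots> \<le> 2 powr p * ((C0 * un (m j)) powr p + 1 * un (m j) powr p)"
      by (intro mult_left_mono add_mono dec_sum_f[OF mj] mult_right_mono sum_half_row_le) auto
    also have "\<dots> = 2 powr p * (C0 powr p + 1) * un (m j) powr p" using C0 u0[of j] by (simp add: powr_mult algebra_simps)
    also have "\<dots> \<le> 2 powr p * (2 powr p * (C0 + 1) powr p) * un (m j) powr p"
    proof (intro mult_right_mono mult_left_mono)
      have "C0 powr p \<le> (C0 + 1) powr p" "1 powr p \<le> (C0 + 1) powr p" using C0 p_gt_1 powr_mono2[of p C0 "C0 + 1"] powr_mono2[of p 1 "C0 + 1"] by simp_all
      moreover have "2 powr 1 \<le> 2 powr p" using p_gt_1 by (intro powr_mono) auto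
      then have "2 * (C0 + 1) powr p \<le> 2 powr p * (C0 + 1) powr p" by (intro mult_right_mono) auto
      ultimately show "C0 powr p + 1 \<le> 2 powr p * (C0 + 1) powr p" by simp
    qed auto
    also have "2 powr p * (2 powr p * (C0 + 1) powr p) = CV powr p"
    proof -
      have "CV = 2 * (2 * (C0 + 1))" by (simp add: CV_def)
      then show ?thesis using C0 by (simp only: powr_mult)
    qed
    finally show ?thesis .
  qed
  have "(\<Sum>r<R. lpnorm p (restr (blk r) (V m)) powr p) \<le> (CV * pnorm m) powr p" for R
  proof -
    have "(\<Sum>r<R. lpnorm p (restr (blk r) (V m)) powr p) \<le> (\<Sum>r<R. h (Jr r) (Lr r))"
      unfolding restr_V by (intro sum_mono one)
    also have "\<dots> \<le> (\<Sum>j<R. \<Sum>l<R. h j l)" unfolding Jr_def Lr_def by (rule sum_pairs_le[OF h0])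
    also have "\<dots> \<le> (\<Sum>j<R. CV powr p * un (m j) powr p)" by (intro sum_mono row)
    also have "\<dots> \<le> CV powr p * pnorm m powr p" unfolding sum_distrib_left[symmetric]
      by (intro mult_left_mono psum_sum_le[OF m rng_hat]) auto
    finally show ?thesis using CV0 by (simp add: powr_mult)
  qed
  then show "V m \<in> lp p" "lpnorm p (V m) \<le> CV * pnorm m" using block_criterion[OF n, of "CV * pnorm m" "V m"] CV0 by auto
qed

lemma V_partial:
  assumes m: "m \<in> psum MM" shows "V m - (\<Sum>r<R. vr r m) = restr {n R..} (V m)"
proof -
  have "(\<Sum>r<R. restr (blk r) y) = restr {..<n R} y" for y :: "nat \<Rightarrow> complex"
  proof (induction R)
    case 0
    then show ?case by (auto simp: n restr_def)
  next
    case (Suc R)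
    have "n R \<le> n (Suc R)" using n(1) by (simp add: strict_mono_less_eq)
    then have "restr {..<n R} y + restr (blk R) y = restr {..<n (Suc R)} y" by (auto simp: restr_def)
    then show ?case using Suc by simp
  qed
  from this[of "V m"] have "(\<Sum>r<R. vr r m) = restr {..<n R} (V m)" by (simp only: restr_V)
  moreover have "V m - restr {..<n R} (V m) = restr {n R..} (V m)" using restr_split[of "V m" "n R"] by (simp add: algebra_simps)
  ultimately show ?thesis by simp
qed

definition "Bu = 2 * lam * C0 + 1"

lemma Bu: "0 \<le> Bu" using lam C0 by (simp add: Bu_def)

lemma ur_bound: assumes y: "y \<in> lp p" shows "un (ur r y) \<le> Bu * lpnorm p (restr (blk r) y)"
proof -
  have "un (ur r y) \<le> (2 * lam * (4 * lam) + er r) * lpnorm p (restr (blk r) y)"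
    unfolding ur_blk[of r y] unfolding ur_def by (rule pB[OF restr_lp[OF y]])
  also have "\<dots> \<le> Bu * lpnorm p (restr (blk r) y)" using er_le_1[of r] by (intro mult_right_mono) (auto simp: Bu_def C0_def)
  finally show ?thesis .
qed

lemma ur_sum_le:
  assumes y: "y \<in> lp p" and F: "finite F" shows "(\<Sum>r\<in>F. un (ur r y) powr p) \<le> (Bu * lpnorm p y) powr p"
proof -
  have "(\<Sum>r\<in>F. un (ur r y) powr p) \<le> (\<Sum>r\<in>F. Bu powr p * lpnorm p (restr (blk r) y) powr p)"
  proof (rule sum_mono)
    fix r
    have "un (ur r y) powr p \<le> (Bu * lpnorm p (restr (blk r) y)) powr p"
      using ur_bound[OF y, of r] seminormedD(2)[OF seminormed_MMj ur_MM] p_gt_1 by (intro powr_mono2) auto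
    then show "un (ur r y) powr p \<le> Bu powr p * lpnorm p (restr (blk r) y) powr p" using Bu by (simp add: powr_mult)
  qed
  also have "\<dots> \<le> Bu powr p * lpnorm p y powr p" unfolding sum_distrib_left[symmetric]
    by (intro mult_left_mono sum_blocks_le[OF n(1) y F]) auto
  finally show ?thesis using Bu by (simp add: powr_mult)
qed

definition "cc y j = (\<lambda>l i. cpair (z (prod_encode (j, l)) i) y)"

lemma ur_cc: "comb (b j) (I j l) (cc y j l) = ur (prod_encode (j, l)) y"
  by (simp add: ur_def cc_def enc)

lemma W_cc: "W y j = Sg j (cc y j)" by (simp add: W_def cc_def)

lemma cc_add: "cc (x + y) j = cc x j + cc y j" and cc_cscale: "cc (k *\<^sub>C x) j = k *\<^sub>C cc x j"
  using clinear_onD[OF clinear_cpair[of UNIV]] by (simp_all add: cc_def fun_eq_iff)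

lemma cc_dsm: assumes y: "y \<in> lp p" shows "dsm j (cc y j)"
  unfolding dsm_def ur_cc
proof (rule summableI_nonneg_bounded)
  fix L
  have "inj_on (\<lambda>l. prod_encode (j, l)) {..<L}" by (auto simp: inj_on_def)
  then have "(\<Sum>l<L. un (ur (prod_encode (j, l)) y) powr p) = (\<Sum>r\<in>(\<lambda>l. prod_encode (j, l)) ` {..<L}. un (ur r y) powr p)"
    by (simp add: sum.reindex)
  then show "(\<Sum>l<L. un (ur (prod_encode (j, l)) y) powr p) \<le> (Bu * lpnorm p y) powr p" using ur_sum_le[OF y] by simp
qed auto

lemma W_MM: "y \<in> lp p \<Longrightarrow> W y j \<in> MM j"
  unfolding W_cc by (rule dec_Sg(1)[OF cc_dsm])

lemma W_partial: "y \<in> lp p \<Longrightarrow> (\<lambda>L. un (W y j - (\<Sum>l<L. ur (prod_encode (j, l)) y))) \<longlonglongrightarrow> 0"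
  using dec_Sg(2)[OF cc_dsm] by (simp add: W_cc ur_cc)

lemma clinear_W: "clinear_on (lp p) W"
  unfolding clinear_on_def
proof (intro conjI ballI allI)
  fix x assume x: "x \<in> lp p"
  show "W (x + y) = W x + W y" if "y \<in> lp p" for y
  proof
    fix j show "W (x + y) j = (W x + W y) j"
      unfolding W_cc cc_add using dec_Sg_add[OF cc_dsm[OF x] cc_dsm[OF that]] by (simp add: W_cc)
  qed
  show "W (c *\<^sub>C x) = c *\<^sub>C W x" for c
  proof
    fix j show "W (c *\<^sub>C x) j = (c *\<^sub>C W x) j"
      unfolding W_cc cc_cscale using dec_Sg_cscale[OF cc_dsm[OF x]] by (simp add: W_cc)
  qed
qed

definition "CW = C0 * Bu"

lemma CW: "0 \<le> CW" using C0 Bu by (simp add: CW_def)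

text \<open>Each \<open>ur r\<close> sees only its own block, so the p-th powers of all pieces
  together are bounded by that of \<open>y\<close>; summation within each copy costs the factor
  \<open>C0\<close>.\<close>

lemma W_bound:
  assumes y: "y \<in> lp p" shows "W y \<in> psum MM" "pnorm (W y) \<le> CW * lpnorm p y"
proof -
  have sm: "summable (\<lambda>l. un (ur (prod_encode (j, l)) y) powr p)" for j using cc_dsm[OF y, of j] by (simp add: dsm_def ur_cc)
  have "(\<Sum>j<J. un (W y j) powr p) \<le> (CW * lpnorm p y) powr p" for J
  proof -
    have "(\<Sum>j<J. un (W y j) powr p) \<le> (\<Sum>j<J. C0 powr p * (\<Sum>l. un (ur (prod_encode (j, l)) y) powr p))"
      by (intro sum_mono) (use dec_Sg(3)[OF cc_dsm[OF y]] in \<open>simp add: W_cc ur_cc\<close>)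
    also have "\<dots> = C0 powr p * (\<Sum>l. \<Sum>j<J. un (ur (prod_encode (j, l)) y) powr p)"
      by (simp add: sum_distrib_left[symmetric] suminf_sum sm)
    also have "(\<Sum>l. \<Sum>j<J. un (ur (prod_encode (j, l)) y) powr p) \<le> (Bu * lpnorm p y) powr p"
    proof (rule suminf_le_const)
      show "summable (\<lambda>l. \<Sum>j<J. un (ur (prod_encode (j, l)) y) powr p)" by (intro summable_sum sm)
      fix L
      have "(\<Sum>l<L. \<Sum>j<J. un (ur (prod_encode (j, l)) y) powr p) = (\<Sum>j<J. \<Sum>l<L. un (ur (prod_encode (j, l)) y) powr p)" by (rule sum.swap)
      also have "\<dots> = (\<Sum>r\<in>prod_encode ` ({..<J} \<times> {..<L}). un (ur r y) powr p)" by (rule sum_pairs_ge)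
      also have "\<dots> \<le> (Bu * lpnorm p y) powr p" by (rule ur_sum_le[OF y]) simp
      finally show "(\<Sum>l<L. \<Sum>j<J. un (ur (prod_encode (j, l)) y) powr p) \<le> (Bu * lpnorm p y) powr p" .
    qed
    finally show ?thesis using C0 Bu by (simp add: CW_def powr_mult mult_left_mono)
  qed
  then show "W y \<in> psum MM" "pnorm (W y) \<le> CW * lpnorm p y"
    using psum_criterion[OF rng_hat W_MM[OF y], of "CW * lpnorm p y"] CW by auto
qed

text \<open>For estimates on partial sums with two remainders that tend to 0.\<close>

lemma limit_le:
  fixes x c :: real assumes "\<And>L. x \<le> f L + c + g L" "f \<longlonglongrightarrow> 0" "g \<longlonglongrightarrow> 0" shows "x \<le> c"
proof -
  have "(\<lambda>L. f L + c + g L) \<longlonglongrightarrow> 0 + c + 0" by (intro tendsto_intros assms)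
  then show ?thesis using LIMSEQ_le_const[of "\<lambda>L. f L + c + g L" c x] assms(1) by auto
qed

text \<open>By disjointness of the blocks, \<open>ur r\<close> applied to \<open>V m\<close> is
  \<open>ur r\<close> applied to the r-th piece alone, which is the composition of g and f up to
  \<open>er r\<close>. These compositions sum to the identity, and the errors within one copy sum to
  at most \<delta>.\<close>

lemma WV_bound:
  assumes m: "m \<in> psum MM" shows "pnorm (W (V m) - m) \<le> \<delta> * pnorm m"
proof (rule psum_mono(2)[OF rng_hat rng_hat m])
  note MMS = csubspaceD[OF rng_sub]
  have mj: "m j \<in> MM j" for j by (rule psumD[OF m])
  have Vl: "V m \<in> lp p" by (rule V_bound[OF m])
  show "(W (V m) - m) j \<in> MM j" for j using MMS(5)[OF W_MM[OF Vl] mj] by simp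
  show "un ((W (V m) - m) j) \<le> \<delta> * un (m j)" for j
  proof (rule limit_le)
    note MMN = seminormedD[OF seminormed_MMj[of j]] note MMS = csubspaceD[OF MMN(1)]
    have gfM: "gf j l (m j) \<in> MM j" for l unfolding gf_def by (rule comb_mem[OF rng_sub dec_b])
    have uM: "ur (prod_encode (j, l)) (V m) \<in> MM j" for l using ur_MM[of "prod_encode (j, l)"] by (simp add: enc)
    have su: "(\<Sum>l<L. ur (prod_encode (j, l)) (V m)) \<in> MM j" "(\<Sum>l<L. gf j l (m j)) \<in> MM j" for L
      by (intro csubspace_sum[OF rng_sub] uM gfM)+
    have piece: "un (ur (prod_encode (j, l)) (V m) - gf j l (m j)) \<le> er (prod_encode (j, l)) * un (m j)" for l
    proof -
      have "ur (prod_encode (j, l)) (V m) = ur (prod_encode (j, l)) (vr (prod_encode (j, l)) m)"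
        using ur_blk[of "prod_encode (j, l)" "V m"] by (simp only: restr_V)
      then show ?thesis using pC[of "m j" "prod_encode (j, l)"] mj[of j] by (simp add: ur_def vr_def gf_def enc)
    qed
    fix L
    have "un (W (V m) j - m j) \<le> un (W (V m) j - (\<Sum>l<L. ur (prod_encode (j, l)) (V m))) + un ((\<Sum>l<L. ur (prod_encode (j, l)) (V m)) - m j)"
      by (intro MMN(10) W_MM Vl su mj)
    moreover have "un ((\<Sum>l<L. ur (prod_encode (j, l)) (V m)) - m j) \<le> un ((\<Sum>l<L. ur (prod_encode (j, l)) (V m)) - (\<Sum>l<L. gf j l (m j))) + un ((\<Sum>l<L. gf j l (m j)) - m j)"
      by (intro MMN(10) su mj)
    moreover have "un ((\<Sum>l<L. gf j l (m j)) - m j) = un (m j - (\<Sum>l<L. gf j l (m j)))" by (intro MMN(8) su mj)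
    moreover have "un ((\<Sum>l<L. ur (prod_encode (j, l)) (V m)) - (\<Sum>l<L. gf j l (m j))) \<le> \<delta> * un (m j)"
    proof -
      have "un (\<Sum>l<L. ur (prod_encode (j, l)) (V m) - gf j l (m j)) \<le> (\<Sum>l<L. un (ur (prod_encode (j, l)) (V m) - gf j l (m j)))"
        by (rule seminormed_sum[OF seminormed_MMj[of j]]) (intro MMS(5) uM gfM)
      also have "\<dots> \<le> (\<Sum>l<L. er (prod_encode (j, l)) * un (m j))" by (intro sum_mono piece)
      also have "\<dots> \<le> \<delta> * un (m j)" unfolding sum_distrib_right[symmetric] by (intro mult_right_mono sum_er_row_le MMN(2) mj)
      finally show ?thesis unfolding sum_subtractf .
    qed
    ultimately show "un ((W (V m) - m) j) \<le> un (W (V m) j - (\<Sum>l<L. ur (prod_encode (j, l)) (V m))) + \<delta> * un (m j) + un (m j - (\<Sum>l<L. gf j l (m j)))"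
      by simp
  next
    show "(\<lambda>L. un (W (V m) j - (\<Sum>l<L. ur (prod_encode (j, l)) (V m)))) \<longlonglongrightarrow> 0" by (rule W_partial[OF Vl])
    show "(\<lambda>L. un (m j - (\<Sum>l<L. gf j l (m j)))) \<longlonglongrightarrow> 0" by (rule dec_gf[OF mj])
  qed
qed (use \<delta> in simp)

section \<open>Intertwining defects of V and W\<close>

definition "qV a r m = lpnorm p (T a (vr r m) - vr r (hatA a m))"
definition "qW a r y = un (hatop (T a) (ur r y) - ur r (T a y))"

lemma qV_le:
  assumes m: "m \<in> psum MM" and a: "a < \<nu> + r" shows "qV a r m \<le> 2 * er r * pnorm m"
proof -
  have "qV a r m \<le> (er r + er r) * un (m (Jr r))"
    unfolding qV_def vr_def hatA_def by (rule pD[OF a psumD[OF m]])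
  also have "\<dots> \<le> (er r + er r) * pnorm m" using er_pos[of r] psum_coord_le[OF m rng_hat] by (intro mult_left_mono) auto
  finally show ?thesis by simp
qed

lemma qW_le:
  assumes y: "y \<in> lp p" and a: "a < \<nu> + r" shows "qW a r y \<le> (2 * lam + 1) * er r * lpnorm p y"
  using pE[OF a y] unfolding qW_def ur_def by (simp add: algebra_simps)

lemma hatA_MM: "m \<in> psum MM \<Longrightarrow> hatA a m \<in> psum MM"
proof -
  assume m: "m \<in> psum MM"
  obtain C where C: "C > 0" "\<And>x. x \<in> lp p \<Longrightarrow> lpnorm p (T a x) \<le> C * lpnorm p x" using T by (rule bopE) (rule that)
  show ?thesis by (rule hatA_psum(1)[OF rng_hat rng_T m less_imp_le[OF C(1)] C(2)])
qed

lemma er_summable: "summable er" using er_sums by (rule sums_summable)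

lemma qV_summable:
  assumes m: "m \<in> psum MM" shows "summable (\<lambda>r. qV a r m)"
proof (rule summable_comparison_test'[of "\<lambda>r. 2 * er r * pnorm m" "Suc a"])
  show "summable (\<lambda>r. 2 * er r * pnorm m)" by (intro summable_mult2 summable_mult er_summable)
  show "norm (qV a r m) \<le> 2 * er r * pnorm m" if "Suc a \<le> r" for r using qV_le[OF m, of a r] that by (simp add: qV_def)
qed

text \<open>On the first \<open>R\<close> pieces the defect is the sum of the piece defects. Both
  remainders are tails of vectors of l^p, so they vanish in the limit.\<close>

lemma dV_le:
  assumes m: "m \<in> psum MM" shows "lpnorm p (T a (V m) - V (hatA a m)) \<le> (\<Sum>r. qV a r m)"
proof -
  obtain C where C: "C > 0" "\<And>x. x \<in> lp p \<Longrightarrow> lpnorm p (T a x) \<le> C * lpnorm p x" using T by (rule bopE) (rule that)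
  note lin = clinear_on_rules[OF bopD(1)[OF T] lpD(1)]
  have Am: "hatA a m \<in> psum MM" by (rule hatA_MM[OF m])
  have Vl: "V m \<in> lp p" "V (hatA a m) \<in> lp p" using V_bound(1) m Am by auto
  show ?thesis
  proof (rule limit_le)
    fix R
    have s1: "(\<Sum>r<R. vr r m) \<in> lp p" "(\<Sum>r<R. vr r (hatA a m)) \<in> lp p" by (intro csubspace_sum[OF lpD(1)] vr_lp)+
    have Ts: "T a (\<Sum>r<R. vr r m) = (\<Sum>r<R. T a (vr r m))" by (rule lin(4)[OF vr_lp])
    have 1: "lpnorm p (T a (V m) - T a (\<Sum>r<R. vr r m)) \<le> C * lpnorm p (restr {n R..} (V m))"
      using C(2)[OF restr_lp[OF Vl(1)], of "{n R..}"] lin(3)[OF Vl(1) s1(1), of a] by (simp add: V_partial[OF m])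
    have 2: "lpnorm p ((\<Sum>r<R. vr r (hatA a m)) - V (hatA a m)) = lpnorm p (restr {n R..} (V (hatA a m)))"
      using lpD(8)[OF s1(2) Vl(2)] by (simp add: V_partial[OF Am])
    have 3: "lpnorm p (T a (\<Sum>r<R. vr r m) - (\<Sum>r<R. vr r (hatA a m))) \<le> (\<Sum>r. qV a r m)"
    proof -
      have "lpnorm p (\<Sum>r<R. T a (vr r m) - vr r (hatA a m)) \<le> (\<Sum>r<R. lpnorm p (T a (vr r m) - vr r (hatA a m)))"
        by (rule seminormed_sum[OF seminormed_lp]) (intro lpS(5) bopD[OF T] vr_lp)
      also have "\<dots> \<le> (\<Sum>r. qV a r m)" unfolding qV_def[symmetric]
        by (rule sum_le_suminf[OF qV_summable[OF m]]) (auto simp: qV_def)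
      finally show ?thesis unfolding Ts sum_subtractf .
    qed
    have "lpnorm p (T a (V m) - V (hatA a m)) \<le> lpnorm p (T a (V m) - T a (\<Sum>r<R. vr r m)) + lpnorm p (T a (\<Sum>r<R. vr r m) - V (hatA a m))"
      by (intro lpD(10) bopD[OF T] Vl s1)
    moreover have "lpnorm p (T a (\<Sum>r<R. vr r m) - V (hatA a m)) \<le> lpnorm p (T a (\<Sum>r<R. vr r m) - (\<Sum>r<R. vr r (hatA a m))) + lpnorm p ((\<Sum>r<R. vr r (hatA a m)) - V (hatA a m))"
      by (intro lpD(10) bopD[OF T] Vl s1)
    ultimately show "lpnorm p (T a (V m) - V (hatA a m)) \<le> C * lpnorm p (restr {n R..} (V m)) + (\<Sum>r. qV a r m) + lpnorm p (restr {n R..} (V (hatA a m)))"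
      using 1 2 3 by linarith
  next
    have t: "(\<lambda>R. lpnorm p (restr {n R..} x)) \<longlonglongrightarrow> 0" if "x \<in> lp p" for x
      using LIMSEQ_subseq_LIMSEQ[OF tail_tendsto[OF that] n(1)] by (simp add: o_def)
    show "(\<lambda>R. C * lpnorm p (restr {n R..} (V m))) \<longlonglongrightarrow> 0" by (rule tendsto_mult_right_zero[OF t[OF Vl(1)]])
    show "(\<lambda>R. lpnorm p (restr {n R..} (V (hatA a m)))) \<longlonglongrightarrow> 0" by (rule t[OF Vl(2)])
  qed
qed

lemma qW_nonneg: "0 \<le> qW a r y"
  unfolding qW_def by (rule seminormedD(2)[OF seminormed_MMj csubspaceD(5)[OF rng_sub rng_T[OF ur_MM] ur_MM]])

lemma qW_summable:
  assumes y: "y \<in> lp p" shows "summable (\<lambda>r. qW a r y)"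
proof (rule summable_comparison_test'[of "\<lambda>r. (2 * lam + 1) * er r * lpnorm p y" "Suc a"])
  show "summable (\<lambda>r. (2 * lam + 1) * er r * lpnorm p y)" by (intro summable_mult2 summable_mult er_summable)
  show "norm (qW a r y) \<le> (2 * lam + 1) * er r * lpnorm p y" if "Suc a \<le> r" for r using qW_le[OF y, of a r] that qW_nonneg[of a r y] by simp
qed

lemma dW_coord_le:
  assumes y: "y \<in> lp p" shows "un ((hatA a (W y) - W (T a y)) j) \<le> (\<Sum>l. qW a (prod_encode (j, l)) y)"
    "summable (\<lambda>l. qW a (prod_encode (j, l)) y)"
proof -
  note MMN = seminormedD[OF seminormed_MMj[of j]] note MMS = csubspaceD[OF MMN(1)]
  obtain C where C: "C > 0" "\<And>x. x \<in> lp p \<Longrightarrow> lpnorm p (T a x) \<le> C * lpnorm p x" using T by (rule bopE) (rule that)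
  have inj: "inj (\<lambda>l. prod_encode (j, l))" by (auto simp: inj_on_def)
  show sm: "summable (\<lambda>l. qW a (prod_encode (j, l)) y)"
    using summable_reindex[OF qW_summable[OF y] inj] qW_nonneg by (simp add: o_def)
  have Ty: "T a y \<in> lp p" by (rule bopD(2)[OF T y])
  have uM: "ur (prod_encode (j, l)) x \<in> MM j" for l x using ur_MM[of "prod_encode (j, l)"] by (simp add: enc)
  have su: "(\<Sum>l<L. ur (prod_encode (j, l)) x) \<in> MM j" for L x by (intro csubspace_sum[OF rng_sub] uM)
  show "un ((hatA a (W y) - W (T a y)) j) \<le> (\<Sum>l. qW a (prod_encode (j, l)) y)"
  proof (rule limit_le)
    fix L
    define s where "s = (\<Sum>l<L. ur (prod_encode (j, l)) y)"
    define s' where "s' = (\<Sum>l<L. ur (prod_encode (j, l)) (T a y))"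
    have sM: "s \<in> MM j" "s' \<in> MM j" unfolding s_def s'_def by (rule su)+
    have WM: "W y j \<in> MM j" "W (T a y) j \<in> MM j" by (intro W_MM y Ty)+
    have 1: "un (hatop (T a) (W y j) - hatop (T a) s) \<le> C * un (W y j - s)"
      using hatop_bound[OF T C(2), of "W y j - s"] clinear_on_rules(3)[OF clinear_hatop[OF T] upN(1) MM_up[OF WM(1)] MM_up[OF sM(1)], of a]
        MM_up[OF MMS(5)[OF WM(1) sM(1)]] by simp
    have 2: "un (s' - W (T a y) j) = un (W (T a y) j - s')" by (rule MMN(8)[OF sM(2) WM(2)])
    have 3: "un (hatop (T a) s - s') \<le> (\<Sum>l. qW a (prod_encode (j, l)) y)"
    proof -
      have Ts: "hatop (T a) s = (\<Sum>l<L. hatop (T a) (ur (prod_encode (j, l)) y))"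
        unfolding s_def by (rule clinear_on_rules(4)[OF clinear_hatop[OF T] upN(1)]) (rule MM_up[OF uM])
      have "un (\<Sum>l<L. hatop (T a) (ur (prod_encode (j, l)) y) - ur (prod_encode (j, l)) (T a y)) \<le> (\<Sum>l<L. qW a (prod_encode (j, l)) y)"
        unfolding qW_def by (rule seminormed_sum[OF seminormed_MMj[of j]]) (intro MMS(5) rng_T uM)
      also have "\<dots> \<le> (\<Sum>l. qW a (prod_encode (j, l)) y)" by (rule sum_le_suminf[OF sm]) (auto simp: qW_nonneg)
      finally show ?thesis unfolding Ts s'_def sum_subtractf .
    qed
    have "un (hatop (T a) (W y j) - W (T a y) j) \<le> un (hatop (T a) (W y j) - hatop (T a) s) + un (hatop (T a) s - W (T a y) j)"
      by (intro MMN(10) rng_T WM sM)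
    moreover have "un (hatop (T a) s - W (T a y) j) \<le> un (hatop (T a) s - s') + un (s' - W (T a y) j)"
      by (intro MMN(10) rng_T WM sM)
    ultimately show "un ((hatA a (W y) - W (T a y)) j) \<le> C * un (W y j - (\<Sum>l<L. ur (prod_encode (j, l)) y)) + (\<Sum>l. qW a (prod_encode (j, l)) y) + un (W (T a y) j - (\<Sum>l<L. ur (prod_encode (j, l)) (T a y)))"
      using 1 2 3 unfolding s_def s'_def by (simp add: hatA_def)
  next
    show "(\<lambda>L. C * un (W y j - (\<Sum>l<L. ur (prod_encode (j, l)) y))) \<longlonglongrightarrow> 0" by (rule tendsto_mult_right_zero[OF W_partial[OF y]])
    show "(\<lambda>L. un (W (T a y) j - (\<Sum>l<L. ur (prod_encode (j, l)) (T a y)))) \<longlonglongrightarrow> 0" by (rule W_partial[OF Ty])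
  qed
qed

text \<open>The l^1-norm dominates the l^p-norm. Piece defects can therefore be added up without
  exploiting disjointness.\<close>

lemma sum_powr_le_powr_sum:
  assumes "\<And>j. j \<in> F \<Longrightarrow> 0 \<le> x j" shows "(\<Sum>j\<in>F. x j powr p) \<le> (\<Sum>j\<in>F. x j) powr p"
proof -
  define S where "S = (\<Sum>j\<in>F. x j)"
  have S0: "0 \<le> S" unfolding S_def by (rule sum_nonneg) (rule assms)
  have "x j powr p \<le> x j * S powr (p - 1)" if "j \<in> F" "finite F" for j
  proof -
    have "x j \<le> S" unfolding S_def by (rule member_le_sum) (use that assms in auto)
    then have "x j powr (p - 1) \<le> S powr (p - 1)" using assms[OF that(1)] p_gt_1 by (intro powr_mono2) auto
    then have "x j * x j powr (p - 1) \<le> x j * S powr (p - 1)" using assms[OF that(1)] by (intro mult_left_mono) auto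
    moreover have "x j * x j powr (p - 1) = x j powr p" using powr_add[of "x j" 1 "p - 1"] assms[OF that(1)] by simp
    ultimately show ?thesis by simp
  qed
  then have "(\<Sum>j\<in>F. x j powr p) \<le> S * S powr (p - 1)"
    by (cases "finite F") (auto simp: S_def sum_distrib_right intro: sum_mono)
  also have "S * S powr (p - 1) = S powr p" using powr_add[of S 1 "p - 1"] S0 by simp
  finally show ?thesis by (simp add: S_def)
qed

lemma dW_le:
  assumes y: "y \<in> lp p" shows "pnorm (hatA a (W y) - W (T a y)) \<le> (\<Sum>r. qW a r y)"
proof (rule psum_criterion(2)[OF rng_hat])
  have Ty: "T a y \<in> lp p" by (rule bopD(2)[OF T y])
  show mem: "(hatA a (W y) - W (T a y)) j \<in> MM j" for j
    using csubspaceD(5)[OF rng_sub rng_T[OF W_MM[OF y]] W_MM[OF Ty]] by (simp add: hatA_def)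
  have nn: "0 \<le> un ((hatA a (W y) - W (T a y)) j)" for j by (rule seminormedD(2)[OF seminormed_MMj mem])
  show "0 \<le> (\<Sum>r. qW a r y)" by (intro suminf_nonneg qW_summable y qW_nonneg)
  fix J
  have "(\<Sum>j<J. un ((hatA a (W y) - W (T a y)) j)) \<le> (\<Sum>j<J. \<Sum>l. qW a (prod_encode (j, l)) y)" by (intro sum_mono dW_coord_le(1)[OF y])
  also have "\<dots> = (\<Sum>l. \<Sum>j<J. qW a (prod_encode (j, l)) y)" by (intro suminf_sum[symmetric] dW_coord_le(2)[OF y])
  also have "\<dots> \<le> (\<Sum>r. qW a r y)"
  proof (rule suminf_le_const)
    show "summable (\<lambda>l. \<Sum>j<J. qW a (prod_encode (j, l)) y)" by (intro summable_sum dW_coord_le(2)[OF y])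
    fix L
    have "(\<Sum>l<L. \<Sum>j<J. qW a (prod_encode (j, l)) y) = (\<Sum>j<J. \<Sum>l<L. qW a (prod_encode (j, l)) y)" by (rule sum.swap)
    also have "\<dots> = (\<Sum>r\<in>prod_encode ` ({..<J} \<times> {..<L}). qW a r y)" by (rule sum_pairs_ge)
    also have "\<dots> \<le> (\<Sum>r. qW a r y)" by (rule sum_le_suminf[OF qW_summable[OF y]]) (auto simp: qW_nonneg)
    finally show "(\<Sum>l<L. \<Sum>j<J. qW a (prod_encode (j, l)) y) \<le> (\<Sum>r. qW a r y)" .
  qed
  finally have "(\<Sum>j<J. un ((hatA a (W y) - W (T a y)) j)) powr p \<le> (\<Sum>r. qW a r y) powr p"
    using p_gt_1 nn by (intro powr_mono2) (auto intro: sum_nonneg)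
  then show "(\<Sum>j<J. un ((hatA a (W y) - W (T a y)) j) powr p) \<le> (\<Sum>r. qW a r y) powr p"
    using sum_powr_le_powr_sum[of "{..<J}" "\<lambda>j. un ((hatA a (W y) - W (T a y)) j)"] nn by (meson order_trans)
qed

lemma cpair_z_bdd: assumes "i \<in> Ir r" shows "bdd_op (lp p) (lpnorm p) (UNIV::complex set) cmod (cpair (z r i))"
proof (rule bdd_opI[where C="\<Sum>s<n (Suc r). cmod (z r i s)"])
  show "clinear_on (lp p) (cpair (z r i))" by (rule clinear_cpair)
  fix y assume y: "y \<in> lp p"
  have "cpair (z r i) y = (\<Sum>s<n (Suc r). z r i s * y s)" by (rule cpair_eq) (use supp[OF assms] in auto)
  then have "cmod (cpair (z r i) y) \<le> (\<Sum>s<n (Suc r). cmod (z r i s) * lpnorm p y)"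
    by (simp only:) (rule sum_norm_le, simp add: norm_mult mult_left_mono coord_le_lpnorm[OF y])
  then show "cmod (cpair (z r i) y) \<le> (\<Sum>s<n (Suc r). cmod (z r i s)) * lpnorm p y" by (simp add: sum_distrib_right)
qed simp

text \<open>A single piece has finite rank: its defect is bounded by finitely many absolute values
  of functionals of \<open>y\<close>. This needs no control of the operator \<open>a\<close> by the
  piece.\<close>

lemma qW_vanishing: "vanishing (qW a r)"
proof (rule vanishing_mono)
  show "vanishing (\<lambda>y. (\<Sum>i\<in>Ir r. un (hatop (T a) (br r i)) * cmod (cpair (z r i) y)) + (\<Sum>i\<in>Ir r. un (br r i) * cmod (cpair (z r i) (T a y))))"
    by (intro vanishing_add vanishing_sum vanishing_cmult vanishing_functional functional_compose_bop[OF _ T] cpair_z_bdd)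
  fix y assume y: "y \<in> lp p"
  have bu: "br r i \<in> upw p" for i by (rule MM_up[OF br_MM])
  have "hatop (T a) (ur r y) = (\<Sum>i\<in>Ir r. cpair (z r i) y *\<^sub>C hatop (T a) (br r i))"
    unfolding ur_def comb_def
    using clinear_on_rules(4)[OF clinear_hatop[OF T] upN(1), of "Ir r" "\<lambda>i. cpair (z r i) y *\<^sub>C br r i" a] clinear_onD(2)[OF clinear_hatop[OF T] bu] upS(3)[OF bu] by simp
  then have 1: "un (hatop (T a) (ur r y)) \<le> (\<Sum>i\<in>Ir r. un (hatop (T a) (br r i)) * cmod (cpair (z r i) y))"
    using seminormed_sum_cscale[OF seminormed_MMj[of "Jr r"], of "Ir r" "\<lambda>i. hatop (T a) (br r i)" "\<lambda>i. cpair (z r i) y"] rng_T[OF br_MM] by (simp add: mult.commute)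
  have 2: "un (ur r (T a y)) \<le> (\<Sum>i\<in>Ir r. un (br r i) * cmod (cpair (z r i) (T a y)))"
    unfolding ur_def comb_def using seminormed_sum_cscale[OF seminormed_MMj[of "Jr r"], of "Ir r" "br r" "\<lambda>i. cpair (z r i) (T a y)"] br_MM by (simp add: mult.commute)
  have "qW a r y \<le> un (hatop (T a) (ur r y)) + un (ur r (T a y))"
    unfolding qW_def by (rule seminormedD(7)[OF seminormed_MMj rng_T[OF ur_MM] ur_MM])
  then show "0 \<le> qW a r y \<and> qW a r y \<le> (\<Sum>i\<in>Ir r. un (hatop (T a) (br r i)) * cmod (cpair (z r i) y)) + (\<Sum>i\<in>Ir r. un (br r i) * cmod (cpair (z r i) (T a y)))"
    using 1 2 qW_nonneg[of a r y] by linarith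
qed

text \<open>The finite-rank argument again, for pieces of \<open>V\<close> precomposed with a
  bounded map \<open>L\<close>; it is used for \<open>W\<close> and for the shifted map
  \<open>tau\<close> after \<open>W\<close>.\<close>

lemma qV_vanishing:
  assumes L: "clinear_on (lp p) L" "\<And>y. y \<in> lp p \<Longrightarrow> L y \<in> psum MM" "\<And>y. y \<in> lp p \<Longrightarrow> pnorm (L y) \<le> CL * lpnorm p y"
  shows "vanishing (\<lambda>y. qV a r (L y))"
proof (rule vanishing_mono)
  obtain C where C: "C > 0" "\<And>x. x \<in> lp p \<Longrightarrow> lpnorm p (T a x) \<le> C * lpnorm p x" using T by (rule bopE) (rule that)
  have fb: "bdd_op (lp p) (lpnorm p) (UNIV::complex set) cmod (\<lambda>y. fr r i (G y))"
    if G: "clinear_on (lp p) G" "\<And>y. y \<in> lp p \<Longrightarrow> G y \<in> MM (Jr r)" "\<And>y. y \<in> lp p \<Longrightarrow> un (G y) \<le> D * lpnorm p y" for G D i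
  proof -
    obtain k where k: "k > 0" "\<And>m. m \<in> MM (Jr r) \<Longrightarrow> cmod (fr r i m) \<le> k * un m"
      unfolding fr_def by (rule bdd_opE[OF dec_phi]) (auto simp: seminormedD(2)[OF seminormed_MMj])
    show ?thesis
    proof (rule bdd_opI[where C="k * D"])
      show "clinear_on (lp p) (\<lambda>y. fr r i (G y))" by (rule clinear_on_compose[OF G(1) clinear_fr]) (use G(2) in auto)
      fix y assume y: "y \<in> lp p"
      show "cmod (fr r i (G y)) \<le> k * D * lpnorm p y"
        using order_trans[OF k(2)[OF G(2)[OF y]] mult_left_mono[OF G(3)[OF y] less_imp_le[OF k(1)]]] by (simp add: mult.assoc)
    qed simp
  qed
  have G1: "clinear_on (lp p) (\<lambda>y. L y (Jr r))" by (rule clinear_on_compose[OF L(1) clinear_coord]) (use L(2) in blast)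
  have G2: "L y (Jr r) \<in> MM (Jr r)" "un (L y (Jr r)) \<le> CL * lpnorm p y" if "y \<in> lp p" for y
    using psumD[OF L(2)[OF that]] order_trans[OF psum_coord_le[OF L(2)[OF that] rng_hat] L(3)[OF that]] by auto
  have H1: "clinear_on (lp p) (\<lambda>y. hatop (T a) (L y (Jr r)))"
    by (rule clinear_on_compose[OF G1 clinear_hatop[OF T]]) (use G2(1) MM_up in blast)
  have H2: "hatop (T a) (L y (Jr r)) \<in> MM (Jr r)" "un (hatop (T a) (L y (Jr r))) \<le> C * CL * lpnorm p y" if y: "y \<in> lp p" for y
  proof -
    show "hatop (T a) (L y (Jr r)) \<in> MM (Jr r)" by (rule rng_T[OF G2(1)[OF y]])
    show "un (hatop (T a) (L y (Jr r))) \<le> C * CL * lpnorm p y"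
      using order_trans[OF hatop_bound[OF T C(2) MM_up[OF G2(1)[OF y]]] mult_left_mono[OF G2(2)[OF y] less_imp_le[OF C(1)]]] by (simp add: mult.assoc)
  qed
  show "vanishing (\<lambda>y. (\<Sum>i\<in>Ir r. lpnorm p (T a (v r i)) * cmod (fr r i (L y (Jr r)))) + (\<Sum>i\<in>Ir r. lpnorm p (v r i) * cmod (fr r i (hatop (T a) (L y (Jr r))))))"
    by (intro vanishing_add vanishing_sum vanishing_cmult vanishing_functional fb[OF G1 G2] fb[OF H1 H2])
  fix y assume y: "y \<in> lp p"
  define m where "m = L y (Jr r)"
  have "T a (comb (v r) (Ir r) c) = (\<Sum>i\<in>Ir r. c i *\<^sub>C T a (v r i))" for c
    unfolding comb_def
    using clinear_on_rules(4)[OF bopD(1)[OF T] lpD(1), of "Ir r" "\<lambda>i. c i *\<^sub>C v r i" a] clinear_onD(2)[OF bopD(1)[OF T] v_lp] lpS(3)[OF v_lp] by simp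
  then have 1: "lpnorm p (T a (vr r (L y))) \<le> (\<Sum>i\<in>Ir r. lpnorm p (T a (v r i)) * cmod (fr r i m))"
    using seminormed_sum_cscale[OF seminormed_lp, of "Ir r" "\<lambda>i. T a (v r i)" "\<lambda>i. fr r i m"] bopD(2)[OF T v_lp] by (simp add: vr_def m_def mult.commute)
  have 2: "lpnorm p (vr r (hatA a (L y))) \<le> (\<Sum>i\<in>Ir r. lpnorm p (v r i) * cmod (fr r i (hatop (T a) m)))"
    using seminormed_sum_cscale[OF seminormed_lp, of "Ir r" "v r" "\<lambda>i. fr r i (hatop (T a) m)"] v_lp by (simp add: vr_def m_def comb_def hatA_def mult.commute)
  have "qV a r (L y) \<le> lpnorm p (T a (vr r (L y))) + lpnorm p (vr r (hatA a (L y)))"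
    unfolding qV_def by (intro lpD(7) bopD[OF T] vr_lp)
  then show "0 \<le> qV a r (L y) \<and> qV a r (L y) \<le> (\<Sum>i\<in>Ir r. lpnorm p (T a (v r i)) * cmod (fr r i (L y (Jr r)))) + (\<Sum>i\<in>Ir r. lpnorm p (v r i) * cmod (fr r i (hatop (T a) (L y (Jr r)))))"
    using 1 2 unfolding m_def[symmetric] by (simp add: qV_def)
qed

text \<open>From index \<open>Suc a\<close> on, the piece defects are dominated by the summable
  errors \<open>er\<close>; the finitely many earlier ones vanish individually.\<close>

lemma QW_vanishing: "vanishing (\<lambda>y. \<Sum>r. qW a r y)"
proof (rule vanishing_suminf(2)[where \<beta>="\<lambda>r. (2 * lam + 1) * er r" and ?R0.0="Suc a"])
  show "summable (\<lambda>r. (2 * lam + 1) * er r)" by (intro summable_mult er_summable)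
qed (use qW_vanishing qW_nonneg qW_le er_pos lam in \<open>auto simp: less_imp_le\<close>)

lemma QV_vanishing:
  assumes L: "clinear_on (lp p) L" "\<And>y. y \<in> lp p \<Longrightarrow> L y \<in> psum MM" "\<And>y. y \<in> lp p \<Longrightarrow> pnorm (L y) \<le> CL * lpnorm p y" and CL: "0 \<le> CL"
  shows "vanishing (\<lambda>y. \<Sum>r. qV a r (L y))"
proof (rule vanishing_suminf(2)[where \<beta>="\<lambda>r. 2 * er r * CL" and ?R0.0="Suc a"])
  show "vanishing (\<lambda>y. qV a r (L y))" for r by (rule qV_vanishing[OF L])
  show "0 \<le> qV a r (L y)" for r y by (simp add: qV_def)
  show "qV a r (L y) \<le> 2 * er r * CL * lpnorm p y" if "Suc a \<le> r" "y \<in> lp p" for r y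
    using order_trans[OF qV_le[OF L(2)[OF that(2)], of a r] mult_left_mono[OF L(3)[OF that(2)], of "2 * er r"]] that er_pos[of r] by (simp add: mult.assoc)
  show "summable (\<lambda>r. 2 * er r * CL)" by (intro summable_mult2 summable_mult er_summable)
  show "0 \<le> 2 * er r * CL" for r using CL er_pos[of r] by simp
qed

lemma QW_le:
  assumes y: "y \<in> lp p" and a: "a < \<nu>" shows "(\<Sum>r. qW a r y) \<le> (2 * lam + 1) * \<delta> * lpnorm p y"
proof -
  have s: "(\<lambda>r. (2 * lam + 1) * er r * lpnorm p y) sums ((2 * lam + 1) * \<delta> * lpnorm p y)" by (intro sums_mult2 sums_mult er_sums)
  have "(\<Sum>r. qW a r y) \<le> (\<Sum>r. (2 * lam + 1) * er r * lpnorm p y)"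
    by (rule suminf_le[OF _ qW_summable[OF y] sums_summable[OF s]]) (rule qW_le[OF y], use a in simp)
  then show ?thesis using s by (simp add: sums_iff)
qed

lemma QV_le:
  assumes m: "m \<in> psum MM" and a: "a < \<nu>" shows "(\<Sum>r. qV a r m) \<le> 2 * \<delta> * pnorm m"
proof -
  have s: "(\<lambda>r. 2 * er r * pnorm m) sums (2 * \<delta> * pnorm m)" by (intro sums_mult2 sums_mult er_sums)
  have "(\<Sum>r. qV a r m) \<le> (\<Sum>r. 2 * er r * pnorm m)"
    by (rule suminf_le[OF _ qV_summable[OF m] sums_summable[OF s]]) (rule qV_le[OF m], use a in simp)
  then show ?thesis using s by (simp add: sums_iff)
qed

end

section \<open>Absorption\<close>

context absorb
begin

text \<open>\<open>localized_piece\<close> works beyond any starting point, so the pieces can be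
  placed one after another: choice for each piece and each starting point, then recursion on the
  piece number.\<close>

lemma glue_exists:
  assumes \<delta>: "0 < \<delta>" "\<delta> \<le> 1"
  obtains I b \<phi> \<psi> Sg n v z Jr Lr Ir br fr gr er where "glue p U T P lam \<delta> \<nu> I b \<phi> \<psi> Sg n v z Jr Lr Ir br fr gr er"
proof -
  define er where "er r = \<delta> * half r" for r
  have er: "er r > 0" for r using \<delta> by (simp add: er_def)
  define Q where "Q j X = decomposition T (MM j) (4 * lam) (\<lambda>l. \<nu> + prod_encode (j, l)) (\<lambda>l. er (prod_encode (j, l)))
     (fst X) (fst (snd X)) (fst (snd (snd X))) (fst (snd (snd (snd X)))) (snd (snd (snd (snd X))))" for j X
  have "\<forall>j. \<exists>X. Q j X"
  proof
    fix j
    have "\<exists>I b \<phi> \<psi> Sg. decomposition T (MM j) (4 * lam) (\<lambda>l. \<nu> + prod_encode (j, l)) (\<lambda>l. er (prod_encode (j, l))) I b \<phi> \<psi> Sg"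
      by (rule rng_decomposition) (rule er)
    then obtain I b \<phi> \<psi> Sg where "decomposition T (MM j) (4 * lam) (\<lambda>l. \<nu> + prod_encode (j, l)) (\<lambda>l. er (prod_encode (j, l))) I b \<phi> \<psi> Sg"
      by (elim exE)
    then have "Q j (I, b, \<phi>, \<psi>, Sg)" by (simp only: Q_def fst_conv snd_conv)
    then show "\<exists>X. Q j X" by (rule exI)
  qed
  from choice[OF this] obtain X where X: "\<forall>j. Q j (X j)" by (elim exE)
  define I where "I j = fst (X j)" for j
  define b where "b j = fst (snd (X j))" for j
  define \<phi> where "\<phi> j = fst (snd (snd (X j)))" for j
  define \<psi> where "\<psi> j = fst (snd (snd (snd (X j))))" for j
  define Sg where "Sg j = snd (snd (snd (snd (X j))))" for j
  have dec: "decomposition T (MM j) (4 * lam) (\<lambda>l. \<nu> + prod_encode (j, l)) (\<lambda>l. er (prod_encode (j, l))) (I j) (b j) (\<phi> j) (\<psi> j) (Sg j)" for j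
    using X[THEN spec, of j] unfolding Q_def I_def b_def \<phi>_def \<psi>_def Sg_def .
  note decj = dec[unfolded decomposition_def]
  define Jr where "Jr r = fst (prod_decode r)" for r
  define Lr where "Lr r = snd (prod_decode r)" for r
  define Ir where "Ir r = I (Jr r) (Lr r)" for r
  define br where "br r = b (Jr r)" for r
  define fr where "fr r = \<phi> (Jr r) (Lr r)" for r
  define gr where "gr r = \<psi> (Jr r) (Lr r)" for r
  have enc: "prod_encode (Jr r, Lr r) = r" for r by (simp add: Jr_def Lr_def)
  define PQ where "PQ r N X \<longleftrightarrow> N < fst X \<and> (\<forall>i s. i \<in> Ir r \<longrightarrow> (s < N \<or> fst X \<le> s) \<longrightarrow> fst (snd X) i s = 0 \<and> snd (snd X) i s = 0) \<and>
    (\<forall>m\<in>MM (Jr r). lpnorm p (comb (fst (snd X)) (Ir r) (\<lambda>i. fr r i m)) \<le> un (comb (br r) (Ir r) (\<lambda>i. fr r i m)) + er r * un m) \<and>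
    (\<forall>y\<in>lp p. un (comb (br r) (Ir r) (\<lambda>i. cpair (snd (snd X) i) y)) \<le> (2 * lam * (4 * lam) + er r) * lpnorm p y) \<and>
    (\<forall>m\<in>MM (Jr r). un (comb (br r) (Ir r) (\<lambda>i. cpair (snd (snd X) i) (comb (fst (snd X)) (Ir r) (\<lambda>i. fr r i m))) - comb (br r) (Ir r) (\<lambda>i. gr r i (comb (br r) (Ir r) (\<lambda>i. fr r i m)))) \<le> er r * un m) \<and>
    (\<forall>a<\<nu> + r. \<forall>m\<in>MM (Jr r). lpnorm p (T a (comb (fst (snd X)) (Ir r) (\<lambda>i. fr r i m)) - comb (fst (snd X)) (Ir r) (\<lambda>i. fr r i (hatop (T a) m))) \<le> (er r + er r) * un m) \<and>
    (\<forall>a<\<nu> + r. \<forall>y\<in>lp p. un (hatop (T a) (comb (br r) (Ir r) (\<lambda>i. cpair (snd (snd X) i) y)) - comb (br r) (Ir r) (\<lambda>i. cpair (snd (snd X) i) (T a y))) \<le> (2 * lam * er r + er r) * lpnorm p y)" for r N and X :: "nat \<times> (nat \<Rightarrow> nat \<Rightarrow> complex) \<times> (nat \<Rightarrow> nat \<Rightarrow> complex)"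
  have PQ_ex: "\<forall>r. \<forall>N. \<exists>X. PQ r N X"
  proof (intro allI)
    fix r N
    have b': "br r i \<in> MM (Jr r)" for i unfolding br_def by (rule decj[THEN conjunct2, THEN conjunct1, THEN spec])
    have I': "finite (Ir r)" unfolding Ir_def by (rule decj[THEN conjunct1, THEN spec])
    have f': "bdd_op (MM (Jr r)) un UNIV cmod (fr r i)" for i unfolding fr_def by (rule decj[THEN conjunct2, THEN conjunct2, THEN conjunct1, THEN spec, THEN spec])
    have g': "bdd_op (MM (Jr r)) un UNIV cmod (gr r i)" for i unfolding gr_def by (rule decj[THEN conjunct2, THEN conjunct2, THEN conjunct2, THEN conjunct1, THEN spec, THEN spec])
    have gC: "un (comb (br r) (Ir r) (\<lambda>i. gr r i m)) \<le> 4 * lam * un m" if "m \<in> MM (Jr r)" for m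
      unfolding br_def Ir_def gr_def
      by (rule decj[THEN conjunct2, THEN conjunct2, THEN conjunct2, THEN conjunct2, THEN conjunct2, THEN conjunct1, rule_format, OF that])
    have fc: "un (hatop (T a) (comb (br r) (Ir r) (\<lambda>i. fr r i m)) - comb (br r) (Ir r) (\<lambda>i. fr r i (hatop (T a) m))) \<le> er r * un m" if "a < \<nu> + r" "m \<in> MM (Jr r)" for a m
      using decj[of "Jr r", THEN conjunct2, THEN conjunct2, THEN conjunct2, THEN conjunct2, THEN conjunct2, THEN conjunct2, THEN conjunct2, THEN conjunct1, THEN spec, of "Lr r"] that
      unfolding br_def Ir_def fr_def enc by simp
    have gc: "un (hatop (T a) (comb (br r) (Ir r) (\<lambda>i. gr r i m)) - comb (br r) (Ir r) (\<lambda>i. gr r i (hatop (T a) m))) \<le> er r * un m" if "a < \<nu> + r" "m \<in> MM (Jr r)" for a m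
      using decj[of "Jr r", THEN conjunct2, THEN conjunct2, THEN conjunct2, THEN conjunct2, THEN conjunct2, THEN conjunct2, THEN conjunct2, THEN conjunct2, THEN conjunct1, THEN spec, of "Lr r"] that
      unfolding br_def Ir_def gr_def enc by simp
    have C0: "0 \<le> 4 * lam" using lam by simp
    have "\<exists>N' v z. PQ r N (N', v, z)" unfolding PQ_def fst_conv snd_conv
      by (rule localized_piece[where T=T and N=N and K="\<nu> + r", OF T P_bdd P_idem P_norm lam P_comm refl I' b' f' g' C0 less_imp_le[OF er] gC fc gc er[of r]])
    then show "\<exists>X. PQ r N X" by (elim exE) (rule exI)
  qed
  have "\<forall>r. \<exists>X. \<forall>N. PQ r N (X N)"
  proof
    fix r show "\<exists>X. \<forall>N. PQ r N (X N)" by (rule choice[OF PQ_ex[THEN spec]])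
  qed
  from choice[OF this] obtain Y where Y: "\<forall>r N. PQ r N (Y r N)" by (elim exE)
  \<comment> \<open>Piece \<open>r\<close> starts where piece \<open>r - 1\<close> ends; the data
    for all starting points have been chosen beforehand, so the recursion only tracks the
    boundary.\<close>
  define n where "n = rec_nat 0 (\<lambda>r N. fst (Y r N))"
  have n0: "n 0 = 0" and nS: "n (Suc r) = fst (Y r (n r))" for r by (simp_all add: n_def)
  define v where "v r = fst (snd (Y r (n r)))" for r
  define z where "z r = snd (snd (Y r (n r)))" for r
  have Pr: "PQ r (n r) (n (Suc r), v r, z r)" for r
    using Y[THEN spec, THEN spec, of r "n r"] unfolding nS v_def z_def by simp
  note PQr = Pr[unfolded PQ_def fst_conv snd_conv]
  have "glue p U T P lam \<delta> \<nu> I b \<phi> \<psi> Sg n v z Jr Lr Ir br fr gr er"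
  proof (unfold_locales)
    show "strict_mono n" unfolding strict_mono_Suc_iff using PQr by blast
    show "n 0 = 0" by (rule n0)
    show "0 < \<delta>" "\<delta> \<le> 1" by (rule \<delta>)+
    show "Jr r = fst (prod_decode r)" "Lr r = snd (prod_decode r)" "Ir r = I (Jr r) (Lr r)" "br r = b (Jr r)" "fr r = \<phi> (Jr r) (Lr r)" "gr r = \<psi> (Jr r) (Lr r)" "er r = \<delta> * half r" for r
      by (simp_all add: Jr_def Lr_def Ir_def br_def fr_def gr_def er_def)
    show "decomposition T (MM j) (4 * lam) (\<lambda>l. \<nu> + prod_encode (j, l)) (\<lambda>l. er (prod_encode (j, l))) (I j) (b j) (\<phi> j) (\<psi> j) (Sg j)" for j by (rule dec)
    fix r
    show "v r i s = 0 \<and> z r i s = 0" if "i \<in> Ir r" "s < n r \<or> n (Suc r) \<le> s" for i s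
      by (rule PQr[THEN conjunct2, THEN conjunct1, rule_format, OF that])
    show "lpnorm p (comb (v r) (Ir r) (\<lambda>i. fr r i m)) \<le> un (comb (br r) (Ir r) (\<lambda>i. fr r i m)) + er r * un m" if "m \<in> MM (Jr r)" for m
      by (rule PQr[THEN conjunct2, THEN conjunct2, THEN conjunct1, THEN bspec, OF that])
    show "un (comb (br r) (Ir r) (\<lambda>i. cpair (z r i) y)) \<le> (2 * lam * (4 * lam) + er r) * lpnorm p y" if "y \<in> lp p" for y
      by (rule PQr[THEN conjunct2, THEN conjunct2, THEN conjunct2, THEN conjunct1, THEN bspec, OF that])
    show "un (comb (br r) (Ir r) (\<lambda>i. cpair (z r i) (comb (v r) (Ir r) (\<lambda>i. fr r i m))) - comb (br r) (Ir r) (\<lambda>i. gr r i (comb (br r) (Ir r) (\<lambda>i. fr r i m)))) \<le> er r * un m" if "m \<in> MM (Jr r)" for m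
      by (rule PQr[THEN conjunct2, THEN conjunct2, THEN conjunct2, THEN conjunct2, THEN conjunct1, THEN bspec, OF that])
    show "lpnorm p (T a (comb (v r) (Ir r) (\<lambda>i. fr r i m)) - comb (v r) (Ir r) (\<lambda>i. fr r i (hatop (T a) m))) \<le> (er r + er r) * un m" if "a < \<nu> + r" "m \<in> MM (Jr r)" for a m
      by (rule PQr[THEN conjunct2, THEN conjunct2, THEN conjunct2, THEN conjunct2, THEN conjunct2, THEN conjunct1, THEN spec, THEN mp, OF that(1), THEN bspec, OF that(2)])
    show "un (hatop (T a) (comb (br r) (Ir r) (\<lambda>i. cpair (z r i) y)) - comb (br r) (Ir r) (\<lambda>i. cpair (z r i) (T a y))) \<le> (2 * lam * er r + er r) * lpnorm p y" if "a < \<nu> + r" "y \<in> lp p" for a y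
      by (rule PQr[THEN conjunct2, THEN conjunct2, THEN conjunct2, THEN conjunct2, THEN conjunct2, THEN conjunct2, THEN spec, THEN mp, OF that(1), THEN bspec, OF that(2)])
  qed
  then show ?thesis by (rule that)
qed

subsection \<open>Shifts on the infinite sum\<close>

text \<open>The code of a copy is the pair of a range number and a copy number. \<open>tau\<close>
  and \<open>sig\<close> are the backward and forward shifts in the copy number, \<open>iot\<close>
  inserts a vector as copy 0 and \<open>pi0\<close> reads copy 0. Together \<open>tau\<close> and
  \<open>pi0\<close> split the infinite sum into itself and one copy of each range.\<close>

definition "tau m = (\<lambda>j. m (prod_encode (fst (prod_decode j), Suc (snd (prod_decode j)))) :: nat \<Rightarrow> nat \<Rightarrow> complex)"
definition "sig m = (\<lambda>j. (case snd (prod_decode j) of 0 \<Rightarrow> 0 | Suc k \<Rightarrow> m (prod_encode (fst (prod_decode j), k))) :: nat \<Rightarrow> nat \<Rightarrow> complex)"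
definition "iot m = (\<lambda>j. (case snd (prod_decode j) of 0 \<Rightarrow> m (fst (prod_decode j)) | Suc k \<Rightarrow> 0) :: nat \<Rightarrow> nat \<Rightarrow> complex)"
definition "pi0 m = (\<lambda>n. m (prod_encode (n, 0)) :: nat \<Rightarrow> nat \<Rightarrow> complex)"

abbreviation "MN \<equiv> \<lambda>n. rng U p (P n)"

text \<open>Covers all four shift maps: each one reads coordinates along an injection and is zero
  elsewhere.\<close>

lemma psum_reindex:
  assumes M: "\<And>j. M j \<subseteq> hat" and M': "\<And>j. M' j \<subseteq> hat" and m: "m \<in> psum M" and m': "\<And>j. m' j \<in> M' j"
    and h: "inj_on h A" "\<And>j. j \<in> A \<Longrightarrow> m' j = m (h j)" "\<And>j. j \<notin> A \<Longrightarrow> m' j = 0"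
  shows "m' \<in> psum M'" "pnorm m' \<le> pnorm m"
proof -
  have "(\<Sum>j<J. un (m' j) powr p) \<le> pnorm m powr p" for J
  proof -
    have "(\<Sum>j<J. un (m' j) powr p) = (\<Sum>j\<in>{..<J} \<inter> A. un (m' j) powr p)"
      by (intro sum.mono_neutral_right) (auto simp: h(3) haN(5))
    also have "\<dots> = (\<Sum>j\<in>{..<J} \<inter> A. un (m (h j)) powr p)" by (intro sum.cong) (auto simp: h(2))
    also have "\<dots> = (\<Sum>j\<in>h ` ({..<J} \<inter> A). un (m j) powr p)"
      using inj_on_subset[OF h(1), of "{..<J} \<inter> A"] by (simp add: sum.reindex)
    also have "\<dots> \<le> pnorm m powr p" by (rule psum_sum_le[OF m M]) simp
    finally show ?thesis .
  qed
  then show "m' \<in> psum M'" "pnorm m' \<le> pnorm m" using psum_criterion[OF M' m', of "pnorm m"] by auto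
qed

lemma tau_psum: assumes m: "m \<in> psum MM" shows "tau m \<in> psum MM" "pnorm (tau m) \<le> pnorm m"
proof -
  have mem: "tau m j \<in> MM j" for j
    using psumD[OF m, of "prod_encode (fst (prod_decode j), Suc (snd (prod_decode j)))"] by (simp add: tau_def)
  have inj: "inj_on (\<lambda>j. prod_encode (fst (prod_decode j), Suc (snd (prod_decode j)))) UNIV"
    by (rule inj_onI) (simp add: prod_eq_iff[symmetric])
  show "tau m \<in> psum MM" "pnorm (tau m) \<le> pnorm m"
    by (rule psum_reindex[OF rng_hat rng_hat m mem inj]; simp add: tau_def)+
qed

lemma sig_psum: assumes m: "m \<in> psum MM" shows "sig m \<in> psum MM" "pnorm (sig m) \<le> pnorm m"
proof -
  have mem: "sig m j \<in> MM j" for j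
    using psumD[OF m, of "prod_encode (fst (prod_decode j), snd (prod_decode j) - 1)"] csubspaceD(1)[OF rng_sub] by (cases "snd (prod_decode j)") (simp_all add: sig_def)
  have inj: "inj_on (\<lambda>j. prod_encode (fst (prod_decode j), snd (prod_decode j) - 1)) {j. snd (prod_decode j) \<noteq> 0}"
  proof (rule inj_onI)
    fix x y assume "x \<in> {j. snd (prod_decode j) \<noteq> 0}" "y \<in> {j. snd (prod_decode j) \<noteq> 0}"
      "prod_encode (fst (prod_decode x), snd (prod_decode x) - 1) = prod_encode (fst (prod_decode y), snd (prod_decode y) - 1)"
    then have "prod_decode x = prod_decode y" by (auto simp: prod_eq_iff)
    then show "x = y" by simp
  qed
  show "sig m \<in> psum MM" "pnorm (sig m) \<le> pnorm m"
    by (rule psum_reindex[OF rng_hat rng_hat m mem inj]; simp add: sig_def split: nat.split)+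
qed

lemma iot_psum: assumes m: "m \<in> psum MN" shows "iot m \<in> psum MM" "pnorm (iot m) \<le> pnorm m"
proof -
  have mem: "iot m j \<in> MM j" for j
    using psumD[OF m, of "fst (prod_decode j)"] csubspaceD(1)[OF rng_sub] by (simp add: iot_def split: nat.split)
  have inj: "inj_on (\<lambda>j. fst (prod_decode j)) {j. snd (prod_decode j) = 0}"
  proof (rule inj_onI)
    fix x y assume "x \<in> {j. snd (prod_decode j) = 0}" "y \<in> {j. snd (prod_decode j) = 0}" "fst (prod_decode x) = fst (prod_decode y)"
    then have "prod_decode x = prod_decode y" by (auto simp: prod_eq_iff)
    then show "x = y" by simp
  qed
  show "iot m \<in> psum MM" "pnorm (iot m) \<le> pnorm m"
    by (rule psum_reindex[OF rng_hat rng_hat m mem inj]; simp add: iot_def split: nat.split)+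
qed

lemma pi0_psum: assumes m: "m \<in> psum MM" shows "pi0 m \<in> psum MN" "pnorm (pi0 m) \<le> pnorm m"
proof -
  have mem: "pi0 m j \<in> MN j" for j using psumD[OF m, of "prod_encode (j, 0)"] by (simp add: pi0_def)
  have inj: "inj_on (\<lambda>j. prod_encode (j, 0)) UNIV" by (rule inj_onI) simp
  show "pi0 m \<in> psum MN" "pnorm (pi0 m) \<le> pnorm m"
    by (rule psum_reindex[OF rng_hat rng_hat m mem inj]; simp add: pi0_def)+
qed

lemma shift_linear: "clinear_on X tau" "clinear_on X sig" "clinear_on X iot" "clinear_on X pi0"
  by (auto simp: clinear_on_def tau_def sig_def iot_def pi0_def fun_eq_iff split: nat.split)

lemma shift_identities: "tau (sig m) = m" "sig (tau m) + iot (pi0 m) = m" "pi0 (sig m) = 0" "tau (iot k) = 0" "pi0 (iot k) = k"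
proof -
  show "tau (sig m) = m" "pi0 (sig m) = 0" "tau (iot k) = 0" "pi0 (iot k) = k" by (simp_all add: tau_def sig_def iot_def pi0_def fun_eq_iff)
  show "sig (tau m) + iot (pi0 m) = m"
  proof
    fix j
    obtain a i where d: "prod_decode j = (a, i)" by (cases "prod_decode j")
    then have j: "j = prod_encode (a, i)" by (metis prod_decode_inverse)
    show "(sig (tau m) + iot (pi0 m)) j = m j" by (cases i) (simp_all add: tau_def sig_def iot_def pi0_def d j)
  qed
qed

text \<open>The sum of the two norms replaces the l^p-norm of the pair. They agree up to a factor 2,
  and triangle inequalities are simpler in this form.\<close>

definition "dn w = lpnorm p (fst w) + pnorm (snd w)"

abbreviation "DS \<equiv> dsum_space U p MN"

lemma DS_iff: "w \<in> DS \<longleftrightarrow> fst w \<in> lp p \<and> snd w \<in> psum MN"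
proof -
  have "summable (\<lambda>n. un (m n) powr p) \<longleftrightarrow> (\<lambda>j. complex_of_real (un (m j))) \<in> lp p" if "\<forall>n. m n \<in> MN n" for m
  proof -
    have "cmod (complex_of_real (un (m n))) = un (m n)" for n using that rng_hat haN(2) by (metis abs_of_nonneg norm_of_real subsetD)
    then show ?thesis by (simp add: lp_def)
  qed
  then show ?thesis by (cases w) (auto simp: dsum_space_def psum_def)
qed

lemma seminormed_MN: "seminormed (psum MN) pnorm" by (rule seminormed_psum[OF rng_hat rng_sub])

lemma seminormed_DS: "seminormed DS dn"
proof -
  note N = seminormedD[OF seminormed_MN] note S = csubspaceD[OF N(1)]
  have "csubspace DS" unfolding csubspace_def by (auto simp: DS_iff lpS S)
  moreover have "dn (x + y) \<le> dn x + dn y" if "x \<in> DS" "y \<in> DS" for x y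
    using that lpD(3)[of "fst x" "fst y"] N(3)[of "snd x" "snd y"] by (simp add: DS_iff dn_def)
  moreover have "dn (c *\<^sub>C x) = cmod c * dn x" if "x \<in> DS" for x c
    using that lpD(4)[of "fst x" c] N(4)[of "snd x" c] by (simp add: DS_iff dn_def distrib_left)
  ultimately show ?thesis by (simp add: seminormed_def dn_def)
qed

lemma dsum_norm_dn:
  assumes "w \<in> DS" shows "dsum_norm U p w \<le> dn w" "dn w \<le> 2 * dsum_norm U p w"
proof -
  have w: "fst w \<in> lp p" "snd w \<in> psum MN" using assms by (auto simp: DS_iff)
  define x y where "x = lpnorm p (fst w)" and "y = pnorm (snd w)"
  have xy: "0 \<le> x" "0 \<le> y" by (simp_all add: x_def y_def)
  have "cmod (complex_of_real (un (snd w n))) = un (snd w n)" for n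
    using psumD[OF w(2)] rng_hat haN(2) by (metis abs_of_nonneg norm_of_real subsetD)
  then have yp: "y powr p = (\<Sum>n. un (snd w n) powr p)"
    using lpnorm_powr[of "\<lambda>j. complex_of_real (un (snd w j))"] w(2) by (simp add: y_def pnorm_def psum_def)
  have dnm: "dsum_norm U p w = (x powr p + y powr p) powr (1/p)" by (simp add: dsum_norm_def x_def yp)
  have "x powr p + y powr p \<le> (x + y) powr p"
  proof (cases "x + y = 0")
    case True
    then have "x = 0" "y = 0" using xy by auto
    then show ?thesis by simp
  next
    case False
    then have s: "x + y > 0" using xy by simp
    have t: "t powr p \<le> t * (x + y) powr (p - 1)" if "0 \<le> t" "t \<le> x + y" for t
    proof -
      have "t powr p = t * t powr (p - 1)" using powr_add[of t 1 "p - 1"] that by simp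
      also have "\<dots> \<le> t * (x + y) powr (p - 1)" using that p_gt_1 by (intro mult_left_mono powr_mono2) auto
      finally show ?thesis .
    qed
    have "x powr p + y powr p \<le> (x + y) * (x + y) powr (p - 1)" using t[of x] t[of y] xy by (simp add: distrib_right)
    also have "\<dots> = (x + y) powr p" using powr_add[of "x + y" 1 "p - 1"] s by simp
    finally show ?thesis .
  qed
  then have "(x powr p + y powr p) powr (1/p) \<le> ((x + y) powr p) powr (1/p)" using p_gt_1 by (intro powr_mono2) auto
  then show "dsum_norm U p w \<le> dn w" using xy by (simp add: dnm dn_def x_def[symmetric] y_def[symmetric] powr_p_root)
  have "(x powr p) powr (1/p) \<le> (x powr p + y powr p) powr (1/p)" "(y powr p) powr (1/p) \<le> (x powr p + y powr p) powr (1/p)"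
    using p_gt_1 by (intro powr_mono2; simp)+
  then show "dn w \<le> 2 * dsum_norm U p w" using xy by (simp add: dnm dn_def x_def[symmetric] y_def[symmetric] powr_p_root)
qed

lemma dsum_op_DS: assumes w: "w \<in> DS" shows "dsum_op (T a) w \<in> DS"
proof -
  obtain C where C: "C > 0" "\<And>x. x \<in> lp p \<Longrightarrow> lpnorm p (T a x) \<le> C * lpnorm p x" using T by (rule bopE) (rule that)
  show ?thesis using w bopD(2)[OF T] hatA_psum(1)[OF rng_hat rng_T _ less_imp_le[OF C(1)] C(2)] unfolding DS_iff dsum_op_def hatA_def by simp
qed

lemma dsum_op_eq: "dsum_op (T a) w = (T a (fst w), hatA a (snd w))"
  by (simp add: dsum_op_def hatA_def)

lemma clinear_dsum_op: "clinear_on DS (dsum_op (T a))"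
  using clinear_onD[OF bopD(1)[OF T]] clinear_onD[OF clinear_hatA[where M=MN, OF rng_hat]]
  by (auto simp: clinear_on_def dsum_op_eq DS_iff prod_eq_iff)

lemma dsum_op_bound: obtains C where "C > 0" "\<And>w. w \<in> DS \<Longrightarrow> dn (dsum_op (T a) w) \<le> C * dn w"
proof -
  obtain C where C: "C > 0" "\<And>x. x \<in> lp p \<Longrightarrow> lpnorm p (T a x) \<le> C * lpnorm p x" using T by (rule bopE) (rule that)
  have "dn (dsum_op (T a) w) \<le> C * dn w" if "w \<in> DS" for w
  proof -
    have w: "fst w \<in> lp p" "snd w \<in> psum MN" using that by (auto simp: DS_iff)
    show ?thesis using C(2)[OF w(1)] hatA_psum(2)[OF rng_hat rng_T w(2) less_imp_le[OF C(1)] C(2)] by (simp add: dn_def dsum_op_eq distrib_left)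
  qed
  then show ?thesis using that C(1) by blast
qed

text \<open>All these constants are functions of \<open>lam\<close> only; neither \<delta> nor \<nu>
  enters, so the condition numbers stay bounded along the sequence of similarities.
  \<open>kV\<close> and \<open>kW\<close> bound \<open>V\<close> and \<open>W\<close>,
  \<open>kS\<close> bounds the similarity and \<open>kR\<close> its approximate inverse.
  \<open>k1\<close> collects the factors of \<delta> in the perturbation estimates,
  \<open>k2\<close> those in the intertwining defect.\<close>

definition "kV = 4 * (4 * lam + 1)"
definition "kW = 4 * lam * (2 * lam * (4 * lam) + 1)"
definition "kS = 1 + 2 * (kV * kW) + kW"
definition "kR = 1 + 2 * (kV * kW) + kV"
definition "k1 = 8 * (kV * kW) * kR * kS + (2 * kV + 1) * (2 * kW + 1) + 8 * (kV * kW)"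
definition "k2 = (2 * kV + 1) * (2 * lam + 1) + 4 * kW"

lemma k_nonneg: "0 \<le> kV" "0 \<le> kW" "1 \<le> kS" "1 \<le> kR" "0 \<le> kV * kW" "0 \<le> k2"
  using lam by (auto simp: kV_def kW_def kS_def kR_def k2_def intro!: add_nonneg_nonneg mult_nonneg_nonneg)

end

context glue
begin

lemma CV_kV: "CV = kV" and CW_kW: "CW = kW"
  by (simp_all add: CV_def kV_def C0_def CW_def kW_def Bu_def)

text \<open>If \<open>W (V m) = m\<close> held exactly, \<open>V\<close> after \<open>W\<close>
  would be an idempotent, \<open>W (fst (S y))\<close> would equal \<open>tau (W y)\<close>, and
  \<open>R0\<close> would be the inverse of \<open>S\<close> because
  \<open>sig (tau m) + iot (pi0 m) = m\<close>. In reality the error is of order \<delta>: a Neumann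
  series turns \<open>R0\<close> into an exact left inverse \<open>R\<close>, and a norm estimate
  then shows that \<open>R\<close> is also a right inverse up to null vectors.\<close>

lemma absorption:
  assumes \<delta>1: "\<delta> * k1 \<le> 1 / 2"
  obtains S R where "clinear_on (lp p) S" "\<And>y. y \<in> lp p \<Longrightarrow> S y \<in> DS" "\<And>y. y \<in> lp p \<Longrightarrow> dn (S y) \<le> kS * lpnorm p y"
    "clinear_on DS R" "\<And>w. w \<in> DS \<Longrightarrow> R w \<in> lp p" "\<And>w. w \<in> DS \<Longrightarrow> lpnorm p (R w) \<le> 2 * kR * dn w"
    "\<And>y. y \<in> lp p \<Longrightarrow> R (S y) = y" "\<And>w. w \<in> DS \<Longrightarrow> dn (S (R w) - w) = 0"
    "\<And>a. \<exists>q. vanishing q \<and> (\<forall>y\<in>lp p. dn (dsum_op (T a) (S y) - S (T a y)) \<le> q y) \<and> (a < \<nu> \<longrightarrow> (\<forall>y\<in>lp p. q y \<le> k2 * \<delta> * lpnorm p y))"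
proof -
  note MMN = seminormedD[OF seminormed_MM] note MMS = csubspaceD[OF MMN(1)]
  note DSN = seminormedD[OF seminormed_DS] note DSS = csubspaceD[OF DSN(1)]
  note Vl = clinear_onD[OF clinear_V] clinear_on_rules[OF clinear_V MMN(1)]
  note Wl = clinear_onD[OF clinear_W] clinear_on_rules[OF clinear_W lpD(1)]
  note Vb = V_bound[unfolded CV_kV] note Wb = W_bound[unfolded CW_kW]
  have tau_add: "tau (m + m') = tau m + tau m'" and tau_diff: "tau (m - m') = tau m - tau m'" for m m'
    using clinear_onD(1)[OF shift_linear(1)[of UNIV]] clinear_on_rules(3)[OF shift_linear(1)[of UNIV] csubspace_UNIV] by simp_all
  have sig_add: "sig (m + m') = sig m + sig m'" for m m'
    using clinear_onD(1)[OF shift_linear(2)[of UNIV]] by simp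
  have pi0_add: "pi0 (m + m') = pi0 m + pi0 m'" and pi0_diff: "pi0 (m - m') = pi0 m - pi0 m'" for m m'
    using clinear_onD(1)[OF shift_linear(4)[of UNIV]] clinear_on_rules(3)[OF shift_linear(4)[of UNIV] csubspace_UNIV] by simp_all
  define S where "S y = ((y - V (W y)) + V (tau (W y)), pi0 (W y))" for y
  define q where "q w = sig (W (fst w)) + iot (snd w)" for w
  define R0 where "R0 w = (fst w - V (W (fst w))) + V (q w)" for w
  have Smem: "fst (S y) \<in> lp p" "snd (S y) \<in> psum MN" if y: "y \<in> lp p" for y
    unfolding S_def fst_conv snd_conv by (intro lpS(2) lpS(5) Vb Wb tau_psum y, intro pi0_psum Wb y)
  have SDS: "S y \<in> DS" if "y \<in> lp p" for y using Smem[OF that] by (simp add: DS_iff)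
  have VWb: "lpnorm p (V m) \<le> kV * kW * lpnorm p y" if "m \<in> psum MM" "pnorm m \<le> kW * lpnorm p y" for m y
    using Vb(2)[OF that(1)] mult_left_mono[OF that(2) k_nonneg(1)] by (simp add: mult.assoc)
  have S_bd: "dn (S y) \<le> kS * lpnorm p y" if y: "y \<in> lp p" for y
  proof -
    have Wy: "W y \<in> psum MM" "pnorm (W y) \<le> kW * lpnorm p y" by (rule Wb[OF y])+
    have tW: "tau (W y) \<in> psum MM" "pnorm (tau (W y)) \<le> kW * lpnorm p y"
      using tau_psum[OF Wy(1)] Wy(2) by auto
    have "lpnorm p ((y - V (W y)) + V (tau (W y))) \<le> lpnorm p (y - V (W y)) + lpnorm p (V (tau (W y)))" by (intro lpD(3) lpS(5) y Vb Wy tW)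
    moreover have "lpnorm p (y - V (W y)) \<le> lpnorm p y + lpnorm p (V (W y))" by (intro lpD(7) y Vb Wy)
    moreover have "pnorm (pi0 (W y)) \<le> kW * lpnorm p y" using pi0_psum(2)[OF Wy(1)] Wy(2) by simp
    ultimately show ?thesis using VWb[OF Wy] VWb[OF tW] by (simp add: dn_def S_def kS_def distrib_right)
  qed
  have Slin: "clinear_on (lp p) S"
    unfolding clinear_on_def
  proof (intro conjI ballI allI)
    fix x assume x: "x \<in> lp p"
    have Wx: "W x \<in> psum MM" "tau (W x) \<in> psum MM" using Wb[OF x] tau_psum by blast+
    show "S (x + y) = S x + S y" if y: "y \<in> lp p" for y
    proof -
      have Wy: "W y \<in> psum MM" "tau (W y) \<in> psum MM" using Wb[OF y] tau_psum by blast+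
      show ?thesis unfolding S_def by (simp add: prod_eq_iff Wl(1)[OF x y] Vl(1)[OF Wx(1) Wy(1)] Vl(1)[OF Wx(2) Wy(2)] tau_add pi0_add algebra_simps)
    qed
    show "S (c *\<^sub>C x) = c *\<^sub>C S x" for c
      unfolding S_def using clinear_onD(2)[OF shift_linear(1)[of UNIV]] clinear_onD(2)[OF shift_linear(4)[of UNIV]]
      by (simp add: prod_eq_iff Wl(2)[OF x] Vl(2)[OF Wx(1)] Vl(2)[OF Wx(2)] cscale_right_distrib cscale_right_diff_distrib)
  qed
  have qM: "q w \<in> psum MM" "pnorm (q w) \<le> kW * lpnorm p (fst w) + pnorm (snd w)" if w: "w \<in> DS" for w
  proof -
    have w': "fst w \<in> lp p" "snd w \<in> psum MN" using w by (auto simp: DS_iff)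
    have s: "sig (W (fst w)) \<in> psum MM" "pnorm (sig (W (fst w))) \<le> kW * lpnorm p (fst w)"
      using sig_psum[OF Wb(1)[OF w'(1)]] Wb(2)[OF w'(1)] by auto
    note i = iot_psum[OF w'(2)]
    show "q w \<in> psum MM" unfolding q_def by (intro MMS(2) s i)
    show "pnorm (q w) \<le> kW * lpnorm p (fst w) + pnorm (snd w)" unfolding q_def using MMN(3)[OF s(1) i(1)] s(2) i(2) by linarith
  qed
  have R0mem: "R0 w \<in> lp p" if w: "w \<in> DS" for w
  proof -
    have w': "fst w \<in> lp p" using w by (auto simp: DS_iff)
    show ?thesis unfolding R0_def by (intro lpS(2) lpS(5) w' Vb Wb qM w)
  qed
  have R0_bd: "lpnorm p (R0 w) \<le> kR * dn w" if w: "w \<in> DS" for w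
  proof -
    have w': "fst w \<in> lp p" "snd w \<in> psum MN" using w by (auto simp: DS_iff)
    have Wx: "W (fst w) \<in> psum MM" "pnorm (W (fst w)) \<le> kW * lpnorm p (fst w)" by (rule Wb[OF w'(1)])+
    have "lpnorm p (R0 w) \<le> lpnorm p (fst w - V (W (fst w))) + lpnorm p (V (q w))" unfolding R0_def by (intro lpD(3) lpS(5) w' Vb Wx qM w)
    moreover have "lpnorm p (fst w - V (W (fst w))) \<le> lpnorm p (fst w) + lpnorm p (V (W (fst w)))" by (intro lpD(7) w' Vb Wx)
    moreover have "lpnorm p (V (q w)) \<le> kV * (kW * lpnorm p (fst w) + pnorm (snd w))"
      using Vb(2)[OF qM(1)[OF w]] mult_left_mono[OF qM(2)[OF w] k_nonneg(1)] by linarith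
    ultimately have "lpnorm p (R0 w) \<le> lpnorm p (fst w) + kV * kW * lpnorm p (fst w) + kV * (kW * lpnorm p (fst w) + pnorm (snd w))"
      using VWb[OF Wx] by linarith
    also have "\<dots> = (1 + 2 * (kV * kW)) * lpnorm p (fst w) + kV * pnorm (snd w)" by (simp add: algebra_simps)
    also have "\<dots> \<le> kR * lpnorm p (fst w) + kR * pnorm (snd w)"
      using k_nonneg by (intro add_mono mult_right_mono) (auto simp: kR_def)
    finally show ?thesis by (simp add: dn_def distrib_left)
  qed
  have R0lin: "clinear_on DS R0"
    unfolding clinear_on_def
  proof (intro conjI ballI allI)
    fix w assume w: "w \<in> DS"
    have w': "fst w \<in> lp p" using w by (auto simp: DS_iff)
    show "R0 (w + w2) = R0 w + R0 w2" if w2: "w2 \<in> DS" for w2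
    proof -
      have w2': "fst w2 \<in> lp p" using w2 by (auto simp: DS_iff)
      have qa: "q (w + w2) = q w + q w2" unfolding q_def
        using Wl(1)[OF w' w2'] clinear_onD(1)[OF shift_linear(3)[of UNIV]] by (simp add: sig_add)
      show ?thesis unfolding R0_def qa by (simp add: Wl(1)[OF w' w2'] Vl(1)[OF Wb(1)[OF w'] Wb(1)[OF w2']] Vl(1)[OF qM(1)[OF w] qM(1)[OF w2]])
    qed
    show "R0 (c *\<^sub>C w) = c *\<^sub>C R0 w" for c
    proof -
      have qa: "q (c *\<^sub>C w) = c *\<^sub>C q w" unfolding q_def
        using Wl(2)[OF w'] clinear_onD(2)[OF shift_linear(2)[of UNIV]] clinear_onD(2)[OF shift_linear(3)[of UNIV]] by (simp add: cscale_right_distrib)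
      show ?thesis unfolding R0_def qa
        by (simp add: Wl(2)[OF w'] Vl(2)[OF Wb(1)[OF w']] Vl(2)[OF qM(1)[OF w]] cscale_right_distrib cscale_right_diff_distrib)
    qed
  qed
  define EE where "EE m = W (V m) - m" for m
  have EEm: "EE m \<in> psum MM" "pnorm (EE m) \<le> \<delta> * pnorm m" "W (V m) = m + EE m" if "m \<in> psum MM" for m
    unfolding EE_def using WV_bound[OF that] MMS(5)[OF Wb(1)[OF Vb(1)[OF that]] that] by auto
  \<comment> \<open>The error in the identity between \<open>W (fst (S y))\<close> and
    \<open>tau (W y)\<close>.\<close>
  define dd where "dd y = EE (tau (W y)) - EE (W y)" for y
  have ddm: "dd y \<in> psum MM" "pnorm (dd y) \<le> 2 * \<delta> * kW * lpnorm p y" if y: "y \<in> lp p" for y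
  proof -
    have Wy: "W y \<in> psum MM" "pnorm (W y) \<le> kW * lpnorm p y" by (rule Wb[OF y])+
    note tW = tau_psum[OF Wy(1)]
    show "dd y \<in> psum MM" unfolding dd_def by (intro MMS(5) EEm tW Wy)
    have "pnorm (dd y) \<le> pnorm (EE (tau (W y))) + pnorm (EE (W y))" unfolding dd_def by (intro MMN(7) EEm tW Wy)
    also have "\<dots> \<le> \<delta> * (kW * lpnorm p y) + \<delta> * (kW * lpnorm p y)"
      using EEm(2)[OF tW(1)] EEm(2)[OF Wy(1)] mult_left_mono[OF order_trans[OF tW(2) Wy(2)] less_imp_le[OF \<delta>(1)]] mult_left_mono[OF Wy(2) less_imp_le[OF \<delta>(1)]] by linarith
    finally show "pnorm (dd y) \<le> 2 * \<delta> * kW * lpnorm p y" by simp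
  qed
  have RS: "R0 (S y) = y + V (sig (dd y) - dd y)" if y: "y \<in> lp p" for y
  proof -
    define u where "u = W y"
    have u: "u \<in> psum MM" unfolding u_def by (rule Wb[OF y])
    note tu = tau_psum(1)[OF u]
    define x1 where "x1 = (y - V u) + V (tau u)"
    have x1: "fst (S y) = x1" "snd (S y) = pi0 u" by (simp_all add: S_def x1_def u_def)
    have Wx1: "W x1 = tau u + dd y"
    proof -
      have 1: "W x1 = W (y - V u) + W (V (tau u))" unfolding x1_def by (intro Wl(1) lpS(5) y Vb u tu)
      have 2: "W (y - V u) = W y - W (V u)" by (intro Wl(5) y Vb u)
      show ?thesis unfolding 1 2 EEm(3)[OF u] EEm(3)[OF tu] dd_def u_def[symmetric] by (simp add: algebra_simps)
    qed
    note d = ddm(1)[OF y] note sd = sig_psum(1)[OF d]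
    have qS: "q (S y) = u + sig (dd y)"
    proof -
      have "q (S y) = (sig (tau u) + iot (pi0 u)) + sig (dd y)" unfolding q_def x1 Wx1 sig_add by (simp add: algebra_simps)
      then show ?thesis unfolding shift_identities(2) .
    qed
    have "R0 (S y) = (x1 - V (tau u + dd y)) + V (u + sig (dd y))" unfolding R0_def qS x1 Wx1 ..
    also have "\<dots> = (x1 - (V (tau u) + V (dd y))) + (V u + V (sig (dd y)))" by (simp only: Vl(1)[OF tu d] Vl(1)[OF u sd])
    also have "\<dots> = y + (V (sig (dd y)) - V (dd y))" unfolding x1_def by (simp add: algebra_simps)
    also have "\<dots> = y + V (sig (dd y) - dd y)" by (simp only: Vl(5)[OF sd d])
    finally show ?thesis .
  qed
  define E1 where "E1 y = R0 (S y) - y" for y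
  have E1eq: "E1 y = V (sig (dd y) - dd y)" if "y \<in> lp p" for y unfolding E1_def RS[OF that] by simp
  have E1l: "E1 y \<in> lp p" if "y \<in> lp p" for y unfolding E1_def by (intro lpS(5) R0mem SDS that)
  have E1b: "lpnorm p (E1 y) \<le> 4 * \<delta> * (kV * kW) * lpnorm p y" if y: "y \<in> lp p" for y
  proof -
    note d = ddm[OF y] note sd = sig_psum[OF d(1)]
    have "pnorm (sig (dd y) - dd y) \<le> pnorm (sig (dd y)) + pnorm (dd y)" by (intro MMN(7) d sd)
    then have b: "pnorm (sig (dd y) - dd y) \<le> 4 * \<delta> * kW * lpnorm p y" using sd(2) d(2) by linarith
    have "lpnorm p (E1 y) \<le> kV * pnorm (sig (dd y) - dd y)" unfolding E1eq[OF y] by (intro Vb MMS(5) sd d)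
    also have "\<dots> \<le> kV * (4 * \<delta> * kW * lpnorm p y)" by (rule mult_left_mono[OF b k_nonneg(1)])
    finally show ?thesis by (simp add: mult_ac)
  qed
  have k1pos: "0 \<le> 8 * (kV * kW) * kR * kS" "0 \<le> (2 * kV + 1) * (2 * kW + 1)" "0 \<le> 8 * (kV * kW)" using k_nonneg by auto
  have sm1: "\<delta> * (8 * (kV * kW)) \<le> 1 / 2"
  proof -
    have "8 * (kV * kW) \<le> k1" unfolding k1_def using k1pos by linarith
    then show ?thesis using mult_left_mono[OF _ less_imp_le[OF \<delta>(1)]] \<delta>1 by (meson order_trans)
  qed
  have sm2: "\<delta> * (8 * (kV * kW) * kR * kS + (2 * kV + 1) * (2 * kW + 1)) \<le> 1 / 2"
  proof -
    have "8 * (kV * kW) * kR * kS + (2 * kV + 1) * (2 * kW + 1) \<le> k1" unfolding k1_def using k1pos by linarith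
    then show ?thesis using mult_left_mono[OF _ less_imp_le[OF \<delta>(1)]] \<delta>1 by (meson order_trans)
  qed
  have E1lin: "clinear_on (lp p) E1"
    unfolding E1_def by (intro clinear_on_diff clinear_on_compose[OF Slin R0lin] clinear_on_id) (use SDS in auto)
  have E1h: "lpnorm p (E1 y) \<le> lpnorm p y / 2" if "y \<in> lp p" for y
  proof -
    have "4 * \<delta> * (kV * kW) * lpnorm p y \<le> (1 / 2) * lpnorm p y" using sm1 k_nonneg(5) \<delta>(1) by (intro mult_right_mono) auto
    then show ?thesis using E1b[OF that] by simp
  qed
  obtain G where G: "clinear_on (lp p) G" "\<And>x. x \<in> lp p \<Longrightarrow> G x \<in> lp p" "\<And>x. x \<in> lp p \<Longrightarrow> lpnorm p (G x) \<le> 2 * lpnorm p x"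
    "\<And>x. x \<in> lp p \<Longrightarrow> G (x + E1 x) = x"
    by (rule left_inverse_of_small_perturbation[OF E1lin E1l E1h]) (assumption | rule that; assumption)+
  define R where "R w = G (R0 w)" for w
  have Rl: "R w \<in> lp p" if "w \<in> DS" for w unfolding R_def by (intro G R0mem that)
  have Rlin: "clinear_on DS R" unfolding R_def[abs_def] by (rule clinear_on_compose[OF R0lin G(1)]) (use R0mem in auto)
  have RSid: "R (S y) = y" if y: "y \<in> lp p" for y
  proof -
    have "R0 (S y) = y + E1 y" by (simp add: E1_def)
    then show ?thesis unfolding R_def using G(4)[OF y] by simp
  qed
  \<comment> \<open>\<open>1 - S \<circ> R\<close> is an idempotent of norm at most \<open>1/2\<close>, hence zero\<close>
  have SRb: "dn (S (R w) - w) \<le> 1 / 2 * dn w" if w: "w \<in> DS" for w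
  proof -
    have w': "fst w \<in> lp p" "snd w \<in> psum MN" using w by (auto simp: DS_iff)
    define x m u x2 where "x = fst w" and "m = snd w" and "u = W x" and "x2 = R0 w"
    have xm: "x \<in> lp p" "m \<in> psum MN" using w' by (simp_all add: x_def m_def)
    have u: "u \<in> psum MM" "pnorm u \<le> kW * lpnorm p x" unfolding u_def by (rule Wb[OF xm(1)])+
    note qw = qM[OF w, folded x_def m_def]
    have x2: "x2 \<in> lp p" unfolding x2_def by (rule R0mem[OF w])
    have x2e: "x2 = (x - V u) + V (q w)" unfolding x2_def R0_def x_def u_def ..
    \<comment> \<open>The error in the identity between \<open>W (R0 w)\<close> and
      \<open>q w\<close>, which is exact if \<open>W\<close> is a left inverse of
      \<open>V\<close>.\<close>
    define d' where "d' = EE (q w) - EE u"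
    have d': "d' \<in> psum MM" unfolding d'_def by (intro MMS(5) EEm qw u)
    have d'b: "pnorm d' \<le> \<delta> * ((2 * kW + 1) * dn w)"
    proof -
      have "pnorm d' \<le> pnorm (EE (q w)) + pnorm (EE u)" unfolding d'_def by (intro MMN(7) EEm qw u)
      also have "\<dots> \<le> \<delta> * pnorm (q w) + \<delta> * pnorm u" by (intro add_mono EEm qw u)
      also have "\<dots> = \<delta> * (pnorm (q w) + pnorm u)" by (simp add: distrib_left)
      also have "\<dots> \<le> \<delta> * ((2 * kW + 1) * dn w)"
      proof (rule mult_left_mono[OF _ less_imp_le[OF \<delta>(1)]])
        have "pnorm (q w) + pnorm u \<le> 2 * kW * lpnorm p x + pnorm m" using qw(2) u(2) by linarith
        also have "\<dots> \<le> (2 * kW + 1) * lpnorm p x + (2 * kW + 1) * pnorm m" using k_nonneg(2) by (intro add_mono) (auto simp: distrib_right)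
        finally show "pnorm (q w) + pnorm u \<le> (2 * kW + 1) * dn w" by (simp add: dn_def x_def m_def distrib_left)
      qed
      finally show ?thesis .
    qed
    have Wx2: "W x2 = q w + d'"
    proof -
      have 1: "W x2 = W (x - V u) + W (V (q w))" unfolding x2e by (intro Wl(1) lpS(5) xm Vb u qw)
      have 2: "W (x - V u) = W x - W (V u)" by (intro Wl(5) xm Vb u)
      show ?thesis unfolding 1 2 EEm(3)[OF u(1)] EEm(3)[OF qw(1)] d'_def u_def[symmetric] by (simp add: algebra_simps)
    qed
    have tq: "tau (q w) = u" unfolding q_def tau_add shift_identities by (simp add: u_def x_def)
    have pq: "pi0 (q w) = m" unfolding q_def pi0_add shift_identities by (simp add: m_def)
    note td = tau_psum[OF d'] note pd = pi0_psum[OF d']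
    have f: "fst (S x2 - w) = V (tau d' - d')"
    proof -
      have "fst (S x2) = (x2 - V (q w + d')) + V (u + tau d')" unfolding S_def fst_conv Wx2 tau_add tq ..
      also have "\<dots> = (x2 - (V (q w) + V d')) + (V u + V (tau d'))" by (simp only: Vl(1)[OF qw(1) d'] Vl(1)[OF u(1) td(1)])
      also have "\<dots> = x + (V (tau d') - V d')" unfolding x2e by (simp add: algebra_simps)
      also have "\<dots> = x + V (tau d' - d')" by (simp only: Vl(5)[OF td(1) d'])
      finally show ?thesis by (simp add: x_def)
    qed
    have s: "snd (S x2 - w) = pi0 d'" unfolding S_def Wx2 pi0_add pq by (simp add: m_def S_def Wx2 pi0_add pq)
    have part1: "dn (S x2 - w) \<le> (2 * kV + 1) * (\<delta> * ((2 * kW + 1) * dn w))"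
    proof -
      have "pnorm (tau d' - d') \<le> pnorm (tau d') + pnorm d'" by (intro MMN(7) td d')
      then have b1: "pnorm (tau d' - d') \<le> 2 * pnorm d'" using td(2) by linarith
      have "lpnorm p (V (tau d' - d')) \<le> kV * pnorm (tau d' - d')" by (intro Vb MMS(5) td d')
      also have "\<dots> \<le> kV * (2 * pnorm d')" by (rule mult_left_mono[OF b1 k_nonneg(1)])
      finally have "dn (S x2 - w) \<le> (2 * kV + 1) * pnorm d'" unfolding dn_def f s using pd(2) by (simp add: algebra_simps)
      also have "\<dots> \<le> (2 * kV + 1) * (\<delta> * ((2 * kW + 1) * dn w))" using k_nonneg(1) by (intro mult_left_mono d'b) auto
      finally show ?thesis .
    qed
    have Gx: "R w - x2 = - G (E1 x2)"
    proof -
      have "G (x2 + E1 x2) = G x2 + G (E1 x2)" by (intro clinear_onD(1)[OF G(1)] x2 E1l)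
      then have "x2 = G x2 + G (E1 x2)" using G(4)[OF x2] by simp
      then show ?thesis unfolding R_def x2_def[symmetric] by (simp add: algebra_simps)
    qed
    have GE: "G (E1 x2) \<in> lp p" by (intro G E1l x2)
    have dR: "lpnorm p (R w - x2) \<le> 8 * \<delta> * (kV * kW) * (kR * dn w)"
    proof -
      have "lpnorm p (R w - x2) = lpnorm p (G (E1 x2))" unfolding Gx by (rule lpD(6)[OF GE])
      also have "\<dots> \<le> 2 * lpnorm p (E1 x2)" by (intro G E1l x2)
      also have "\<dots> \<le> 8 * \<delta> * (kV * kW) * lpnorm p x2" using E1b[OF x2] by simp
      also have "\<dots> \<le> 8 * \<delta> * (kV * kW) * (kR * dn w)" using R0_bd[OF w] k_nonneg(5) \<delta>(1) unfolding x2_def by (intro mult_left_mono) auto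
      finally show ?thesis .
    qed
    have Rx: "R w - x2 \<in> lp p" by (intro lpS(5) Rl w x2)
    have Seq: "S (R w) - S x2 = S (R w - x2)" using clinear_on_rules(3)[OF Slin lpD(1) Rl[OF w] x2] by simp
    have part2: "dn (S (R w) - S x2) \<le> kS * (8 * \<delta> * (kV * kW) * (kR * dn w))"
      unfolding Seq using S_bd[OF Rx] mult_left_mono[OF dR, of kS] k_nonneg(3) by linarith
    have "dn (S (R w) - w) \<le> dn (S (R w) - S x2) + dn (S x2 - w)" by (intro DSN(10) SDS Rl w x2)
    also have "\<dots> \<le> kS * (8 * \<delta> * (kV * kW) * (kR * dn w)) + (2 * kV + 1) * (\<delta> * ((2 * kW + 1) * dn w))" by (intro add_mono part1 part2)
    also have "\<dots> = \<delta> * (8 * (kV * kW) * kR * kS + (2 * kV + 1) * (2 * kW + 1)) * dn w" by (simp add: algebra_simps)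
    also have "\<dots> \<le> 1 / 2 * dn w" by (rule mult_right_mono[OF sm2 DSN(2)[OF w]])
    finally show ?thesis .
  qed
  have SR0: "dn (S (R w) - w) = 0" if w: "w \<in> DS" for w
  proof -
    define w1 where "w1 = S (R w) - w"
    have SRw: "S (R w) \<in> DS" by (intro SDS Rl w)
    have w1: "w1 \<in> DS" unfolding w1_def by (rule DSS(5)[OF SRw w])
    have "R w1 = R (S (R w)) - R w" unfolding w1_def by (rule clinear_on_rules(3)[OF Rlin DSN(1) SRw w])
    then have "R w1 = 0" by (simp add: RSid[OF Rl[OF w]])
    then have "S (R w1) = 0" by (simp only: clinear_on_rules(1)[OF Slin lpD(1)])
    then have "dn (S (R w1) - w1) = dn w1" using DSN(6)[OF w1] by simp
    then have "dn w1 \<le> 1 / 2 * dn w1" using SRb[OF w1] by simp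
    then show ?thesis using DSN(2)[OF w1] unfolding w1_def[symmetric] by simp
  qed
  have inter: "\<exists>q. vanishing q \<and> (\<forall>y\<in>lp p. dn (dsum_op (T a) (S y) - S (T a y)) \<le> q y) \<and> (a < \<nu> \<longrightarrow> (\<forall>y\<in>lp p. q y \<le> k2 * \<delta> * lpnorm p y))" for a
  proof -
    define QV where "QV m = (\<Sum>r. qV a r m)" for m
    define QW where "QW y = (\<Sum>r. qW a r y)" for y
    \<comment> \<open>The defect \<open>D\<close> of \<open>W\<close> enters through
      \<open>V (tau D - D)\<close> and through \<open>pi0 D\<close>, hence the factor
      \<open>2 * kV + 1\<close>. The other terms are the defects of \<open>V\<close> at
      \<open>W y\<close> and at its shift; the shifts themselves commute with the operators.\<close>
    define qq where "qq y = (2 * kV + 1) * QW y + (QV (W y) + QV (tau (W y)))" for y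
    have twl: "clinear_on (lp p) (\<lambda>y. tau (W y))" by (rule clinear_on_compose[OF clinear_W shift_linear(1)[of UNIV]]) simp
    have twb: "tau (W y) \<in> psum MM" "pnorm (tau (W y)) \<le> kW * lpnorm p y" if "y \<in> lp p" for y
      using tau_psum[OF Wb(1)[OF that]] Wb(2)[OF that] by auto
    have v1: "vanishing qq" unfolding qq_def QV_def QW_def
      by (intro vanishing_add vanishing_cmult QW_vanishing QV_vanishing[OF clinear_W Wb k_nonneg(2)] QV_vanishing[OF twl twb k_nonneg(2)])
    have v2: "dn (dsum_op (T a) (S y) - S (T a y)) \<le> qq y" if y: "y \<in> lp p" for y
    proof -
      note Tl = clinear_onD[OF bopD(1)[OF T]] clinear_on_rules[OF bopD(1)[OF T] lpD(1)]
      have Ty: "T a y \<in> lp p" by (rule bopD(2)[OF T y])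
      define u u' where "u = W y" and "u' = W (T a y)"
      have u: "u \<in> psum MM" "u' \<in> psum MM" unfolding u_def u'_def by (intro Wb y Ty)+
      note tu = tau_psum(1)[OF u(1)] tau_psum(1)[OF u(2)]
      define D where "D = hatA a u - u'"
      have hu: "hatA a u \<in> psum MM" by (rule hatA_MM[OF u(1)])
      have D: "D \<in> psum MM" unfolding D_def by (rule MMS(5)[OF hu u(2)])
      have Db: "pnorm D \<le> QW y" unfolding D_def u_def u'_def QW_def by (rule dW_le[OF y])
      define dV where "dV m = T a (V m) - V (hatA a m)" for m
      have dVl: "dV m \<in> lp p" "lpnorm p (dV m) \<le> QV m" if "m \<in> psum MM" for m
        unfolding dV_def QV_def by (intro lpS(5) bopD[OF T] Vb that hatA_MM, rule dV_le[OF that])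
      have ht: "hatA a (tau m) = tau (hatA a m)" "hatA a (pi0 m) = pi0 (hatA a m)" for m by (simp_all add: hatA_def tau_def pi0_def)
      have f: "fst (dsum_op (T a) (S y) - S (T a y)) = V (tau D - D) + (dV (tau u) - dV u)"
      proof -
        have a1: "T a ((y - V u) + V (tau u)) = (T a y - T a (V u)) + T a (V (tau u))"
          by (subst Tl(1)) (use y u tu Vb lpS in \<open>auto simp: Tl(5)\<close>)
        have a2: "V (tau D - D) = (V (tau (hatA a u)) - V (tau u')) - (V (hatA a u) - V u')"
        proof -
          have "V (tau D - D) = V (tau D) - V D" by (intro Vl(5) tau_psum D)
          moreover have "V D = V (hatA a u) - V u'" unfolding D_def by (rule Vl(5)[OF hu u(2)])
          moreover have "V (tau D) = V (tau (hatA a u)) - V (tau u')" unfolding D_def tau_diff by (intro Vl(5) tau_psum hu u)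
          ultimately show ?thesis by simp
        qed
        have "fst (dsum_op (T a) (S y) - S (T a y)) = T a ((y - V u) + V (tau u)) - ((T a y - V u') + V (tau u'))"
          by (simp add: dsum_op_eq S_def u_def u'_def)
        also have "\<dots> = V (tau D - D) + (dV (tau u) - dV u)"
          unfolding a1 a2 dV_def ht by (simp add: algebra_simps)
        finally show ?thesis .
      qed
      have s: "snd (dsum_op (T a) (S y) - S (T a y)) = pi0 D"
        unfolding D_def pi0_diff by (simp add: dsum_op_eq S_def ht u_def u'_def)
      note tD = tau_psum[OF D]
      have "pnorm (tau D - D) \<le> pnorm (tau D) + pnorm D" by (intro MMN(7) tD D)
      then have b1: "pnorm (tau D - D) \<le> 2 * QW y" using tD(2) Db by linarith
      have tDD: "tau D - D \<in> psum MM" by (intro MMS(5) tD D)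
      have b2: "lpnorm p (V (tau D - D)) \<le> kV * (2 * QW y)" using Vb(2)[OF tDD] mult_left_mono[OF b1 k_nonneg(1)] by linarith
      have b3: "lpnorm p (dV (tau u) - dV u) \<le> QV (tau u) + QV u"
        using lpD(7)[OF dVl(1)[OF tu(1)] dVl(1)[OF u(1)]] dVl(2)[OF tu(1)] dVl(2)[OF u(1)] by linarith
      have "lpnorm p (V (tau D - D) + (dV (tau u) - dV u)) \<le> lpnorm p (V (tau D - D)) + lpnorm p (dV (tau u) - dV u)"
        by (intro lpD(3) lpS(5) Vb tDD dVl tu u)
      then have "dn (dsum_op (T a) (S y) - S (T a y)) \<le> (kV * (2 * QW y) + (QV (tau u) + QV u)) + QW y"
        unfolding dn_def f s using b2 b3 pi0_psum(2)[OF D] Db by linarith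
      then show ?thesis unfolding qq_def u_def by (simp add: algebra_simps)
    qed
    have v3: "qq y \<le> k2 * \<delta> * lpnorm p y" if a: "a < \<nu>" and y: "y \<in> lp p" for y
    proof -
      have 1: "QW y \<le> (2 * lam + 1) * \<delta> * lpnorm p y" unfolding QW_def by (rule QW_le[OF y a])
      have 2: "QV m \<le> 2 * \<delta> * (kW * lpnorm p y)" if "m \<in> psum MM" "pnorm m \<le> kW * lpnorm p y" for m
        unfolding QV_def by (rule order_trans[OF QV_le[OF that(1) a] mult_left_mono[OF that(2)]]) (use \<delta>(1) in simp)
      have "qq y \<le> (2 * kV + 1) * ((2 * lam + 1) * \<delta> * lpnorm p y) + (2 * \<delta> * (kW * lpnorm p y) + 2 * \<delta> * (kW * lpnorm p y))"
        unfolding qq_def using k_nonneg(1) by (intro add_mono mult_left_mono 1 2 Wb twb y) auto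
      then show ?thesis by (simp add: k2_def algebra_simps)
    qed
    show ?thesis using v1 v2 v3 by blast
  qed
  show ?thesis
  proof (rule that[of S R])
    show "lpnorm p (R w) \<le> 2 * kR * dn w" if "w \<in> DS" for w
      unfolding R_def using G(3)[OF R0mem[OF that]] R0_bd[OF that] by linarith
  qed (use Slin SDS S_bd Rlin Rl RSid SR0 inter in blast)+
qed

end

section \<open>Approximate similarity\<close>

lemma diff_regroup: "(a - b) - (c - d) = (a - e) + ((e - c) - (b - d))" for a :: "'a::ab_group_add"
  by (simp add: algebra_simps)

text \<open>Every condition concerns one operator at a time with the same \<open>S n\<close> and
  \<open>R n\<close>, so a list with repetitions serves as well as the indexed family.\<close>

lemma approx_similar_reindex:
  assumes "approx_similar UNIV V nV T' W nW X'" "\<And>\<alpha>. \<alpha> \<in> \<Lambda> \<Longrightarrow> T' (f \<alpha>) = T \<alpha>" "\<And>\<alpha>. \<alpha> \<in> \<Lambda> \<Longrightarrow> X' (f \<alpha>) = X \<alpha>"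
  shows "approx_similar \<Lambda> V nV T W nW X"
proof -
  obtain l S R where l: "1 \<le> l" and 1: "\<forall>n. \<exists>a b. iso_data V nV W nW (S n) (R n) a b \<and> a * b \<le> l"
    and 2: "\<forall>\<alpha>\<in>UNIV. \<forall>n. compact_op W nW W nW (\<lambda>w. X' \<alpha> w - S n (T' \<alpha> (R n w)))"
    and 3: "\<forall>\<alpha>\<in>UNIV. \<forall>\<epsilon>>0. eventually (\<lambda>n. op_bound W nW nW (\<lambda>w. X' \<alpha> w - S n (T' \<alpha> (R n w))) \<epsilon>) sequentially"
    using assms(1) unfolding approx_similar_def by (elim exE conjE) (rule that; assumption)
  have 4: "\<forall>\<alpha>\<in>\<Lambda>. \<forall>n. compact_op W nW W nW (\<lambda>w. X \<alpha> w - S n (T \<alpha> (R n w)))"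
  proof
    fix \<alpha> assume \<alpha>: "\<alpha> \<in> \<Lambda>"
    show "\<forall>n. compact_op W nW W nW (\<lambda>w. X \<alpha> w - S n (T \<alpha> (R n w)))"
      using 2[THEN bspec, of "f \<alpha>"] unfolding assms(2)[OF \<alpha>] assms(3)[OF \<alpha>] by simp
  qed
  have 5: "\<forall>\<alpha>\<in>\<Lambda>. \<forall>\<epsilon>>0. eventually (\<lambda>n. op_bound W nW nW (\<lambda>w. X \<alpha> w - S n (T \<alpha> (R n w))) \<epsilon>) sequentially"
  proof
    fix \<alpha> assume \<alpha>: "\<alpha> \<in> \<Lambda>"
    show "\<forall>\<epsilon>>0. eventually (\<lambda>n. op_bound W nW nW (\<lambda>w. X \<alpha> w - S n (T \<alpha> (R n w))) \<epsilon>) sequentially"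
      using 3[THEN bspec, of "f \<alpha>"] unfolding assms(2)[OF \<alpha>] assms(3)[OF \<alpha>] by simp
  qed
  show ?thesis unfolding approx_similar_def using l 1 4 5 by (intro exI[of _ l] exI[of _ S] exI[of _ R] conjI)
qed

context absorb
begin

definition "similarity \<nu> \<delta> S R \<longleftrightarrow>
  clinear_on (lp p) S \<and> (\<forall>y\<in>lp p. S y \<in> DS \<and> dn (S y) \<le> kS * lpnorm p y) \<and>
  clinear_on DS R \<and> (\<forall>w\<in>DS. R w \<in> lp p \<and> lpnorm p (R w) \<le> 2 * kR * dn w) \<and>
  (\<forall>y\<in>lp p. R (S y) = y) \<and> (\<forall>w\<in>DS. dn (S (R w) - w) = 0) \<and>
  (\<forall>a. \<exists>q. vanishing q \<and> (\<forall>y\<in>lp p. dn (dsum_op (T a) (S y) - S (T a y)) \<le> q y) \<and>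
     (a < \<nu> \<longrightarrow> (\<forall>y\<in>lp p. q y \<le> k2 * \<delta> * lpnorm p y)))"

lemma similarityD:
  assumes "similarity \<nu> \<delta> S R"
  shows "clinear_on (lp p) S" "y \<in> lp p \<Longrightarrow> S y \<in> DS" "y \<in> lp p \<Longrightarrow> dn (S y) \<le> kS * lpnorm p y"
    "clinear_on DS R" "w \<in> DS \<Longrightarrow> R w \<in> lp p" "w \<in> DS \<Longrightarrow> lpnorm p (R w) \<le> 2 * kR * dn w"
    "y \<in> lp p \<Longrightarrow> R (S y) = y" "w \<in> DS \<Longrightarrow> dn (S (R w) - w) = 0"
    "\<exists>q. vanishing q \<and> (\<forall>y\<in>lp p. dn (dsum_op (T a) (S y) - S (T a y)) \<le> q y) \<and> (a < \<nu> \<longrightarrow> (\<forall>y\<in>lp p. q y \<le> k2 * \<delta> * lpnorm p y))"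
proof -
  note s = assms[unfolded similarity_def]
  show "clinear_on (lp p) S" by (rule s[THEN conjunct1])
  note s = s[THEN conjunct2]
  show "y \<in> lp p \<Longrightarrow> S y \<in> DS" "y \<in> lp p \<Longrightarrow> dn (S y) \<le> kS * lpnorm p y" using s[THEN conjunct1, THEN bspec] by simp_all
  note s = s[THEN conjunct2]
  show "clinear_on DS R" by (rule s[THEN conjunct1])
  note s = s[THEN conjunct2]
  show "w \<in> DS \<Longrightarrow> R w \<in> lp p" "w \<in> DS \<Longrightarrow> lpnorm p (R w) \<le> 2 * kR * dn w" using s[THEN conjunct1, THEN bspec] by simp_all
  note s = s[THEN conjunct2]
  show "y \<in> lp p \<Longrightarrow> R (S y) = y" by (rule s[THEN conjunct1, THEN bspec])
  note s = s[THEN conjunct2]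
  show "w \<in> DS \<Longrightarrow> dn (S (R w) - w) = 0" by (rule s[THEN conjunct1, THEN bspec])
  show "\<exists>q. vanishing q \<and> (\<forall>y\<in>lp p. dn (dsum_op (T a) (S y) - S (T a y)) \<le> q y) \<and> (a < \<nu> \<longrightarrow> (\<forall>y\<in>lp p. q y \<le> k2 * \<delta> * lpnorm p y))"
    by (rule s[THEN conjunct2, THEN spec])
qed

lemma similarity_exists:
  assumes "0 < \<delta>" "\<delta> \<le> 1" "\<delta> * k1 \<le> 1 / 2" shows "\<exists>S R. similarity \<nu> \<delta> S R"
proof -
  obtain I b \<phi> \<psi> Sg n v z Jr Lr Ir br fr gr er where g: "glue p U T P lam \<delta> \<nu> I b \<phi> \<psi> Sg n v z Jr Lr Ir br fr gr er"
    by (rule glue_exists[OF assms(1,2)])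
  obtain S R where SR: "clinear_on (lp p) S" "\<And>y. y \<in> lp p \<Longrightarrow> S y \<in> DS" "\<And>y. y \<in> lp p \<Longrightarrow> dn (S y) \<le> kS * lpnorm p y"
    "clinear_on DS R" "\<And>w. w \<in> DS \<Longrightarrow> R w \<in> lp p" "\<And>w. w \<in> DS \<Longrightarrow> lpnorm p (R w) \<le> 2 * kR * dn w"
    "\<And>y. y \<in> lp p \<Longrightarrow> R (S y) = y" "\<And>w. w \<in> DS \<Longrightarrow> dn (S (R w) - w) = 0"
    "\<And>a. \<exists>q. vanishing q \<and> (\<forall>y\<in>lp p. dn (dsum_op (T a) (S y) - S (T a y)) \<le> q y) \<and> (a < \<nu> \<longrightarrow> (\<forall>y\<in>lp p. q y \<le> k2 * \<delta> * lpnorm p y))"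
    by (rule glue.absorption[OF g assms(3)]) (rule that; assumption)
  have "similarity \<nu> \<delta> S R" unfolding similarity_def by (intro conjI ballI allI SR)
  then show ?thesis by (intro exI)
qed

lemma dsum_norm_nonneg [simp]: "0 \<le> dsum_norm U p w" by (simp add: dsum_norm_def)

lemma similarity_iso:
  assumes S: "similarity \<nu> \<delta> S R" shows "iso_data (lp p) (lpnorm p) DS (dsum_norm U p) S R kS (4 * kR)"
  unfolding iso_data_def op_bound_def
proof (intro conjI ballI image_subsetI)
  note SR = similarityD[OF S]
  note DSN = seminormedD[OF seminormed_DS] note DSS = csubspaceD[OF DSN(1)]
  show "clinear_on (lp p) S" "clinear_on DS R" by (rule SR)+
  show "0 \<le> kS" "0 \<le> 4 * kR" using k_nonneg by simp_all
  fix y assume y: "y \<in> lp p"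
  show "S y \<in> DS" by (rule SR(2)[OF y])
  show "lpnorm p (R (S y) - y) = 0" unfolding SR(7)[OF y] using lpD(5) by simp
  show "dsum_norm U p (S y) \<le> kS * lpnorm p y" by (rule order_trans[OF dsum_norm_dn(1)[OF SR(2)[OF y]] SR(3)[OF y]])
next
  note SR = similarityD[OF S]
  note DSN = seminormedD[OF seminormed_DS] note DSS = csubspaceD[OF DSN(1)]
  fix w assume w: "w \<in> DS"
  show "R w \<in> lp p" by (rule SR(5)[OF w])
  have "S (R w) - w \<in> DS" by (rule DSS(5)[OF SR(2)[OF SR(5)[OF w]] w])
  then have "dsum_norm U p (S (R w) - w) \<le> 0" using dsum_norm_dn(1) SR(8)[OF w] by metis
  then show "dsum_norm U p (S (R w) - w) = 0" by (rule antisym) simp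
  have "2 * kR * dn w \<le> 2 * kR * (2 * dsum_norm U p w)" using k_nonneg by (intro mult_left_mono dsum_norm_dn(2)[OF w]) simp
  then show "lpnorm p (R w) \<le> 4 * kR * dsum_norm U p w" using SR(6)[OF w] by linarith
qed

text \<open>\<open>S (R w)\<close> and \<open>w\<close> may be different representatives of one
  class; the operators of the direct sum respect classes.\<close>

lemma similarity_null:
  assumes S: "similarity \<nu> \<delta> S R" and w: "w \<in> DS"
  shows "dn (dsum_op (T a) w - dsum_op (T a) (S (R w))) = 0"
proof -
  note SR = similarityD[OF S]
  note DSN = seminormedD[OF seminormed_DS] note DSS = csubspaceD[OF DSN(1)]
  have s: "S (R w) \<in> DS" by (rule SR(2)[OF SR(5)[OF w]])
  have d: "w - S (R w) \<in> DS" by (rule DSS(5)[OF w s])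
  have e: "dsum_op (T a) w - dsum_op (T a) (S (R w)) = dsum_op (T a) (w - S (R w))"
    by (rule clinear_on_rules(3)[OF clinear_dsum_op DSN(1) w s, symmetric])
  obtain C where C: "C > 0" "\<And>w. w \<in> DS \<Longrightarrow> dn (dsum_op (T a) w) \<le> C * dn w" by (rule dsum_op_bound[of a]) (rule that; assumption)
  have "dn (w - S (R w)) = 0" using DSN(8)[OF w s] SR(8)[OF w] by simp
  then have "dn (dsum_op (T a) (w - S (R w))) \<le> 0" using C(2)[OF d] by simp
  then show ?thesis unfolding e using DSN(2)[OF dsum_op_DS[OF d, of a]] by simp
qed

lemma similarity_small:
  assumes S: "similarity \<nu> \<delta> S R" and a: "a < \<nu>" and \<delta>: "0 \<le> \<delta>"
  shows "op_bound DS (dsum_norm U p) (dsum_norm U p) (\<lambda>w. dsum_op (T a) w - S (T a (R w))) (4 * k2 * kR * \<delta>)"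
  unfolding op_bound_def
proof
  note SR = similarityD[OF S]
  note DSN = seminormedD[OF seminormed_DS] note DSS = csubspaceD[OF DSN(1)]
  fix w assume w: "w \<in> DS"
  note Rw = SR(5)[OF w] note TR = bopD(2)[OF T[of a] Rw]
  obtain q where q: "\<forall>y\<in>lp p. dn (dsum_op (T a) (S y) - S (T a y)) \<le> q y" "a < \<nu> \<longrightarrow> (\<forall>y\<in>lp p. q y \<le> k2 * \<delta> * lpnorm p y)"
    using SR(9)[of a] by (elim exE conjE) (rule that; assumption)
  have "dn (dsum_op (T a) w - S (T a (R w))) \<le> dn (dsum_op (T a) w - dsum_op (T a) (S (R w))) + dn (dsum_op (T a) (S (R w)) - S (T a (R w)))"
    by (intro DSN(10) dsum_op_DS w SR(2) Rw TR)
  then have 1: "dn (dsum_op (T a) w - S (T a (R w))) \<le> k2 * \<delta> * lpnorm p (R w)"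
    using similarity_null[OF S w, of a] q(1)[THEN bspec, OF Rw] q(2)[THEN mp, OF a, THEN bspec, OF Rw] by linarith
  have "2 * kR * dn w \<le> 2 * kR * (2 * dsum_norm U p w)" using k_nonneg by (intro mult_left_mono dsum_norm_dn(2)[OF w]) simp
  then have "lpnorm p (R w) \<le> 4 * kR * dsum_norm U p w" using SR(6)[OF w] by linarith
  then have "k2 * \<delta> * lpnorm p (R w) \<le> k2 * \<delta> * (4 * kR * dsum_norm U p w)" using k_nonneg \<delta> by (intro mult_left_mono) auto
  moreover have "dsum_norm U p (dsum_op (T a) w - S (T a (R w))) \<le> dn (dsum_op (T a) w - S (T a (R w)))"
    by (intro dsum_norm_dn(1) DSS(5) dsum_op_DS w SR(2) TR)
  ultimately have "dsum_norm U p (dsum_op (T a) w - S (T a (R w))) \<le> k2 * \<delta> * (4 * kR * dsum_norm U p w)" using 1 by linarith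
  then show "dsum_norm U p (dsum_op (T a) w - S (T a (R w))) \<le> 4 * k2 * kR * \<delta> * dsum_norm U p w" by (simp add: mult_ac)
qed

text \<open>The vectors \<open>R (w j)\<close> are bounded, so a subsequence converges weakly to
  some \<open>x\<close>. The intertwining defect is dominated by a vanishing function, so it tends
  to 0 on the differences to \<open>x\<close>, and the images converge in norm to the defect at
  \<open>x\<close>.\<close>

lemma similarity_compact:
  assumes S: "similarity \<nu> \<delta> S R"
  shows "compact_op DS (dsum_norm U p) DS (dsum_norm U p) (\<lambda>w. dsum_op (T a) w - S (T a (R w)))"
  unfolding compact_op_def
proof (intro allI impI)
  note SR = similarityD[OF S]
  note DSN = seminormedD[OF seminormed_DS] note DSS = csubspaceD[OF DSN(1)]
  let ?X = "dsum_op (T a)"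
  fix w :: "nat \<Rightarrow> (nat \<Rightarrow> complex) \<times> (nat \<Rightarrow> nat \<Rightarrow> nat \<Rightarrow> complex)" assume w': "\<forall>j. w j \<in> DS \<and> dsum_norm U p (w j) \<le> 1"
  have w: "w j \<in> DS" "dsum_norm U p (w j) \<le> 1" for j using w' by simp_all
  have Rw: "R (w j) \<in> lp p" "lpnorm p (R (w j)) \<le> 4 * kR" for j
  proof -
    show "R (w j) \<in> lp p" by (rule SR(5)[OF w(1)])
    have "dn (w j) \<le> 2" using dsum_norm_dn(2)[OF w(1), of j] w(2)[of j] by linarith
    then have "2 * kR * dn (w j) \<le> 2 * kR * 2" using k_nonneg by (intro mult_left_mono) auto
    then show "lpnorm p (R (w j)) \<le> 4 * kR" using SR(6)[OF w(1), of j] by linarith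
  qed
  obtain r x where r: "strict_mono (r::nat \<Rightarrow> nat)" and x: "x \<in> lp p" "lpnorm p x \<le> 4 * kR" and wn: "wnull sequentially p (\<lambda>j. R (w (r j)) - x)"
    by (rule weak_seq_compact[of "\<lambda>j. R (w j)" "4 * kR", OF Rw])
  obtain q where q: "vanishing q" "\<forall>y\<in>lp p. dn (?X (S y) - S (T a y)) \<le> q y"
    using SR(9)[of a] by (elim exE conjE) (rule that; assumption)
  define y where "y = ?X (S x) - S (T a x)"
  have y: "y \<in> DS" unfolding y_def by (intro DSS(5) dsum_op_DS SR(2) bopD(2)[OF T] x)
  have est: "dn ((?X (w j) - S (T a (R (w j)))) - y) \<le> q (R (w j) - x)" for j
  proof -
    define s where "s = R (w j)"
    have s: "s \<in> lp p" unfolding s_def by (rule Rw)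
    have sx: "s - x \<in> lp p" by (rule lpS(5)[OF s x(1)])
    note TD = bopD(2)[OF T[of a]]
    have e1: "S (s - x) = S s - S x" by (rule clinear_on_rules(3)[OF SR(1) lpD(1) s x(1)])
    have e2: "?X (S s - S x) = ?X (S s) - ?X (S x)" by (rule clinear_on_rules(3)[OF clinear_dsum_op DSN(1) SR(2)[OF s] SR(2)[OF x(1)]])
    have e3: "T a (s - x) = T a s - T a x" by (rule clinear_on_rules(3)[OF bopD(1)[OF T] lpD(1) s x(1)])
    have e4: "S (T a s - T a x) = S (T a s) - S (T a x)" by (rule clinear_on_rules(3)[OF SR(1) lpD(1) TD[OF s] TD[OF x(1)]])
    have e: "(?X (w j) - S (T a s)) - y = (?X (w j) - ?X (S s)) + (?X (S (s - x)) - S (T a (s - x)))"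
      unfolding e1 e2 e3 e4 y_def by (rule diff_regroup)
    have "dn ((?X (w j) - ?X (S s)) + (?X (S (s - x)) - S (T a (s - x)))) \<le> dn (?X (w j) - ?X (S s)) + dn (?X (S (s - x)) - S (T a (s - x)))"
      by (intro DSN(3) DSS(5) dsum_op_DS w SR(2) TD s sx)
    then show ?thesis using similarity_null[OF S w(1), of a j] q(2)[THEN bspec, OF sx] unfolding s_def[symmetric] e by linarith
  qed
  have lim: "(\<lambda>j. q (R (w (r j)) - x)) \<longlonglongrightarrow> 0"
  proof (rule vanishingD[OF q(1) _ _ wn])
    show "R (w (r j)) - x \<in> lp p" for j by (rule lpS(5)[OF Rw(1) x(1)])
    show "lpnorm p (R (w (r j)) - x) \<le> 8 * kR" for j using lpD(7)[OF Rw(1)[of "r j"] x(1)] Rw(2)[of "r j"] x(2) by linarith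
  qed
  have "(\<lambda>j. dsum_norm U p ((?X (w (r j)) - S (T a (R (w (r j))))) - y)) \<longlonglongrightarrow> 0"
  proof (rule tendsto_sandwich[OF _ _ tendsto_const lim]; rule always_eventually; rule allI)
    fix j
    have "(?X (w (r j)) - S (T a (R (w (r j))))) - y \<in> DS" by (intro DSS(5) dsum_op_DS w SR(2) bopD(2)[OF T] Rw y)
    then show "dsum_norm U p ((?X (w (r j)) - S (T a (R (w (r j))))) - y) \<le> q (R (w (r j)) - x)"
      using order_trans[OF dsum_norm_dn(1) est] by simp
  qed simp
  then show "\<exists>(r::nat \<Rightarrow> nat) y. strict_mono r \<and> y \<in> DS \<and> (\<lambda>j. dsum_norm U p ((?X (w (r j)) - S (T a (R (w (r j))))) - y)) \<longlonglongrightarrow> 0"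
    using r y by (intro exI[of _ r] exI[of _ y] conjI)
qed

theorem approx_similar_dsum: "approx_similar UNIV (lp p) (lpnorm p) T DS (dsum_norm U p) (\<lambda>a. dsum_op (T a))"
proof -
  have k1: "0 \<le> k1" unfolding k1_def using k_nonneg by (intro add_nonneg_nonneg mult_nonneg_nonneg) auto
  \<comment> \<open>Tends to 0 while always satisfying \<open>d \<nu> \<le> 1\<close> and
    \<open>d \<nu> * k1 \<le> 1 / 2\<close>; the summand 2 keeps the denominator positive when
    \<open>k1 = 0\<close>.\<close>
  define d where "d \<nu> = inverse (real (Suc \<nu>)) / (2 * k1 + 2)" for \<nu>
  have d0: "0 < d \<nu>" for \<nu> unfolding d_def using k1 by (intro divide_pos_pos) auto
  have dle: "d \<nu> \<le> 1 / (2 * k1 + 2)" for \<nu>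
    unfolding d_def using k1 by (intro divide_right_mono) (auto intro: inverse_le_1_iff[THEN iffD2])
  have d1: "d \<nu> \<le> 1" for \<nu> using dle[of \<nu>] k1 by (auto intro: order_trans simp: divide_le_eq)
  have d2: "d \<nu> * k1 \<le> 1 / 2" for \<nu>
  proof -
    have "1 / (2 * k1 + 2) * k1 \<le> 1 / 2" using k1 by (simp add: divide_le_eq)
    then show ?thesis using mult_right_mono[OF dle[of \<nu>] k1] by linarith
  qed
  have dlim: "d \<longlonglongrightarrow> 0" unfolding d_def[abs_def] by (rule tendsto_divide_zero[OF LIMSEQ_inverse_real_of_nat])
  have "\<forall>\<nu>. \<exists>X. similarity \<nu> (d \<nu>) (fst X) (snd X)"
  proof
    fix \<nu>
    obtain S R where "similarity \<nu> (d \<nu>) S R" using similarity_exists[OF d0 d1 d2, of \<nu> \<nu>] by (elim exE)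
    then have "similarity \<nu> (d \<nu>) (fst (S, R)) (snd (S, R))" by (simp only: fst_conv snd_conv)
    then show "\<exists>X. similarity \<nu> (d \<nu>) (fst X) (snd X)" by (rule exI)
  qed
  from choice[OF this] obtain X where X: "\<forall>\<nu>. similarity \<nu> (d \<nu>) (fst (X \<nu>)) (snd (X \<nu>))" by (elim exE)
  define S R where "S \<nu> = fst (X \<nu>)" and "R \<nu> = snd (X \<nu>)" for \<nu>
  have sim: "similarity \<nu> (d \<nu>) (S \<nu>) (R \<nu>)" for \<nu> using X[THEN spec, of \<nu>] unfolding S_def R_def .
  have iso: "\<forall>\<nu>. \<exists>a b. iso_data (lp p) (lpnorm p) DS (dsum_norm U p) (S \<nu>) (R \<nu>) a b \<and> a * b \<le> kS * (4 * kR)"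
  proof
    fix \<nu>
    show "\<exists>a b. iso_data (lp p) (lpnorm p) DS (dsum_norm U p) (S \<nu>) (R \<nu>) a b \<and> a * b \<le> kS * (4 * kR)"
      by (rule exI[of _ kS], rule exI[of _ "4 * kR"]) (intro conjI similarity_iso[OF sim] order_refl)
  qed
  have small: "\<forall>a\<in>UNIV. \<forall>\<epsilon>>0. eventually (\<lambda>\<nu>. op_bound DS (dsum_norm U p) (dsum_norm U p) (\<lambda>w. dsum_op (T a) w - S \<nu> (T a (R \<nu> w))) \<epsilon>) sequentially"
  proof (intro ballI allI impI)
    fix a and \<epsilon> :: real assume \<epsilon>: "\<epsilon> > 0"
    have "(\<lambda>\<nu>. 4 * k2 * kR * d \<nu>) \<longlonglongrightarrow> 0" by (rule tendsto_mult_right_zero[OF dlim])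
    then have "\<forall>\<^sub>F \<nu> in sequentially. 4 * k2 * kR * d \<nu> < \<epsilon>" using \<epsilon> by (rule order_tendstoD)
    moreover have "\<forall>\<^sub>F \<nu> in sequentially. a < \<nu>" by (rule eventually_gt_at_top)
    ultimately show "\<forall>\<^sub>F \<nu> in sequentially. op_bound DS (dsum_norm U p) (dsum_norm U p) (\<lambda>w. dsum_op (T a) w - S \<nu> (T a (R \<nu> w))) \<epsilon>"
    proof eventually_elim
      case (elim \<nu>)
      show ?case unfolding op_bound_def
      proof
        fix w assume "w \<in> DS"
        then have "dsum_norm U p (dsum_op (T a) w - S \<nu> (T a (R \<nu> w))) \<le> 4 * k2 * kR * d \<nu> * dsum_norm U p w"
          by (rule similarity_small[OF sim elim(2) less_imp_le[OF d0], unfolded op_bound_def, THEN bspec])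
        also have "\<dots> \<le> \<epsilon> * dsum_norm U p w" by (rule mult_right_mono[OF less_imp_le[OF elim(1)] dsum_norm_nonneg])
        finally show "dsum_norm U p (dsum_op (T a) w - S \<nu> (T a (R \<nu> w))) \<le> \<epsilon> * dsum_norm U p w" .
      qed
    qed
  qed
  have one: "1 \<le> kS * (4 * kR)" using mult_mono[of 1 kS 1 "4 * kR"] k_nonneg(3,4) by simp
  have cpt: "\<forall>a\<in>UNIV. \<forall>\<nu>. compact_op DS (dsum_norm U p) DS (dsum_norm U p) (\<lambda>w. dsum_op (T a) w - S \<nu> (T a (R \<nu> w)))"
    by (intro ballI allI similarity_compact[OF sim])
  show ?thesis unfolding approx_similar_def
    by (rule exI[of _ "kS * (4 * kR)"], rule conjI[OF one], rule exI[of _ S], rule exI[of _ R]) (intro conjI iso cpt small)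
qed

end

section \<open>From sequences to countable families\<close>

theorem theorem2p2:
  fixes U :: "nat filter" and p lam :: real and \<Lambda> :: "'i set"
    and T :: "'i \<Rightarrow> (nat \<Rightarrow> complex) \<Rightarrow> (nat \<Rightarrow> complex)"
    and P :: "nat \<Rightarrow> (nat \<Rightarrow> nat \<Rightarrow> complex) \<Rightarrow> (nat \<Rightarrow> nat \<Rightarrow> complex)"
  assumes U: "free_ultrafilter_nat U"
    and p: "1 < p"
    and cnt: "countable \<Lambda>"
    and T: "\<forall>\<alpha>\<in>\<Lambda>. bdd_op (lp p) (lpnorm p) (lp p) (lpnorm p) (T \<alpha>)"
    and lam: "1 \<le> lam"
    and P_op: "\<forall>n. bdd_op (hatlp U p) (unorm U p) (hatlp U p) (unorm U p) (P n)"
    and P_idem: "\<forall>n. \<forall>X\<in>hatlp U p. unorm U p (P n (P n X) - P n X) = 0"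
    and P_norm: "\<forall>n. op_bound (hatlp U p) (unorm U p) (unorm U p) (P n) lam"
    and P_comm: "\<forall>n. \<forall>\<alpha>\<in>\<Lambda>. \<forall>X\<in>hatlp U p.
                   unorm U p (P n (hatop (T \<alpha>) X) - hatop (T \<alpha>) (P n X)) = 0"
    and M: "\<forall>n. fin_dim_mod (rng U p (P n)) (unorm U p) \<or>
               lambda_iso (rng U p (P n)) (unorm U p) (lp p) (lpnorm p) lam"
  shows "approx_similar \<Lambda> (lp p) (lpnorm p) T
           (dsum_space U p (\<lambda>n. rng U p (P n))) (dsum_norm U p) (\<lambda>\<alpha>. dsum_op (T \<alpha>))"
proof -
  interpret ultra p U by unfold_locales (rule p, rule U)
  \<comment> \<open>An empty family is replaced by the identity operator, which satisfies all
    hypotheses; a nonempty one is enumerated, with repetitions if it is finite.\<close>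
  define T' where "T' a = (if \<Lambda> = {} then (\<lambda>x. x) else T (from_nat_into \<Lambda> a))" for a :: nat
  have T'_T: "T' (to_nat_on \<Lambda> \<alpha>) = T \<alpha>" if "\<alpha> \<in> \<Lambda>" for \<alpha>
    using that cnt by (auto simp: T'_def)
  have T': "T' a = (\<lambda>x. x) \<or> (\<exists>\<alpha>\<in>\<Lambda>. T' a = T \<alpha>)" for a
    unfolding T'_def using from_nat_into[of \<Lambda> a] by auto
  have id: "bop (\<lambda>x. x)" unfolding bop_def bdd_op_def op_bound_def clinear_on_def by (auto intro!: exI[of _ 1])
  interpret absorb p U T' P lam
  proof unfold_locales
    fix n a X
    show "bop (T' a)" using T'[of a] T id unfolding bop_def by (elim disjE bexE) simp_all
    show "1 \<le> lam" by (rule lam)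
    show "bdd_op (hatlp U p) (unorm U p) (hatlp U p) (unorm U p) (P n)" by (rule P_op[THEN spec])
    show "fin_dim_mod (rng U p (P n)) (unorm U p) \<or> lambda_iso (rng U p (P n)) (unorm U p) (lp p) (lpnorm p) lam" by (rule M[THEN spec])
    assume X: "X \<in> hatlp U p"
    show "unorm U p (P n (P n X) - P n X) = 0" by (rule P_idem[THEN spec, THEN bspec, OF X])
    show "unorm U p (P n X) \<le> lam * unorm U p X" using P_norm[THEN spec, of n] X unfolding op_bound_def by simp
    show "unorm U p (P n (hatop (T' a) X) - hatop (T' a) (P n X)) = 0"
      using T'[of a]
    proof
      assume "T' a = (\<lambda>x. x)"
      then show ?thesis using haN(5) by (simp add: hatop_def)
    next
      assume "\<exists>\<alpha>\<in>\<Lambda>. T' a = T \<alpha>"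
      then obtain \<alpha> where \<alpha>: "\<alpha> \<in> \<Lambda>" "T' a = T \<alpha>" by (elim bexE)
      show ?thesis unfolding \<alpha>(2) by (rule P_comm[THEN spec, THEN bspec, OF \<alpha>(1), THEN bspec, OF X])
    qed
  qed
  show ?thesis
  proof (rule approx_similar_reindex[OF approx_similar_dsum])
    show "T' (to_nat_on \<Lambda> \<alpha>) = T \<alpha>" "dsum_op (T' (to_nat_on \<Lambda> \<alpha>)) = dsum_op (T \<alpha>)" if "\<alpha> \<in> \<Lambda>" for \<alpha> by (simp_all add: T'_T[OF that])
  qed
qed

end
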